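(* Let $k$ be an algebraically closed field of characteristic $p>0$. Let $G$ be a finite group, $P$ a $p$-subgroup of $G$, and $M=S(G,P)$ the Scott $kG$-module with vertex $P$. Suppose that the fusion system $\mathcal{F}_P(G)$ is saturated, and that $R$ is a subgroup of $P$. Then the following are equivalent: (i) The module $M$ is relatively $R$-Brauer indecomposable. (ii) The module $S(N_G(Q),N_P(Q)){\downarrow}^{N_G(Q)}_{QC_G(Q)}$ is indecomposable for each fully normalized subgroup $Q$ of $P$ (in $\mathcal{F}_P(G)$) containing a $G$-conjugate of $R$. Moreover, if these conditions hold, then $M(Q)\cong S(N_G(Q),N_P(Q))$ for any fully normalized subgroup $Q$ of $P$ containing a $G$-conjugate of $R$.
   Context: All modules are finitely generated right modules. ${\downarrow}$ denotes restriction and ${\uparrow}$ induction. For $H\le G$, the Scott module $S(G,H)$ is the unique indecomposable direct summand of $k_H{\uparrow}^G$ having the trivial module $k_G$ as a direct summand of its top; if $H$ is a $p$-group, $S(G,H)$ has vertex $H$. For a $kG$-module $M$ and a $p$-subgroup $Q$ of $G$, the Brauer construction is the $kN_G(Q)$-module $M(Q)=M^Q/\sum_{R<Q}\mathrm{tr}_R^Q(M^R)$, where $M^Q$ is the set of $Q$-fixed points, the sum is over proper subgroups $R$ of $Q$, and $\mathrm{tr}_R^Q(m)=\sum_{t\in[R\backslash Q]}mt$. Relative Brauer indecomposability: for a $kG$-module $M$ and a $p$-subgroup $R$ of $G$, $M$ is relatively $R$-Brauer indecomposable if for any $p$-subgroup $Q$ of $G$ containing $R$, the Brauer construction $M(Q)$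 is indecomposable (or zero) as a $kQC_G(Q)$-module. Fusion systems: $\mathcal{F}_P(G)$ is the category whose objects are the subgroups of $P$ and whose morphisms $Q\to R$ are the conjugation maps $c_g: x\mapsto g^{-1}xg$ for $g\in G$ with $Q^g=g^{-1}Qg\leq R$. Subgroups of $P$ are $\mathcal{F}_P(G)$-conjugate if they are isomorphic in $\mathcal{F}_P(G)$. Let $Q\le P$. $Q$ is fully normalized if $|N_P(Q)|\geq|N_P(R)|$ for any $R\le P$ that is $\mathcal{F}_P(G)$-conjugate to $Q$. $Q$ is fully automized if $\mathrm{Aut}_P(Q)$ is a Sylow $p$-subgroup of $\mathrm{Aut}_{\mathcal{F}_P(G)}(Q)$. $Q$ is receptive if for any $R\le P$ and any isomorphism $\varphi:R\to Q$ in $\mathcal{F}_P(G)$ there is $\bar\varphi\in\mathrm{Hom}_{\mathcal{F}_P(G)}(N_\varphi,P)$ with $\bar\varphi|_R=\varphi$, where $N_\varphi=\{g\in N_P(R)\mid \varphi\circ c_g\circ\varphi^{-1}\in\mathrm{Aut}_P(Q)\}$. $\mathcal{F}_P(G)$ is saturated if any subgroup of $P$ is $\mathcal{F}_P(G)$-conjugate to a subgroup that is fully automized and receptive. *)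

theory Defs
  imports "HOL-Algebra.Algebra" "HOL-Computational_Algebra.Primes"
begin

section \<open>Groups and fields\<close>

definition characteristic :: "('k, 'r) ring_scheme \<Rightarrow> nat" where
  "characteristic k = group.ord (add_monoid k) \<one>\<^bsub>k\<^esub>"

definition p_subgroup :: "nat \<Rightarrow> ('g, 's) monoid_scheme \<Rightarrow> 'g set \<Rightarrow> bool" where
  "p_subgroup p G Q \<longleftrightarrow> subgroup Q G \<and> (\<exists>n. card Q = p ^ n)"

definition sylow_subgroup :: "nat \<Rightarrow> ('g, 's) monoid_scheme \<Rightarrow> 'g set \<Rightarrow> bool" where
  "sylow_subgroup p G S \<longleftrightarrow> subgroup S G \<and> card S = p ^ multiplicity p (order G)"

definition centralizer :: "('g, 's) monoid_scheme \<Rightarrow> 'g set \<Rightarrow> 'g set" where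
  "centralizer G Q = {g \<in> carrier G. \<forall>x\<in>Q. g \<otimes>\<^bsub>G\<^esub> x = x \<otimes>\<^bsub>G\<^esub> g}"

definition conj_by :: "('g, 's) monoid_scheme \<Rightarrow> 'g \<Rightarrow> 'g \<Rightarrow> 'g" where
  "conj_by G g x = inv\<^bsub>G\<^esub> g \<otimes>\<^bsub>G\<^esub> x \<otimes>\<^bsub>G\<^esub> g"


section \<open>The fusion system of a subgroup\<close>

text \<open>Morphisms are extensional functions, so that the conjugation maps of two group elements
  are the same morphism if and only if they agree on the source.\<close>

definition fusion_hom :: "('g, 's) monoid_scheme \<Rightarrow> 'g set \<Rightarrow> 'g set \<Rightarrow> ('g \<Rightarrow> 'g) set" where
  "fusion_hom G Q R = {restrict (conj_by G g) Q | g. g \<in> carrier G \<and> conj_by G g ` Q \<subseteq> R}"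

definition fusion_iso :: "('g, 's) monoid_scheme \<Rightarrow> 'g set \<Rightarrow> 'g set \<Rightarrow> ('g \<Rightarrow> 'g) set" where
  "fusion_iso G Q R = {\<phi> \<in> fusion_hom G Q R. \<exists>\<psi> \<in> fusion_hom G R Q.
     (\<forall>x\<in>Q. \<psi> (\<phi> x) = x) \<and> (\<forall>y\<in>R. \<phi> (\<psi> y) = y)}"

definition fusion_conjugate :: "('g, 's) monoid_scheme \<Rightarrow> 'g set \<Rightarrow> 'g set \<Rightarrow> bool" where
  "fusion_conjugate G Q R \<longleftrightarrow> fusion_iso G Q R \<noteq> {}"

definition aut_P :: "('g, 's) monoid_scheme \<Rightarrow> 'g set \<Rightarrow> 'g set \<Rightarrow> ('g \<Rightarrow> 'g) set" where
  "aut_P G P Q = {restrict (conj_by G g) Q | g. g \<in> normalizer (G\<lparr>carrier := P\<rparr>) Q}"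

definition aut_F :: "('g, 's) monoid_scheme \<Rightarrow> 'g set \<Rightarrow> ('g \<Rightarrow> 'g) monoid" where
  "aut_F G Q = (BijGroup Q)\<lparr>carrier := fusion_iso G Q Q\<rparr>"

definition fully_normalized :: "('g, 's) monoid_scheme \<Rightarrow> 'g set \<Rightarrow> 'g set \<Rightarrow> bool" where
  "fully_normalized G P Q \<longleftrightarrow> subgroup Q (G\<lparr>carrier := P\<rparr>) \<and>
     (\<forall>R. subgroup R (G\<lparr>carrier := P\<rparr>) \<and> fusion_conjugate G Q R \<longrightarrow>
        card (normalizer (G\<lparr>carrier := P\<rparr>) R) \<le> card (normalizer (G\<lparr>carrier := P\<rparr>) Q))"

definition fully_automized :: "nat \<Rightarrow> ('g, 's) monoid_scheme \<Rightarrow> 'g set \<Rightarrow> 'g set \<Rightarrow> bool" where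
  "fully_automized p G P Q \<longleftrightarrow> sylow_subgroup p (aut_F G Q) (aut_P G P Q)"

text \<open>The set $N_\varphi$ of an isomorphism $\varphi : R \to Q$.\<close>

definition extension_control ::
    "('g, 's) monoid_scheme \<Rightarrow> 'g set \<Rightarrow> 'g set \<Rightarrow> 'g set \<Rightarrow> ('g \<Rightarrow> 'g) \<Rightarrow> 'g set" where
  "extension_control G P R Q \<phi> = {g \<in> normalizer (G\<lparr>carrier := P\<rparr>) R.
     (\<lambda>x\<in>Q. \<phi> (conj_by G g (inv_into R \<phi> x))) \<in> aut_P G P Q}"

definition receptive :: "('g, 's) monoid_scheme \<Rightarrow> 'g set \<Rightarrow> 'g set \<Rightarrow> bool" where
  "receptive G P Q \<longleftrightarrow> (\<forall>R \<phi>. subgroup R (G\<lparr>carrier := P\<rparr>) \<and> \<phi> \<in> fusion_iso G R Q \<longrightarrow>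
     (\<exists>\<phi>' \<in> fusion_hom G (extension_control G P R Q \<phi>) P. \<forall>x\<in>R. \<phi>' x = \<phi> x))"

definition saturated :: "nat \<Rightarrow> ('g, 's) monoid_scheme \<Rightarrow> 'g set \<Rightarrow> bool" where
  "saturated p G P \<longleftrightarrow> (\<forall>Q. subgroup Q (G\<lparr>carrier := P\<rparr>) \<longrightarrow>
     (\<exists>R. subgroup R (G\<lparr>carrier := P\<rparr>) \<and> fusion_conjugate G Q R \<and>
          fully_automized p G P R \<and> receptive G P R))"


section \<open>Modules over a group algebra\<close>

text \<open>A right $kG$-module is a $k$-module with a $k$-linear right action of $G$. The fields
  \<open>mult\<close> and \<open>one\<close>, which \<open>module\<close> inherits from \<open>ring\<close>, play no role. Restriction to a subgroup
  \<open>H\<close> keeps the record \<open>M\<close> and replaces \<open>G\<close> by \<open>G\<lparr>carrier := H\<rparr>\<close>.\<close>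

record ('k, 'g, 'm) gmodule = "('k, 'm) module" +
  act :: "'m \<Rightarrow> 'g \<Rightarrow> 'm" (infixl \<open>\<star>\<index>\<close> 70)

definition gsubmodule ::
    "('k, 'r) ring_scheme \<Rightarrow> ('g, 's) monoid_scheme \<Rightarrow> ('k, 'g, 'm) gmodule \<Rightarrow> 'm set \<Rightarrow> bool" where
  "gsubmodule k G M N \<longleftrightarrow> submodule N k M \<and> (\<forall>n\<in>N. \<forall>g\<in>carrier G. n \<star>\<^bsub>M\<^esub> g \<in> N)"

locale fg_right_module = kM: module k M + G: group G
  for k :: "('k, 'r) ring_scheme" and G :: "('g, 's) monoid_scheme"
    and M :: "('k, 'g, 'm) gmodule" +
  assumes act_closed: "\<lbrakk>m \<in> carrier M; g \<in> carrier G\<rbrakk> \<Longrightarrow> m \<star>\<^bsub>M\<^esub> g \<in> carrier M"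
    and act_add: "\<lbrakk>m \<in> carrier M; n \<in> carrier M; g \<in> carrier G\<rbrakk>
      \<Longrightarrow> (m \<oplus>\<^bsub>M\<^esub> n) \<star>\<^bsub>M\<^esub> g = (m \<star>\<^bsub>M\<^esub> g) \<oplus>\<^bsub>M\<^esub> (n \<star>\<^bsub>M\<^esub> g)"
    and act_smult: "\<lbrakk>a \<in> carrier k; m \<in> carrier M; g \<in> carrier G\<rbrakk>
      \<Longrightarrow> (a \<odot>\<^bsub>M\<^esub> m) \<star>\<^bsub>M\<^esub> g = a \<odot>\<^bsub>M\<^esub> (m \<star>\<^bsub>M\<^esub> g)"
    and act_one: "m \<in> carrier M \<Longrightarrow> m \<star>\<^bsub>M\<^esub> \<one>\<^bsub>G\<^esub> = m"
    and act_mult: "\<lbrakk>m \<in> carrier M; g \<in> carrier G; h \<in> carrier G\<rbrakk>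
      \<Longrightarrow> m \<star>\<^bsub>M\<^esub> (g \<otimes>\<^bsub>G\<^esub> h) = m \<star>\<^bsub>M\<^esub> g \<star>\<^bsub>M\<^esub> h"
    and finitely_generated: "\<exists>B \<subseteq> carrier M. finite B \<and>
      (\<forall>N. gsubmodule k G M N \<and> B \<subseteq> N \<longrightarrow> N = carrier M)"

definition isomorphic ::
    "('k, 'r) ring_scheme \<Rightarrow> ('g, 's) monoid_scheme \<Rightarrow>
     ('k, 'g, 'm) gmodule \<Rightarrow> ('k, 'g, 'n) gmodule \<Rightarrow> bool" where
  "isomorphic k G M N \<longleftrightarrow> (\<exists>f. bij_betw f (carrier M) (carrier N) \<and>
     (\<forall>x\<in>carrier M. \<forall>y\<in>carrier M. f (x \<oplus>\<^bsub>M\<^esub> y) = f x \<oplus>\<^bsub>N\<^esub> f y) \<and>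
     (\<forall>a\<in>carrier k. \<forall>x\<in>carrier M. f (a \<odot>\<^bsub>M\<^esub> x) = a \<odot>\<^bsub>N\<^esub> f x) \<and>
     (\<forall>x\<in>carrier M. \<forall>g\<in>carrier G. f (x \<star>\<^bsub>M\<^esub> g) = f x \<star>\<^bsub>N\<^esub> g))"

definition direct_summand ::
    "('k, 'r) ring_scheme \<Rightarrow> ('g, 's) monoid_scheme \<Rightarrow> ('k, 'g, 'm) gmodule \<Rightarrow> 'm set \<Rightarrow> bool" where
  "direct_summand k G M N \<longleftrightarrow> gsubmodule k G M N \<and>
     (\<exists>N'. gsubmodule k G M N' \<and> N \<inter> N' = {\<zero>\<^bsub>M\<^esub>} \<and> N <+>\<^bsub>M\<^esub> N' = carrier M)"

definition zero_module :: "('k, 'g, 'm) gmodule \<Rightarrow> bool" where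
  "zero_module M \<longleftrightarrow> carrier M = {\<zero>\<^bsub>M\<^esub>}"

definition indecomposable ::
    "('k, 'r) ring_scheme \<Rightarrow> ('g, 's) monoid_scheme \<Rightarrow> ('k, 'g, 'm) gmodule \<Rightarrow> bool" where
  "indecomposable k G M \<longleftrightarrow> \<not> zero_module M \<and>
     (\<forall>N. direct_summand k G M N \<longrightarrow> N = {\<zero>\<^bsub>M\<^esub>} \<or> N = carrier M)"

text \<open>The operations on cosets are unions over representatives because a scalar multiple
  $aC$ of a coset need not be a whole coset (take $a = 0$).\<close>

definition quotient_module ::
    "('k, 'g, 'm) gmodule \<Rightarrow> 'm set \<Rightarrow> ('k, 'g, 'm set) gmodule" where
  "quotient_module M N =
     \<lparr>carrier = a_rcosets\<^bsub>M\<^esub> N, monoid.mult = undefined, one = undefined,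
      ring.zero = N, ring.add = set_add M,
      smult = \<lambda>a C. \<Union>x\<in>C. N +>\<^bsub>M\<^esub> (a \<odot>\<^bsub>M\<^esub> x),
      act = \<lambda>C g. \<Union>x\<in>C. N +>\<^bsub>M\<^esub> (x \<star>\<^bsub>M\<^esub> g)\<rparr>"

definition maximal_gsubmodule ::
    "('k, 'r) ring_scheme \<Rightarrow> ('g, 's) monoid_scheme \<Rightarrow> ('k, 'g, 'm) gmodule \<Rightarrow> 'm set \<Rightarrow> bool" where
  "maximal_gsubmodule k G M N \<longleftrightarrow> gsubmodule k G M N \<and> N \<noteq> carrier M \<and>
     (\<forall>N'. gsubmodule k G M N' \<and> N \<subseteq> N' \<longrightarrow> N' = N \<or> N' = carrier M)"

definition radical ::
    "('k, 'r) ring_scheme \<Rightarrow> ('g, 's) monoid_scheme \<Rightarrow> ('k, 'g, 'm) gmodule \<Rightarrow> 'm set" where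
  "radical k G M = carrier M \<inter> \<Inter>{N. maximal_gsubmodule k G M N}"

definition module_top ::
    "('k, 'r) ring_scheme \<Rightarrow> ('g, 's) monoid_scheme \<Rightarrow> ('k, 'g, 'm) gmodule \<Rightarrow>
     ('k, 'g, 'm set) gmodule" where
  "module_top k G M = quotient_module M (radical k G M)"


section \<open>Scott modules\<close>

definition trivial_module :: "('k, 'r) ring_scheme \<Rightarrow> ('k, 'g, 'k) gmodule" where
  "trivial_module k =
     \<lparr>carrier = carrier k, monoid.mult = monoid.mult k, one = \<one>\<^bsub>k\<^esub>,
      ring.zero = \<zero>\<^bsub>k\<^esub>, ring.add = ring.add k,
      smult = monoid.mult k, act = \<lambda>a g. a\<rparr>"

text \<open>Each element of the induced module $U \otimes_{kH} kG$ is $\sum_{Hg} f(g) \otimes g$, the sum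
  being over the right cosets of $H$ in $G$, for a unique $f : G \to U$ such that $f(g) \otimes g$
  depends only on $Hg$, that is, $f(hg)h = f(g)$ for all $h \in H$. We represent it by $f$.
  Since $(f(g) \otimes g)x = f(g) \otimes gx$, the element $x$ takes $f$ to
  $g \mapsto f(gx^{-1})$.\<close>

definition induced_module ::
    "('g, 's) monoid_scheme \<Rightarrow> 'g set \<Rightarrow> ('k, 'g, 'm) gmodule \<Rightarrow> ('k, 'g, 'g \<Rightarrow> 'm) gmodule" where
  "induced_module G H U =
     \<lparr>carrier = {f \<in> carrier G \<rightarrow>\<^sub>E carrier U.
        \<forall>h\<in>H. \<forall>g\<in>carrier G. f (h \<otimes>\<^bsub>G\<^esub> g) \<star>\<^bsub>U\<^esub> h = f g},
      monoid.mult = undefined, one = undefined,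
      ring.zero = (\<lambda>g\<in>carrier G. \<zero>\<^bsub>U\<^esub>),
      ring.add = (\<lambda>f f'. \<lambda>g\<in>carrier G. f g \<oplus>\<^bsub>U\<^esub> f' g),
      smult = (\<lambda>a f. \<lambda>g\<in>carrier G. a \<odot>\<^bsub>U\<^esub> f g),
      act = (\<lambda>f x. \<lambda>g\<in>carrier G. f (g \<otimes>\<^bsub>G\<^esub> inv\<^bsub>G\<^esub> x))\<rparr>"

text \<open>The Scott module $S(G,H)$ is determined up to isomorphism; \<open>scott_module\<close> is some
  submodule of $k_H{\uparrow}^G$ representing it.\<close>

definition scott_module ::
    "('k, 'r) ring_scheme \<Rightarrow> ('g, 's) monoid_scheme \<Rightarrow> 'g set \<Rightarrow> ('k, 'g, 'g \<Rightarrow> 'k) gmodule" where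
  "scott_module k G H = (let V = induced_module G H (trivial_module k) in
     V\<lparr>carrier := SOME S. direct_summand k G V S \<and> indecomposable k G (V\<lparr>carrier := S\<rparr>) \<and>
       (let T = module_top k G (V\<lparr>carrier := S\<rparr>) in
          \<exists>N. direct_summand k G T N \<and> isomorphic k G (T\<lparr>carrier := N\<rparr>) (trivial_module k))\<rparr>)"


section \<open>The Brauer construction\<close>

definition fixed_points :: "('k, 'g, 'm) gmodule \<Rightarrow> 'g set \<Rightarrow> 'm set" where
  "fixed_points M Q = {m \<in> carrier M. \<forall>x\<in>Q. m \<star>\<^bsub>M\<^esub> x = m}"

definition relative_trace ::
    "('g, 's) monoid_scheme \<Rightarrow> ('k, 'g, 'm) gmodule \<Rightarrow> 'g set \<Rightarrow> 'g set \<Rightarrow> 'm \<Rightarrow> 'm" where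
  "relative_trace G M R Q m =
     (\<Oplus>\<^bsub>M\<^esub>C\<in>rcosets\<^bsub>G\<lparr>carrier := Q\<rparr>\<^esub> R. m \<star>\<^bsub>M\<^esub> (SOME t. t \<in> C))"

definition proper_subgroups :: "('g, 's) monoid_scheme \<Rightarrow> 'g set \<Rightarrow> 'g set set" where
  "proper_subgroups G Q = {R. subgroup R (G\<lparr>carrier := Q\<rparr>) \<and> R \<noteq> Q}"

definition trace_sum ::
    "('g, 's) monoid_scheme \<Rightarrow> ('k, 'g, 'm) gmodule \<Rightarrow> 'g set \<Rightarrow> 'm set" where
  "trace_sum G M Q = {\<Oplus>\<^bsub>M\<^esub>R\<in>proper_subgroups G Q. f R | f.
     \<forall>R\<in>proper_subgroups G Q. f R \<in> relative_trace G M R Q ` fixed_points M R}"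

text \<open>The result is a module for the normalizer of \<open>Q\<close> in \<open>G\<close> only.\<close>

definition brauer_construction ::
    "('g, 's) monoid_scheme \<Rightarrow> ('k, 'g, 'm) gmodule \<Rightarrow> 'g set \<Rightarrow> ('k, 'g, 'm set) gmodule" where
  "brauer_construction G M Q =
     quotient_module (M\<lparr>carrier := fixed_points M Q\<rparr>) (trace_sum G M Q)"

definition relatively_brauer_indecomposable ::
    "nat \<Rightarrow> ('k, 'r) ring_scheme \<Rightarrow> ('g, 's) monoid_scheme \<Rightarrow> 'g set \<Rightarrow>
     ('k, 'g, 'm) gmodule \<Rightarrow> bool" where
  "relatively_brauer_indecomposable p k G R M \<longleftrightarrow> (\<forall>Q. p_subgroup p G Q \<and> R \<subseteq> Q \<longrightarrow>
     indecomposable k (G\<lparr>carrier := Q <#>\<^bsub>G\<^esub> centralizer G Q\<rparr>) (brauer_construction G M Q) \<or>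
     zero_module (brauer_construction G M Q))"

end

theory Submission
  imports Defs
begin

text \<open>Let $\Omega$ be the set of right cosets of $P$ in $G$ and let $A$ be the ring of matrices
  over $k$ indexed by $\Omega \times \Omega$. Summands of the permutation module $k\Omega$ for a
  subgroup $H$ are the images of the idempotents of the ring $A^H$ of $H$-invariant matrices, and
  indecomposable summands are the images of primitive ones. Thus $M$ is the image of a primitive
  $e \in A^G$. For a $p$-subgroup $Q$, restricting a matrix to the fixed points of $Q$ is
  multiplicative on $A^Q$, and the image of the restriction $e_Q$ of $e$ is $M(Q)$. An
  indecomposable summand of the permutation module of an orbit is the Scott module if and only if
  the row sums of its idempotent are $1$.

  Let $Q$ be fully normalized and $N = N_G(Q)$. Saturation says that every stabilizer in $N$ of a
  $Q$-fixed point is contained in a conjugate of $N_P(Q)$, which is the stabilizer of the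
  coset $P$. Comparing row sums, this makes $S(N, N_P(Q))$ the image of an idempotent
  $s \in A^N$ with $e_Q s = s = s e_Q$. Hence (i) implies $s = e_Q$, the additional assertion and
  (ii). For the converse, go down with the order of $Q$ and put $f = e_Q - s$. By induction $f$
  vanishes on the fixed points of every $p$-subgroup of $N$ properly containing $Q$.
  So $Q$ is a Sylow $p$-subgroup of the stabilizer of each pair of points where $f$ does not
  vanish, and $f$ is the restriction of some $f' \in A^G$. The element $e f' e$ of the local
  ring $e A^G e$ is not nilpotent unless $f = 0$, so it is a unit and then $f = e_Q$ and $s = 0$,
  a contradiction. Thus $s = e_Q$.\<close>

section \<open>Actions of finite groups\<close>

text \<open>The modules of the statement live over different groups and on different carriers.
  Padding with zeros outside the fixed points keeps all Brauer constructions in the one ring $A$,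
  where being a summand is an equation between idempotents. The role of Krull-Schmidt is taken by
  Fitting's lemma for $e A^H e$ with $e$ primitive: an element that is not nilpotent is a unit.

  Non-nilpotence is always certified by something multiplicative. On one orbit this is the row sum,
  which invariance makes constant. It singles out the Scott summand because it is the augmentation,
  up to scalars the only functional from an indecomposable summand of the orbit module to the
  trivial module. For $e f' e$ the certificate is restriction to fixed points, which sends it to the
  idempotent $f$.

  The lift $f'$ dictates the direction of the induction. A matrix invariant only under the
  normalizer extends to $G$ if entries identified by $G$ are already identified by the normalizer.
  Burnside's fusion argument in the stabilizer of a pair of points gives this, but only once the
  larger subgroups have been settled.\<close>

lemma card_eq_card_image_times:
  assumes "finite A" and "\<And>y. y \<in> f ` A \<Longrightarrow> card {x \<in> A. f x = y} = c"
  shows "card A = card (f ` A) * c"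
proof -
  have "card A = (\<Sum>y\<in>f ` A. \<Sum>x\<in>{x \<in> A. f x = y}. 1)"
    using sum.image_gen[OF assms(1), of "\<lambda>_. 1::nat" f] by simp
  also have "\<dots> = card (f ` A) * c"
    using assms(2) by simp
  finally show ?thesis .
qed

text \<open>The action is a parameter because several occur: on the cosets of \<open>P\<close> for
  the matrices, on cosets of other subgroups for Sylow arguments and traces, and restrictions of
  these to subgroups.\<close>

locale right_action = group G for G (structure) +
  fixes \<Omega> :: "'x set" and dot :: "'x \<Rightarrow> 'a \<Rightarrow> 'x" (infixl \<open>\<bullet>\<close> 70)
  assumes dot_closed [simp, intro]: "\<lbrakk>x \<in> \<Omega>; g \<in> carrier G\<rbrakk> \<Longrightarrow> x \<bullet> g \<in> \<Omega>"
    and dot_one [simp]: "x \<in> \<Omega> \<Longrightarrow> x \<bullet> \<one> = x"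
    and dot_mult: "\<lbrakk>x \<in> \<Omega>; g \<in> carrier G; h \<in> carrier G\<rbrakk> \<Longrightarrow> x \<bullet> (g \<otimes> h) = x \<bullet> g \<bullet> h"
begin

definition fixed :: "'a set \<Rightarrow> 'x set" where
  "fixed Q = {x \<in> \<Omega>. \<forall>q\<in>Q. x \<bullet> q = x}"

definition stab :: "'x \<Rightarrow> 'a set" where
  "stab x = {g \<in> carrier G. x \<bullet> g = x}"

lemma dot_inv_eq_iff:
  "\<lbrakk>x \<in> \<Omega>; y \<in> \<Omega>; g \<in> carrier G\<rbrakk> \<Longrightarrow> x \<bullet> inv g = y \<longleftrightarrow> x = y \<bullet> g"
  by (metis dot_mult dot_one inv_closed l_inv r_inv)

lemma dot_dot_inv [simp]: "\<lbrakk>x \<in> \<Omega>; g \<in> carrier G\<rbrakk> \<Longrightarrow> x \<bullet> g \<bullet> inv g = x"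
  "\<lbrakk>x \<in> \<Omega>; g \<in> carrier G\<rbrakk> \<Longrightarrow> x \<bullet> inv g \<bullet> g = x"
  by (metis dot_mult dot_one inv_closed r_inv, metis dot_mult dot_one inv_closed l_inv)

lemma dot_cancel: "\<lbrakk>x \<in> \<Omega>; y \<in> \<Omega>; g \<in> carrier G\<rbrakk> \<Longrightarrow> x \<bullet> g = y \<bullet> g \<longleftrightarrow> x = y"
  by (metis dot_dot_inv(1))

lemma dot_in_fixed_iff:
  assumes "x \<in> \<Omega>" "g \<in> carrier G"
  shows "x \<bullet> g \<in> fixed (carrier G) \<longleftrightarrow> x \<in> fixed (carrier G)"
proof
  assume "x \<bullet> g \<in> fixed (carrier G)"
  then have "x \<bullet> g \<bullet> inv g = x \<bullet> g" using assms(2) by (simp add: fixed_def)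
  then show "x \<in> fixed (carrier G)" using \<open>x \<bullet> g \<in> _\<close> assms by simp
next
  assume "x \<in> fixed (carrier G)"
  then show "x \<bullet> g \<in> fixed (carrier G)" using assms by (simp add: fixed_def)
qed

lemma stab_subgroup: "x \<in> \<Omega> \<Longrightarrow> subgroup (stab x) G"
  by (rule subgroupI) (auto simp: stab_def dot_mult dot_inv_eq_iff)

lemma subgroup_action: "subgroup H G \<Longrightarrow> right_action (G\<lparr>carrier := H\<rparr>) \<Omega> (\<bullet>)"
  by (intro right_action.intro right_action_axioms.intro)
    (auto simp: dot_mult subgroup.mem_carrier intro: subgroup_imp_group)

lemma card_orbit:
  assumes "finite (carrier G)" and x: "x \<in> \<Omega>"
  shows "order G = card ((\<lambda>g. x \<bullet> g) ` carrier G) * card (stab x)"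
  unfolding order_def
proof (rule card_eq_card_image_times[OF assms(1)])
  fix y assume "y \<in> (\<lambda>g. x \<bullet> g) ` carrier G"
  then obtain h where h: "h \<in> carrier G" "y = x \<bullet> h" by auto
  have "{g \<in> carrier G. x \<bullet> g = y} = (\<lambda>s. s \<otimes> h) ` stab x"
  proof (intro Set.set_eqI iffI)
    fix g assume "g \<in> {g \<in> carrier G. x \<bullet> g = y}"
    then have g: "g \<in> carrier G" "x \<bullet> g = x \<bullet> h" using h by auto
    have "g \<otimes> inv h \<in> stab x"
      using g h x by (simp add: stab_def dot_mult)
    moreover have "g = g \<otimes> inv h \<otimes> h" using g h by (simp add: m_assoc)
    ultimately show "g \<in> (\<lambda>s. s \<otimes> h) ` stab x" by blast
  next
    fix g assume "g \<in> (\<lambda>s. s \<otimes> h) ` stab x"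
    then show "g \<in> {g \<in> carrier G. x \<bullet> g = y}"
      using h x by (auto simp: stab_def dot_mult)
  qed
  moreover have "inj_on (\<lambda>s. s \<otimes> h) (stab x)"
    using h by (intro inj_onI) (auto simp: stab_def)
  ultimately show "card {g \<in> carrier G. x \<bullet> g = y} = card (stab x)"
    by (simp add: card_image)
qed

lemma dvd_card_orbit:
  assumes "Factorial_Ring.prime p" "order G = p ^ n" and x: "x \<in> \<Omega>" "x \<notin> fixed (carrier G)"
  shows "p dvd card ((\<lambda>g. x \<bullet> g) ` carrier G)"
proof -
  let ?O = "(\<lambda>g. x \<bullet> g) ` carrier G"
  have fin: "finite (carrier G)"
    using assms(1,2) by (metis order_gt_0_iff_finite prime_gt_0_nat zero_less_power)
  have "card ?O dvd p ^ n" using card_orbit[OF fin x(1)] assms(2) by (metis dvd_triv_left)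
  then obtain i where i: "card ?O = p ^ i" using divides_primepow_nat[OF assms(1)] by blast
  obtain g where g: "g \<in> carrier G" "x \<bullet> g \<noteq> x" using x by (auto simp: fixed_def)
  \<comment> \<open>The orbit has at least two points, which excludes the power $p^0$.\<close>
  have "{x, x \<bullet> g} \<subseteq> ?O" using g x by (auto intro: image_eqI[of _ _ \<one>])
  then have "card {x, x \<bullet> g} \<le> card ?O" using fin by (intro card_mono) auto
  then have "i \<noteq> 0" using g i by (cases "i = 0") auto
  then show ?thesis using i by (simp add: dvd_power)
qed

text \<open>Orbits are split off one at a time. The rest stays stable, because a point with a
  translate in the orbit lies in the orbit itself. This replaces the partition into orbits in sums
  and cardinalities.\<close>

lemma stable_induct [consumes 3, case_names empty orbit]:
  assumes "finite Y" "Y \<subseteq> \<Omega>" "\<And>x g. \<lbrakk>x \<in> Y; g \<in> carrier G\<rbrakk> \<Longrightarrow> x \<bullet> g \<in> Y"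
    and "P {}"
    and "\<And>x Z. \<lbrakk>x \<in> Y; Z \<subseteq> Y; (\<lambda>g. x \<bullet> g) ` carrier G \<inter> Z = {}; (\<lambda>g. x \<bullet> g) ` carrier G \<subseteq> Y; P Z\<rbrakk>
      \<Longrightarrow> P ((\<lambda>g. x \<bullet> g) ` carrier G \<union> Z)"
  shows "P Y"
  using assms(1,2,3,5)
proof (induction Y rule: finite_psubset_induct)
  case (psubset Y)
  show ?case
  proof (cases "Y = {}")
    case False
    then obtain x where x: "x \<in> Y" by blast
    then have x\<Omega>: "x \<in> \<Omega>" using psubset.prems(1) by blast
    define O' where "O' = (\<lambda>g. x \<bullet> g) ` carrier G"
    have O: "O' \<subseteq> Y" using x psubset.prems(2) by (auto simp: O'_def)
    have xO: "x \<in> O'" unfolding O'_def using x\<Omega> by (intro image_eqI[of _ _ \<one>]) simp_all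
    have stable: "y \<bullet> g \<in> Y - O'" if y: "y \<in> Y - O'" "g \<in> carrier G" for y g
    proof -
      have y\<Omega>: "y \<in> \<Omega>" using y psubset.prems(1) by auto
      have "y \<bullet> g \<notin> O'"
      proof
        assume "y \<bullet> g \<in> O'"
        then obtain h where h: "h \<in> carrier G" "y \<bullet> g = x \<bullet> h" by (auto simp: O'_def)
        then have "y = x \<bullet> (h \<otimes> inv g)" "h \<otimes> inv g \<in> carrier G"
          using y dot_dot_inv(1)[OF y\<Omega>, of g] x\<Omega> by (simp_all add: dot_mult)
        then show False using y by (auto simp: O'_def)
      qed
      then show ?thesis using y psubset.prems(2) by blast
    qed
    have "P (Y - O')"
    proof (rule psubset.IH)
      show "Y - O' \<subset> Y" "Y - O' \<subseteq> \<Omega>" using O x xO psubset.prems(1) by auto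
      fix z Z assume "z \<in> Y - O'" "Z \<subseteq> Y - O'" "(\<lambda>g. z \<bullet> g) ` carrier G \<inter> Z = {}"
        "(\<lambda>g. z \<bullet> g) ` carrier G \<subseteq> Y - O'" "P Z"
      then show "P ((\<lambda>g. z \<bullet> g) ` carrier G \<union> Z)" by (intro psubset.prems(3)) auto
    qed (rule stable)
    then have "P (O' \<union> (Y - O'))"
      unfolding O'_def using x O by (intro psubset.prems(3)) (auto simp: O'_def)
    moreover have "O' \<union> (Y - O') = Y" using O by blast
    ultimately show ?thesis by simp
  qed (use assms(4) in simp)
qed

text \<open>Every orbit in \<open>Y\<close> has a multiple of \<open>p\<close> points and
  \<open>F\<close> is constant on it, so it contributes a multiple of \<open>p\<close> times one
  value. The cardinality is carried along in the same induction; the values lie in an abelian group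
  killed by \<open>p\<close>, which may be trivial.\<close>

lemma no_fixed_points_sum:
  assumes p: "Factorial_Ring.prime p" "order G = p ^ n" and "finite \<Omega>"
    and k: "abelian_group k" "\<And>a. a \<in> carrier k \<Longrightarrow> [p] \<cdot>\<^bsub>k\<^esub> a = \<zero>\<^bsub>k\<^esub>"
    and F: "\<And>x. x \<in> \<Omega> \<Longrightarrow> F x \<in> carrier k"
      "\<And>x g. \<lbrakk>x \<in> \<Omega>; g \<in> carrier G\<rbrakk> \<Longrightarrow> F (x \<bullet> g) = F x"
    and Y: "Y \<subseteq> \<Omega>" "Y \<inter> fixed (carrier G) = {}"
      "\<And>x g. \<lbrakk>x \<in> Y; g \<in> carrier G\<rbrakk> \<Longrightarrow> x \<bullet> g \<in> Y"
  shows "finsum k F Y = \<zero>\<^bsub>k\<^esub> \<and> p dvd card Y"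
proof -
  interpret k: abelian_group k by fact
  have fin: "finite Y" using \<open>finite \<Omega>\<close> Y(1) finite_subset by blast
  show ?thesis
  proof (rule stable_induct[OF fin Y(1)])
    fix x Z assume x: "x \<in> Y" and Z: "Z \<subseteq> Y" "(\<lambda>g. x \<bullet> g) ` carrier G \<inter> Z = {}"
      "(\<lambda>g. x \<bullet> g) ` carrier G \<subseteq> Y" "finsum k F Z = \<zero>\<^bsub>k\<^esub> \<and> p dvd card Z"
    let ?O = "(\<lambda>g. x \<bullet> g) ` carrier G"
    have x\<Omega>: "x \<in> \<Omega>" "x \<notin> fixed (carrier G)" using x Y(1,2) by auto
    obtain m where m: "card ?O = p * m" using dvd_card_orbit[OF p x\<Omega>] by (elim dvdE)
    have fOZ: "finite ?O" "finite Z" using Z(1,3) fin finite_subset by blast+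
    have "finsum k F ?O = finsum k (\<lambda>_. F x) ?O"
      using F x\<Omega> by (intro k.finsum_cong') auto
    also have "\<dots> = [card ?O] \<cdot>\<^bsub>k\<^esub> F x" using F x\<Omega> by (simp add: k.add.finprod_const)
    also have "\<dots> = [m] \<cdot>\<^bsub>k\<^esub> ([p] \<cdot>\<^bsub>k\<^esub> F x)" using F x\<Omega> m by (simp add: k.add.nat_pow_pow)
    finally have "finsum k F ?O = \<zero>\<^bsub>k\<^esub>" using k F x\<Omega> by simp
    moreover have "finsum k F (?O \<union> Z) = finsum k F ?O \<oplus>\<^bsub>k\<^esub> finsum k F Z"
      using fOZ Z F Y(1) x\<Omega>(1) by (intro k.finsum_Un_disjoint) auto
    moreover have "card (?O \<union> Z) = card ?O + card Z" using fOZ Z(2) by (rule card_Un_disjoint)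
    ultimately show "finsum k F (?O \<union> Z) = \<zero>\<^bsub>k\<^esub> \<and> p dvd card (?O \<union> Z)" using Z(4) m by simp
  qed (use Y(3) in simp_all)
qed

text \<open>The cancellation modulo \<open>p\<close> behind all properties of the Brauer map: sums
  over products, rows and vectors that are invariant under a \<open>p\<close>-group only see its
  fixed points.\<close>

lemma p_group_sum_fixed:
  assumes p: "Factorial_Ring.prime p" "order G = p ^ n" and "finite \<Omega>"
    and k: "abelian_group k" "\<And>a. a \<in> carrier k \<Longrightarrow> [p] \<cdot>\<^bsub>k\<^esub> a = \<zero>\<^bsub>k\<^esub>"
    and F: "\<And>x. x \<in> \<Omega> \<Longrightarrow> F x \<in> carrier k"
      "\<And>x g. \<lbrakk>x \<in> \<Omega>; g \<in> carrier G\<rbrakk> \<Longrightarrow> F (x \<bullet> g) = F x"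
  shows "finsum k F \<Omega> = finsum k F (fixed (carrier G))"
proof -
  interpret k: abelian_group k by fact
  have "finsum k F (\<Omega> - fixed (carrier G)) = \<zero>\<^bsub>k\<^esub>"
    using no_fixed_points_sum[OF assms, of "\<Omega> - fixed (carrier G)"]
    by (auto simp: dot_in_fixed_iff)
  moreover have "fixed (carrier G) \<subseteq> \<Omega>" by (auto simp: fixed_def)
  then have "finsum k F \<Omega> = finsum k F (fixed (carrier G)) \<oplus>\<^bsub>k\<^esub> finsum k F (\<Omega> - fixed (carrier G))"
    using k.finsum_Un_disjoint[of "fixed (carrier G)" "\<Omega> - fixed (carrier G)" F] \<open>finite \<Omega>\<close> F
    by (auto simp: Un_absorb1 finite_subset subset_iff Pi_iff Un_Diff_cancel)
  ultimately show ?thesis using F by (simp add: fixed_def k.finsum_closed Pi_iff)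
qed

lemma p_group_card_fixed:
  assumes p: "Factorial_Ring.prime p" "order G = p ^ n" and "finite \<Omega>"
  shows "p dvd card \<Omega> \<longleftrightarrow> p dvd card (fixed (carrier G))"
proof -
  \<comment> \<open>Only the divisibility part is wanted, so the values are taken in the group with
    one element.\<close>
  let ?k = "\<lparr>carrier = {()}, monoid.mult = undefined, one = undefined, ring.zero = (), ring.add = (\<lambda>_ _. ())\<rparr>"
  have "abelian_group ?k" by (rule abelian_groupI) auto
  then have "p dvd card (\<Omega> - fixed (carrier G))"
    using no_fixed_points_sum[OF assms, of ?k "\<lambda>_. ()" "\<Omega> - fixed (carrier G)"]
    by (auto simp: dot_in_fixed_iff)
  moreover have "card \<Omega> = card (fixed (carrier G)) + card (\<Omega> - fixed (carrier G))"
    using \<open>finite \<Omega>\<close> card_Int_Diff[of \<Omega> "fixed (carrier G)"]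
    by (simp add: fixed_def Int_absorb1 Collect_conj_eq)
  ultimately show ?thesis by (simp add: dvd_add_left_iff)
qed

end

section \<open>Conjugation, normalizers and \<open>p\<close>-subgroups\<close>

context group
begin

lemma conj_by_closed [simp, intro]:
  "\<lbrakk>g \<in> carrier G; x \<in> carrier G\<rbrakk> \<Longrightarrow> conj_by G g x \<in> carrier G"
  by (simp add: conj_by_def)

lemma conj_by_one [simp]: "x \<in> carrier G \<Longrightarrow> conj_by G \<one> x = x"
  by (simp add: conj_by_def)

lemma conj_by_mult:
  "\<lbrakk>g \<in> carrier G; h \<in> carrier G; x \<in> carrier G\<rbrakk>
    \<Longrightarrow> conj_by G (g \<otimes> h) x = conj_by G h (conj_by G g x)"
  by (simp add: conj_by_def inv_mult_group m_assoc)

lemma conj_by_hom: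
  "\<lbrakk>g \<in> carrier G; x \<in> carrier G; y \<in> carrier G\<rbrakk>
    \<Longrightarrow> conj_by G g (x \<otimes> y) = conj_by G g x \<otimes> conj_by G g y"
  by (simp add: conj_by_def m_assoc) (simp add: m_assoc[symmetric])

lemma conj_by_cancel [simp]:
  "\<lbrakk>g \<in> carrier G; x \<in> carrier G\<rbrakk> \<Longrightarrow> conj_by G (inv g) (conj_by G g x) = x"
  "\<lbrakk>g \<in> carrier G; x \<in> carrier G\<rbrakk> \<Longrightarrow> conj_by G g (conj_by G (inv g) x) = x"
  by (simp_all flip: conj_by_mult)

lemma conj_by_inv:
  "\<lbrakk>g \<in> carrier G; x \<in> carrier G\<rbrakk> \<Longrightarrow> conj_by G g (inv x) = inv (conj_by G g x)"
  by (simp add: conj_by_def inv_mult_group m_assoc)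

lemma inj_on_conj_by: "\<lbrakk>g \<in> carrier G; Q \<subseteq> carrier G\<rbrakk> \<Longrightarrow> inj_on (conj_by G g) Q"
  by (rule inj_onI) (metis conj_by_cancel(1) subsetD)

lemma card_conj_by: "\<lbrakk>g \<in> carrier G; Q \<subseteq> carrier G\<rbrakk> \<Longrightarrow> card (conj_by G g ` Q) = card Q"
  by (simp add: card_image inj_on_conj_by)

lemma conj_by_image_mult:
  "\<lbrakk>g \<in> carrier G; h \<in> carrier G; Q \<subseteq> carrier G\<rbrakk>
    \<Longrightarrow> conj_by G (g \<otimes> h) ` Q = conj_by G h ` conj_by G g ` Q"
  by (auto simp: image_image conj_by_mult subset_iff intro!: image_cong)

lemma conj_by_image_one [simp]: "Q \<subseteq> carrier G \<Longrightarrow> conj_by G \<one> ` Q = Q"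
  by (force simp: subset_iff)

lemma conj_by_image_inv_eq_iff:
  assumes "g \<in> carrier G" "Q \<subseteq> carrier G" "R \<subseteq> carrier G"
  shows "conj_by G (inv g) ` Q = R \<longleftrightarrow> Q = conj_by G g ` R"
proof
  assume "conj_by G (inv g) ` Q = R"
  then have "conj_by G g ` R = conj_by G (inv g \<otimes> g) ` Q"
    using assms by (subst conj_by_image_mult) auto
  then show "Q = conj_by G g ` R" using assms by simp
next
  assume "Q = conj_by G g ` R"
  then have "conj_by G (inv g) ` Q = conj_by G (g \<otimes> inv g) ` R"
    using assms by (subst conj_by_image_mult) auto
  then show "conj_by G (inv g) ` Q = R" using assms by simp
qed

lemma subgroup_conj_by:
  assumes "subgroup Q G" "g \<in> carrier G"
  shows "subgroup (conj_by G g ` Q) G"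
proof -
  interpret Q: subgroup Q G by fact
  show ?thesis
  proof (rule subgroupI)
    show "conj_by G g ` Q \<subseteq> carrier G" "conj_by G g ` Q \<noteq> {}"
      using assms(2) Q.one_closed by (auto simp del: Q.one_closed)
    show "inv a \<in> conj_by G g ` Q" if "a \<in> conj_by G g ` Q" for a
      using that assms(2) by (auto simp flip: conj_by_inv)
    show "a \<otimes> b \<in> conj_by G g ` Q" if "a \<in> conj_by G g ` Q" "b \<in> conj_by G g ` Q" for a b
      using that assms(2) by (auto simp flip: conj_by_hom)
  qed
qed

lemma p_subgroup_conj_by:
  "\<lbrakk>p_subgroup p G Q; g \<in> carrier G\<rbrakk> \<Longrightarrow> p_subgroup p G (conj_by G g ` Q)"
  by (auto simp: p_subgroup_def subgroup_conj_by card_conj_by subgroup.subset)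

section \<open>Normalizers, centralizers and stabilizers of cosets\<close>

lemma normalizer_eq:
  assumes "Q \<subseteq> carrier G"
  shows "normalizer G Q = {g \<in> carrier G. conj_by G g ` Q = Q}"
proof -
  \<comment> \<open>The left side conjugates as $g Q g^{-1}$, while \<open>conj_by\<close> forms
    $g^{-1} x g$.\<close>
  have "(g <# Q) #> inv g = conj_by G (inv g) ` Q" if "g \<in> carrier G" for g
    using that by (auto simp: l_coset_def r_coset_def conj_by_def)
  then show ?thesis
    using assms conj_by_image_inv_eq_iff[OF _ assms assms]
    by (simp add: normalizer_def stabilizer_def eq_commute[of Q] cong: conj_cong)
qed

lemma normalizerD:
  "\<lbrakk>g \<in> normalizer G Q; Q \<subseteq> carrier G\<rbrakk> \<Longrightarrow> g \<in> carrier G"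
  "\<lbrakk>g \<in> normalizer G Q; Q \<subseteq> carrier G\<rbrakk> \<Longrightarrow> conj_by G g ` Q = Q"
  "\<lbrakk>g \<in> normalizer G Q; Q \<subseteq> carrier G; x \<in> Q\<rbrakk> \<Longrightarrow> conj_by G g x \<in> Q"
  by (auto simp: normalizer_eq)

lemma subgroup_normalizer: "Q \<subseteq> carrier G \<Longrightarrow> subgroup (normalizer G Q) G"
proof (rule subgroupI)
  assume Q: "Q \<subseteq> carrier G"
  have "\<one> \<in> normalizer G Q" using Q by (simp add: normalizer_eq)
  then show "normalizer G Q \<noteq> {}" by blast
qed (auto simp: normalizer_eq conj_by_image_inv_eq_iff conj_by_image_mult)

lemma subset_normalizer:
  assumes "subgroup Q G" shows "Q \<subseteq> normalizer G Q"
proof -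
  interpret Q: subgroup Q G by fact
  have "conj_by G q ` Q \<subseteq> Q" if "q \<in> Q" for q using that by (auto simp: conj_by_def)
  moreover have "Q \<subseteq> conj_by G q ` Q" if "q \<in> Q" for q
  proof
    fix x assume "x \<in> Q"
    then have "conj_by G (inv q) x \<in> Q" using that by (auto simp: conj_by_def)
    then show "x \<in> conj_by G q ` Q"
      using that \<open>x \<in> Q\<close> by (metis Q.mem_carrier conj_by_cancel(2) image_eqI)
  qed
  ultimately have "conj_by G q ` Q = Q" if "q \<in> Q" for q using that by blast
  then show ?thesis by (auto simp: normalizer_eq Q.subset)
qed

lemma conj_by_subgroup:
  "\<lbrakk>subgroup H G; g \<in> H\<rbrakk> \<Longrightarrow> conj_by (G\<lparr>carrier := H\<rparr>) g = conj_by G g"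
  by (simp add: fun_eq_iff conj_by_def m_inv_consistent)

lemma normalizer_subgroup:
  assumes "subgroup P G" "Q \<subseteq> P"
  shows "normalizer (G\<lparr>carrier := P\<rparr>) Q = normalizer G Q \<inter> P"
proof -
  interpret P: group "G\<lparr>carrier := P\<rparr>" using assms(1) by (rule subgroup_imp_group)
  show ?thesis
    using assms by (auto simp: P.normalizer_eq normalizer_eq conj_by_subgroup subgroup.subset
        subgroup.mem_carrier order_trans[OF assms(2) subgroup.subset])
qed

lemma centralizer_eq:
  "Q \<subseteq> carrier G \<Longrightarrow> centralizer G Q = {g \<in> carrier G. \<forall>x\<in>Q. conj_by G g x = x}"
  by (auto simp: centralizer_def conj_by_def m_assoc inv_solve_left' subset_iff)

text \<open>The dictionary between fixed points on a coset space and subconjugacy. It serves for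
  Sylow subgroups, for \<open>induces_aut_P\<close> and finally for the cosets of
  \<open>P\<close>.\<close>

lemma rcoset_dot_eq_iff:
  assumes "subgroup B G" "c \<in> carrier G" "g \<in> carrier G"
  shows "B #> c #> g = B #> c \<longleftrightarrow> conj_by G (inv c) g \<in> B"
proof -
  have "B #> c #> g = B #> (c \<otimes> g)"
    using assms by (simp add: coset_mult_assoc subgroup.subset)
  also have "\<dots> = B #> c \<longleftrightarrow> c \<otimes> g \<otimes> inv c \<in> B"
    using assms subgroup.rcos_module[OF assms(1) group_axioms, of c "c \<otimes> g"]
    by (metis m_closed repr_independence repr_independenceD rcos_self subgroup.subset)
  finally show ?thesis using assms by (simp add: conj_by_def)
qed

lemma rcosets_action:
  assumes "subgroup B G" shows "right_action G (rcosets B) (r_coset G)"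
proof
  show "C #> g \<in> rcosets B" if "C \<in> rcosets B" "g \<in> carrier G" for C g
    using that assms by (auto simp: RCOSETS_def coset_mult_assoc subgroup.subset)
  show "C #> \<one> = C" if "C \<in> rcosets B" for C
    using that rcosets_subset_PowG[OF assms] by auto
  show "C #> (g \<otimes> h) = C #> g #> h" if "C \<in> rcosets B" "g \<in> carrier G" "h \<in> carrier G" for C g h
    using that rcosets_subset_PowG[OF assms] by (auto simp: coset_mult_assoc)
qed

section \<open>Fixed cosets and Sylow arguments\<close>

lemma p_subgroup_fixes_coset:
  assumes "finite (carrier G)" "Factorial_Ring.prime p" "subgroup B G"
    and "\<not> p dvd card (rcosets B)" and W: "p_subgroup p G W"
  shows "\<exists>c\<in>carrier G. \<forall>w\<in>W. conj_by G (inv c) w \<in> B"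
proof -
  obtain n where n: "subgroup W G" "card W = p ^ n" using W by (auto simp: p_subgroup_def)
  interpret A: right_action G "rcosets B" "r_coset G" using assms(3) by (rule rcosets_action)
  interpret W: right_action "G\<lparr>carrier := W\<rparr>" "rcosets B" "r_coset G"
    using n(1) by (rule A.subgroup_action)
  have "finite (rcosets B)"
    using assms(1,3) by (metis finite_Pow_iff finite_subset rcosets_subset_PowG)
  \<comment> \<open>The number of cosets is prime to \<open>p\<close>, hence so is the number of
    fixed ones, which therefore is not zero.\<close>
  then have "W.fixed W \<noteq> {}"
    using W.p_group_card_fixed[OF assms(2), of n] assms(4) n by (auto simp: order_def)
  then obtain c where "c \<in> carrier G" "\<forall>w\<in>W. B #> c #> w = B #> c"
    using W.fixed_def by (fastforce simp: RCOSETS_def)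
  then show ?thesis using n(1) assms(3) by (metis rcoset_dot_eq_iff subgroup.mem_carrier)
qed

lemma p_subgroup_subset:
  assumes p: "Factorial_Ring.prime p" and S: "p_subgroup p G S" and H: "subgroup H G" "H \<subseteq> S"
  shows "p_subgroup p G H"
proof -
  obtain a where a: "subgroup S G" "card S = p ^ a" using S by (auto simp: p_subgroup_def)
  have "subgroup H (G\<lparr>carrier := S\<rparr>)" using subgroup_incl[OF H(1) a(1) H(2)] .
  from group.lagrange[OF subgroup_imp_group[OF a(1)] this]
  have "card H dvd p ^ a" using a(2) by (simp add: order_def) (metis dvd_triv_right)
  then show ?thesis using H(1) p by (auto simp: p_subgroup_def divides_primepow_nat)
qed

text \<open>The cosets of \<open>Q\<close> in \<open>S\<close> fixed by \<open>Q\<close> are those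
  of elements normalizing \<open>Q\<close>. Their number is a multiple of \<open>p\<close> and
  \<open>Q\<close> is one of them, so some element of \<open>S\<close> outside \<open>Q\<close>
  normalizes \<open>Q\<close>; the intersection of \<open>S\<close> with the normalizer then serves
  as \<open>L\<close>.\<close>

lemma p_subgroup_normalizer_grows:
  assumes fin: "finite (carrier G)" and p: "Factorial_Ring.prime p"
    and S: "p_subgroup p G S" and Q: "subgroup Q G" "Q \<subset> S"
  shows "\<exists>L. p_subgroup p G L \<and> Q \<subset> L \<and> L \<subseteq> S \<and> L \<subseteq> normalizer G Q"
proof -
  obtain a where a: "subgroup S G" "card S = p ^ a" using S by (auto simp: p_subgroup_def)
  interpret S: group "G\<lparr>carrier := S\<rparr>" using a(1) by (rule subgroup_imp_group)
  have QS: "subgroup Q (G\<lparr>carrier := S\<rparr>)" using Q a(1) by (simp add: subgroup_incl psubset_imp_subset)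
  interpret A: right_action "G\<lparr>carrier := S\<rparr>" "rcosets\<^bsub>G\<lparr>carrier := S\<rparr>\<^esub> Q" "r_coset (G\<lparr>carrier := S\<rparr>)"
    using QS by (rule S.rcosets_action)
  interpret B: right_action "G\<lparr>carrier := Q\<rparr>" "rcosets\<^bsub>G\<lparr>carrier := S\<rparr>\<^esub> Q" "r_coset (G\<lparr>carrier := S\<rparr>)"
    using A.subgroup_action[OF QS] by simp
  have finS: "finite S" using fin a(1) by (meson finite_subset subgroup.subset)
  have lag: "card (rcosets\<^bsub>G\<lparr>carrier := S\<rparr>\<^esub> Q) * card Q = p ^ a"
    using S.lagrange[OF QS] a(2) by (simp add: order_def)
  then obtain b where b: "card Q = p ^ b" by (metis divides_primepow_nat dvd_triv_right p)
  obtain i where i: "card (rcosets\<^bsub>G\<lparr>carrier := S\<rparr>\<^esub> Q) = p ^ i"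
    using lag by (metis divides_primepow_nat dvd_triv_left p)
  have "card Q < card S" using finS Q(2) by (rule psubset_card_mono)
  then have "i \<noteq> 0" using lag i a by (cases "i = 0") auto
  then have "p dvd card (rcosets\<^bsub>G\<lparr>carrier := S\<rparr>\<^esub> Q)" using i by (simp add: dvd_power)
  moreover have "finite (rcosets\<^bsub>G\<lparr>carrier := S\<rparr>\<^esub> Q)"
    using i p by (intro card_ge_0_finite) (simp add: prime_gt_0_nat)
  ultimately have pd: "p dvd card (B.fixed Q)"
    using B.p_group_card_fixed[OF p, of b] b by (simp add: order_def)
  have one: "Q \<in> B.fixed Q"
    using QS subgroup.subgroup_in_rcosets[OF QS S.group_axioms]
      subgroup.rcos_const[OF QS S.group_axioms]
    by (auto simp: B.fixed_def)
  have "\<not> B.fixed Q \<subseteq> {Q}"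
  proof
    assume "B.fixed Q \<subseteq> {Q}"
    then have "B.fixed Q = {Q}" using one by blast
    then show False using pd p by auto
  qed
  then obtain C where C: "C \<in> B.fixed Q" "C \<noteq> Q" by blast
  then have "C \<in> rcosets\<^bsub>G\<lparr>carrier := S\<rparr>\<^esub> Q" by (simp add: B.fixed_def)
  then obtain c where "c \<in> S" "C = Q #>\<^bsub>G\<lparr>carrier := S\<rparr>\<^esub> c"
    by (auto simp: RCOSETS_def)
  note c = this(1) C[unfolded this(2)]
  have cG: "c \<in> carrier G" using a c subgroup.mem_carrier by metis
  have "conj_by G (inv c) q \<in> Q" if "q \<in> Q" for q
    using S.rcoset_dot_eq_iff[OF QS, of c q] c that Q a
    by (auto simp: B.fixed_def m_inv_consistent conj_by_subgroup subgroup.m_inv_closed)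
  then have "conj_by G (inv c) ` Q \<subseteq> Q" by blast
  then have "conj_by G (inv c) ` Q = Q"
    using cG Q finite_subset[OF psubset_imp_subset[OF Q(2)] finS] card_conj_by[of "inv c" Q]
    by (intro card_subset_eq) (auto dest: subgroup.subset)
  then have "c \<in> normalizer G Q"
    using cG Q(1) by (simp add: normalizer_eq subgroup.subset conj_by_image_inv_eq_iff)
  moreover have "c \<notin> Q"
    using c(3) S.coset_join2[OF _ QS, of c] c(1) by auto
  moreover have "subgroup (S \<inter> normalizer G Q) G"
    using subgroups_Inter_pair[OF a(1) subgroup_normalizer[OF subgroup.subset[OF Q(1)]]] .
  then have "p_subgroup p G (S \<inter> normalizer G Q)" by (intro p_subgroup_subset[OF p S]) auto
  ultimately show ?thesis
    using c(1) Q subset_normalizer[OF Q(1)] by (intro exI[of _ "S \<inter> normalizer G Q"]) auto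
qed

text \<open>If no larger \<open>p\<close>-subgroup normalizes \<open>Q\<close>, then
  \<open>Q\<close> is a Sylow subgroup because normalizers grow in \<open>p\<close>-groups. By its
  order \<open>Q'\<close> is one too, and Sylow subgroups are conjugate.\<close>

lemma p_subgroups_conjugate_or_extend:
  assumes fin: "finite (carrier G)" and p: "Factorial_Ring.prime p"
    and Q: "p_subgroup p G Q" "p_subgroup p G Q'" "card Q' = card Q"
  shows "(\<exists>c\<in>carrier G. conj_by G c ` Q = Q') \<or>
    (\<exists>L. p_subgroup p G L \<and> Q \<subset> L \<and> L \<subseteq> normalizer G Q)"
proof (rule disjCI)
  assume no: "\<nexists>L. p_subgroup p G L \<and> Q \<subset> L \<and> L \<subseteq> normalizer G Q"
  have ord: "order G \<noteq> 0" using fin order_gt_0_iff_finite by auto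
  then obtain m where m: "order G = p ^ multiplicity p (order G) * m"
    using multiplicity_dvd[of p "order G"] by blast
  have pm: "\<not> p dvd m"
  proof
    assume "p dvd m"
    then have "p ^ Suc (multiplicity p (order G)) dvd order G"
      using m by (metis mult.commute mult_dvd_mono dvd_refl power_Suc)
    then show False using ord p by (metis multiplicity_geI not_prime_unit Suc_n_not_le_n)
  qed
  obtain S where S: "subgroup S G" "card S = p ^ multiplicity p (order G)"
    using sylow_thm[OF p group_axioms m fin] by blast
  have "card (rcosets S) * p ^ multiplicity p (order G) = m * p ^ multiplicity p (order G)"
    using lagrange[OF S(1)] S(2) m by (simp add: mult.commute)
  then have "card (rcosets S) = m" using p by (simp add: prime_gt_0_nat)
  then have np: "\<not> p dvd card (rcosets S)" using pm by simp
  have finS: "finite S" using fin S(1) by (meson finite_subset subgroup.subset)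
  have pS: "p_subgroup p G S" using S by (auto simp: p_subgroup_def)
  have *: "\<exists>c\<in>carrier G. conj_by G c ` R \<subseteq> S" if "p_subgroup p G R" for R
    using p_subgroup_fixes_coset[OF fin p S(1) np that] by (metis image_subsetI inv_closed)
  have sub: "Q \<subseteq> carrier G" "Q' \<subseteq> carrier G"
    using Q by (auto simp: p_subgroup_def dest: subgroup.subset)
  obtain c where c: "c \<in> carrier G" "conj_by G c ` Q \<subseteq> S" using *[OF Q(1)] by blast
  obtain d where d: "d \<in> carrier G" "conj_by G d ` Q' \<subseteq> S" using *[OF Q(2)] by blast
  have "conj_by G c ` Q = S"
  proof (rule ccontr)
    assume "conj_by G c ` Q \<noteq> S"
    then have "Q \<subset> conj_by G (inv c) ` S"
      using c sub S(1) image_mono[OF c(2), of "conj_by G (inv c)"]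
        conj_by_image_inv_eq_iff[OF c(1), of S Q]
      by (auto simp: subgroup.subset conj_by_image_mult[symmetric])
    then obtain L where "p_subgroup p G L" "Q \<subset> L" "L \<subseteq> normalizer G Q"
      using p_subgroup_normalizer_grows[OF fin p p_subgroup_conj_by[OF pS inv_closed[OF c(1)]]] Q(1)
      by (metis p_subgroup_def)
    then show False using no by blast
  qed
  moreover from this have "conj_by G d ` Q' = S"
    using Q(3) d c sub finS by (metis card_conj_by card_subset_eq)
  ultimately have "conj_by G (c \<otimes> inv d) ` Q = Q'"
    using c d sub S(1) by (simp add: conj_by_image_mult conj_by_image_inv_eq_iff subgroup.subset)
  then show "\<exists>c\<in>carrier G. conj_by G c ` Q = Q'" using c d by blast
qed


section \<open>Saturated fusion systems\<close>

lemma fusion_iso_eq: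
  assumes "Q \<subseteq> carrier G" "R \<subseteq> carrier G"
  shows "fusion_iso G Q R = {restrict (conj_by G g) Q | g. g \<in> carrier G \<and> conj_by G g ` Q = R}"
proof (intro subset_antisym subsetI)
  fix \<phi> assume "\<phi> \<in> fusion_iso G Q R"
  then have "\<phi> \<in> fusion_hom G Q R"
    and "\<exists>\<psi>\<in>fusion_hom G R Q. (\<forall>x\<in>Q. \<psi> (\<phi> x) = x) \<and> (\<forall>y\<in>R. \<phi> (\<psi> y) = y)"
    unfolding fusion_iso_def by blast+
  then obtain g \<psi> where g: "g \<in> carrier G" "conj_by G g ` Q \<subseteq> R" "\<phi> = restrict (conj_by G g) Q"
    and \<psi>: "\<psi> \<in> fusion_hom G R Q" "\<forall>y\<in>R. \<phi> (\<psi> y) = y"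
    by (auto simp only: fusion_hom_def mem_Collect_eq)
  have "y \<in> conj_by G g ` Q" if "y \<in> R" for y
  proof -
    have "\<psi> y \<in> Q" using \<psi>(1) that by (auto simp: fusion_hom_def)
    then show ?thesis using \<psi>(2) g that by (metis image_eqI restrict_apply')
  qed
  then show "\<phi> \<in> {restrict (conj_by G g) Q | g. g \<in> carrier G \<and> conj_by G g ` Q = R}"
    using g by blast
next
  fix \<phi> assume "\<phi> \<in> {restrict (conj_by G g) Q | g. g \<in> carrier G \<and> conj_by G g ` Q = R}"
  then obtain g where g: "g \<in> carrier G" "conj_by G g ` Q = R" "\<phi> = restrict (conj_by G g) Q"
    by blast
  have inv: "conj_by G (inv g) ` R = Q"
    using assms g(1) g(2)[symmetric] by (simp add: conj_by_image_inv_eq_iff)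
  have "restrict (conj_by G (inv g)) R \<in> fusion_hom G R Q"
    using g(1) inv by (auto simp: fusion_hom_def)
  moreover have "\<phi> \<in> fusion_hom G Q R" using g by (auto simp: fusion_hom_def)
  moreover have "restrict (conj_by G (inv g)) R (\<phi> x) = x" if "x \<in> Q" for x
    using g(1) g(2)[symmetric] g(3) assms that by (simp add: subset_iff)
  moreover have "\<phi> (restrict (conj_by G (inv g)) R y) = y" if "y \<in> R" for y
    using g(1,3) inv[symmetric] assms that by (simp add: subset_iff)
  ultimately show "\<phi> \<in> fusion_iso G Q R"
    unfolding fusion_iso_def by blast
qed

lemma fusion_conjugate_iff:
  assumes "Q \<subseteq> carrier G" "R \<subseteq> carrier G"
  shows "fusion_conjugate G Q R \<longleftrightarrow> (\<exists>g\<in>carrier G. conj_by G g ` Q = R)"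
  using fusion_iso_eq[OF assms] by (auto simp: fusion_conjugate_def)

text \<open>For a subgroup \<open>T\<close> of \<open>P\<close> this is $N_P(T) C_G(T)$. Written as
  the preimage of $Aut_P(T)$, it visibly has the same index in $N_G(T)$ as $Aut_P(T)$ has among the
  automorphisms of \<open>T\<close> in the fusion system.\<close>

definition induces_aut_P :: "'a set \<Rightarrow> 'a set \<Rightarrow> 'a set" where
  "induces_aut_P P T = {b \<in> carrier G. restrict (conj_by G b) T \<in> aut_P G P T}"

lemma induces_aut_P_iff:
  assumes "subgroup P G" "T \<subseteq> P"
  shows "b \<in> induces_aut_P P T \<longleftrightarrow>
    b \<in> carrier G \<and> (\<exists>a\<in>normalizer G T \<inter> P. \<forall>x\<in>T. conj_by G b x = conj_by G a x)"
proof -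
  have "restrict f T = restrict g T \<longleftrightarrow> (\<forall>x\<in>T. f x = g x)" for f g :: "'a \<Rightarrow> 'a"
    by (auto simp: fun_eq_iff)
  then show ?thesis
    unfolding induces_aut_P_def aut_P_def normalizer_subgroup[OF assms] by blast
qed

lemma induces_aut_P_subgroup:
  assumes P: "subgroup P G" "T \<subseteq> P"
  shows "subgroup (induces_aut_P P T) (G\<lparr>carrier := normalizer G T\<rparr>)"
proof -
  note iff = induces_aut_P_iff[OF P]
  have T: "T \<subseteq> carrier G" using P by (meson order_trans subgroup.subset)
  interpret N: subgroup "normalizer G T" G using T by (rule subgroup_normalizer)
  interpret P: subgroup P G by fact
  have 1: "induces_aut_P P T \<subseteq> normalizer G T"
  proof
    fix b assume "b \<in> induces_aut_P P T"
    then obtain a where a: "b \<in> carrier G" "a \<in> normalizer G T"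
      "\<forall>x\<in>T. conj_by G b x = conj_by G a x" using iff by blast
    have "conj_by G b ` T = conj_by G a ` T" using a(3) by (intro image_cong) auto
    also have "\<dots> = T" using a(2) T by (rule normalizerD)
    finally show "b \<in> normalizer G T" using a(1) unfolding normalizer_eq[OF T] by blast
  qed
  have "subgroup (induces_aut_P P T) G"
  proof (rule subgroupI)
    show "induces_aut_P P T \<subseteq> carrier G" using 1 N.subset by blast
    have "\<one> \<in> induces_aut_P P T"
      using iff[of \<one>] N.one_closed P.one_closed by blast
    then show "induces_aut_P P T \<noteq> {}" by blast
  next
    fix b assume "b \<in> induces_aut_P P T"
    then obtain a where a: "b \<in> carrier G" "a \<in> normalizer G T" "a \<in> P"
      "\<forall>x\<in>T. conj_by G b x = conj_by G a x" by (auto simp: iff)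
    have "conj_by G (inv b) x = conj_by G (inv a) x" if "x \<in> T" for x
    proof -
      have y: "conj_by G (inv a) x \<in> T" using a that T by (intro normalizerD(3)) auto
      then have "conj_by G b (conj_by G (inv a) x) = x"
        using a that T by (auto simp: subset_iff)
      then show ?thesis using a y T by (metis conj_by_cancel(1) subsetD)
    qed
    then show "inv b \<in> induces_aut_P P T"
      using a by (auto simp: iff intro!: bexI[of _ "inv a"])
  next
    fix b c assume bc: "b \<in> induces_aut_P P T" "c \<in> induces_aut_P P T"
    obtain a where a: "b \<in> carrier G" "a \<in> normalizer G T" "a \<in> P"
      "\<forall>x\<in>T. conj_by G b x = conj_by G a x" using bc by (auto simp: iff)
    obtain d where d: "c \<in> carrier G" "d \<in> normalizer G T" "d \<in> P"
      "\<forall>x\<in>T. conj_by G c x = conj_by G d x" using bc by (auto simp: iff)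
    have "conj_by G (b \<otimes> c) x = conj_by G (a \<otimes> d) x" if "x \<in> T" for x
      using that a d T normalizerD(3)[OF a(2) T that] by (simp add: conj_by_mult subset_iff)
    then show "b \<otimes> c \<in> induces_aut_P P T"
      using a d by (auto simp: iff intro!: bexI[of _ "a \<otimes> d"])
  qed
  then show ?thesis using 1 N.subgroup_axioms by (intro subgroup_incl) auto
qed

text \<open>Two elements act alike on \<open>T\<close> exactly when they differ by a factor
  centralizing \<open>T\<close>, so each fibre is a coset of the centralizer. The last hypothesis
  says that \<open>A\<close> contains whole fibres.\<close>

lemma card_inducing:
  assumes "finite (carrier G)" "T \<subseteq> carrier G" "A \<subseteq> carrier G"
    and "\<And>a b. \<lbrakk>a \<in> A; b \<in> carrier G; \<forall>x\<in>T. conj_by G b x = conj_by G a x\<rbrakk> \<Longrightarrow> b \<in> A"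
  shows "card A = card ((\<lambda>g. restrict (conj_by G g) T) ` A) * card (centralizer G T)"
proof (rule card_eq_card_image_times)
  show "finite A" using assms finite_subset by blast
next
  fix y assume "y \<in> (\<lambda>g. restrict (conj_by G g) T) ` A"
  then obtain a where a: "a \<in> A" "y = restrict (conj_by G a) T" by blast
  have aG: "a \<in> carrier G" using a assms by blast
  have "{x \<in> A. restrict (conj_by G x) T = y} = (\<lambda>z. z \<otimes> a) ` centralizer G T"
  proof (intro subset_antisym subsetI)
    fix b assume b: "b \<in> {x \<in> A. restrict (conj_by G x) T = y}"
    then have bG: "b \<in> carrier G" using assms by auto
    have "conj_by G b x = conj_by G a x" if "x \<in> T" for x
    proof -
      have "restrict (conj_by G b) T = restrict (conj_by G a) T" using a b by simp
      from fun_cong[OF this, of x] show ?thesis using that by simp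
    qed
    then have "b \<otimes> inv a \<in> centralizer G T"
      using aG bG assms(2) by (auto simp: centralizer_eq conj_by_mult subset_iff)
    moreover have "b = b \<otimes> inv a \<otimes> a" using aG bG by (simp add: m_assoc)
    ultimately show "b \<in> (\<lambda>z. z \<otimes> a) ` centralizer G T" by blast
  next
    fix b assume "b \<in> (\<lambda>z. z \<otimes> a) ` centralizer G T"
    then obtain z where z: "z \<in> centralizer G T" "b = z \<otimes> a" by blast
    then have *: "\<forall>x\<in>T. conj_by G b x = conj_by G a x" "b \<in> carrier G"
      using aG assms(2) by (auto simp: centralizer_eq conj_by_mult subset_iff)
    then show "b \<in> {x \<in> A. restrict (conj_by G x) T = y}"
      using a assms(4)[OF a(1), of b] by (auto simp: restrict_def fun_eq_iff)
  qed
  moreover have "inj_on (\<lambda>z. z \<otimes> a) (centralizer G T)"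
    using aG by (intro inj_onI) (auto simp: centralizer_def)
  ultimately show "card {x \<in> A. restrict (conj_by G x) T = y} = card (centralizer G T)"
    by (simp add: card_image)
qed

text \<open>Both $N_G(T)$ and \<open>induces_aut_P P T\<close> are full preimages of groups of
  automorphisms, so the order of the centralizer cancels in the index. What remains is the index of
  a Sylow \<open>p\<close>-subgroup.\<close>

lemma fully_automized_index:
  assumes fin: "finite (carrier G)" and p: "Factorial_Ring.prime p"
    and P: "subgroup P G" "T \<subseteq> P" and T: "fully_automized p G P T"
  shows "\<not> p dvd card (rcosets\<^bsub>G\<lparr>carrier := normalizer G T\<rparr>\<^esub> (induces_aut_P P T))"
proof -
  let ?N = "G\<lparr>carrier := normalizer G T\<rparr>" and ?B = "induces_aut_P P T"
  let ?f = "\<lambda>g. restrict (conj_by G g) T"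
  have TG: "T \<subseteq> carrier G" using P by (meson order_trans subgroup.subset)
  interpret N: group ?N using subgroup_normalizer[OF TG] by (rule subgroup_imp_group)
  have cN: "card (normalizer G T) = card (fusion_iso G T T) * card (centralizer G T)"
  proof -
    have "?f ` normalizer G T = fusion_iso G T T"
      using TG by (auto simp: fusion_iso_eq normalizer_eq)
    moreover have "card (normalizer G T) = card (?f ` normalizer G T) * card (centralizer G T)"
      using TG fin by (intro card_inducing) (auto simp: normalizer_eq)
    ultimately show ?thesis by simp
  qed
  have cB: "card ?B = card (aut_P G P T) * card (centralizer G T)"
  proof -
    have "?f ` ?B = aut_P G P T"
      using normalizerD(1)[OF _ TG] unfolding induces_aut_P_def aut_P_def
      by (auto simp: normalizer_subgroup[OF P])
    moreover have "card ?B = card (?f ` ?B) * card (centralizer G T)"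
      using TG fin by (intro card_inducing) (auto simp: induces_aut_P_iff[OF P])
    ultimately show ?thesis by simp
  qed
  define m where "m = multiplicity p (card (fusion_iso G T T))"
  have cA: "card (aut_P G P T) = p ^ m"
    using T by (simp add: fully_automized_def sylow_subgroup_def aut_F_def order_def m_def)
  have finN: "finite (normalizer G T)" using fin normalizerD(1)[OF _ TG] by (meson finite_subset subsetI)
  have "card (rcosets\<^bsub>?N\<^esub> ?B) * card ?B = card (normalizer G T)"
    using N.lagrange[OF induces_aut_P_subgroup[OF P]] by (simp add: order_def)
  moreover have "card (normalizer G T) \<noteq> 0"
    using finN subgroup.one_closed[OF subgroup_normalizer[OF TG]] by auto
  ultimately have eq: "card (rcosets\<^bsub>?N\<^esub> ?B) * p ^ m = card (fusion_iso G T T)"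
    and nz: "card (fusion_iso G T T) \<noteq> 0"
    unfolding cN cB cA by auto
  show ?thesis
  proof
    assume "p dvd card (rcosets\<^bsub>?N\<^esub> ?B)"
    then have "p ^ Suc m dvd card (fusion_iso G T T)"
      unfolding eq[symmetric] by (simp add: mult_dvd_mono)
    then have "Suc m \<le> m" unfolding m_def using nz p
      by (intro multiplicity_geI) (auto simp: not_prime_unit)
    then show False by simp
  qed
qed

text \<open>The index of \<open>induces_aut_P P T\<close> in the normalizer of \<open>T\<close> is prime to \<open>p\<close>, so the
  isomorphism can be adjusted by an automorphism of \<open>T\<close> until its extension control is all of
  the normalizer of \<open>S\<close> in \<open>P\<close>.\<close>

lemma receptive_extension:
  assumes fin: "finite (carrier G)" and p: "Factorial_Ring.prime p" and P: "p_subgroup p G P"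
    and T: "T \<subseteq> P" "fully_automized p G P T" "receptive G P T"
    and S: "subgroup S G" "S \<subseteq> P" and h0: "h0 \<in> carrier G" "conj_by G h0 ` S = T"
  shows "\<exists>h\<in>carrier G. conj_by G h ` S = T \<and>
    conj_by G h ` (normalizer G S \<inter> P) \<subseteq> normalizer G T \<inter> P"
proof -
  have PG: "subgroup P G" using P by (simp add: p_subgroup_def)
  have TG: "T \<subseteq> carrier G" and SG: "S \<subseteq> carrier G"
    using PG T(1) S by (auto dest: subgroup.subset)
  let ?N = "G\<lparr>carrier := normalizer G T\<rparr>" and ?B = "induces_aut_P P T"
  have NT: "subgroup (normalizer G T) G" using TG by (rule subgroup_normalizer)
  interpret N: group ?N using NT by (rule subgroup_imp_group)
  \<comment> \<open>The conjugate of $N_P(S)$ by the given \<open>h0\<close>. It is a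
    \<open>p\<close>-subgroup of $N_G(T)$ and hence fixes a coset of
    \<open>induces_aut_P P T\<close>.\<close>
  define W where "W = conj_by G h0 ` (normalizer G S \<inter> P)"
  have NSP: "subgroup (normalizer G S \<inter> P) G"
    using subgroups_Inter_pair[OF subgroup_normalizer[OF SG] PG] .
  have "p_subgroup p G W"
    unfolding W_def using h0(1) p_subgroup_subset[OF p P NSP] by (intro p_subgroup_conj_by) auto
  moreover have "W \<subseteq> normalizer G T"
  proof
    fix w assume "w \<in> W"
    then obtain n where n: "n \<in> normalizer G S" "w = conj_by G h0 n" by (auto simp: W_def)
    have nG: "n \<in> carrier G" using n normalizerD(1) SG by blast
    have "conj_by G w ` T = conj_by G (inv h0 \<otimes> n \<otimes> h0) ` T" using n by (simp add: conj_by_def)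
    also have "\<dots> = conj_by G h0 ` conj_by G n ` conj_by G (inv h0) ` T"
      using nG h0 TG by (simp add: conj_by_image_mult image_subset_iff subset_iff)
    also have "conj_by G (inv h0) ` T = S" using h0 SG TG by (simp add: conj_by_image_inv_eq_iff)
    also have "conj_by G n ` S = S" using n SG by (simp add: normalizerD(2))
    finally show "w \<in> normalizer G T" using n nG h0 TG by (simp add: normalizer_eq)
  qed
  ultimately have "p_subgroup p ?N W" using NT by (auto simp: p_subgroup_def intro: subgroup_incl)
  then obtain c where c: "c \<in> normalizer G T" "\<And>w. w \<in> W \<Longrightarrow> conj_by ?N (inv\<^bsub>?N\<^esub> c) w \<in> ?B"
    using N.p_subgroup_fixes_coset[OF _ p induces_aut_P_subgroup[OF PG T(1)]
        fully_automized_index[OF fin p PG T(1,2)], of W]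
      finite_subset[OF subgroup.subset[OF NT] fin] by (simp add: Bex_def) blast
  have cG: "c \<in> carrier G" using c(1) TG by (rule normalizerD(1))
  have ic: "inv c \<in> normalizer G T" using NT c(1) by (rule subgroup.m_inv_closed)
  have c2: "conj_by G (inv c) w \<in> ?B" if "w \<in> W" for w
    using c(2)[OF that] NT c(1) ic by (simp add: m_inv_consistent conj_by_subgroup)
  \<comment> \<open>Following \<open>h0\<close> by \<open>inv c\<close> conjugates $N_P(S)$ into
    \<open>induces_aut_P P T\<close>. As \<open>c\<close> normalizes \<open>T\<close>, the image of
    \<open>S\<close> is still \<open>T\<close>.\<close>
  define h where "h = h0 \<otimes> inv c"
  have hG: "h \<in> carrier G" using h0 cG by (simp add: h_def)
  have hS: "conj_by G h ` S = T"
    using h0 cG SG normalizerD(2)[OF ic TG] by (simp add: h_def conj_by_image_mult)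
  define \<phi> where "\<phi> = restrict (conj_by G h) S"
  have \<phi>: "\<phi> \<in> fusion_iso G S T" using hG hS fusion_iso_eq[OF SG TG] by (auto simp: \<phi>_def)
  have "subgroup S (G\<lparr>carrier := P\<rparr>)" using S PG by (intro subgroup_incl)
  then obtain \<phi>' where \<phi>': "\<phi>' \<in> fusion_hom G (extension_control G P S T \<phi>) P" "\<forall>x\<in>S. \<phi>' x = \<phi> x"
    using T(3) \<phi> unfolding receptive_def by blast
  \<comment> \<open>Membership in \<open>extension_control\<close> means that the transported
    element acts on \<open>T\<close> like an element of $N_P(T)$, which the choice of
    \<open>c\<close> guarantees.\<close>
  have ext: "normalizer G S \<inter> P \<subseteq> extension_control G P S T \<phi>"
  proof
    fix g assume g: "g \<in> normalizer G S \<inter> P"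
    then have gG: "g \<in> carrier G" using SG normalizerD(1) by blast
    have "conj_by G h g \<in> ?B"
      using c2[of "conj_by G h0 g"] g gG h0 cG by (simp add: h_def conj_by_mult W_def)
    then have "restrict (conj_by G (conj_by G h g)) T \<in> aut_P G P T"
      by (simp add: induces_aut_P_def)
    also have "restrict (conj_by G (conj_by G h g)) T =
      (\<lambda>x\<in>T. \<phi> (conj_by G g (inv_into S \<phi> x)))"
    proof (rule restrict_ext)
      fix x assume x: "x \<in> T"
      then obtain s where s: "s \<in> S" "x = conj_by G h s" using hS by blast
      have "inj_on \<phi> S" using inj_on_conj_by[OF hG SG] by (simp add: \<phi>_def inj_on_def)
      moreover have "x = \<phi> s" using s by (simp add: \<phi>_def)
      ultimately have inv: "inv_into S \<phi> x = s" using s(1) by simp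
      have sG: "s \<in> carrier G" using s SG by auto
      have "conj_by G (conj_by G h g) x = conj_by G (inv h \<otimes> g \<otimes> h) x" by (simp add: conj_by_def)
      also have "\<dots> = conj_by G h (conj_by G g s)"
        using hG gG sG s by (simp add: conj_by_mult)
      also have "\<dots> = \<phi> (conj_by G g s)" using g s(1) SG normalizerD(3) by (auto simp: \<phi>_def)
      finally show "conj_by G (conj_by G h g) x = \<phi> (conj_by G g (inv_into S \<phi> x))"
        by (simp add: inv)
    qed
    finally show "g \<in> extension_control G P S T \<phi>"
      using g unfolding extension_control_def normalizer_subgroup[OF PG S(2)] by blast
  qed
  from \<phi>'(1) obtain h' where h': "h' \<in> carrier G"
    "conj_by G h' ` extension_control G P S T \<phi> \<subseteq> P"
    "\<phi>' = restrict (conj_by G h') (extension_control G P S T \<phi>)"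
    by (auto simp: fusion_hom_def)
  \<comment> \<open>The extending element \<open>h'\<close> agrees with \<open>h\<close> on
    \<open>S\<close>, so it also maps \<open>S\<close> onto \<open>T\<close>; being an extension to
    $N_P(S)$ with values in \<open>P\<close>, it is the element sought.\<close>
  have "S \<subseteq> normalizer G S \<inter> P" using subset_normalizer[OF S(1)] S(2) by blast
  then have "conj_by G h' x = conj_by G h x" if "x \<in> S" for x
    using \<phi>'(2) h'(3) subsetD[OF ext] that by (simp add: \<phi>_def subset_iff)
  then have h'S: "conj_by G h' ` S = T" using hS by auto
  have "conj_by G h' n \<in> normalizer G T" if n: "n \<in> normalizer G S" for n
  proof -
    have nG: "n \<in> carrier G" using n normalizerD(1) SG by blast
    have "conj_by G (conj_by G h' n) ` T = conj_by G (inv h' \<otimes> n \<otimes> h') ` T" by (simp add: conj_by_def)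
    also have "\<dots> = conj_by G h' ` conj_by G n ` conj_by G (inv h') ` T"
      using nG h' TG by (simp add: conj_by_image_mult image_subset_iff subset_iff)
    also have "conj_by G (inv h') ` T = S" using h' h'S SG TG by (simp add: conj_by_image_inv_eq_iff)
    also have "conj_by G n ` S = S" using n SG by (simp add: normalizerD(2))
    finally show ?thesis using nG h' h'S TG by (simp add: normalizer_eq)
  qed
  moreover have "conj_by G h' ` (normalizer G S \<inter> P) \<subseteq> P" using ext h'(2) by blast
  ultimately show ?thesis using h' h'S by blast
qed

text \<open>The form in which saturation is used. For a fully automized and receptive conjugate
  \<open>T\<close> of \<open>Q\<close>, the normalizers in \<open>P\<close> of \<open>Q\<close> and
  of its conjugate \<open>S\<close> both map into that of \<open>T\<close>. As \<open>Q\<close> is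
  fully normalized, the map from $N_P(Q)$ is onto, so it can be inverted and leads from
  \<open>T\<close> back to \<open>Q\<close>.\<close>

lemma saturated_normalizer_conj:
  assumes fin: "finite (carrier G)" and p: "Factorial_Ring.prime p" and P: "p_subgroup p G P"
    and sat: "saturated p G P" and Q: "fully_normalized G P Q"
    and g: "g \<in> carrier G" "conj_by G g ` Q \<subseteq> P"
  shows "\<exists>n\<in>normalizer G Q. \<forall>l\<in>normalizer G Q. conj_by G g l \<in> P \<longrightarrow> conj_by G n l \<in> P"
proof -
  have PG: "subgroup P G" using P by (simp add: p_subgroup_def)
  have subP: "subgroup T G \<and> T \<subseteq> P" if "subgroup T (G\<lparr>carrier := P\<rparr>)" for T
    using that PG incl_subgroup[of P T] subgroup.subset by fastforce
  have QP: "subgroup Q (G\<lparr>carrier := P\<rparr>)" using Q by (simp add: fully_normalized_def)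
  then have QG: "subgroup Q G" "Q \<subseteq> P" using subP by auto
  then have QC: "Q \<subseteq> carrier G" using subgroup.subset by blast
  obtain T where T: "subgroup T (G\<lparr>carrier := P\<rparr>)" "fusion_conjugate G Q T"
    "fully_automized p G P T" "receptive G P T"
    using sat QP unfolding saturated_def by blast
  then have TG: "subgroup T G" "T \<subseteq> P" using subP by auto
  then have TC: "T \<subseteq> carrier G" using subgroup.subset by blast
  obtain a where a: "a \<in> carrier G" "conj_by G a ` Q = T"
    using T(2) fusion_conjugate_iff[OF QC TC] by blast
  define S where "S = conj_by G g ` Q"
  have S: "subgroup S G" "S \<subseteq> P" using subgroup_conj_by[OF QG(1) g(1)] g by (auto simp: S_def)
  then have SC: "S \<subseteq> carrier G" using subgroup.subset by blast
  have gS: "conj_by G (inv g \<otimes> a) ` S = T"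
    using g a QC SC by (simp add: conj_by_image_mult conj_by_image_inv_eq_iff S_def)
      (simp add: conj_by_image_mult[symmetric])
  obtain h2 where h2: "h2 \<in> carrier G" "conj_by G h2 ` Q = T"
    "conj_by G h2 ` (normalizer G Q \<inter> P) \<subseteq> normalizer G T \<inter> P"
    using receptive_extension[OF fin p P TG(2) T(3,4) QG a] by blast
  obtain h1 where h1: "h1 \<in> carrier G" "conj_by G h1 ` S = T"
    "conj_by G h1 ` (normalizer G S \<inter> P) \<subseteq> normalizer G T \<inter> P"
    using receptive_extension[OF fin p P TG(2) T(3,4) S _ gS] g a by auto
  \<comment> \<open>Full normalization enters here: it turns the inclusion of the image of $N_P(Q)$
    in $N_P(T)$ into an equality.\<close>
  have "card (normalizer (G\<lparr>carrier := P\<rparr>) T) \<le> card (normalizer (G\<lparr>carrier := P\<rparr>) Q)"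
    using Q T(1,2) unfolding fully_normalized_def by blast
  then have "card (normalizer G T \<inter> P) \<le> card (normalizer G Q \<inter> P)"
    by (simp add: normalizer_subgroup[OF PG TG(2)] normalizer_subgroup[OF PG QG(2)])
  also have "\<dots> = card (conj_by G h2 ` (normalizer G Q \<inter> P))"
    using h2(1) PG by (intro card_conj_by[symmetric]) (auto dest: subgroup.subset)
  finally have eq: "conj_by G h2 ` (normalizer G Q \<inter> P) = normalizer G T \<inter> P"
    using h2(3) fin PG by (intro card_seteq) (auto intro: finite_subset dest: subgroup.subset)
  \<comment> \<open>\<open>g\<close> carries \<open>Q\<close> to \<open>S\<close>, \<open>h1\<close>
    carries \<open>S\<close> to \<open>T\<close>, and \<open>inv h2\<close> carries \<open>T\<close>
    back to \<open>Q\<close>.\<close>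
  define n where "n = g \<otimes> h1 \<otimes> inv h2"
  have nG: "n \<in> carrier G" using g h1 h2 by (simp add: n_def)
  have "conj_by G n ` Q = conj_by G (inv h2) ` conj_by G h1 ` S"
    using g h1 h2 QC SC by (simp add: n_def conj_by_image_mult S_def)
  also have "\<dots> = Q" using h1 h2 QC TC by (simp add: conj_by_image_inv_eq_iff)
  finally have "n \<in> normalizer G Q" using nG QC by (simp add: normalizer_eq)
  moreover have "conj_by G n l \<in> P" if l: "l \<in> normalizer G Q" "conj_by G g l \<in> P" for l
  proof -
    have lG: "l \<in> carrier G" using l QC normalizerD by blast
    have "conj_by G (conj_by G g l) ` S = conj_by G (inv g \<otimes> l \<otimes> g) ` S" by (simp add: conj_by_def)
    also have "\<dots> = conj_by G g ` conj_by G l ` conj_by G (inv g) ` S"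
      using lG g(1) SC by (simp add: conj_by_image_mult image_subset_iff subset_iff)
    also have "conj_by G (inv g) ` S = Q" using g(1) SC QC by (simp add: conj_by_image_inv_eq_iff S_def)
    also have "conj_by G l ` Q = Q" using l QC by (simp add: normalizerD(2))
    finally have "conj_by G g l \<in> normalizer G S \<inter> P"
      using l lG g(1) SC by (simp add: normalizer_eq S_def)
    then have "conj_by G h1 (conj_by G g l) \<in> normalizer G T \<inter> P" using h1(3) by blast
    then obtain y where y: "y \<in> normalizer G Q \<inter> P" "conj_by G h1 (conj_by G g l) = conj_by G h2 y"
      using eq by (metis (no_types, lifting) imageE)
    have "conj_by G n l = conj_by G (inv h2) (conj_by G h1 (conj_by G g l))"
      using g(1) h1(1) h2(1) lG by (simp add: n_def conj_by_mult)
    then show ?thesis using y h2(1) PG by (auto simp: subgroup.mem_carrier)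
  qed
  ultimately show ?thesis by blast
qed

end

section \<open>Modules, homomorphisms and quotients\<close>

text \<open>The axioms of \<open>fg_right_module\<close> without finite generation, so that
  submodules, quotients and restrictions call for no argument about generators.\<close>

locale right_module = kM: module k M + G: group G
  for k :: "('k, 'r) ring_scheme" and G :: "('g, 's) monoid_scheme"
    and M :: "('k, 'g, 'm) gmodule" +
  assumes act_closed [simp]: "\<lbrakk>m \<in> carrier M; g \<in> carrier G\<rbrakk> \<Longrightarrow> m \<star>\<^bsub>M\<^esub> g \<in> carrier M"
    and act_add: "\<lbrakk>m \<in> carrier M; n \<in> carrier M; g \<in> carrier G\<rbrakk>
      \<Longrightarrow> (m \<oplus>\<^bsub>M\<^esub> n) \<star>\<^bsub>M\<^esub> g = (m \<star>\<^bsub>M\<^esub> g) \<oplus>\<^bsub>M\<^esub> (n \<star>\<^bsub>M\<^esub> g)"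
    and act_smult: "\<lbrakk>a \<in> carrier k; m \<in> carrier M; g \<in> carrier G\<rbrakk>
      \<Longrightarrow> (a \<odot>\<^bsub>M\<^esub> m) \<star>\<^bsub>M\<^esub> g = a \<odot>\<^bsub>M\<^esub> (m \<star>\<^bsub>M\<^esub> g)"
    and act_one [simp]: "m \<in> carrier M \<Longrightarrow> m \<star>\<^bsub>M\<^esub> \<one>\<^bsub>G\<^esub> = m"
    and act_mult: "\<lbrakk>m \<in> carrier M; g \<in> carrier G; h \<in> carrier G\<rbrakk>
      \<Longrightarrow> m \<star>\<^bsub>M\<^esub> (g \<otimes>\<^bsub>G\<^esub> h) = m \<star>\<^bsub>M\<^esub> g \<star>\<^bsub>M\<^esub> h"

lemma (in fg_right_module) right_module: "right_module k G M"
  by unfold_locales (simp_all add: act_closed act_add act_smult act_one act_mult)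

lemma abelian_group_inj_transport:
  assumes V: "abelian_group V" and f: "f \<in> carrier W \<rightarrow> carrier V" "inj_on f (carrier W)"
    and cl: "\<And>x y. \<lbrakk>x \<in> carrier W; y \<in> carrier W\<rbrakk> \<Longrightarrow> x \<oplus>\<^bsub>W\<^esub> y \<in> carrier W"
    and add: "\<And>x y. \<lbrakk>x \<in> carrier W; y \<in> carrier W\<rbrakk> \<Longrightarrow> f (x \<oplus>\<^bsub>W\<^esub> y) = f x \<oplus>\<^bsub>V\<^esub> f y"
    and zero: "\<zero>\<^bsub>W\<^esub> \<in> carrier W" "f \<zero>\<^bsub>W\<^esub> = \<zero>\<^bsub>V\<^esub>"
    and neg: "\<And>x. x \<in> carrier W \<Longrightarrow> \<exists>y\<in>carrier W. f y = \<ominus>\<^bsub>V\<^esub> f x"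
  shows "abelian_group W"
proof -
  interpret V: abelian_group V by fact
  have fc: "f x \<in> carrier V" if "x \<in> carrier W" for x using f that by auto
  have eq: "x = y" if "f x = f y" "x \<in> carrier W" "y \<in> carrier W" for x y
    using f that by (auto dest: inj_onD)
  show ?thesis
  proof (rule abelian_groupI)
    fix x y z assume "x \<in> carrier W" "y \<in> carrier W" "z \<in> carrier W"
    then show "(x \<oplus>\<^bsub>W\<^esub> y) \<oplus>\<^bsub>W\<^esub> z = x \<oplus>\<^bsub>W\<^esub> (y \<oplus>\<^bsub>W\<^esub> z)"
      by (intro eq) (auto simp: add cl fc V.a_assoc)
  next
    fix x y assume "x \<in> carrier W" "y \<in> carrier W"
    then show "x \<oplus>\<^bsub>W\<^esub> y = y \<oplus>\<^bsub>W\<^esub> x" by (intro eq) (auto simp: add cl fc V.a_comm)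
  next
    fix x assume x: "x \<in> carrier W"
    then show "\<zero>\<^bsub>W\<^esub> \<oplus>\<^bsub>W\<^esub> x = x" by (intro eq) (auto simp: add cl fc zero)
    obtain y where "y \<in> carrier W" "f y = \<ominus>\<^bsub>V\<^esub> f x" using neg x by blast
    then have "f (y \<oplus>\<^bsub>W\<^esub> x) = f \<zero>\<^bsub>W\<^esub>" using x by (simp add: add fc zero V.l_neg)
    then have "y \<oplus>\<^bsub>W\<^esub> x = \<zero>\<^bsub>W\<^esub>" using x \<open>y \<in> carrier W\<close> by (intro eq) (auto simp: cl zero)
    then show "\<exists>y\<in>carrier W. y \<oplus>\<^bsub>W\<^esub> x = \<zero>\<^bsub>W\<^esub>" using \<open>y \<in> carrier W\<close> by blast
  qed (use zero cl in auto)
qed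

text \<open>Module laws are inherited along an injection that respects the operations. This serves
  for submodules, with the identity map, and for induced modules, viewed as functions on an
  orbit.\<close>

lemma right_module_inj_transport:
  assumes V: "right_module k G V" and f: "f \<in> carrier W \<rightarrow> carrier V" "inj_on f (carrier W)"
    and add: "\<And>x y. \<lbrakk>x \<in> carrier W; y \<in> carrier W\<rbrakk> \<Longrightarrow>
      x \<oplus>\<^bsub>W\<^esub> y \<in> carrier W \<and> f (x \<oplus>\<^bsub>W\<^esub> y) = f x \<oplus>\<^bsub>V\<^esub> f y"
    and zero: "\<zero>\<^bsub>W\<^esub> \<in> carrier W"
    and smult: "\<And>a x. \<lbrakk>a \<in> carrier k; x \<in> carrier W\<rbrakk> \<Longrightarrow>
      a \<odot>\<^bsub>W\<^esub> x \<in> carrier W \<and> f (a \<odot>\<^bsub>W\<^esub> x) = a \<odot>\<^bsub>V\<^esub> f x"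
    and act: "\<And>x g. \<lbrakk>x \<in> carrier W; g \<in> carrier G\<rbrakk> \<Longrightarrow>
      x \<star>\<^bsub>W\<^esub> g \<in> carrier W \<and> f (x \<star>\<^bsub>W\<^esub> g) = f x \<star>\<^bsub>V\<^esub> g"
    and zero2: "f \<zero>\<^bsub>W\<^esub> = \<zero>\<^bsub>V\<^esub>"
  shows "right_module k G W"
proof -
  interpret V: right_module k G V by fact
  have fc: "f x \<in> carrier V" if "x \<in> carrier W" for x using f that by auto
  have eq: "x = y" if "f x = f y" "x \<in> carrier W" "y \<in> carrier W" for x y
    using f that by (auto dest: inj_onD)
  have "abelian_group W"
  proof (rule abelian_group_inj_transport[OF _ f])
    \<comment> \<open>Negatives arise as multiples by $-1$, so closure under scalars is
      enough.\<close>
    show "\<exists>y\<in>carrier W. f y = \<ominus>\<^bsub>V\<^esub> f x" if "x \<in> carrier W" for x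
      using that smult[of "\<ominus>\<^bsub>k\<^esub> \<one>\<^bsub>k\<^esub>" x] fc[OF that]
      by (auto simp: V.kM.smult_l_minus intro!: bexI[of _ "\<ominus>\<^bsub>k\<^esub> \<one>\<^bsub>k\<^esub> \<odot>\<^bsub>W\<^esub> x"])
  qed (use add zero zero2 V.kM.abelian_group_axioms in auto)
  then have "module k W"
    by (intro moduleI V.kM.R.is_cring)
      (auto intro!: eq simp: add smult fc V.kM.smult_l_distr V.kM.smult_r_distr V.kM.smult_assoc1)
  then show ?thesis
    by (intro right_module.intro right_module_axioms.intro V.G.group_axioms)
      (auto intro!: eq simp: add smult act fc V.act_add V.act_smult V.act_mult)
qed

locale gmodule_hom = M: right_module k G M + N: right_module k G N
  for k :: "('k, 'r) ring_scheme" and G :: "('g, 's) monoid_scheme"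
    and M :: "('k, 'g, 'm) gmodule" and N :: "('k, 'g, 'n) gmodule" +
  fixes f :: "'m \<Rightarrow> 'n"
  assumes f_closed [simp]: "x \<in> carrier M \<Longrightarrow> f x \<in> carrier N"
    and f_add: "\<lbrakk>x \<in> carrier M; y \<in> carrier M\<rbrakk> \<Longrightarrow> f (x \<oplus>\<^bsub>M\<^esub> y) = f x \<oplus>\<^bsub>N\<^esub> f y"
    and f_smult: "\<lbrakk>a \<in> carrier k; x \<in> carrier M\<rbrakk> \<Longrightarrow> f (a \<odot>\<^bsub>M\<^esub> x) = a \<odot>\<^bsub>N\<^esub> f x"
    and f_act: "\<lbrakk>x \<in> carrier M; g \<in> carrier G\<rbrakk> \<Longrightarrow> f (x \<star>\<^bsub>M\<^esub> g) = f x \<star>\<^bsub>N\<^esub> g"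

lemma gmodule_homI:
  assumes "right_module k G M" "right_module k G N"
    and "\<And>x. x \<in> carrier M \<Longrightarrow> f x \<in> carrier N"
    and "\<And>x y. \<lbrakk>x \<in> carrier M; y \<in> carrier M\<rbrakk> \<Longrightarrow> f (x \<oplus>\<^bsub>M\<^esub> y) = f x \<oplus>\<^bsub>N\<^esub> f y"
    and "\<And>a x. \<lbrakk>a \<in> carrier k; x \<in> carrier M\<rbrakk> \<Longrightarrow> f (a \<odot>\<^bsub>M\<^esub> x) = a \<odot>\<^bsub>N\<^esub> f x"
    and "\<And>x g. \<lbrakk>x \<in> carrier M; g \<in> carrier G\<rbrakk> \<Longrightarrow> f (x \<star>\<^bsub>M\<^esub> g) = f x \<star>\<^bsub>N\<^esub> g"
  shows "gmodule_hom k G M N f"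
  using assms by (intro gmodule_hom.intro gmodule_hom_axioms.intro)

lemma isomorphic_iff_hom:
  assumes "right_module k G M" "right_module k G N"
  shows "isomorphic k G M N \<longleftrightarrow> (\<exists>f. gmodule_hom k G M N f \<and> bij_betw f (carrier M) (carrier N))"
proof
  assume "isomorphic k G M N"
  then obtain f where f: "bij_betw f (carrier M) (carrier N)"
    "\<forall>x\<in>carrier M. \<forall>y\<in>carrier M. f (x \<oplus>\<^bsub>M\<^esub> y) = f x \<oplus>\<^bsub>N\<^esub> f y"
    "\<forall>a\<in>carrier k. \<forall>x\<in>carrier M. f (a \<odot>\<^bsub>M\<^esub> x) = a \<odot>\<^bsub>N\<^esub> f x"
    "\<forall>x\<in>carrier M. \<forall>g\<in>carrier G. f (x \<star>\<^bsub>M\<^esub> g) = f x \<star>\<^bsub>N\<^esub> g"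
    unfolding isomorphic_def by blast
  then have "gmodule_hom k G M N f"
    using assms by (intro gmodule_homI) (auto dest: bij_betwE)
  then show "\<exists>f. gmodule_hom k G M N f \<and> bij_betw f (carrier M) (carrier N)" using f(1) by blast
next
  assume "\<exists>f. gmodule_hom k G M N f \<and> bij_betw f (carrier M) (carrier N)"
  then obtain f where f: "gmodule_hom k G M N f" "bij_betw f (carrier M) (carrier N)" by blast
  interpret gmodule_hom k G M N f by fact
  show "isomorphic k G M N"
    unfolding isomorphic_def using f(2) f_add f_smult f_act by (intro exI[of _ f]) blast
qed

lemma (in gmodule_hom) inverse:
  assumes "bij_betw f (carrier M) (carrier N)"
  shows "gmodule_hom k G N M (inv_into (carrier M) f)"
proof -
  let ?g = "inv_into (carrier M) f"
  have g: "?g y \<in> carrier M" "f (?g y) = y" if "y \<in> carrier N" for y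
    using assms that by (auto simp: bij_betw_def inv_into_into f_inv_into_f)
  have eq: "?g y = x" if "y = f x" "x \<in> carrier M" for x y
    using assms that by (auto simp: bij_betw_def)
  show ?thesis
    by (rule gmodule_homI[OF N.right_module_axioms M.right_module_axioms])
      (auto intro!: eq simp: g f_add f_smult f_act)
qed

lemma isomorphic_sym:
  assumes "right_module k G M" "right_module k G N" "isomorphic k G M N"
  shows "isomorphic k G N M"
  using assms gmodule_hom.inverse bij_betw_inv_into by (fastforce simp: isomorphic_iff_hom)

lemma isomorphic_trans:
  assumes "isomorphic k G L M" "isomorphic k G M N"
  shows "isomorphic k G L N"
proof -
  obtain f where f: "bij_betw f (carrier L) (carrier M)"
    "\<forall>x\<in>carrier L. \<forall>y\<in>carrier L. f (x \<oplus>\<^bsub>L\<^esub> y) = f x \<oplus>\<^bsub>M\<^esub> f y"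
    "\<forall>a\<in>carrier k. \<forall>x\<in>carrier L. f (a \<odot>\<^bsub>L\<^esub> x) = a \<odot>\<^bsub>M\<^esub> f x"
    "\<forall>x\<in>carrier L. \<forall>g\<in>carrier G. f (x \<star>\<^bsub>L\<^esub> g) = f x \<star>\<^bsub>M\<^esub> g"
    using assms(1) unfolding isomorphic_def by blast
  obtain g where g: "bij_betw g (carrier M) (carrier N)"
    "\<forall>x\<in>carrier M. \<forall>y\<in>carrier M. g (x \<oplus>\<^bsub>M\<^esub> y) = g x \<oplus>\<^bsub>N\<^esub> g y"
    "\<forall>a\<in>carrier k. \<forall>x\<in>carrier M. g (a \<odot>\<^bsub>M\<^esub> x) = a \<odot>\<^bsub>N\<^esub> g x"
    "\<forall>x\<in>carrier M. \<forall>h\<in>carrier G. g (x \<star>\<^bsub>M\<^esub> h) = g x \<star>\<^bsub>N\<^esub> h"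
    using assms(2) unfolding isomorphic_def by blast
  have "bij_betw (g \<circ> f) (carrier L) (carrier N)" using f(1) g(1) by (rule bij_betw_trans)
  then show ?thesis
    unfolding isomorphic_def using f g bij_betwE[OF f(1)] by (intro exI[of _ "g \<circ> f"]) simp
qed

lemma isomorphic_subgroup:
  "\<lbrakk>isomorphic k G M N; H \<subseteq> carrier G\<rbrakk> \<Longrightarrow> isomorphic k (G\<lparr>carrier := H\<rparr>) M N"
  unfolding isomorphic_def by (auto simp: subset_iff)

lemma (in right_module) subgroup_module:
  assumes "subgroup H G" shows "right_module k (G\<lparr>carrier := H\<rparr>) M"
  using subgroup.mem_carrier[OF assms]
  by (intro right_module.intro right_module_axioms.intro kM.module_axioms G.subgroup_imp_group assms)
    (simp_all add: act_add act_smult act_mult)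

section \<open>Submodules, sums and direct summands\<close>

context right_module
begin

lemma gsubmoduleI:
  assumes "N \<subseteq> carrier M" "\<zero>\<^bsub>M\<^esub> \<in> N" "\<And>x y. \<lbrakk>x \<in> N; y \<in> N\<rbrakk> \<Longrightarrow> x \<oplus>\<^bsub>M\<^esub> y \<in> N"
    and "\<And>a x. \<lbrakk>a \<in> carrier k; x \<in> N\<rbrakk> \<Longrightarrow> a \<odot>\<^bsub>M\<^esub> x \<in> N"
    and "\<And>x g. \<lbrakk>x \<in> N; g \<in> carrier G\<rbrakk> \<Longrightarrow> x \<star>\<^bsub>M\<^esub> g \<in> N"
  shows "gsubmodule k G M N"
proof -
  have "\<ominus>\<^bsub>M\<^esub> x \<in> N" if "x \<in> N" for x
    using assms(4)[of "\<ominus>\<^bsub>k\<^esub> \<one>\<^bsub>k\<^esub>" x] that assms(1) kM.smult_l_minus[of "\<one>\<^bsub>k\<^esub>" x] by auto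
  then show ?thesis
    unfolding gsubmodule_def using assms by (auto intro!: kM.submoduleI)
qed

lemma gsubmoduleD:
  assumes "gsubmodule k G M N"
  shows "N \<subseteq> carrier M" "\<zero>\<^bsub>M\<^esub> \<in> N" "\<And>x y. \<lbrakk>x \<in> N; y \<in> N\<rbrakk> \<Longrightarrow> x \<oplus>\<^bsub>M\<^esub> y \<in> N"
    "\<And>x. x \<in> N \<Longrightarrow> \<ominus>\<^bsub>M\<^esub> x \<in> N" "\<And>x y. \<lbrakk>x \<in> N; y \<in> N\<rbrakk> \<Longrightarrow> x \<ominus>\<^bsub>M\<^esub> y \<in> N"
    "\<And>a x. \<lbrakk>a \<in> carrier k; x \<in> N\<rbrakk> \<Longrightarrow> a \<odot>\<^bsub>M\<^esub> x \<in> N"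
    "\<And>x g. \<lbrakk>x \<in> N; g \<in> carrier G\<rbrakk> \<Longrightarrow> x \<star>\<^bsub>M\<^esub> g \<in> N" "x \<in> N \<Longrightarrow> x \<in> carrier M"
proof -
  have sub: "submodule N k M" and act: "\<forall>n\<in>N. \<forall>g\<in>carrier G. n \<star>\<^bsub>M\<^esub> g \<in> N"
    using assms by (auto simp: gsubmodule_def)
  note E = kM.submoduleE[OF sub]
  show "N \<subseteq> carrier M" "\<And>x y. \<lbrakk>x \<in> N; y \<in> N\<rbrakk> \<Longrightarrow> x \<oplus>\<^bsub>M\<^esub> y \<in> N"
    "\<And>x. x \<in> N \<Longrightarrow> \<ominus>\<^bsub>M\<^esub> x \<in> N" "\<And>a x. \<lbrakk>a \<in> carrier k; x \<in> N\<rbrakk> \<Longrightarrow> a \<odot>\<^bsub>M\<^esub> x \<in> N"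
    "x \<in> N \<Longrightarrow> x \<in> carrier M" using E by auto
  show "x \<ominus>\<^bsub>M\<^esub> y \<in> N" if "x \<in> N" "y \<in> N" for x y
    using E that by (simp add: a_minus_def)
  show "\<And>x g. \<lbrakk>x \<in> N; g \<in> carrier G\<rbrakk> \<Longrightarrow> x \<star>\<^bsub>M\<^esub> g \<in> N" using act by blast
  obtain x where "x \<in> N" using E(2) by blast
  then show "\<zero>\<^bsub>M\<^esub> \<in> N" using E(1,3,5) kM.M.r_neg by (metis subsetD)
qed

lemma mem_sumI: "\<lbrakk>a \<in> A; b \<in> B; x = a \<oplus>\<^bsub>M\<^esub> b\<rbrakk> \<Longrightarrow> x \<in> A <+>\<^bsub>M\<^esub> B"
  unfolding set_add_def' by auto

lemma mem_sumE:
  assumes "x \<in> A <+>\<^bsub>M\<^esub> B" obtains a b where "a \<in> A" "b \<in> B" "x = a \<oplus>\<^bsub>M\<^esub> b"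
  using assms unfolding set_add_def' by auto

lemma diff_eq_zero_iff:
  "\<lbrakk>x \<in> carrier M; y \<in> carrier M\<rbrakk> \<Longrightarrow> x \<ominus>\<^bsub>M\<^esub> y = \<zero>\<^bsub>M\<^esub> \<longleftrightarrow> x = y"
  by (metis a_minus_def kM.M.a_inv_closed kM.M.minus_equality kM.M.minus_minus kM.M.r_neg)

lemma diff_add_cancel: "\<lbrakk>x \<in> carrier M; y \<in> carrier M\<rbrakk> \<Longrightarrow> (x \<ominus>\<^bsub>M\<^esub> y) \<oplus>\<^bsub>M\<^esub> y = x"
  by (simp add: a_minus_def kM.M.a_assoc kM.M.l_neg)

lemma add_diff_cancel: "\<lbrakk>x \<in> carrier M; y \<in> carrier M\<rbrakk> \<Longrightarrow> (x \<oplus>\<^bsub>M\<^esub> y) \<ominus>\<^bsub>M\<^esub> y = x"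
  by (simp add: a_minus_def kM.M.a_assoc kM.M.r_neg)

lemma diff_diff_diff:
  assumes "x \<in> carrier M" "m \<in> carrier M" "n \<in> carrier M"
  shows "(x \<ominus>\<^bsub>M\<^esub> m) \<ominus>\<^bsub>M\<^esub> (x \<ominus>\<^bsub>M\<^esub> n) = n \<ominus>\<^bsub>M\<^esub> m"
proof -
  have "(x \<ominus>\<^bsub>M\<^esub> m) \<ominus>\<^bsub>M\<^esub> (x \<ominus>\<^bsub>M\<^esub> n) = (x \<oplus>\<^bsub>M\<^esub> \<ominus>\<^bsub>M\<^esub> x) \<oplus>\<^bsub>M\<^esub> (n \<oplus>\<^bsub>M\<^esub> \<ominus>\<^bsub>M\<^esub> m)"
    using assms by (simp add: a_minus_def kM.M.minus_add kM.M.a_ac del: kM.M.r_neg)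
  then show ?thesis using assms by (simp add: a_minus_def kM.M.r_neg)
qed

lemma minus_zero [simp]: "\<ominus>\<^bsub>M\<^esub> \<zero>\<^bsub>M\<^esub> = \<zero>\<^bsub>M\<^esub>"
  by (metis kM.M.a_inv_closed kM.M.l_zero kM.M.r_neg kM.M.zero_closed)

lemma diff_zero [simp]: "x \<in> carrier M \<Longrightarrow> x \<ominus>\<^bsub>M\<^esub> \<zero>\<^bsub>M\<^esub> = x"
  by (simp add: a_minus_def)

lemma act_zero [simp]: "g \<in> carrier G \<Longrightarrow> \<zero>\<^bsub>M\<^esub> \<star>\<^bsub>M\<^esub> g = \<zero>\<^bsub>M\<^esub>"
  using act_smult[of "\<zero>\<^bsub>k\<^esub>" "\<zero>\<^bsub>M\<^esub>" g] by simp

lemma act_diff: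
  assumes "x \<in> carrier M" "y \<in> carrier M" "g \<in> carrier G"
  shows "(x \<ominus>\<^bsub>M\<^esub> y) \<star>\<^bsub>M\<^esub> g = x \<star>\<^bsub>M\<^esub> g \<ominus>\<^bsub>M\<^esub> y \<star>\<^bsub>M\<^esub> g"
  using act_add[of "x \<ominus>\<^bsub>M\<^esub> y" y g] assms add_diff_cancel[of "(x \<ominus>\<^bsub>M\<^esub> y) \<star>\<^bsub>M\<^esub> g" "y \<star>\<^bsub>M\<^esub> g"]
  by (simp add: diff_add_cancel)

lemma smult_diff:
  assumes "x \<in> carrier M" "y \<in> carrier M" "a \<in> carrier k"
  shows "a \<odot>\<^bsub>M\<^esub> (x \<ominus>\<^bsub>M\<^esub> y) = a \<odot>\<^bsub>M\<^esub> x \<ominus>\<^bsub>M\<^esub> a \<odot>\<^bsub>M\<^esub> y"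
  using assms by (simp add: a_minus_def kM.smult_r_distr kM.smult_r_minus)

lemma gsubmodule_carrier: "gsubmodule k G M (carrier M)"
  by (rule gsubmoduleI) auto

lemma gsubmodule_Int:
  assumes "gsubmodule k G M A" "gsubmodule k G M B" shows "gsubmodule k G M (A \<inter> B)"
  using gsubmoduleD[OF assms(1)] gsubmoduleD[OF assms(2)] by (intro gsubmoduleI) auto

lemma gsubmodule_sum:
  assumes "gsubmodule k G M A" "gsubmodule k G M B" shows "gsubmodule k G M (A <+>\<^bsub>M\<^esub> B)"
proof (rule gsubmoduleI)
  note A = gsubmoduleD[OF assms(1)] and B = gsubmoduleD[OF assms(2)]
  show "A <+>\<^bsub>M\<^esub> B \<subseteq> carrier M" using A(1) B(1) by (rule kM.M.setadd_subset_G)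
  show "\<zero>\<^bsub>M\<^esub> \<in> A <+>\<^bsub>M\<^esub> B" using A(2) B(2) by (rule mem_sumI) simp
  show "x \<oplus>\<^bsub>M\<^esub> y \<in> A <+>\<^bsub>M\<^esub> B" if "x \<in> A <+>\<^bsub>M\<^esub> B" "y \<in> A <+>\<^bsub>M\<^esub> B" for x y
  proof -
    from that obtain a b c d where *: "a \<in> A" "b \<in> B" "c \<in> A" "d \<in> B" "x = a \<oplus>\<^bsub>M\<^esub> b" "y = c \<oplus>\<^bsub>M\<^esub> d"
      by (elim mem_sumE)
    then have "x \<oplus>\<^bsub>M\<^esub> y = (a \<oplus>\<^bsub>M\<^esub> c) \<oplus>\<^bsub>M\<^esub> (b \<oplus>\<^bsub>M\<^esub> d)"
      using A(1) B(1) by (simp add: subset_iff kM.M.a_ac)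
    then show ?thesis using * A(3) B(3) by (blast intro: mem_sumI)
  qed
  show "a \<odot>\<^bsub>M\<^esub> x \<in> A <+>\<^bsub>M\<^esub> B" if "a \<in> carrier k" "x \<in> A <+>\<^bsub>M\<^esub> B" for a x
  proof -
    from that obtain c d where *: "c \<in> A" "d \<in> B" "x = c \<oplus>\<^bsub>M\<^esub> d" by (elim mem_sumE)
    then have "a \<odot>\<^bsub>M\<^esub> x = a \<odot>\<^bsub>M\<^esub> c \<oplus>\<^bsub>M\<^esub> a \<odot>\<^bsub>M\<^esub> d"
      using A(1) B(1) that by (simp add: subset_iff kM.smult_r_distr)
    then show ?thesis using mem_sumI[OF A(6)[OF that(1) *(1)] B(6)[OF that(1) *(2)]] by simp
  qed
  show "x \<star>\<^bsub>M\<^esub> g \<in> A <+>\<^bsub>M\<^esub> B" if "x \<in> A <+>\<^bsub>M\<^esub> B" "g \<in> carrier G" for x g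
  proof -
    from that obtain c d where *: "c \<in> A" "d \<in> B" "x = c \<oplus>\<^bsub>M\<^esub> d" by (elim mem_sumE)
    then have "x \<star>\<^bsub>M\<^esub> g = c \<star>\<^bsub>M\<^esub> g \<oplus>\<^bsub>M\<^esub> d \<star>\<^bsub>M\<^esub> g"
      using A(1) B(1) that by (simp add: subset_iff act_add)
    then show ?thesis using mem_sumI[OF A(7)[OF *(1) that(2)] B(7)[OF *(2) that(2)]] by simp
  qed
qed

lemma subset_sum:
  assumes "gsubmodule k G M A" "gsubmodule k G M B"
  shows "A \<subseteq> A <+>\<^bsub>M\<^esub> B" "B \<subseteq> A <+>\<^bsub>M\<^esub> B"
proof -
  note A = gsubmoduleD[OF assms(1)] and B = gsubmoduleD[OF assms(2)]
  have "x \<in> A <+>\<^bsub>M\<^esub> B" if "x \<in> A" for x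
    using that B(2) by (rule mem_sumI) (use A(8) that in simp)
  then show "A \<subseteq> A <+>\<^bsub>M\<^esub> B" by blast
  have "x \<in> A <+>\<^bsub>M\<^esub> B" if "x \<in> B" for x
    using A(2) that by (rule mem_sumI) (use B(8) that in simp)
  then show "B \<subseteq> A <+>\<^bsub>M\<^esub> B" by blast
qed

lemma submodule_right_module:
  assumes "gsubmodule k G M N" shows "right_module k G (M\<lparr>carrier := N\<rparr>)"
proof (rule right_module_inj_transport[OF right_module_axioms, where f = "\<lambda>x. x"])
  show "(\<lambda>x. x) \<in> carrier (M\<lparr>carrier := N\<rparr>) \<rightarrow> carrier M" using gsubmoduleD(1)[OF assms] by auto
qed (use gsubmoduleD[OF assms] in auto)

lemma gsubmodule_submodule_iff:
  assumes "gsubmodule k G M N"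
  shows "gsubmodule k G (M\<lparr>carrier := N\<rparr>) L \<longleftrightarrow> gsubmodule k G M L \<and> L \<subseteq> N"
proof -
  interpret N: right_module k G "M\<lparr>carrier := N\<rparr>" using assms by (rule submodule_right_module)
  show ?thesis
  proof
    assume "gsubmodule k G (M\<lparr>carrier := N\<rparr>) L"
    note L = N.gsubmoduleD[OF this, simplified]
    then show "gsubmodule k G M L \<and> L \<subseteq> N" using gsubmoduleD(1)[OF assms] by (auto intro!: gsubmoduleI)
  next
    assume L: "gsubmodule k G M L \<and> L \<subseteq> N"
    then show "gsubmodule k G (M\<lparr>carrier := N\<rparr>) L"
      using gsubmoduleD[OF conjunct1[OF L]] by (intro N.gsubmoduleI) auto
  qed
qed

text \<open>The component \<open>n\<close> of \<open>x\<close> is pinned down by $x - n$ lying in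
  \<open>N'\<close>. Additivity, linearity and equivariance of \<open>\<pi>\<close> all follow from
  this uniqueness.\<close>

lemma direct_summand_projection:
  assumes N: "gsubmodule k G M N" and N': "gsubmodule k G M N'"
    and disj: "N \<inter> N' = {\<zero>\<^bsub>M\<^esub>}" and sum: "N <+>\<^bsub>M\<^esub> N' = carrier M"
  obtains \<pi> where "gmodule_hom k G M (M\<lparr>carrier := N\<rparr>) \<pi>" "\<And>x. x \<in> N \<Longrightarrow> \<pi> x = x"
    "\<And>x. x \<in> N' \<Longrightarrow> \<pi> x = \<zero>\<^bsub>M\<^esub>" "\<And>x. x \<in> carrier M \<Longrightarrow> x \<ominus>\<^bsub>M\<^esub> \<pi> x \<in> N'"
proof -
  note ND = gsubmoduleD[OF N] and ND' = gsubmoduleD[OF N']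
  have uniq: "n = m" if "n \<in> N" "m \<in> N" "x \<ominus>\<^bsub>M\<^esub> n \<in> N'" "x \<ominus>\<^bsub>M\<^esub> m \<in> N'" "x \<in> carrier M" for x n m
  proof -
    have c: "n \<in> carrier M" "m \<in> carrier M" using that ND by auto
    have "n \<ominus>\<^bsub>M\<^esub> m \<in> N \<inter> N'"
      using that c ND(5)[OF that(1,2)] ND'(5)[OF that(4,3)] by (simp add: diff_diff_diff)
    then show ?thesis using disj c by (simp add: diff_eq_zero_iff)
  qed
  have ex: "\<exists>n\<in>N. x \<ominus>\<^bsub>M\<^esub> n \<in> N'" if "x \<in> carrier M" for x
  proof -
    have "x \<in> N <+>\<^bsub>M\<^esub> N'" using that sum by simp
    then obtain n n' where *: "n \<in> N" "n' \<in> N'" "x = n \<oplus>\<^bsub>M\<^esub> n'" by (rule mem_sumE)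
    then have "x \<ominus>\<^bsub>M\<^esub> n = n'"
      using ND(8) ND'(8) add_diff_cancel[of n' n] by (simp add: kM.M.a_comm)
    then show ?thesis using * by blast
  qed
  define \<pi> where "\<pi> x = (SOME n. n \<in> N \<and> x \<ominus>\<^bsub>M\<^esub> n \<in> N')" for x
  have \<pi>: "\<pi> x \<in> N" "x \<ominus>\<^bsub>M\<^esub> \<pi> x \<in> N'" if "x \<in> carrier M" for x
    using someI_ex[of "\<lambda>n. n \<in> N \<and> x \<ominus>\<^bsub>M\<^esub> n \<in> N'"] ex[OF that] by (auto simp: \<pi>_def)
  have \<pi>c: "\<pi> x \<in> carrier M" if "x \<in> carrier M" for x using \<pi>(1)[OF that] ND by auto
  have eq: "\<pi> x = n" if "n \<in> N" "x \<ominus>\<^bsub>M\<^esub> n \<in> N'" "x \<in> carrier M" for x n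
    using uniq[of "\<pi> x" n x] that \<pi> by blast
  have "gmodule_hom k G M (M\<lparr>carrier := N\<rparr>) \<pi>"
  proof (rule gmodule_homI[OF right_module_axioms submodule_right_module[OF N]])
    fix x y assume xy: "x \<in> carrier M" "y \<in> carrier M"
    have "(x \<oplus>\<^bsub>M\<^esub> y) \<ominus>\<^bsub>M\<^esub> (\<pi> x \<oplus>\<^bsub>M\<^esub> \<pi> y) = (x \<ominus>\<^bsub>M\<^esub> \<pi> x) \<oplus>\<^bsub>M\<^esub> (y \<ominus>\<^bsub>M\<^esub> \<pi> y)"
      using xy \<pi>c by (simp add: a_minus_def kM.M.minus_add kM.M.a_ac)
    then show "\<pi> (x \<oplus>\<^bsub>M\<^esub> y) = \<pi> x \<oplus>\<^bsub>M\<lparr>carrier := N\<rparr>\<^esub> \<pi> y"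
      using xy \<pi> ND(3) ND'(3) by (intro eq[simplified]) auto
  next
    fix a x assume ax: "a \<in> carrier k" "x \<in> carrier M"
    have "a \<odot>\<^bsub>M\<^esub> x \<ominus>\<^bsub>M\<^esub> a \<odot>\<^bsub>M\<^esub> \<pi> x = a \<odot>\<^bsub>M\<^esub> (x \<ominus>\<^bsub>M\<^esub> \<pi> x)"
      using ax \<pi>c by (simp add: smult_diff)
    then show "\<pi> (a \<odot>\<^bsub>M\<^esub> x) = a \<odot>\<^bsub>M\<lparr>carrier := N\<rparr>\<^esub> \<pi> x"
      using ax \<pi> ND(6) ND'(6) by (intro eq[simplified]) auto
  next
    fix x g assume xg: "x \<in> carrier M" "g \<in> carrier G"
    have "x \<star>\<^bsub>M\<^esub> g \<ominus>\<^bsub>M\<^esub> \<pi> x \<star>\<^bsub>M\<^esub> g = (x \<ominus>\<^bsub>M\<^esub> \<pi> x) \<star>\<^bsub>M\<^esub> g"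
      using xg \<pi>c by (simp add: act_diff)
    then show "\<pi> (x \<star>\<^bsub>M\<^esub> g) = \<pi> x \<star>\<^bsub>M\<lparr>carrier := N\<rparr>\<^esub> g"
      using xg \<pi> ND(7) ND'(7) by (intro eq[simplified]) auto
  qed (simp add: \<pi>)
  moreover have "\<pi> x = x" if "x \<in> N" for x
    using that ND(8)[OF that] ND'(2) diff_eq_zero_iff[of x x] by (intro eq) auto
  moreover have "\<pi> x = \<zero>\<^bsub>M\<^esub>" if "x \<in> N'" for x
    using that ND(2) ND'(8)[OF that] by (intro eq) auto
  ultimately show ?thesis using that \<pi>(2) by blast
qed

end

section \<open>Homomorphisms and invariance under isomorphism\<close>

context gmodule_hom
begin

lemma f_zero [simp]: "f \<zero>\<^bsub>M\<^esub> = \<zero>\<^bsub>N\<^esub>"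
proof -
  have "f \<zero>\<^bsub>M\<^esub> \<oplus>\<^bsub>N\<^esub> f \<zero>\<^bsub>M\<^esub> = f \<zero>\<^bsub>M\<^esub>" using f_add[of "\<zero>\<^bsub>M\<^esub>" "\<zero>\<^bsub>M\<^esub>"] by simp
  then show ?thesis by (metis M.kM.zero_closed f_closed N.kM.M.add.l_cancel_one')
qed

lemma f_minus: "x \<in> carrier M \<Longrightarrow> f (\<ominus>\<^bsub>M\<^esub> x) = \<ominus>\<^bsub>N\<^esub> f x"
  using f_add[of "\<ominus>\<^bsub>M\<^esub> x" x] by (simp add: M.kM.M.l_neg N.kM.M.minus_equality)

lemma f_diff: "\<lbrakk>x \<in> carrier M; y \<in> carrier M\<rbrakk> \<Longrightarrow> f (x \<ominus>\<^bsub>M\<^esub> y) = f x \<ominus>\<^bsub>N\<^esub> f y"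
  by (simp add: a_minus_def f_add f_minus)

lemma f_finsum:
  "\<lbrakk>finite I; \<And>i. i \<in> I \<Longrightarrow> x i \<in> carrier M\<rbrakk> \<Longrightarrow> f (finsum M x I) = (\<Oplus>\<^bsub>N\<^esub>i\<in>I. f (x i))"
  by (induction I rule: finite_induct) (auto simp: f_add Pi_iff)

lemma gsubmodule_vimage:
  assumes "gsubmodule k G N L" shows "gsubmodule k G M {x \<in> carrier M. f x \<in> L}"
  using N.gsubmoduleD[OF assms] by (intro M.gsubmoduleI) (auto simp: f_add f_smult f_act)

lemma gsubmodule_image:
  assumes "gsubmodule k G M L" shows "gsubmodule k G N (f ` L)"
proof (rule N.gsubmoduleI)
  note L = M.gsubmoduleD[OF assms]
  show "f ` L \<subseteq> carrier N" "\<zero>\<^bsub>N\<^esub> \<in> f ` L" using L f_zero by (auto, metis image_eqI)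
  show "x \<oplus>\<^bsub>N\<^esub> y \<in> f ` L" if "x \<in> f ` L" "y \<in> f ` L" for x y
    using that L(3) L(8) by (auto simp flip: f_add)
  show "a \<odot>\<^bsub>N\<^esub> x \<in> f ` L" if "a \<in> carrier k" "x \<in> f ` L" for a x
    using that L(6) L(8) by (auto simp flip: f_smult)
  show "x \<star>\<^bsub>N\<^esub> g \<in> f ` L" if "x \<in> f ` L" "g \<in> carrier G" for x g
    using that L(7) L(8) by (auto simp flip: f_act)
qed

lemma direct_summand_vimage:
  assumes f: "bij_betw f (carrier M) (carrier N)" and L: "direct_summand k G N L"
  shows "direct_summand k G M {x \<in> carrier M. f x \<in> L}"
proof -
  obtain L' where L': "gsubmodule k G N L" "gsubmodule k G N L'" "L \<inter> L' = {\<zero>\<^bsub>N\<^esub>}"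
    "L <+>\<^bsub>N\<^esub> L' = carrier N" using L by (auto simp: direct_summand_def)
  let ?V = "\<lambda>L. {x \<in> carrier M. f x \<in> L}"
  have inj: "x = y" if "f x = f y" "x \<in> carrier M" "y \<in> carrier M" for x y
    using f that by (auto simp: bij_betw_def dest: inj_onD)
  have sub: "gsubmodule k G M (?V L)" "gsubmodule k G M (?V L')"
    using L' by (simp_all add: gsubmodule_vimage)
  have "?V L \<inter> ?V L' = {\<zero>\<^bsub>M\<^esub>}"
  proof -
    have "x = \<zero>\<^bsub>M\<^esub>" if "x \<in> ?V L \<inter> ?V L'" for x
      using that L'(3) by (intro inj) auto
    then show ?thesis using M.gsubmoduleD(2)[OF sub(1)] M.gsubmoduleD(2)[OF sub(2)] by blast
  qed
  moreover have "?V L <+>\<^bsub>M\<^esub> ?V L' = carrier M"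
  proof
    show "?V L <+>\<^bsub>M\<^esub> ?V L' \<subseteq> carrier M" using M.gsubmodule_sum[OF sub] by (rule M.gsubmoduleD)
    show "carrier M \<subseteq> ?V L <+>\<^bsub>M\<^esub> ?V L'"
    proof
      fix x assume x: "x \<in> carrier M"
      then obtain l l' where l: "l \<in> L" "l' \<in> L'" "f x = l \<oplus>\<^bsub>N\<^esub> l'"
        using L'(4) f_closed[OF x] unfolding set_add_def' by blast
      have "l \<in> f ` carrier M" "l' \<in> f ` carrier M"
        using l L'(1,2) N.gsubmoduleD(1) f unfolding bij_betw_def by blast+
      then obtain y y' where y: "y \<in> carrier M" "y' \<in> carrier M" "f y = l" "f y' = l'" by blast
      then have "x = y \<oplus>\<^bsub>M\<^esub> y'" using x l by (intro inj) (auto simp: f_add)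
      then show "x \<in> ?V L <+>\<^bsub>M\<^esub> ?V L'" unfolding set_add_def' using y l by blast
    qed
  qed
  ultimately show ?thesis using sub by (auto simp: direct_summand_def)
qed

end

lemma indecomposable_isomorphic_imp:
  assumes "right_module k G M" "right_module k G N" "isomorphic k G M N" "indecomposable k G M"
  shows "indecomposable k G N"
proof -
  obtain f where f: "gmodule_hom k G M N f" "bij_betw f (carrier M) (carrier N)"
    using assms isomorphic_iff_hom by blast
  interpret gmodule_hom k G M N f by fact
  have img: "f ` carrier M = carrier N" using f(2) by (simp add: bij_betw_def)
  have "\<not> zero_module N"
  proof
    assume "zero_module N"
    then have "f x = f \<zero>\<^bsub>M\<^esub>" if "x \<in> carrier M" for x
      using f_closed[OF that] by (simp add: zero_module_def)
    then have "carrier M = {\<zero>\<^bsub>M\<^esub>}" using f(2) by (auto simp: bij_betw_def inj_on_def)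
    then show False using assms(4) by (simp add: indecomposable_def zero_module_def)
  qed
  moreover have "L = {\<zero>\<^bsub>N\<^esub>} \<or> L = carrier N" if L: "direct_summand k G N L" for L
  proof -
    have sub: "L \<subseteq> carrier N" using L N.gsubmoduleD(1) by (auto simp: direct_summand_def)
    have fV: "f ` {x \<in> carrier M. f x \<in> L} = L" using sub img by auto
    have "{x \<in> carrier M. f x \<in> L} = {\<zero>\<^bsub>M\<^esub>} \<or> {x \<in> carrier M. f x \<in> L} = carrier M"
      using assms(4) direct_summand_vimage[OF f(2) L] unfolding indecomposable_def by blast
    then show ?thesis
    proof
      assume "{x \<in> carrier M. f x \<in> L} = {\<zero>\<^bsub>M\<^esub>}"
      then show ?thesis using fV by simp
    next
      assume "{x \<in> carrier M. f x \<in> L} = carrier M"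
      then show ?thesis using fV img by simp
    qed
  qed
  ultimately show ?thesis by (simp add: indecomposable_def)
qed

lemma indecomposable_isomorphic:
  assumes "right_module k G M" "right_module k G N" "isomorphic k G M N"
  shows "indecomposable k G M \<longleftrightarrow> indecomposable k G N"
  using indecomposable_isomorphic_imp[OF assms]
    indecomposable_isomorphic_imp[OF assms(2,1) isomorphic_sym[OF assms]] by blast

lemma zero_module_isomorphic:
  assumes "right_module k G M" "right_module k G N" "isomorphic k G M N"
  shows "zero_module M \<longleftrightarrow> zero_module N"
proof -
  obtain f where f: "gmodule_hom k G M N f" "bij_betw f (carrier M) (carrier N)"
    using assms isomorphic_iff_hom by blast
  interpret gmodule_hom k G M N f by fact
  have inj: "x = y" if "f x = f y" "x \<in> carrier M" "y \<in> carrier M" for x y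
    using f that by (auto simp: bij_betw_def dest: inj_onD)
  have img: "f ` carrier M = carrier N" using f(2) by (simp add: bij_betw_def)
  show ?thesis
  proof
    assume "zero_module M"
    then show "zero_module N" using img by (auto simp: zero_module_def)
  next
    assume N: "zero_module N"
    have "x = \<zero>\<^bsub>M\<^esub>" if "x \<in> carrier M" for x
      using N f_closed[OF that] that by (intro inj) (auto simp: zero_module_def)
    then show "zero_module M" by (auto simp: zero_module_def)
  qed
qed

section \<open>Quotient modules and the isomorphism theorem\<close>

context right_module
begin

text \<open>All members of a coset lead to the same coset after scaling or acting, so the unions in
  \<open>quotient_module\<close> collapse to a single term and computations can use
  representatives.\<close>

lemma quotient_ops:
  assumes "gsubmodule k G M N"
  shows "carrier (quotient_module M N) = (\<lambda>x. N +>\<^bsub>M\<^esub> x) ` carrier M"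
    and "\<zero>\<^bsub>quotient_module M N\<^esub> = N +>\<^bsub>M\<^esub> \<zero>\<^bsub>M\<^esub>"
    and "\<lbrakk>x \<in> carrier M; y \<in> carrier M\<rbrakk>
      \<Longrightarrow> (N +>\<^bsub>M\<^esub> x) \<oplus>\<^bsub>quotient_module M N\<^esub> (N +>\<^bsub>M\<^esub> y) = N +>\<^bsub>M\<^esub> (x \<oplus>\<^bsub>M\<^esub> y)"
    and "\<lbrakk>a \<in> carrier k; x \<in> carrier M\<rbrakk>
      \<Longrightarrow> a \<odot>\<^bsub>quotient_module M N\<^esub> (N +>\<^bsub>M\<^esub> x) = N +>\<^bsub>M\<^esub> (a \<odot>\<^bsub>M\<^esub> x)"
    and "\<lbrakk>x \<in> carrier M; g \<in> carrier G\<rbrakk>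
      \<Longrightarrow> (N +>\<^bsub>M\<^esub> x) \<star>\<^bsub>quotient_module M N\<^esub> g = N +>\<^bsub>M\<^esub> (x \<star>\<^bsub>M\<^esub> g)"
    and "\<lbrakk>x \<in> carrier M; y \<in> carrier M\<rbrakk> \<Longrightarrow> N +>\<^bsub>M\<^esub> x = N +>\<^bsub>M\<^esub> y \<longleftrightarrow> x \<ominus>\<^bsub>M\<^esub> y \<in> N"
proof -
  note N = gsubmoduleD[OF assms]
  have sg: "subgroup N (add_monoid M)"
    using assms by (auto simp: gsubmodule_def submodule_def)
  interpret N: abelian_subgroup N M
    by (rule abelian_subgroupI2[OF kM.M.a_comm_group sg])
  show eq: "N +>\<^bsub>M\<^esub> x = N +>\<^bsub>M\<^esub> y \<longleftrightarrow> x \<ominus>\<^bsub>M\<^esub> y \<in> N" if xy: "x \<in> carrier M" "y \<in> carrier M" for x y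
  proof
    assume "N +>\<^bsub>M\<^esub> x = N +>\<^bsub>M\<^esub> y"
    then have "x \<in> N +>\<^bsub>M\<^esub> y" using N.a_rcos_self[OF xy(1)] by simp
    then obtain n where "n \<in> N" "x = n \<oplus>\<^bsub>M\<^esub> y" by (auto simp: a_r_coset_def')
    then show "x \<ominus>\<^bsub>M\<^esub> y \<in> N" using N(8) xy by (simp add: add_diff_cancel)
  next
    assume "x \<ominus>\<^bsub>M\<^esub> y \<in> N"
    then have "(x \<ominus>\<^bsub>M\<^esub> y) \<oplus>\<^bsub>M\<^esub> y \<in> N +>\<^bsub>M\<^esub> y" using N(1) xy(2) by (intro kM.M.a_rcosI)
    then have "x \<in> N +>\<^bsub>M\<^esub> y" using xy by (simp add: diff_add_cancel)
    then show "N +>\<^bsub>M\<^esub> x = N +>\<^bsub>M\<^esub> y" using kM.M.a_repr_independence[OF _ xy(2) sg] by simp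
  qed
  show "carrier (quotient_module M N) = (\<lambda>x. N +>\<^bsub>M\<^esub> x) ` carrier M"
    by (auto simp: quotient_module_def A_RCOSETS_def' a_r_coset_def' r_coset_def)
  show "\<zero>\<^bsub>quotient_module M N\<^esub> = N +>\<^bsub>M\<^esub> \<zero>\<^bsub>M\<^esub>"
    using N(1) by (simp add: quotient_module_def)
  show "(N +>\<^bsub>M\<^esub> x) \<oplus>\<^bsub>quotient_module M N\<^esub> (N +>\<^bsub>M\<^esub> y) = N +>\<^bsub>M\<^esub> (x \<oplus>\<^bsub>M\<^esub> y)"
    if "x \<in> carrier M" "y \<in> carrier M"
    using that by (simp add: quotient_module_def N.a_rcos_sum)
  have cos: "y \<in> carrier M \<and> y \<ominus>\<^bsub>M\<^esub> x \<in> N" if "y \<in> N +>\<^bsub>M\<^esub> x" "x \<in> carrier M" for x y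
  proof -
    have "y \<in> carrier M" using that N(1) kM.M.a_r_coset_subset_G by blast
    then show ?thesis using that eq[of y x] kM.M.a_repr_independence[OF that sg] by simp
  qed
  show "a \<odot>\<^bsub>quotient_module M N\<^esub> (N +>\<^bsub>M\<^esub> x) = N +>\<^bsub>M\<^esub> (a \<odot>\<^bsub>M\<^esub> x)"
    if ax: "a \<in> carrier k" "x \<in> carrier M"
  proof -
    have e1: "N +>\<^bsub>M\<^esub> (a \<odot>\<^bsub>M\<^esub> y) = N +>\<^bsub>M\<^esub> (a \<odot>\<^bsub>M\<^esub> x)" if "y \<in> N +>\<^bsub>M\<^esub> x" for y
    proof -
      have y: "y \<in> carrier M" "y \<ominus>\<^bsub>M\<^esub> x \<in> N" using cos that ax by auto
      then show ?thesis using eq[of "a \<odot>\<^bsub>M\<^esub> y" "a \<odot>\<^bsub>M\<^esub> x"] ax N(6)[OF ax(1) y(2)]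
        by (simp add: smult_diff)
    qed
    have e2: "x \<in> N +>\<^bsub>M\<^esub> x" using ax by (simp add: N.a_rcos_self)
    have "(\<Union>y\<in>N +>\<^bsub>M\<^esub> x. N +>\<^bsub>M\<^esub> (a \<odot>\<^bsub>M\<^esub> y)) = N +>\<^bsub>M\<^esub> (a \<odot>\<^bsub>M\<^esub> x)"
      by (rule UN_constant_eq[OF e2]) (use e1 in blast)
    then show ?thesis by (simp add: quotient_module_def)
  qed
  show "(N +>\<^bsub>M\<^esub> x) \<star>\<^bsub>quotient_module M N\<^esub> g = N +>\<^bsub>M\<^esub> (x \<star>\<^bsub>M\<^esub> g)"
    if xg: "x \<in> carrier M" "g \<in> carrier G"
  proof -
    have e1: "N +>\<^bsub>M\<^esub> (y \<star>\<^bsub>M\<^esub> g) = N +>\<^bsub>M\<^esub> (x \<star>\<^bsub>M\<^esub> g)" if "y \<in> N +>\<^bsub>M\<^esub> x" for y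
    proof -
      have y: "y \<in> carrier M" "y \<ominus>\<^bsub>M\<^esub> x \<in> N" using cos that xg by auto
      then show ?thesis using eq[of "y \<star>\<^bsub>M\<^esub> g" "x \<star>\<^bsub>M\<^esub> g"] xg N(7)[OF y(2) xg(2)]
        by (simp add: act_diff)
    qed
    have e2: "x \<in> N +>\<^bsub>M\<^esub> x" using xg by (simp add: N.a_rcos_self)
    have "(\<Union>y\<in>N +>\<^bsub>M\<^esub> x. N +>\<^bsub>M\<^esub> (y \<star>\<^bsub>M\<^esub> g)) = N +>\<^bsub>M\<^esub> (x \<star>\<^bsub>M\<^esub> g)"
      by (rule UN_constant_eq[OF e2]) (use e1 in blast)
    then show ?thesis by (simp add: quotient_module_def)
  qed
qed

lemma quotient_right_module:
  assumes N: "gsubmodule k G M N"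
  shows "right_module k G (quotient_module M N)"
proof -
  note ops = quotient_ops[OF N]
  let ?Q = "quotient_module M N" and ?q = "\<lambda>x. N +>\<^bsub>M\<^esub> x"
  have "abelian_group ?Q"
  proof (rule abelian_groupI)
    show "x \<oplus>\<^bsub>?Q\<^esub> y \<in> carrier ?Q" if "x \<in> carrier ?Q" "y \<in> carrier ?Q" for x y
      using that by (auto simp: ops)
    show "x \<oplus>\<^bsub>?Q\<^esub> y \<oplus>\<^bsub>?Q\<^esub> z = x \<oplus>\<^bsub>?Q\<^esub> (y \<oplus>\<^bsub>?Q\<^esub> z)"
      if "x \<in> carrier ?Q" "y \<in> carrier ?Q" "z \<in> carrier ?Q" for x y z
      using that by (auto simp: ops kM.M.a_assoc)
    show "x \<oplus>\<^bsub>?Q\<^esub> y = y \<oplus>\<^bsub>?Q\<^esub> x" if "x \<in> carrier ?Q" "y \<in> carrier ?Q" for x y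
      using that by (auto simp: ops kM.M.a_comm)
    show "\<exists>y\<in>carrier ?Q. y \<oplus>\<^bsub>?Q\<^esub> x = \<zero>\<^bsub>?Q\<^esub>" if "x \<in> carrier ?Q" for x
    proof -
      obtain y where y: "y \<in> carrier M" "x = ?q y" using \<open>x \<in> carrier ?Q\<close> ops(1) by auto
      then show ?thesis
        by (intro bexI[of _ "?q (\<ominus>\<^bsub>M\<^esub> y)"]) (auto simp: ops kM.M.l_neg)
    qed
  qed (auto simp: ops)
  then have "module k ?Q"
    by (intro moduleI kM.R.is_cring)
      (auto simp: ops kM.smult_l_distr kM.smult_r_distr kM.smult_assoc1)
  then show ?thesis
    by (intro right_module.intro right_module_axioms.intro G.group_axioms)
      (auto simp: ops act_add act_smult act_mult)
qed

lemma quotient_hom: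
  assumes N: "gsubmodule k G M N"
  shows "gmodule_hom k G M (quotient_module M N) (\<lambda>x. N +>\<^bsub>M\<^esub> x)"
  by (rule gmodule_homI[OF right_module_axioms quotient_right_module[OF N]])
    (simp_all add: quotient_ops[OF N])

lemma quotient_zero_iff:
  assumes N: "gsubmodule k G M N" and "x \<in> carrier M"
  shows "N +>\<^bsub>M\<^esub> x = \<zero>\<^bsub>quotient_module M N\<^esub> \<longleftrightarrow> x \<in> N"
  using assms by (simp add: quotient_ops[OF N])

end

lemma (in gmodule_hom) first_isomorphism:
  assumes onto: "f ` carrier M = carrier N"
  shows "isomorphic k G (quotient_module M {x \<in> carrier M. f x = \<zero>\<^bsub>N\<^esub>}) N"
proof -
  let ?K = "{x \<in> carrier M. f x = \<zero>\<^bsub>N\<^esub>}"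
  have "gsubmodule k G N {\<zero>\<^bsub>N\<^esub>}" by (rule N.gsubmoduleI) auto
  then have K: "gsubmodule k G M ?K" using gsubmodule_vimage[of "{\<zero>\<^bsub>N\<^esub>}"] by simp
  note ops = M.quotient_ops[OF K]
  let ?Q = "quotient_module M ?K" and ?q = "\<lambda>x. ?K +>\<^bsub>M\<^esub> x"
  define F where "F C = f (SOME x. x \<in> carrier M \<and> ?q x = C)" for C
  have F: "F (?q x) = f x" if "x \<in> carrier M" for x
  proof -
    have "f y = f x" if y: "y \<in> carrier M" "?q y = ?q x" for y
    proof -
      have "y \<ominus>\<^bsub>M\<^esub> x \<in> ?K" using ops(6)[of y x] y \<open>x \<in> carrier M\<close> by simp
      then show ?thesis using y \<open>x \<in> carrier M\<close> by (simp add: f_diff N.diff_eq_zero_iff)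
    qed
    moreover have "\<exists>y. y \<in> carrier M \<and> ?q y = ?q x" using that by blast
    ultimately show ?thesis
      unfolding F_def using someI_ex[of "\<lambda>y. y \<in> carrier M \<and> ?q y = ?q x"] by blast
  qed
  have "gmodule_hom k G ?Q N F"
    by (rule gmodule_homI[OF M.quotient_right_module[OF K] N.right_module_axioms])
      (auto simp: ops F f_add f_smult f_act)
  moreover have "bij_betw F (carrier ?Q) (carrier N)"
    unfolding bij_betw_def
  proof
    show "inj_on F (carrier ?Q)"
    proof (rule inj_onI)
      fix C D assume "C \<in> carrier ?Q" "D \<in> carrier ?Q" and eq: "F C = F D"
      then obtain x y where xy: "x \<in> carrier M" "y \<in> carrier M" "C = ?q x" "D = ?q y"
        by (auto simp: ops)
      then have "f x = f y" using eq F by simp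
      then have "x \<ominus>\<^bsub>M\<^esub> y \<in> ?K" using xy by (simp add: f_diff N.diff_eq_zero_iff)
      then show "C = D" using ops(6) xy by simp
    qed
    show "F ` carrier ?Q = carrier N"
      using onto by (auto simp: ops(1) image_image F cong: image_cong_simp)
  qed
  ultimately show ?thesis
    using isomorphic_iff_hom[OF M.quotient_right_module[OF K] N.right_module_axioms] by blast
qed


section \<open>Trivial summands of the top\<close>

text \<open>Names the third condition in the choice made by \<open>scott_module\<close>. The top
  then enters only through \<open>trivial_top_imp_functional\<close> and
  \<open>functional_imp_trivial_top\<close>, which trade it for functionals.\<close>

definition has_trivial_top ::
    "('k, 'r) ring_scheme \<Rightarrow> ('g, 's) monoid_scheme \<Rightarrow> ('k, 'g, 'm) gmodule \<Rightarrow> bool" where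
  "has_trivial_top k G M \<longleftrightarrow> (let T = module_top k G M in
     \<exists>N. direct_summand k G T N \<and> isomorphic k G (T\<lparr>carrier := N\<rparr>) (trivial_module k))"

lemma trivial_module_simps [simp]:
  "carrier (trivial_module k) = carrier k" "\<zero>\<^bsub>trivial_module k\<^esub> = \<zero>\<^bsub>k\<^esub>"
  "x \<oplus>\<^bsub>trivial_module k\<^esub> y = x \<oplus>\<^bsub>k\<^esub> y" "a \<odot>\<^bsub>trivial_module k\<^esub> x = a \<otimes>\<^bsub>k\<^esub> x"
  "x \<star>\<^bsub>trivial_module k\<^esub> g = x"
  by (simp_all add: trivial_module_def)

lemma trivial_right_module:
  assumes "cring k" "group G" shows "right_module k G (trivial_module k)"
proof -
  interpret k: cring k by fact
  have "abelian_group (trivial_module k)"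
    by (rule abelian_groupI) (auto simp: k.a_ac intro: k.l_neg)
  then have "module k (trivial_module k)"
    by (intro moduleI assms) (auto simp: k.l_distr k.r_distr k.m_assoc)
  then show ?thesis
    by (intro right_module.intro right_module_axioms.intro assms) auto
qed

context right_module
begin

lemma radical_gsubmodule: "gsubmodule k G M (radical k G M)"
  unfolding radical_def maximal_gsubmodule_def
  by (rule gsubmoduleI) (auto dest: gsubmoduleD)

lemma trivial_top_imp_functional:
  assumes "\<one>\<^bsub>k\<^esub> \<noteq> \<zero>\<^bsub>k\<^esub>" "has_trivial_top k G M"
  shows "\<exists>l. gmodule_hom k G M (trivial_module k) l \<and> (\<exists>x\<in>carrier M. l x \<noteq> \<zero>\<^bsub>k\<^esub>)"
proof -
  define T where "T = quotient_module M (radical k G M)"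
  interpret q: gmodule_hom k G M T "\<lambda>x. radical k G M +>\<^bsub>M\<^esub> x"
    unfolding T_def by (rule quotient_hom[OF radical_gsubmodule])
  obtain N N' where N: "gsubmodule k G T N" "gsubmodule k G T N'" "N \<inter> N' = {\<zero>\<^bsub>T\<^esub>}"
    "N <+>\<^bsub>T\<^esub> N' = carrier T" "isomorphic k G (T\<lparr>carrier := N\<rparr>) (trivial_module k)"
    using assms(2) unfolding has_trivial_top_def module_top_def T_def direct_summand_def Let_def by blast
  obtain \<pi> where \<pi>: "gmodule_hom k G T (T\<lparr>carrier := N\<rparr>) \<pi>" "\<And>x. x \<in> N \<Longrightarrow> \<pi> x = x"
    using q.N.direct_summand_projection[OF N(1-4)] by metis
  obtain \<phi> where \<phi>: "gmodule_hom k G (T\<lparr>carrier := N\<rparr>) (trivial_module k) \<phi>"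
    "bij_betw \<phi> N (carrier k)"
    using N(5) isomorphic_iff_hom[OF q.N.submodule_right_module[OF N(1)]
        trivial_right_module[OF kM.R.is_cring G.group_axioms]] by auto
  interpret \<pi>: gmodule_hom k G T "T\<lparr>carrier := N\<rparr>" \<pi> by fact
  interpret \<phi>: gmodule_hom k G "T\<lparr>carrier := N\<rparr>" "trivial_module k" \<phi> by fact
  let ?l = "\<lambda>x. \<phi> (\<pi> (radical k G M +>\<^bsub>M\<^esub> x))"
  have "gmodule_hom k G M (trivial_module k) ?l"
    using \<pi>.f_closed \<phi>.f_closed \<pi>.f_add \<pi>.f_smult \<pi>.f_act \<phi>.f_add \<phi>.f_smult \<phi>.f_act
    by (intro gmodule_homI right_module_axioms \<phi>.N.right_module_axioms)
      (simp_all add: q.f_add q.f_smult q.f_act)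
  moreover have "\<exists>x\<in>carrier M. ?l x \<noteq> \<zero>\<^bsub>k\<^esub>"
  proof -
    have "\<one>\<^bsub>k\<^esub> \<in> \<phi> ` N" using \<phi>(2) by (simp add: bij_betw_def)
    then obtain n where n: "n \<in> N" "\<phi> n = \<one>\<^bsub>k\<^esub>" by force
    then have "n \<in> carrier T" using q.N.gsubmoduleD(1)[OF N(1)] by auto
    then obtain x where "x \<in> carrier M" "n = radical k G M +>\<^bsub>M\<^esub> x"
      unfolding T_def quotient_ops(1)[OF radical_gsubmodule] by blast
    then show ?thesis using n \<pi>(2) assms(1) by (intro bexI[of _ x]) auto
  qed
  ultimately show ?thesis by blast
qed

text \<open>A strictly larger submodule has an element with non-zero value, and subtracting
  multiples of it moves any element into the kernel.\<close>

lemma functional_kernel_maximal: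
  assumes "field k" and l: "gmodule_hom k G M (trivial_module k) l"
    and x: "x \<in> carrier M" "l x \<noteq> \<zero>\<^bsub>k\<^esub>"
  shows "maximal_gsubmodule k G M {x \<in> carrier M. l x = \<zero>\<^bsub>k\<^esub>}"
proof -
  interpret k: field k by fact
  interpret l: gmodule_hom k G M "trivial_module k" l by fact
  let ?K = "{x \<in> carrier M. l x = \<zero>\<^bsub>k\<^esub>}"
  have "gsubmodule k G (trivial_module k) {\<zero>\<^bsub>k\<^esub>}" by (rule l.N.gsubmoduleI) auto
  then have K: "gsubmodule k G M ?K" using l.gsubmodule_vimage[of "{\<zero>\<^bsub>k\<^esub>}"] by simp
  have "N = ?K \<or> N = carrier M" if N: "gsubmodule k G M N" "?K \<subseteq> N" for N
  proof (rule disjCI)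
    assume "N \<noteq> carrier M"
    have "l y = \<zero>\<^bsub>k\<^esub>" if y: "y \<in> N" for y
    proof (rule ccontr)
      assume ly: "l y \<noteq> \<zero>\<^bsub>k\<^esub>"
      have yM: "y \<in> carrier M" using y gsubmoduleD(8)[OF N(1)] by simp
      have lyk: "l y \<in> carrier k" using l.f_closed[OF yM] by simp
      have inv: "inv\<^bsub>k\<^esub> l y \<in> carrier k" "inv\<^bsub>k\<^esub> l y \<otimes>\<^bsub>k\<^esub> l y = \<one>\<^bsub>k\<^esub>"
        using ly lyk k.field_Units by auto
      have "z \<in> N" if z: "z \<in> carrier M" for z
      proof -
        define c where "c = l z \<otimes>\<^bsub>k\<^esub> inv\<^bsub>k\<^esub> l y"
        have lz: "l z \<in> carrier k" using l.f_closed[OF z] by simp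
        have c: "c \<in> carrier k" using lz inv by (simp add: c_def)
        have "l (c \<odot>\<^bsub>M\<^esub> y) = l z"
          using yM c lz lyk inv l.f_smult[of c y] by (simp add: c_def kM.R.m_assoc)
        then have "l (z \<ominus>\<^bsub>M\<^esub> c \<odot>\<^bsub>M\<^esub> y) = \<zero>\<^bsub>k\<^esub>"
          using z yM c lz l.f_diff[of z "c \<odot>\<^bsub>M\<^esub> y"] l.N.diff_eq_zero_iff[of "l z" "l z"] by simp
        then have "z \<ominus>\<^bsub>M\<^esub> c \<odot>\<^bsub>M\<^esub> y \<in> N" using N(2) z yM c by auto
        then have "(z \<ominus>\<^bsub>M\<^esub> c \<odot>\<^bsub>M\<^esub> y) \<oplus>\<^bsub>M\<^esub> c \<odot>\<^bsub>M\<^esub> y \<in> N"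
          using gsubmoduleD(3,6)[OF N(1)] y c by blast
        then show ?thesis using z yM c by (simp add: diff_add_cancel)
      qed
      then show False using \<open>N \<noteq> carrier M\<close> gsubmoduleD(1)[OF N(1)] by blast
    qed
    then show "N = ?K" using N gsubmoduleD(1)[OF N(1)] by blast
  qed
  then show ?thesis using K x by (auto simp: maximal_gsubmodule_def)
qed

text \<open>A minimal submodule containing the radical but not contained in the kernel of the
  functional meets the kernel in the radical, so that it splits off modulo the radical.\<close>

lemma functional_imp_trivial_top:
  assumes "field k" and l: "gmodule_hom k G M (trivial_module k) l"
    and x: "x \<in> carrier M" "l x \<noteq> \<zero>\<^bsub>k\<^esub>"
    and dcc: "\<And>A B. \<lbrakk>gsubmodule k G M A; gsubmodule k G M B; A \<subset> B\<rbrakk> \<Longrightarrow> \<mu> A < (\<mu> B :: nat)"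
  shows "has_trivial_top k G M"
proof -
  interpret k: field k by fact
  interpret l: gmodule_hom k G M "trivial_module k" l by fact
  define K where "K = {x \<in> carrier M. l x = \<zero>\<^bsub>k\<^esub>}"
  define J where "J = radical k G M"
  have maxK: "maximal_gsubmodule k G M K"
    unfolding K_def by (rule functional_kernel_maximal[OF assms(1-4)])
  then have K: "gsubmodule k G M K" by (simp add: maximal_gsubmodule_def)
  have J: "gsubmodule k G M J" unfolding J_def by (rule radical_gsubmodule)
  have JK: "J \<subseteq> K" using maxK by (auto simp: J_def radical_def)
  \<comment> \<open>The measure \<open>\<mu>\<close> increases strictly along inclusions, so a
    candidate of least measure contains no smaller candidate.\<close>
  define ok where "ok C \<longleftrightarrow> gsubmodule k G M C \<and> J \<subseteq> C \<and> \<not> C \<subseteq> K" for C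
  have "ok (carrier M)" using gsubmodule_carrier gsubmoduleD(1)[OF J] x by (auto simp: ok_def K_def)
  then obtain C where C: "ok C" and min: "\<And>D. ok D \<Longrightarrow> \<mu> C \<le> \<mu> D"
    using ex_has_least_nat[of ok "carrier M" \<mu>] by blast
  have Cs: "gsubmodule k G M C" "J \<subseteq> C" "\<not> C \<subseteq> K" using C by (auto simp: ok_def)
  note CD = gsubmoduleD[OF Cs(1)] and KD = gsubmoduleD[OF K]
  \<comment> \<open>If \<open>z\<close> in \<open>C\<close> and \<open>K\<close> were outside the
    radical, some maximal submodule \<open>L\<close> would omit it. Minimality of \<open>C\<close>
    puts the intersection of \<open>C\<close> and \<open>L\<close> into \<open>K\<close>, while
    \<open>L\<close> together with the intersection of \<open>C\<close> and \<open>K\<close> spans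
    everything; by the modular law \<open>C\<close> would lie in \<open>K\<close>.\<close>
  have CK: "C \<inter> K = J"
  proof (rule ccontr)
    assume "C \<inter> K \<noteq> J"
    then obtain z where z: "z \<in> C" "z \<in> K" "z \<notin> J" using JK Cs(2) by blast
    then obtain L where L: "maximal_gsubmodule k G M L" "z \<notin> L"
      using KD(1) by (auto simp: J_def radical_def)
    have Ls: "gsubmodule k G M L" using L by (simp add: maximal_gsubmodule_def)
    note LD = gsubmoduleD[OF Ls]
    have CL: "gsubmodule k G M (C \<inter> L)" by (rule gsubmodule_Int[OF Cs(1) Ls])
    have "\<mu> (C \<inter> L) < \<mu> C" using z L by (intro dcc CL Cs(1)) auto
    then have "\<not> ok (C \<inter> L)" using min by (metis not_less)
    moreover have "J \<subseteq> C \<inter> L" using Cs(2) L(1) by (auto simp: J_def radical_def)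
    ultimately have sub: "C \<inter> L \<subseteq> K" using CL by (auto simp: ok_def)
    have CKs: "gsubmodule k G M (C \<inter> K)" by (rule gsubmodule_Int[OF Cs(1) K])
    have "L <+>\<^bsub>M\<^esub> (C \<inter> K) = L \<or> L <+>\<^bsub>M\<^esub> (C \<inter> K) = carrier M"
      using L(1) gsubmodule_sum[OF Ls CKs] subset_sum(1)[OF Ls CKs]
      by (simp add: maximal_gsubmodule_def)
    then have all: "L <+>\<^bsub>M\<^esub> (C \<inter> K) = carrier M" using z L(2) subset_sum(2)[OF Ls CKs] by blast
    have "C \<subseteq> K"
    proof
      fix c assume c: "c \<in> C"
      then have "c \<in> L <+>\<^bsub>M\<^esub> (C \<inter> K)" using CD(8) all by simp
      then obtain a d where ad: "a \<in> L" "d \<in> C \<inter> K" "c = a \<oplus>\<^bsub>M\<^esub> d" by (rule mem_sumE)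
      then have "c \<ominus>\<^bsub>M\<^esub> d = a" using LD(8) CD(8) by (simp add: add_diff_cancel)
      then have "a \<in> C \<inter> L" using ad c CD(5)[of c d] by auto
      then show "c \<in> K" using ad sub KD(3) by blast
    qed
    then show False using Cs(3) by simp
  qed
  obtain c where c: "c \<in> C" "l c \<noteq> \<zero>\<^bsub>k\<^esub>" using Cs(3) CD(8) by (auto simp: K_def)
  have cM: "c \<in> carrier M" using c CD by simp
  have lck: "l c \<in> carrier k" using l.f_closed[OF cM] by simp
  have inv: "inv\<^bsub>k\<^esub> l c \<in> carrier k" "inv\<^bsub>k\<^esub> l c \<otimes>\<^bsub>k\<^esub> l c = \<one>\<^bsub>k\<^esub>"
    using c lck k.field_Units by auto
  define T where "T = quotient_module M J"
  let ?q = "\<lambda>x. J +>\<^bsub>M\<^esub> x"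
  interpret q: gmodule_hom k G M T ?q unfolding T_def by (rule quotient_hom[OF J])
  have qz: "?q x = \<zero>\<^bsub>T\<^esub> \<longleftrightarrow> x \<in> J" if "x \<in> carrier M" for x
    unfolding T_def by (rule quotient_zero_iff[OF J that])
  have qC: "gsubmodule k G T (?q ` C)" and qK: "gsubmodule k G T (?q ` K)"
    by (rule q.gsubmodule_image[OF Cs(1)], rule q.gsubmodule_image[OF K])
  have "?q ` C \<inter> ?q ` K = {\<zero>\<^bsub>T\<^esub>}"
  proof -
    have "t = \<zero>\<^bsub>T\<^esub>" if t: "t \<in> ?q ` C \<inter> ?q ` K" for t
    proof -
      obtain y z where yz: "y \<in> C" "z \<in> K" "t = ?q y" "t = ?q z" using t by blast
      have yzM: "y \<in> carrier M" "z \<in> carrier M" using yz CD(8) KD(8) by auto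
      then have "?q (y \<ominus>\<^bsub>M\<^esub> z) = \<zero>\<^bsub>T\<^esub>"
        using yz q.f_diff[OF yzM] q.N.diff_eq_zero_iff[of "?q y" "?q z"] by simp
      then have "y \<ominus>\<^bsub>M\<^esub> z \<in> K" using qz[of "y \<ominus>\<^bsub>M\<^esub> z"] yzM JK by auto
      then have "y \<in> K" using KD(3)[OF _ yz(2)] diff_add_cancel[OF yzM] by metis
      then have "y \<in> J" using CK yz by blast
      then show ?thesis using qz yzM yz by simp
    qed
    then show ?thesis using q.N.gsubmoduleD(2)[OF qC] q.N.gsubmoduleD(2)[OF qK] by blast
  qed
  moreover have "?q ` C <+>\<^bsub>T\<^esub> ?q ` K = carrier T"
  proof
    show "?q ` C <+>\<^bsub>T\<^esub> ?q ` K \<subseteq> carrier T"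
      using q.N.gsubmodule_sum[OF qC qK] by (rule q.N.gsubmoduleD)
    show "carrier T \<subseteq> ?q ` C <+>\<^bsub>T\<^esub> ?q ` K"
    proof
      fix t assume "t \<in> carrier T"
      then obtain y where y: "y \<in> carrier M" "t = ?q y"
        unfolding T_def quotient_ops(1)[OF J] by blast
      define b where "b = l y \<otimes>\<^bsub>k\<^esub> inv\<^bsub>k\<^esub> l c"
      have ly: "l y \<in> carrier k" using l.f_closed[OF y(1)] by simp
      have b: "b \<in> carrier k" using ly inv by (simp add: b_def)
      have "l (b \<odot>\<^bsub>M\<^esub> c) = l y"
        using cM b ly lck inv l.f_smult[of b c] by (simp add: b_def kM.R.m_assoc)
      then have "l (y \<ominus>\<^bsub>M\<^esub> b \<odot>\<^bsub>M\<^esub> c) = \<zero>\<^bsub>k\<^esub>"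
        using y cM b ly l.f_diff[of y "b \<odot>\<^bsub>M\<^esub> c"] l.N.diff_eq_zero_iff[of "l y" "l y"] by simp
      then have dK: "y \<ominus>\<^bsub>M\<^esub> b \<odot>\<^bsub>M\<^esub> c \<in> K" using y cM b by (simp add: K_def)
      have bc: "b \<odot>\<^bsub>M\<^esub> c \<in> C" "b \<odot>\<^bsub>M\<^esub> c \<in> carrier M" using b c cM CD(6) by auto
      have "t = ?q (b \<odot>\<^bsub>M\<^esub> c) \<oplus>\<^bsub>T\<^esub> ?q (y \<ominus>\<^bsub>M\<^esub> b \<odot>\<^bsub>M\<^esub> c)"
        using y bc diff_add_cancel[OF y(1) bc(2)]
        by (simp add: kM.M.a_comm flip: q.f_add)
      then show "t \<in> ?q ` C <+>\<^bsub>T\<^esub> ?q ` K" using bc dK by (blast intro: q.N.mem_sumI)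
    qed
  qed
  ultimately have ds: "direct_summand k G T (?q ` C)"
    unfolding direct_summand_def using qC qK by blast
  interpret C: right_module k G "M\<lparr>carrier := C\<rparr>" by (rule submodule_right_module[OF Cs(1)])
  interpret lC: gmodule_hom k G "M\<lparr>carrier := C\<rparr>" "trivial_module k" l
    using CD(8) l.f_closed l.f_add l.f_smult l.f_act
    by (intro gmodule_homI C.right_module_axioms l.N.right_module_axioms) simp_all
  have "l ` C = carrier k"
  proof
    show "l ` C \<subseteq> carrier k" using CD(8) l.f_closed by auto
    show "carrier k \<subseteq> l ` C"
    proof
      fix a assume a: "a \<in> carrier k"
      have "l ((a \<otimes>\<^bsub>k\<^esub> inv\<^bsub>k\<^esub> l c) \<odot>\<^bsub>M\<^esub> c) = a"
        using a inv lck cM by (simp add: l.f_smult kM.R.m_assoc)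
      then show "a \<in> l ` C" using CD(6)[OF _ c(1)] a inv by (metis image_eqI kM.R.m_closed)
    qed
  qed
  then have "isomorphic k G (quotient_module (M\<lparr>carrier := C\<rparr>) {x \<in> C. l x = \<zero>\<^bsub>k\<^esub>}) (trivial_module k)"
    using lC.first_isomorphism by simp
  also have "{x \<in> C. l x = \<zero>\<^bsub>k\<^esub>} = J" using CK CD(8) by (auto simp: K_def)
  \<comment> \<open>The operations of a quotient do not depend on the carrier of the module, so the
    quotient of \<open>C\<close> and the image of \<open>C\<close> in the top are equal as
    records.\<close>
  also have "quotient_module (M\<lparr>carrier := C\<rparr>) J = T\<lparr>carrier := ?q ` C\<rparr>"
    by (auto simp: quotient_module_def T_def A_RCOSETS_def RCOSETS_def a_r_coset_def r_coset_def
        set_add_def set_mult_def fun_eq_iff)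
  finally show ?thesis
    using ds by (auto simp: has_trivial_top_def module_top_def T_def J_def Let_def)
qed

end

section \<open>Matrices and vectors indexed by a finite set\<close>

text \<open>Functions vanish outside the index set instead of being undefined there, so pointwise
  sums and multiples stay in the space without being cut off, and matrices on smaller sets of points
  are matrices on \<open>\<Omega>\<close>.\<close>

definition fun_space :: "('k, 'r) ring_scheme \<Rightarrow> 'x set \<Rightarrow> ('x \<Rightarrow> 'k) set" where
  "fun_space k \<Omega> = {v. (\<forall>x. v x \<in> carrier k) \<and> (\<forall>x. x \<notin> \<Omega> \<longrightarrow> v x = \<zero>\<^bsub>k\<^esub>)}"

definition subspace :: "('k, 'r) ring_scheme \<Rightarrow> 'x set \<Rightarrow> ('x \<Rightarrow> 'k) set \<Rightarrow> bool" where
  "subspace k \<Omega> A \<longleftrightarrow> A \<subseteq> fun_space k \<Omega> \<and> (\<lambda>_. \<zero>\<^bsub>k\<^esub>) \<in> A \<and>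
     (\<forall>u\<in>A. \<forall>v\<in>A. (\<lambda>x. u x \<oplus>\<^bsub>k\<^esub> v x) \<in> A) \<and>
     (\<forall>a\<in>carrier k. \<forall>v\<in>A. (\<lambda>x. a \<otimes>\<^bsub>k\<^esub> v x) \<in> A)"

lemma fun_spaceD:
  "v \<in> fun_space k \<Omega> \<Longrightarrow> v x \<in> carrier k" "\<lbrakk>v \<in> fun_space k \<Omega>; x \<notin> \<Omega>\<rbrakk> \<Longrightarrow> v x = \<zero>\<^bsub>k\<^esub>"
  by (auto simp: fun_space_def)

lemma fun_spaceI:
  "\<lbrakk>\<And>x. x \<in> \<Omega> \<Longrightarrow> v x \<in> carrier k; \<And>x. x \<notin> \<Omega> \<Longrightarrow> v x = \<zero>\<^bsub>k\<^esub>; \<zero>\<^bsub>k\<^esub> \<in> carrier k\<rbrakk>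
    \<Longrightarrow> v \<in> fun_space k \<Omega>"
proof -
  assume *: "\<And>x. x \<in> \<Omega> \<Longrightarrow> v x \<in> carrier k" "\<And>x. x \<notin> \<Omega> \<Longrightarrow> v x = \<zero>\<^bsub>k\<^esub>" "\<zero>\<^bsub>k\<^esub> \<in> carrier k"
  have "v x \<in> carrier k" for x
  proof (cases "x \<in> \<Omega>")
    case False show ?thesis unfolding *(2)[OF False] by (rule *(3))
  qed (rule *(1))
  then have "\<forall>x. v x \<in> carrier k" by (rule allI)
  moreover have "\<forall>x. x \<notin> \<Omega> \<longrightarrow> v x = \<zero>\<^bsub>k\<^esub>" by (intro allI impI) (rule *(2))
  ultimately have "(\<forall>x. v x \<in> carrier k) \<and> (\<forall>x. x \<notin> \<Omega> \<longrightarrow> v x = \<zero>\<^bsub>k\<^esub>)" by (rule conjI)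
  then show ?thesis unfolding fun_space_def mem_Collect_eq .
qed

lemma subspace_add: "\<lbrakk>subspace k \<Omega> A; u \<in> A; v \<in> A\<rbrakk> \<Longrightarrow> (\<lambda>x. u x \<oplus>\<^bsub>k\<^esub> v x) \<in> A"
  by (simp add: subspace_def)

text \<open>The measure counts the pivot positions of a subspace. It replaces the dimension.\<close>

lemma (in field) subspace_measure:
  assumes "finite \<Omega>"
  obtains \<mu> :: "('x \<Rightarrow> 'a) set \<Rightarrow> nat"
  where "\<And>A B. \<lbrakk>subspace R \<Omega> A; subspace R \<Omega> B; A \<subset> B\<rbrakk> \<Longrightarrow> \<mu> A < \<mu> B"
proof -
  obtain f :: "'x \<Rightarrow> nat" where f: "inj_on f \<Omega>"
    using finite_imp_inj_to_nat_seg[OF assms] by auto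
  \<comment> \<open>The positions at which some vector of \<open>A\<close> has its first non-zero
    coordinate, in the order given by the numbering \<open>f\<close>.\<close>
  define piv where "piv A = {x \<in> \<Omega>. \<exists>v\<in>A. v x \<noteq> \<zero> \<and> (\<forall>y\<in>\<Omega>. f y < f x \<longrightarrow> v y = \<zero>)}"
    for A :: "('x \<Rightarrow> 'a) set"
  have "card (piv A) < card (piv B)"
    if A: "subspace R \<Omega> A" and B: "subspace R \<Omega> B" and AB: "A \<subset> B" for A B
  proof -
    have fin: "finite (piv B)" using assms by (simp add: piv_def)
    have sub: "piv A \<subseteq> piv B" using AB by (auto simp: piv_def)
    have "piv A \<noteq> piv B"
    proof
      assume eq: "piv A = piv B"
      define P where "P x \<longleftrightarrow> x \<in> \<Omega> \<and> (\<exists>v\<in>B - A. v x \<noteq> \<zero> \<and> (\<forall>y\<in>\<Omega>. f y < f x \<longrightarrow> v y = \<zero>))" for x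
      have lead: "\<exists>x. P x \<and> v x \<noteq> \<zero>" if v: "v \<in> B - A" for v
      proof -
        have "v \<noteq> (\<lambda>_. \<zero>)" using v A by (auto simp: subspace_def)
        then obtain z where "v z \<noteq> \<zero>" by (auto simp: fun_eq_iff)
        moreover have "z \<in> \<Omega>" using v B \<open>v z \<noteq> \<zero>\<close> by (auto simp: subspace_def fun_space_def)
        ultimately have "\<exists>x. (x \<in> \<Omega> \<and> v x \<noteq> \<zero>) \<and> (\<forall>y. y \<in> \<Omega> \<and> v y \<noteq> \<zero> \<longrightarrow> f x \<le> f y)"
          using ex_has_least_nat[of "\<lambda>x. x \<in> \<Omega> \<and> v x \<noteq> \<zero>" z f] by simp
        then obtain x where x: "x \<in> \<Omega>" "v x \<noteq> \<zero>" "\<forall>y. y \<in> \<Omega> \<and> v y \<noteq> \<zero> \<longrightarrow> f x \<le> f y"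
          by auto
        then have "\<forall>y\<in>\<Omega>. f y < f x \<longrightarrow> v y = \<zero>" by (metis not_le)
        then have "P x" using x(1,2) v unfolding P_def by blast
        then show ?thesis using x(2) by blast
      qed
      \<comment> \<open>Among the vectors of \<open>B\<close> outside \<open>A\<close> one with the
        latest pivot is chosen. If \<open>A\<close> has a vector with the same pivot, subtracting a
        multiple of it leaves a vector outside \<open>A\<close> whose first non-zero coordinate
        comes later still, which is impossible.\<close>
      define D where "D = {x. P x}"
      have finD: "finite D" using assms by (auto simp: D_def P_def intro: finite_subset[of _ \<Omega>])
      obtain v0 where "v0 \<in> B - A" using AB by blast
      then have "D \<noteq> {}" using lead by (auto simp: D_def)
      then have "Max (f ` D) \<in> f ` D" using finD by simp
      then obtain x where x: "x \<in> D" "f x = Max (f ` D)" by auto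
      then have max: "f y \<le> f x" if "y \<in> D" for y using finD that by simp
      obtain v where v: "v \<in> B" "v \<notin> A" "v x \<noteq> \<zero>" "\<forall>y\<in>\<Omega>. f y < f x \<longrightarrow> v y = \<zero>" and x\<Omega>: "x \<in> \<Omega>"
        using x(1) unfolding D_def P_def mem_Collect_eq by (elim conjE bexE DiffE) (rule that)
      then have "x \<in> piv A" using eq by (auto simp: piv_def)
      then obtain w where w: "w \<in> A" "w x \<noteq> \<zero>" "\<forall>y\<in>\<Omega>. f y < f x \<longrightarrow> w y = \<zero>"
        by (auto simp: piv_def)
      have wB: "w \<in> B" using w AB by blast
      have vk: "v y \<in> carrier R" and wk: "w y \<in> carrier R" for y
        using v(1) wB B by (auto simp: subspace_def fun_space_def)
      have iw: "inv (w x) \<in> carrier R" "inv (w x) \<otimes> w x = \<one>" using w(2) wk field_Units by auto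
      define c where "c = v x \<otimes> inv (w x)"
      have c: "c \<in> carrier R" "c \<otimes> w x = v x" using iw vk wk by (auto simp: c_def m_assoc)
      define u where "u = (\<lambda>y. v y \<oplus> (\<ominus> c) \<otimes> w y)"
      have "(\<lambda>y. (\<ominus> c) \<otimes> w y) \<in> B" using B wB c by (auto simp: subspace_def)
      then have uB: "u \<in> B" using subspace_add[OF B v(1)] unfolding u_def by blast
      have "u \<notin> A"
      proof
        assume u: "u \<in> A"
        have "(\<lambda>y. c \<otimes> w y) \<in> A" using A w(1) c by (auto simp: subspace_def)
        then have "(\<lambda>y. u y \<oplus> c \<otimes> w y) \<in> A" using A u by (auto simp: subspace_def)
        moreover have "(\<lambda>y. u y \<oplus> c \<otimes> w y) = v"
          using c vk wk by (auto simp: u_def fun_eq_iff a_assoc l_minus l_neg)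
        ultimately show False using v(2) by simp
      qed
      then obtain z where z: "P z" "u z \<noteq> \<zero>" using lead uB by blast
      have z\<Omega>: "z \<in> \<Omega>" using z by (simp add: P_def)
      have "f z \<le> f x" using max z(1) by (simp add: D_def)
      moreover have "u x = \<zero>" using c vk wk by (simp add: u_def l_minus r_neg)
      then have "f z \<noteq> f x" using f z z\<Omega> x\<Omega> by (auto dest: inj_onD)
      ultimately have "f z < f x" by simp
      then have "u z = \<zero>" using v(4) w(3) z\<Omega> c by (simp add: u_def)
      then show False using z(2) by simp
    qed
    then show ?thesis using sub fin by (intro psubset_card_mono) auto
  qed
  then show ?thesis by (rule that)
qed

lemma (in abelian_monoid) finsum_swap:
  assumes "finite A" "finite B" "\<And>x y. \<lbrakk>x \<in> A; y \<in> B\<rbrakk> \<Longrightarrow> f x y \<in> carrier G"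
  shows "(\<Oplus>x\<in>A. \<Oplus>y\<in>B. f x y) = (\<Oplus>y\<in>B. \<Oplus>x\<in>A. f x y)"
  using assms(1,3)
proof (induction A rule: finite_induct)
  case empty then show ?case by simp
next
  case (insert a A)
  then have "(\<Oplus>y\<in>B. \<Oplus>x\<in>insert a A. f x y) = (\<Oplus>y\<in>B. f a y \<oplus> (\<Oplus>x\<in>A. f x y))"
    by (intro finsum_cong') (auto simp: Pi_iff)
  then show ?case using insert by (simp add: finsum_addf Pi_iff)
qed

section \<open>The ring of matrices over the index set\<close>

locale function_space = field k for k (structure) +
  fixes \<Omega> :: "'x set"
  assumes finite_index: "finite \<Omega>"
begin

definition Mat :: "('x \<times> 'x \<Rightarrow> 'a) ring" where
  "Mat = \<lparr>carrier = fun_space k (\<Omega> \<times> \<Omega>),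
     monoid.mult = (\<lambda>a b (x, y). \<Oplus>z\<in>\<Omega>. a (x, z) \<otimes> b (z, y)),
     one = (\<lambda>(x, y). if x = y \<and> x \<in> \<Omega> then \<one> else \<zero>),
     ring.zero = (\<lambda>_. \<zero>), ring.add = (\<lambda>a b xy. a xy \<oplus> b xy)\<rparr>"

text \<open>Matrices act on row vectors from the right, so that a product of matrices acts in the
  order in which it is written.\<close>

definition vmult :: "('x \<Rightarrow> 'a) \<Rightarrow> ('x \<times> 'x \<Rightarrow> 'a) \<Rightarrow> 'x \<Rightarrow> 'a" where
  "vmult v a = (\<lambda>y. \<Oplus>x\<in>\<Omega>. v x \<otimes> a (x, y))"

definition diag :: "'x set \<Rightarrow> 'x \<times> 'x \<Rightarrow> 'a" where
  "diag Y = (\<lambda>(x, y). if x = y \<and> x \<in> Y then \<one> else \<zero>)"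

definition delta :: "'x \<Rightarrow> 'x \<Rightarrow> 'a" where
  "delta x = (\<lambda>y. if x = y then \<one> else \<zero>)"

lemma MatD [simp]: "a \<in> carrier Mat \<Longrightarrow> a xy \<in> carrier k"
  unfolding Mat_def fun_space_def by (cases xy) simp

lemma Mat_outside: "\<lbrakk>a \<in> carrier Mat; x \<notin> \<Omega> \<or> y \<notin> \<Omega>\<rbrakk> \<Longrightarrow> a (x, y) = \<zero>"
  unfolding Mat_def fun_space_def by simp

lemma vecD [simp]: "v \<in> fun_space k \<Omega> \<Longrightarrow> v x \<in> carrier k"
  by (simp add: fun_space_def)

lemma Mat_simps:
  "(a \<otimes>\<^bsub>Mat\<^esub> b) (x, y) = (\<Oplus>z\<in>\<Omega>. a (x, z) \<otimes> b (z, y))"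
  "(a \<oplus>\<^bsub>Mat\<^esub> b) xy = a xy \<oplus> b xy" "\<zero>\<^bsub>Mat\<^esub> xy = \<zero>" "\<one>\<^bsub>Mat\<^esub> = diag \<Omega>"
  by (simp_all add: Mat_def diag_def)

lemma MatI:
  "\<lbrakk>\<And>x y. \<lbrakk>x \<in> \<Omega>; y \<in> \<Omega>\<rbrakk> \<Longrightarrow> a (x, y) \<in> carrier k; \<And>x y. x \<notin> \<Omega> \<or> y \<notin> \<Omega> \<Longrightarrow> a (x, y) = \<zero>\<rbrakk>
    \<Longrightarrow> a \<in> carrier Mat"
  by (force simp: Mat_def intro: fun_spaceI)

lemma Mat_eqI:
  "\<lbrakk>a \<in> carrier Mat; b \<in> carrier Mat; \<And>x y. \<lbrakk>x \<in> \<Omega>; y \<in> \<Omega>\<rbrakk> \<Longrightarrow> a (x, y) = b (x, y)\<rbrakk> \<Longrightarrow> a = b"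
proof (rule ext, clarify)
  fix x y assume *: "a \<in> carrier Mat" "b \<in> carrier Mat" "\<And>x y. \<lbrakk>x \<in> \<Omega>; y \<in> \<Omega>\<rbrakk> \<Longrightarrow> a (x, y) = b (x, y)"
  show "a (x, y) = b (x, y)"
    using * Mat_outside[OF *(1), of x y] Mat_outside[OF *(2), of x y] by (cases "x \<in> \<Omega> \<and> y \<in> \<Omega>") auto
qed

lemma vec_eqI:
  "\<lbrakk>u \<in> fun_space k \<Omega>; v \<in> fun_space k \<Omega>; \<And>x. x \<in> \<Omega> \<Longrightarrow> u x = v x\<rbrakk> \<Longrightarrow> u = v"
proof
  fix x assume *: "u \<in> fun_space k \<Omega>" "v \<in> fun_space k \<Omega>" "\<And>x. x \<in> \<Omega> \<Longrightarrow> u x = v x"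
  show "u x = v x" using * fun_spaceD(2)[OF *(1), of x] fun_spaceD(2)[OF *(2), of x] by (cases "x \<in> \<Omega>") auto
qed

lemma finsum_delta:
  assumes "x \<in> \<Omega>" "f x \<in> carrier k"
  shows "(\<Oplus>z\<in>\<Omega>. if x = z then f z else \<zero>) = f x"
proof -
  have "(\<Oplus>z\<in>\<Omega>. if x = z then f z else \<zero>) = (\<Oplus>z\<in>\<Omega>. if x = z then f x else \<zero>)"
    using assms by (intro finsum_cong') auto
  then show ?thesis using assms finite_index finsum_singleton[of x \<Omega> "\<lambda>_. f x"] by simp
qed

lemma Mat_mult_closed [simp]:
  assumes "a \<in> carrier Mat" "b \<in> carrier Mat" shows "a \<otimes>\<^bsub>Mat\<^esub> b \<in> carrier Mat"
proof (rule MatI)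
  show "(a \<otimes>\<^bsub>Mat\<^esub> b) (x, y) \<in> carrier k" if "x \<in> \<Omega>" "y \<in> \<Omega>" for x y
    using assms by (simp add: Mat_simps Pi_iff)
  show "(a \<otimes>\<^bsub>Mat\<^esub> b) (x, y) = \<zero>" if "x \<notin> \<Omega> \<or> y \<notin> \<Omega>" for x y
  proof -
    have "(a \<otimes>\<^bsub>Mat\<^esub> b) (x, y) = (\<Oplus>z\<in>\<Omega>. \<zero>)"
      unfolding Mat_simps using assms that Mat_outside[OF assms(1)] Mat_outside[OF assms(2)]
      by (intro finsum_cong') (metis MatD l_null r_null, auto)
    then show ?thesis by simp
  qed
qed

lemma diag_closed [simp]: "Y \<subseteq> \<Omega> \<Longrightarrow> diag Y \<in> carrier Mat"
  by (rule MatI) (auto simp: diag_def)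

lemma diag_mult:
  assumes "a \<in> carrier Mat" "Y \<subseteq> \<Omega>"
  shows "(diag Y \<otimes>\<^bsub>Mat\<^esub> a) (x, y) = (if x \<in> Y then a (x, y) else \<zero>)"
    and "(a \<otimes>\<^bsub>Mat\<^esub> diag Y) (y, x) = (if x \<in> Y then a (y, x) else \<zero>)"
proof -
  show "(diag Y \<otimes>\<^bsub>Mat\<^esub> a) (x, y) = (if x \<in> Y then a (x, y) else \<zero>)"
  proof (cases "x \<in> Y")
    case True
    have "(diag Y \<otimes>\<^bsub>Mat\<^esub> a) (x, y) = (\<Oplus>z\<in>\<Omega>. if x = z then a (z, y) else \<zero>)"
      unfolding Mat_simps diag_def using True assms by (intro finsum_cong') auto
    also have "\<dots> = a (x, y)"
      using finsum_delta[of x "\<lambda>z. a (z, y)"] True assms by auto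
    finally show ?thesis using True by simp
  next
    case False
    have "(diag Y \<otimes>\<^bsub>Mat\<^esub> a) (x, y) = (\<Oplus>z\<in>\<Omega>. \<zero>)"
      unfolding Mat_simps diag_def using False assms by (intro finsum_cong') auto
    then show ?thesis using False by simp
  qed
  show "(a \<otimes>\<^bsub>Mat\<^esub> diag Y) (y, x) = (if x \<in> Y then a (y, x) else \<zero>)"
  proof (cases "x \<in> Y")
    case True
    have "(a \<otimes>\<^bsub>Mat\<^esub> diag Y) (y, x) = (\<Oplus>z\<in>\<Omega>. if x = z then a (y, z) else \<zero>)"
      unfolding Mat_simps diag_def using True assms by (intro finsum_cong') auto
    also have "\<dots> = a (y, x)"
      using finsum_delta[of x "\<lambda>z. a (y, z)"] True assms by auto
    finally show ?thesis using True by simp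
  next
    case False
    have "(a \<otimes>\<^bsub>Mat\<^esub> diag Y) (y, x) = (\<Oplus>z\<in>\<Omega>. \<zero>)"
      unfolding Mat_simps diag_def using False assms by (intro finsum_cong') auto
    then show ?thesis using False by simp
  qed
qed

lemma Mat_assoc:
  assumes "a \<in> carrier Mat" "b \<in> carrier Mat" "c \<in> carrier Mat"
  shows "a \<otimes>\<^bsub>Mat\<^esub> b \<otimes>\<^bsub>Mat\<^esub> c = a \<otimes>\<^bsub>Mat\<^esub> (b \<otimes>\<^bsub>Mat\<^esub> c)"
proof (rule Mat_eqI)
  fix x y
  have "(a \<otimes>\<^bsub>Mat\<^esub> b \<otimes>\<^bsub>Mat\<^esub> c) (x, y) = (\<Oplus>z\<in>\<Omega>. \<Oplus>w\<in>\<Omega>. a (x, w) \<otimes> b (w, z) \<otimes> c (z, y))"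
    using assms finite_index by (simp add: Mat_simps finsum_ldistr Pi_iff)
  also have "\<dots> = (\<Oplus>w\<in>\<Omega>. \<Oplus>z\<in>\<Omega>. a (x, w) \<otimes> b (w, z) \<otimes> c (z, y))"
    using assms finite_index by (intro finsum_swap) auto
  also have "\<dots> = (a \<otimes>\<^bsub>Mat\<^esub> (b \<otimes>\<^bsub>Mat\<^esub> c)) (x, y)"
    using assms finite_index by (simp add: Mat_simps finsum_rdistr Pi_iff m_assoc)
  finally show "(a \<otimes>\<^bsub>Mat\<^esub> b \<otimes>\<^bsub>Mat\<^esub> c) (x, y) = (a \<otimes>\<^bsub>Mat\<^esub> (b \<otimes>\<^bsub>Mat\<^esub> c)) (x, y)" .
qed (use assms in auto)

lemma Mat_add_closed: "\<lbrakk>a \<in> carrier Mat; b \<in> carrier Mat\<rbrakk> \<Longrightarrow> a \<oplus>\<^bsub>Mat\<^esub> b \<in> carrier Mat"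
  by (rule MatI) (auto simp: Mat_simps Mat_outside)

lemma Mat_zero_closed: "\<zero>\<^bsub>Mat\<^esub> \<in> carrier Mat"
  by (rule MatI) (auto simp: Mat_simps)

lemma Mat_smult_closed: "\<lbrakk>c \<in> carrier k; a \<in> carrier Mat\<rbrakk> \<Longrightarrow> (\<lambda>xy. c \<otimes> a xy) \<in> carrier Mat"
  by (rule MatI) (auto simp: Mat_outside)

lemma Mat_ring: "ring Mat"
proof (rule ringI)
  show "abelian_group Mat"
  proof (rule abelian_groupI)
    show "\<exists>b\<in>carrier Mat. b \<oplus>\<^bsub>Mat\<^esub> a = \<zero>\<^bsub>Mat\<^esub>" if "a \<in> carrier Mat" for a
      using that Mat_smult_closed[of "\<ominus> \<one>" a]
      by (intro bexI[of _ "\<lambda>xy. \<ominus> \<one> \<otimes> a xy"]) (auto simp: Mat_simps fun_eq_iff l_minus l_neg)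
  qed (auto simp: fun_eq_iff Mat_simps a_ac Mat_add_closed Mat_zero_closed)
  show "monoid Mat"
    by (rule monoidI)
      (auto simp: Mat_assoc Mat_simps(4) diag_mult Mat_outside fun_eq_iff)
  show "(a \<oplus>\<^bsub>Mat\<^esub> b) \<otimes>\<^bsub>Mat\<^esub> c = a \<otimes>\<^bsub>Mat\<^esub> c \<oplus>\<^bsub>Mat\<^esub> b \<otimes>\<^bsub>Mat\<^esub> c"
    "c \<otimes>\<^bsub>Mat\<^esub> (a \<oplus>\<^bsub>Mat\<^esub> b) = c \<otimes>\<^bsub>Mat\<^esub> a \<oplus>\<^bsub>Mat\<^esub> c \<otimes>\<^bsub>Mat\<^esub> b"
    if "a \<in> carrier Mat" "b \<in> carrier Mat" "c \<in> carrier Mat" for a b c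
    using that by (auto simp: fun_eq_iff Mat_simps l_distr r_distr finsum_addf Pi_iff)
qed

sublocale Mat: ring Mat by (rule Mat_ring)

lemma Mat_smult_mult:
  assumes "c \<in> carrier k" "a \<in> carrier Mat" "b \<in> carrier Mat"
  shows "(\<lambda>xy. c \<otimes> a xy) \<otimes>\<^bsub>Mat\<^esub> b = (\<lambda>xy. c \<otimes> (a \<otimes>\<^bsub>Mat\<^esub> b) xy)"
    "a \<otimes>\<^bsub>Mat\<^esub> (\<lambda>xy. c \<otimes> b xy) = (\<lambda>xy. c \<otimes> (a \<otimes>\<^bsub>Mat\<^esub> b) xy)"
  using assms finite_index
  by (auto simp: fun_eq_iff Mat_simps finsum_rdistr Pi_iff m_assoc m_lcomm)

lemma vmult_closed [simp]:
  assumes "v \<in> fun_space k \<Omega>" "a \<in> carrier Mat" shows "vmult v a \<in> fun_space k \<Omega>"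
proof (rule fun_spaceI)
  show "vmult v a y \<in> carrier k" if "y \<in> \<Omega>" for y
    using assms by (simp add: vmult_def Pi_iff)
  show "vmult v a y = \<zero>" if "y \<notin> \<Omega>" for y
  proof -
    have "vmult v a y = (\<Oplus>x\<in>\<Omega>. \<zero>)"
      unfolding vmult_def using assms that by (intro finsum_cong') (auto simp: Mat_outside)
    then show ?thesis by simp
  qed
qed simp

lemma vmult_assoc:
  assumes "v \<in> fun_space k \<Omega>" "a \<in> carrier Mat" "b \<in> carrier Mat"
  shows "vmult (vmult v a) b = vmult v (a \<otimes>\<^bsub>Mat\<^esub> b)"
proof (rule ext)
  fix y
  have "vmult (vmult v a) b y = (\<Oplus>z\<in>\<Omega>. \<Oplus>w\<in>\<Omega>. v w \<otimes> a (w, z) \<otimes> b (z, y))"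
    using assms finite_index by (simp add: vmult_def finsum_ldistr Pi_iff)
  also have "\<dots> = (\<Oplus>w\<in>\<Omega>. \<Oplus>z\<in>\<Omega>. v w \<otimes> a (w, z) \<otimes> b (z, y))"
    using assms finite_index by (intro finsum_swap) auto
  also have "\<dots> = vmult v (a \<otimes>\<^bsub>Mat\<^esub> b) y"
    using assms finite_index by (simp add: vmult_def Mat_simps finsum_rdistr Pi_iff m_assoc)
  finally show "vmult (vmult v a) b y = vmult v (a \<otimes>\<^bsub>Mat\<^esub> b) y" .
qed

lemma vmult_add:
  assumes "u \<in> fun_space k \<Omega>" "v \<in> fun_space k \<Omega>" "a \<in> carrier Mat"
  shows "vmult (\<lambda>x. u x \<oplus> v x) a = (\<lambda>x. vmult u a x \<oplus> vmult v a x)"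
  using assms by (auto simp: fun_eq_iff vmult_def l_distr finsum_addf Pi_iff)

lemma vmult_add_right:
  assumes "v \<in> fun_space k \<Omega>" "a \<in> carrier Mat" "b \<in> carrier Mat"
  shows "vmult v (a \<oplus>\<^bsub>Mat\<^esub> b) = (\<lambda>x. vmult v a x \<oplus> vmult v b x)"
  using assms by (auto simp: fun_eq_iff vmult_def Mat_simps r_distr finsum_addf Pi_iff)

lemma vmult_smult:
  assumes "v \<in> fun_space k \<Omega>" "c \<in> carrier k" "a \<in> carrier Mat"
  shows "vmult (\<lambda>x. c \<otimes> v x) a = (\<lambda>x. c \<otimes> vmult v a x)"
  using assms finite_index by (auto simp: fun_eq_iff vmult_def finsum_rdistr Pi_iff m_assoc)

lemma vmult_diag:
  assumes "v \<in> fun_space k \<Omega>" "Y \<subseteq> \<Omega>"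
  shows "vmult v (diag Y) y = (if y \<in> Y then v y else \<zero>)"
proof (cases "y \<in> Y")
  case True
  have "vmult v (diag Y) y = (\<Oplus>z\<in>\<Omega>. if y = z then v z else \<zero>)"
    unfolding vmult_def diag_def using True assms by (intro finsum_cong') auto
  also have "\<dots> = v y" using finsum_delta[of y v] True assms by auto
  finally show ?thesis using True by simp
next
  case False
  have "vmult v (diag Y) y = (\<Oplus>z\<in>\<Omega>. \<zero>)"
    unfolding vmult_def diag_def using False assms by (intro finsum_cong') auto
  then show ?thesis using False by simp
qed

lemma delta_closed [simp]: "x \<in> \<Omega> \<Longrightarrow> delta x \<in> fun_space k \<Omega>"
  by (rule fun_spaceI) (auto simp: delta_def)

lemma vmult_delta:
  assumes "x \<in> \<Omega>" "a \<in> carrier Mat" shows "vmult (delta x) a y = a (x, y)"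
proof -
  have "vmult (delta x) a y = (\<Oplus>z\<in>\<Omega>. if x = z then a (z, y) else \<zero>)"
    unfolding vmult_def delta_def using assms by (intro finsum_cong') auto
  then show ?thesis using finsum_delta[of x "\<lambda>z. a (z, y)"] assms by auto
qed

lemma Mat_eq_vmultI:
  assumes "a \<in> carrier Mat" "b \<in> carrier Mat"
    and "\<And>v. v \<in> fun_space k \<Omega> \<Longrightarrow> vmult v a = vmult v b"
  shows "a = b"
  using assms by (intro Mat_eqI) (auto simp flip: vmult_delta)

text \<open>Fitting's lemma: the chains of subspaces \<open>a^n E\<close> and \<open>E a^n\<close> become stationary.\<close>

lemma fitting:
  assumes E: "subspace k (\<Omega> \<times> \<Omega>) E" "\<And>a b. \<lbrakk>a \<in> E; b \<in> E\<rbrakk> \<Longrightarrow> a \<otimes>\<^bsub>Mat\<^esub> b \<in> E"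
    and e: "e \<in> E" "\<And>a. a \<in> E \<Longrightarrow> e \<otimes>\<^bsub>Mat\<^esub> a = a \<and> a \<otimes>\<^bsub>Mat\<^esub> e = a"
    and prim: "\<And>f. \<lbrakk>f \<in> E; f \<otimes>\<^bsub>Mat\<^esub> f = f\<rbrakk> \<Longrightarrow> f = \<zero>\<^bsub>Mat\<^esub> \<or> f = e"
    and a: "a \<in> E"
  shows "(\<exists>n::nat. a [^]\<^bsub>Mat\<^esub> n = \<zero>\<^bsub>Mat\<^esub>) \<or> (\<exists>b\<in>E. a \<otimes>\<^bsub>Mat\<^esub> b = e \<and> b \<otimes>\<^bsub>Mat\<^esub> a = e)"
proof -
  have EM: "x \<in> carrier Mat" if "x \<in> E" for x
    using that E(1) by (auto simp: subspace_def Mat_def)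
  have aM: "a \<in> carrier Mat" using a EM by simp
  obtain \<mu> :: "('x \<times> 'x \<Rightarrow> 'a) set \<Rightarrow> nat" where
    \<mu>: "\<And>A B. \<lbrakk>subspace k (\<Omega> \<times> \<Omega>) A; subspace k (\<Omega> \<times> \<Omega>) B; A \<subset> B\<rbrakk> \<Longrightarrow> \<mu> A < \<mu> B"
    using subspace_measure[of "\<Omega> \<times> \<Omega>"] finite_index by auto
  have pw: "a [^]\<^bsub>Mat\<^esub> (n::nat) \<otimes>\<^bsub>Mat\<^esub> x \<in> E" "x \<otimes>\<^bsub>Mat\<^esub> a [^]\<^bsub>Mat\<^esub> n \<in> E" if "x \<in> E" for n x
  proof -
    show "a [^]\<^bsub>Mat\<^esub> n \<otimes>\<^bsub>Mat\<^esub> x \<in> E"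
      using that by (induction n arbitrary: x) (auto simp: EM aM Mat.m_assoc E(2) a)
    show "x \<otimes>\<^bsub>Mat\<^esub> a [^]\<^bsub>Mat\<^esub> n \<in> E"
      using that by (induction n arbitrary: x) (auto simp: EM aM Mat.m_assoc[symmetric] E(2) a)
  qed
  have powM: "a [^]\<^bsub>Mat\<^esub> (n::nat) \<in> carrier Mat" for n using aM by simp
  define L where "L n = (\<lambda>x. a [^]\<^bsub>Mat\<^esub> (n::nat) \<otimes>\<^bsub>Mat\<^esub> x) ` E" for n
  define R where "R n = (\<lambda>x. x \<otimes>\<^bsub>Mat\<^esub> a [^]\<^bsub>Mat\<^esub> (n::nat)) ` E" for n
  have sub: "subspace k (\<Omega> \<times> \<Omega>) (F ` E)"
    if F: "\<And>x. x \<in> E \<Longrightarrow> F x \<in> E"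
      "\<And>x y. \<lbrakk>x \<in> E; y \<in> E\<rbrakk> \<Longrightarrow> F (x \<oplus>\<^bsub>Mat\<^esub> y) = F x \<oplus>\<^bsub>Mat\<^esub> F y"
      "\<And>c x. \<lbrakk>x \<in> E; c \<in> carrier k\<rbrakk> \<Longrightarrow> F (\<lambda>xy. c \<otimes> x xy) = (\<lambda>xy. c \<otimes> F x xy)" for F
  proof -
    have addE: "x \<oplus>\<^bsub>Mat\<^esub> y \<in> E" if "x \<in> E" "y \<in> E" for x y
      using E(1) that by (simp add: subspace_def Mat_def)
    have smE: "(\<lambda>xy. c \<otimes> x xy) \<in> E" if "x \<in> E" "c \<in> carrier k" for c x
      using E(1) that by (simp add: subspace_def)
    have z: "\<zero>\<^bsub>Mat\<^esub> \<in> E" using E(1) by (simp add: subspace_def Mat_def)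
    have "F \<zero>\<^bsub>Mat\<^esub> \<oplus>\<^bsub>Mat\<^esub> F \<zero>\<^bsub>Mat\<^esub> = F \<zero>\<^bsub>Mat\<^esub>" using F(2)[OF z z] by simp
    then have Fz: "F \<zero>\<^bsub>Mat\<^esub> = \<zero>\<^bsub>Mat\<^esub>" using EM F(1) z by (metis Mat.add.l_cancel_one')
    have "F ` E \<subseteq> fun_space k (\<Omega> \<times> \<Omega>)" using F(1) EM by (auto simp: Mat_def)
    moreover have "(\<lambda>_. \<zero>) \<in> F ` E" using Fz z by (auto simp: Mat_def intro!: image_eqI)
    moreover have "(\<lambda>xy. u xy \<oplus> v xy) \<in> F ` E" if "u \<in> F ` E" "v \<in> F ` E" for u v
    proof -
      from that obtain x y where "x \<in> E" "y \<in> E" "u = F x" "v = F y" by auto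
      then have "(\<lambda>xy. u xy \<oplus> v xy) = F (x \<oplus>\<^bsub>Mat\<^esub> y)" using F(2) by (simp add: Mat_def)
      then show ?thesis using addE \<open>x \<in> E\<close> \<open>y \<in> E\<close> by blast
    qed
    moreover have "(\<lambda>xy. c \<otimes> v xy) \<in> F ` E" if "c \<in> carrier k" "v \<in> F ` E" for c v
      using that smE F(3) by (auto simp flip: F(3))
    ultimately show ?thesis by (simp add: subspace_def)
  qed
  have Ls: "subspace k (\<Omega> \<times> \<Omega>) (L n)" and Rs: "subspace k (\<Omega> \<times> \<Omega>) (R n)" for n
    unfolding L_def R_def
    by (rule sub; use pw EM powM in \<open>auto simp: Mat.r_distr Mat.l_distr Mat_smult_mult\<close>)+
  have Ldec: "L m \<subseteq> L n" if "n \<le> m" for n m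
  proof -
    have "a [^]\<^bsub>Mat\<^esub> m \<otimes>\<^bsub>Mat\<^esub> x = a [^]\<^bsub>Mat\<^esub> n \<otimes>\<^bsub>Mat\<^esub> (a [^]\<^bsub>Mat\<^esub> (m - n) \<otimes>\<^bsub>Mat\<^esub> x)" if "x \<in> E" for x
      using EM[OF that] powM \<open>n \<le> m\<close> aM by (simp add: Mat.m_assoc[symmetric] Mat.nat_pow_mult)
    then show ?thesis unfolding L_def using pw(1) by blast
  qed
  have Rdec: "R m \<subseteq> R n" if "n \<le> m" for n m
  proof -
    have "x \<otimes>\<^bsub>Mat\<^esub> a [^]\<^bsub>Mat\<^esub> m = x \<otimes>\<^bsub>Mat\<^esub> a [^]\<^bsub>Mat\<^esub> (m - n) \<otimes>\<^bsub>Mat\<^esub> a [^]\<^bsub>Mat\<^esub> n" if "x \<in> E" for x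
      using EM[OF that] powM \<open>n \<le> m\<close> aM by (simp add: Mat.m_assoc Mat.nat_pow_mult)
    then show ?thesis unfolding R_def using pw(2) by blast
  qed
  obtain n1 where n1: "\<And>m. \<mu> (L n1) \<le> \<mu> (L m)"
    using ex_has_least_nat[of "\<lambda>_. True" 0 "\<lambda>n. \<mu> (L n)"] by blast
  obtain n2 where n2: "\<And>m. \<mu> (R n2) \<le> \<mu> (R m)"
    using ex_has_least_nat[of "\<lambda>_. True" 0 "\<lambda>n. \<mu> (R n)"] by blast
  have L1: "L m = L n1" if "n1 \<le> m" for m using \<mu>[OF Ls Ls] Ldec[OF that] n1 by (metis not_less psubsetI)
  have R1: "R m = R n2" if "n2 \<le> m" for m using \<mu>[OF Rs Rs] Rdec[OF that] n2 by (metis not_less psubsetI)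
  \<comment> \<open>The successor makes the exponent positive. Then the power lies in
    \<open>E\<close>, whereas the zeroth power is the full identity matrix, and a factor
    \<open>a\<close> can be split off on either side.\<close>
  define N where "N = Suc (n1 + n2)"
  define c where "c = a [^]\<^bsub>Mat\<^esub> N"
  have cM: "c \<in> carrier Mat" using powM by (simp add: c_def)
  have cE: "c \<in> E" using pw(1)[OF a, of "n1 + n2"] aM by (simp add: c_def N_def)
  have cc: "a [^]\<^bsub>Mat\<^esub> (N + N) = c \<otimes>\<^bsub>Mat\<^esub> c" using aM by (simp add: c_def Mat.nat_pow_mult)
  have "c \<in> L N" using e cE unfolding L_def c_def[symmetric] by force
  also have "L N = L (N + N)" using L1[of N] L1[of "N + N"] by (simp add: N_def)
  finally obtain x where x: "x \<in> E" "c = c \<otimes>\<^bsub>Mat\<^esub> c \<otimes>\<^bsub>Mat\<^esub> x" unfolding L_def cc by blast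
  have "c \<in> R N" using e cE unfolding R_def c_def[symmetric] by force
  also have "R N = R (N + N)" using R1[of N] R1[of "N + N"] by (simp add: N_def)
  finally obtain y where y: "y \<in> E" "c = y \<otimes>\<^bsub>Mat\<^esub> (c \<otimes>\<^bsub>Mat\<^esub> c)" unfolding R_def cc by blast
  have xM: "x \<in> carrier Mat" and yM: "y \<in> carrier Mat" using x y EM by auto
  \<comment> \<open>From $c = c^2 x = y c^2$ it follows that $c x = y c$. This common value is
    idempotent and satisfies $c g = c$, so primitivity decides between the nilpotent case and the
    unit case.\<close>
  define g where "g = c \<otimes>\<^bsub>Mat\<^esub> x"
  have gM: "g \<in> carrier Mat" using cM xM by (simp add: g_def)
  have "g = y \<otimes>\<^bsub>Mat\<^esub> (c \<otimes>\<^bsub>Mat\<^esub> c) \<otimes>\<^bsub>Mat\<^esub> x" using y(2) by (simp add: g_def)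
  also have "\<dots> = y \<otimes>\<^bsub>Mat\<^esub> (c \<otimes>\<^bsub>Mat\<^esub> c \<otimes>\<^bsub>Mat\<^esub> x)" using cM xM yM by (simp add: Mat.m_assoc)
  finally have g2: "g = y \<otimes>\<^bsub>Mat\<^esub> c" using x(2) by simp
  have cg: "c \<otimes>\<^bsub>Mat\<^esub> g = c" using x(2) cM xM by (simp add: g_def Mat.m_assoc)
  have "g \<otimes>\<^bsub>Mat\<^esub> g = y \<otimes>\<^bsub>Mat\<^esub> (c \<otimes>\<^bsub>Mat\<^esub> g)" using g2 cM yM gM by (metis Mat.m_assoc)
  then have "g \<otimes>\<^bsub>Mat\<^esub> g = g" using cg g2 by simp
  moreover have "g \<in> E" unfolding g_def using cE x(1) by (rule E(2))
  ultimately have "g = \<zero>\<^bsub>Mat\<^esub> \<or> g = e" by (intro prim)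
  then show ?thesis
  proof
    assume "g = \<zero>\<^bsub>Mat\<^esub>"
    then have "c = \<zero>\<^bsub>Mat\<^esub>" using cg cM by simp
    then show ?thesis unfolding c_def by blast
  next
    assume ge: "g = e"
    \<comment> \<open>With $g = e$, splitting one factor \<open>a\<close> off the power
      \<open>c\<close> gives a right inverse \<open>r\<close> and a left inverse \<open>l\<close> of
      \<open>a\<close>, which must coincide.\<close>
    define r where "r = a [^]\<^bsub>Mat\<^esub> (n1 + n2) \<otimes>\<^bsub>Mat\<^esub> x"
    define l where "l = y \<otimes>\<^bsub>Mat\<^esub> a [^]\<^bsub>Mat\<^esub> (n1 + n2)"
    have rE: "r \<in> E" and lE: "l \<in> E" using pw x y by (simp_all add: r_def l_def)
    have "c = a \<otimes>\<^bsub>Mat\<^esub> a [^]\<^bsub>Mat\<^esub> (n1 + n2)"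
      using aM Mat.nat_pow_mult[of a 1 "n1 + n2"] by (simp add: c_def N_def)
    then have ar: "a \<otimes>\<^bsub>Mat\<^esub> r = e" using ge aM xM powM by (simp add: r_def g_def Mat.m_assoc)
    have "c = a [^]\<^bsub>Mat\<^esub> (n1 + n2) \<otimes>\<^bsub>Mat\<^esub> a" using aM by (simp add: c_def N_def)
    then have la: "l \<otimes>\<^bsub>Mat\<^esub> a = e" using ge g2 aM yM powM by (simp add: l_def Mat.m_assoc)
    have "l = l \<otimes>\<^bsub>Mat\<^esub> (a \<otimes>\<^bsub>Mat\<^esub> r)" using ar e(2)[OF lE] by simp
    also have "\<dots> = l \<otimes>\<^bsub>Mat\<^esub> a \<otimes>\<^bsub>Mat\<^esub> r" using EM lE rE aM by (simp add: Mat.m_assoc)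
    finally have "l = r" using la e(2)[OF rE] by simp
    then show ?thesis using rE ar la by blast
  qed
qed

end

section \<open>Permutation modules and invariant matrices\<close>

lemma finsum_pointwise:
  assumes "abelian_monoid W" "abelian_monoid k" "finite I"
    and "\<And>u v. u \<oplus>\<^bsub>W\<^esub> v = (\<lambda>x. u x \<oplus>\<^bsub>k\<^esub> v x)" "\<zero>\<^bsub>W\<^esub> = (\<lambda>_. \<zero>\<^bsub>k\<^esub>)"
    and "\<And>i. i \<in> I \<Longrightarrow> F i \<in> carrier W" "\<And>i. i \<in> I \<Longrightarrow> F i x \<in> carrier k"
  shows "finsum W F I x = (\<Oplus>\<^bsub>k\<^esub>i\<in>I. F i x)"
proof -
  interpret W: abelian_monoid W by fact
  interpret k: abelian_monoid k by fact
  show ?thesis using assms(3,6,7)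
    by (induction I rule: finite_induct) (auto simp: assms(4,5) Pi_iff)
qed

locale finite_action = right_action G \<Omega> dot + K: function_space k \<Omega>
  for G (structure) and \<Omega> :: "'x set" and dot :: "'x \<Rightarrow> 'a \<Rightarrow> 'x" (infixl \<open>\<bullet>\<close> 70)
    and k :: "('k, 'r) ring_scheme"
begin

definition Inv :: "'a set \<Rightarrow> ('x \<times> 'x \<Rightarrow> 'k) set" where
  "Inv H = {a \<in> carrier K.Mat. \<forall>h\<in>H. \<forall>x\<in>\<Omega>. \<forall>y\<in>\<Omega>. a (x \<bullet> h, y \<bullet> h) = a (x, y)}"

definition primitive :: "'a set \<Rightarrow> ('x \<times> 'x \<Rightarrow> 'k) \<Rightarrow> bool" where
  "primitive H e \<longleftrightarrow> e \<in> Inv H \<and> e \<otimes>\<^bsub>K.Mat\<^esub> e = e \<and> e \<noteq> \<zero>\<^bsub>K.Mat\<^esub> \<and>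
     (\<forall>f\<in>Inv H. f \<otimes>\<^bsub>K.Mat\<^esub> f = f \<and> e \<otimes>\<^bsub>K.Mat\<^esub> f = f \<and> f \<otimes>\<^bsub>K.Mat\<^esub> e = f
        \<longrightarrow> f = \<zero>\<^bsub>K.Mat\<^esub> \<or> f = e)"

definition perm_module :: "('k, 'a, 'x \<Rightarrow> 'k) gmodule" where
  "perm_module =
     \<lparr>carrier = fun_space k \<Omega>, monoid.mult = undefined, one = undefined,
      ring.zero = (\<lambda>_. \<zero>\<^bsub>k\<^esub>), ring.add = (\<lambda>u v x. u x \<oplus>\<^bsub>k\<^esub> v x),
      smult = (\<lambda>a v x. a \<otimes>\<^bsub>k\<^esub> v x),
      act = (\<lambda>v g x. if x \<in> \<Omega> then v (x \<bullet> inv g) else \<zero>\<^bsub>k\<^esub>)\<rparr>"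

text \<open>For an idempotent the vectors it fixes are exactly its values. In this form membership
  is an equation and needs no preimage.\<close>

definition image :: "('x \<times> 'x \<Rightarrow> 'k) \<Rightarrow> ('k, 'a, 'x \<Rightarrow> 'k) gmodule" where
  "image e = perm_module\<lparr>carrier := {v \<in> fun_space k \<Omega>. K.vmult v e = v}\<rparr>"

abbreviation trans :: "('x \<Rightarrow> 'k) \<Rightarrow> 'a \<Rightarrow> 'x \<Rightarrow> 'k" where
  "trans v g \<equiv> act perm_module v g"

lemma perm_module_simps [simp]:
  "carrier perm_module = fun_space k \<Omega>" "\<zero>\<^bsub>perm_module\<^esub> = (\<lambda>_. \<zero>\<^bsub>k\<^esub>)"
  "u \<oplus>\<^bsub>perm_module\<^esub> v = (\<lambda>x. u x \<oplus>\<^bsub>k\<^esub> v x)" "a \<odot>\<^bsub>perm_module\<^esub> v = (\<lambda>x. a \<otimes>\<^bsub>k\<^esub> v x)"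
  by (simp_all add: perm_module_def)

lemma image_simps [simp]:
  "carrier (image e) = {v \<in> fun_space k \<Omega>. K.vmult v e = v}" "\<zero>\<^bsub>image e\<^esub> = (\<lambda>_. \<zero>\<^bsub>k\<^esub>)"
  "u \<oplus>\<^bsub>image e\<^esub> v = (\<lambda>x. u x \<oplus>\<^bsub>k\<^esub> v x)" "a \<odot>\<^bsub>image e\<^esub> v = (\<lambda>x. a \<otimes>\<^bsub>k\<^esub> v x)"
  "v \<star>\<^bsub>image e\<^esub> g = trans v g"
  by (simp_all add: image_def perm_module_def)

lemma trans_apply: "trans v g x = (if x \<in> \<Omega> then v (x \<bullet> inv g) else \<zero>\<^bsub>k\<^esub>)"
  by (simp add: perm_module_def)

lemma trans_dot: "\<lbrakk>x \<in> \<Omega>; g \<in> carrier G\<rbrakk> \<Longrightarrow> trans v g (x \<bullet> g) = v x"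
  by (simp add: trans_apply)

lemma sum_dot:
  assumes "h \<in> carrier G" "\<And>x. x \<in> \<Omega> \<Longrightarrow> F x \<in> carrier k"
  shows "(\<Oplus>\<^bsub>k\<^esub>x\<in>\<Omega>. F (x \<bullet> h)) = (\<Oplus>\<^bsub>k\<^esub>x\<in>\<Omega>. F x)"
proof -
  have "(\<lambda>x. x \<bullet> h) ` \<Omega> = \<Omega>"
  proof
    show "\<Omega> \<subseteq> (\<lambda>x. x \<bullet> h) ` \<Omega>"
    proof
      fix x assume "x \<in> \<Omega>"
      then show "x \<in> (\<lambda>x. x \<bullet> h) ` \<Omega>"
        using assms(1) by (intro image_eqI[of _ _ "x \<bullet> inv h"]) auto
    qed
  qed (use assms(1) in auto)
  moreover have "inj_on (\<lambda>x. x \<bullet> h) \<Omega>" using assms(1) by (intro inj_onI) (simp add: dot_cancel)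
  ultimately show ?thesis
    using K.finsum_reindex[of F "\<lambda>x. x \<bullet> h" \<Omega>] assms(2) by (simp add: Pi_iff)
qed

lemma trans_closed [simp]: "\<lbrakk>v \<in> fun_space k \<Omega>; g \<in> carrier G\<rbrakk> \<Longrightarrow> trans v g \<in> fun_space k \<Omega>"
  by (rule fun_spaceI) (simp_all add: trans_apply)

lemma perm_right_module: "right_module k G perm_module"
proof -
  have "abelian_group perm_module"
  proof (rule abelian_groupI)
    show "\<exists>v\<in>carrier perm_module. v \<oplus>\<^bsub>perm_module\<^esub> u = \<zero>\<^bsub>perm_module\<^esub>"
      if "u \<in> carrier perm_module" for u
    proof
      show "(\<lambda>x. \<ominus>\<^bsub>k\<^esub> u x) \<oplus>\<^bsub>perm_module\<^esub> u = \<zero>\<^bsub>perm_module\<^esub>"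
        using that by (simp add: fun_eq_iff K.l_neg)
      show "(\<lambda>x. \<ominus>\<^bsub>k\<^esub> u x) \<in> carrier perm_module"
        using that fun_spaceD(2)[of u k \<Omega>] by (auto intro!: fun_spaceI)
    qed
    show "u \<oplus>\<^bsub>perm_module\<^esub> v \<in> carrier perm_module"
      if "u \<in> carrier perm_module" "v \<in> carrier perm_module" for u v
      using that fun_spaceD(2)[of u k \<Omega>] fun_spaceD(2)[of v k \<Omega>] by (auto intro!: fun_spaceI)
  qed (auto simp: fun_eq_iff K.a_ac intro!: fun_spaceI)
  then have "module k perm_module"
  proof (intro moduleI K.is_cring)
    show "a \<odot>\<^bsub>perm_module\<^esub> v \<in> carrier perm_module"
      if "a \<in> carrier k" "v \<in> carrier perm_module" for a v
      using that fun_spaceD(2)[of v k \<Omega>] by (auto intro!: fun_spaceI)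
  qed (auto simp: K.l_distr K.r_distr K.m_assoc)
  then show ?thesis
  proof (intro right_module.intro right_module_axioms.intro group_axioms)
    show "v \<star>\<^bsub>perm_module\<^esub> \<one> = v" if "v \<in> carrier perm_module" for v
      using that by (intro K.vec_eqI) (auto simp: trans_apply)
    show "v \<star>\<^bsub>perm_module\<^esub> (g \<otimes> h) = v \<star>\<^bsub>perm_module\<^esub> g \<star>\<^bsub>perm_module\<^esub> h"
      if "v \<in> carrier perm_module" "g \<in> carrier G" "h \<in> carrier G" for v g h
      using that by (intro K.vec_eqI) (auto simp: trans_apply inv_mult_group dot_mult)
  qed (auto simp: trans_apply fun_eq_iff)
qed

lemma InvD: "a \<in> Inv H \<Longrightarrow> a \<in> carrier K.Mat"
  by (simp add: Inv_def)

lemma Inv_dot: "\<lbrakk>a \<in> Inv H; h \<in> H; x \<in> \<Omega>; y \<in> \<Omega>\<rbrakk> \<Longrightarrow> a (x \<bullet> h, y \<bullet> h) = a (x, y)"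
  by (simp add: Inv_def)

lemma Inv_mono: "H \<subseteq> H' \<Longrightarrow> Inv H' \<subseteq> Inv H"
  by (auto simp: Inv_def)

lemma Inv_add: "\<lbrakk>a \<in> Inv H; b \<in> Inv H\<rbrakk> \<Longrightarrow> a \<oplus>\<^bsub>K.Mat\<^esub> b \<in> Inv H"
  by (simp add: Inv_def K.Mat_simps)

lemma Inv_zero: "\<zero>\<^bsub>K.Mat\<^esub> \<in> Inv H"
  by (simp add: Inv_def K.Mat_simps)

lemma Inv_smult: "\<lbrakk>c \<in> carrier k; a \<in> Inv H\<rbrakk> \<Longrightarrow> (\<lambda>xy. c \<otimes>\<^bsub>k\<^esub> a xy) \<in> Inv H"
  by (simp add: Inv_def K.Mat_smult_closed)

lemma Mat_minus_eq:
  assumes "a \<in> carrier K.Mat" shows "\<ominus>\<^bsub>K.Mat\<^esub> a = (\<lambda>xy. \<ominus>\<^bsub>k\<^esub> \<one>\<^bsub>k\<^esub> \<otimes>\<^bsub>k\<^esub> a xy)"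
proof (rule K.Mat.minus_equality)
  show "(\<lambda>xy. \<ominus>\<^bsub>k\<^esub> \<one>\<^bsub>k\<^esub> \<otimes>\<^bsub>k\<^esub> a xy) \<oplus>\<^bsub>K.Mat\<^esub> a = \<zero>\<^bsub>K.Mat\<^esub>"
    using assms by (auto simp: fun_eq_iff K.Mat_simps K.l_minus K.l_neg)
qed (use assms in \<open>simp_all add: K.Mat_smult_closed\<close>)

lemma Inv_diff: "\<lbrakk>a \<in> Inv H; b \<in> Inv H\<rbrakk> \<Longrightarrow> a \<ominus>\<^bsub>K.Mat\<^esub> b \<in> Inv H"
  by (simp add: a_minus_def Mat_minus_eq Inv_add Inv_smult InvD)

lemma Inv_mult:
  assumes "H \<subseteq> carrier G" "a \<in> Inv H" "b \<in> Inv H" shows "a \<otimes>\<^bsub>K.Mat\<^esub> b \<in> Inv H"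
proof -
  have "(a \<otimes>\<^bsub>K.Mat\<^esub> b) (x \<bullet> h, y \<bullet> h) = (a \<otimes>\<^bsub>K.Mat\<^esub> b) (x, y)" if "h \<in> H" "x \<in> \<Omega>" "y \<in> \<Omega>" for x y h
  proof -
    have "(a \<otimes>\<^bsub>K.Mat\<^esub> b) (x \<bullet> h, y \<bullet> h) = (\<Oplus>\<^bsub>k\<^esub>z\<in>\<Omega>. a (x \<bullet> h, z \<bullet> h) \<otimes>\<^bsub>k\<^esub> b (z \<bullet> h, y \<bullet> h))"
      unfolding K.Mat_simps using InvD[OF assms(2)] InvD[OF assms(3)] assms(1) that
      by (intro sum_dot[symmetric]) auto
    also have "\<dots> = (a \<otimes>\<^bsub>K.Mat\<^esub> b) (x, y)"
      unfolding K.Mat_simps using assms that InvD[OF assms(2)] InvD[OF assms(3)]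
      by (intro K.finsum_cong') (auto simp: Inv_dot)
    finally show ?thesis .
  qed
  then show ?thesis using assms by (simp add: Inv_def)
qed

lemma Inv_diag:
  assumes "Y \<subseteq> \<Omega>" "H \<subseteq> carrier G" "\<And>x h. \<lbrakk>x \<in> \<Omega>; h \<in> H\<rbrakk> \<Longrightarrow> x \<bullet> h \<in> Y \<longleftrightarrow> x \<in> Y"
  shows "K.diag Y \<in> Inv H"
  using assms K.diag_closed[OF assms(1)]
  by (auto simp: Inv_def K.diag_def dot_cancel subset_iff)

declare InvD [simp]

text \<open>The corner \<open>E\<close> of \<open>e\<close> is closed under products and contains no
  idempotents but zero and \<open>e\<close>, so Fitting's lemma applies with \<open>e\<close> as
  identity. This is the locality of the endomorphism ring of an indecomposable module.\<close>

lemma primitive_fitting: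
  assumes H: "H \<subseteq> carrier G" and e: "primitive H e"
    and a: "a \<in> Inv H" "e \<otimes>\<^bsub>K.Mat\<^esub> a = a" "a \<otimes>\<^bsub>K.Mat\<^esub> e = a"
  shows "(\<exists>n::nat. a [^]\<^bsub>K.Mat\<^esub> n = \<zero>\<^bsub>K.Mat\<^esub>) \<or>
    (\<exists>b\<in>Inv H. e \<otimes>\<^bsub>K.Mat\<^esub> b = b \<and> b \<otimes>\<^bsub>K.Mat\<^esub> e = b \<and> a \<otimes>\<^bsub>K.Mat\<^esub> b = e \<and> b \<otimes>\<^bsub>K.Mat\<^esub> a = e)"
proof -
  define E where "E = {x \<in> Inv H. e \<otimes>\<^bsub>K.Mat\<^esub> x = x \<and> x \<otimes>\<^bsub>K.Mat\<^esub> e = x}"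
  have e': "e \<in> Inv H" "e \<otimes>\<^bsub>K.Mat\<^esub> e = e" using e by (auto simp: primitive_def)
  have eM: "e \<in> carrier K.Mat" using e' by simp
  have 1: "subspace k (\<Omega> \<times> \<Omega>) E"
    unfolding subspace_def
  proof (intro conjI ballI)
    show "E \<subseteq> fun_space k (\<Omega> \<times> \<Omega>)" by (auto simp: E_def K.Mat_def Inv_def)
    show "(\<lambda>_. \<zero>\<^bsub>k\<^esub>) \<in> E"
      using Inv_zero[of H] eM K.Mat.r_null[OF eM] K.Mat.l_null[OF eM] by (simp add: E_def K.Mat_def)
    show "(\<lambda>xy. c \<otimes>\<^bsub>k\<^esub> x xy) \<in> E" if "c \<in> carrier k" "x \<in> E" for c x
      using that eM by (auto simp: E_def Inv_smult K.Mat_smult_mult)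
    show "(\<lambda>xy. x xy \<oplus>\<^bsub>k\<^esub> y xy) \<in> E" if "x \<in> E" "y \<in> E" for x y
    proof -
      have "x \<oplus>\<^bsub>K.Mat\<^esub> y \<in> E" using that eM by (auto simp: E_def Inv_add K.Mat.l_distr K.Mat.r_distr)
      then show ?thesis by (simp add: K.Mat_def)
    qed
  qed
  have "(\<exists>n::nat. a [^]\<^bsub>K.Mat\<^esub> n = \<zero>\<^bsub>K.Mat\<^esub>) \<or> (\<exists>b\<in>E. a \<otimes>\<^bsub>K.Mat\<^esub> b = e \<and> b \<otimes>\<^bsub>K.Mat\<^esub> a = e)"
  proof (rule K.fitting[OF 1])
    show "x \<otimes>\<^bsub>K.Mat\<^esub> y \<in> E" if "x \<in> E" "y \<in> E" for x y
      using that eM by (auto simp: E_def Inv_mult[OF H] K.Mat.m_assoc) (metis InvD K.Mat.m_assoc)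
    show "f = \<zero>\<^bsub>K.Mat\<^esub> \<or> f = e" if "f \<in> E" "f \<otimes>\<^bsub>K.Mat\<^esub> f = f" for f
      using e that by (auto simp: E_def primitive_def)
  qed (use e' a in \<open>auto simp: E_def\<close>)
  then show ?thesis by (auto simp: E_def)
qed

lemma vmult_trans:
  assumes "subgroup H G" "v \<in> fun_space k \<Omega>" "a \<in> Inv H" "h \<in> H"
  shows "K.vmult (trans v h) a = trans (K.vmult v a) h"
proof (rule K.vec_eqI)
  have h: "h \<in> carrier G" using assms subgroup.mem_carrier by metis
  have aM: "a \<in> carrier K.Mat" using assms by simp
  show "K.vmult (trans v h) a \<in> fun_space k \<Omega>" "trans (K.vmult v a) h \<in> fun_space k \<Omega>"
    using assms h by simp_all
  fix y assume y: "y \<in> \<Omega>"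
  have "K.vmult (trans v h) a y = (\<Oplus>\<^bsub>k\<^esub>x\<in>\<Omega>. trans v h (x \<bullet> h) \<otimes>\<^bsub>k\<^esub> a (x \<bullet> h, y))"
    unfolding K.vmult_def using assms(2) aM h by (intro sum_dot[symmetric]) auto
  also have "\<dots> = (\<Oplus>\<^bsub>k\<^esub>x\<in>\<Omega>. v x \<otimes>\<^bsub>k\<^esub> a (x, y \<bullet> inv h))"
    using assms aM h y Inv_dot[OF assms(3,4), of _ "y \<bullet> inv h"]
    by (intro K.finsum_cong') (auto simp: trans_dot)
  also have "\<dots> = trans (K.vmult v a) h y" using y by (simp add: trans_apply K.vmult_def)
  finally show "K.vmult (trans v h) a y = trans (K.vmult v a) h y" .
qed

lemma image_gsubmodule:
  assumes "subgroup H G" "e \<in> Inv H"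
  shows "gsubmodule k (G\<lparr>carrier := H\<rparr>) perm_module (carrier (image e))"
proof -
  interpret W: right_module k "G\<lparr>carrier := H\<rparr>" perm_module
    by (rule right_module.subgroup_module[OF perm_right_module assms(1)])
  interpret H: subgroup H G by fact
  show ?thesis
  proof (rule W.gsubmoduleI)
    show "\<zero>\<^bsub>perm_module\<^esub> \<in> carrier (image e)"
      using K.vmult_smult[of "\<lambda>_. \<zero>\<^bsub>k\<^esub>" "\<zero>\<^bsub>k\<^esub>" e] assms(2) W.kM.M.zero_closed
      by simp
    show "x \<oplus>\<^bsub>perm_module\<^esub> y \<in> carrier (image e)"
      if "x \<in> carrier (image e)" "y \<in> carrier (image e)" for x y
      using that assms(2) W.kM.M.a_closed[of x y] by (simp add: K.vmult_add)
    show "a \<odot>\<^bsub>perm_module\<^esub> x \<in> carrier (image e)"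
      if "a \<in> carrier k" "x \<in> carrier (image e)" for a x
      using that assms(2) W.kM.smult_closed[of a x] by (simp add: K.vmult_smult)
    show "x \<star>\<^bsub>perm_module\<^esub> g \<in> carrier (image e)"
      if "x \<in> carrier (image e)" "g \<in> carrier (G\<lparr>carrier := H\<rparr>)" for x g
      using that assms by (simp add: vmult_trans)
  qed auto
qed

lemma image_right_module:
  assumes "subgroup H G" "e \<in> Inv H" shows "right_module k (G\<lparr>carrier := H\<rparr>) (image e)"
  using right_module.submodule_right_module[OF right_module.subgroup_module[OF perm_right_module assms(1)]
      image_gsubmodule[OF assms]]
  by (simp add: image_def)

section \<open>Direct summands and idempotents\<close>

lemma image_isomorphic:
  assumes H: "subgroup H G" and st: "s \<in> Inv H" "t \<in> Inv H"
    and a: "a \<in> Inv H" "a \<otimes>\<^bsub>K.Mat\<^esub> s = a" and b: "b \<in> Inv H" "b \<otimes>\<^bsub>K.Mat\<^esub> t = b"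
    and ab: "a \<otimes>\<^bsub>K.Mat\<^esub> b = t" "b \<otimes>\<^bsub>K.Mat\<^esub> a = s"
  shows "isomorphic k (G\<lparr>carrier := H\<rparr>) (image t) (image s)"
proof -
  interpret T: right_module k "G\<lparr>carrier := H\<rparr>" "image t" by (rule image_right_module[OF H st(2)])
  interpret S: right_module k "G\<lparr>carrier := H\<rparr>" "image s" by (rule image_right_module[OF H st(1)])
  have "gmodule_hom k (G\<lparr>carrier := H\<rparr>) (image t) (image s) (\<lambda>v. K.vmult v a)"
    using a by (intro gmodule_homI T.right_module_axioms S.right_module_axioms)
      (auto simp: K.vmult_assoc K.vmult_add K.vmult_smult InvD[OF st(1)] vmult_trans[OF H])
  moreover have "bij_betw (\<lambda>v. K.vmult v a) (carrier (image t)) (carrier (image s))"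
    by (rule bij_betw_byWitness[where f' = "\<lambda>v. K.vmult v b"])
      (use a b st ab in \<open>auto simp: K.vmult_assoc\<close>)
  ultimately show ?thesis
    using isomorphic_iff_hom[OF T.right_module_axioms S.right_module_axioms] by blast
qed

text \<open>The map sending \<open>v\<close> to the projection onto \<open>N\<close> of its product
  with \<open>e\<close> is given by a matrix, whose rows are the values at the basis vectors.
  Equivariance of the projection becomes invariance of this matrix.\<close>

lemma summand_imp_idempotent:
  assumes H: "subgroup H G" and e: "e \<in> Inv H" "e \<otimes>\<^bsub>K.Mat\<^esub> e = e"
    and N: "direct_summand k (G\<lparr>carrier := H\<rparr>) (image e) N"
  obtains f where "f \<in> Inv H" "f \<otimes>\<^bsub>K.Mat\<^esub> f = f" "e \<otimes>\<^bsub>K.Mat\<^esub> f = f" "f \<otimes>\<^bsub>K.Mat\<^esub> e = f"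
    "N = carrier (image f)"
proof -
  let ?H = "G\<lparr>carrier := H\<rparr>"
  interpret H: subgroup H G by fact
  interpret W: right_module k ?H "image e" by (rule image_right_module[OF H e(1)])
  have eM: "e \<in> carrier K.Mat" using e by simp
  obtain N' where N': "gsubmodule k ?H (image e) N" "gsubmodule k ?H (image e) N'"
    "N \<inter> N' = {\<zero>\<^bsub>image e\<^esub>}" "N <+>\<^bsub>image e\<^esub> N' = carrier (image e)"
    using N unfolding direct_summand_def by blast
  obtain \<pi> where \<pi>h: "gmodule_hom k ?H (image e) (image e\<lparr>carrier := N\<rparr>) \<pi>"
    and \<pi>N: "\<And>x. x \<in> N \<Longrightarrow> \<pi> x = x"
    using W.direct_summand_projection[OF N'] by metis
  interpret \<pi>: gmodule_hom k ?H "image e" "image e\<lparr>carrier := N\<rparr>" \<pi> by fact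
  have N_sub: "v \<in> fun_space k \<Omega>" "K.vmult v e = v" if "v \<in> N" for v
    using W.gsubmoduleD(1)[OF N'(1)] that by auto
  have ve: "K.vmult v e \<in> carrier (image e)" if "v \<in> fun_space k \<Omega>" for v
    using that eM e(2) by (simp add: K.vmult_assoc)
  have \<pi>v: "\<pi> (K.vmult v e) \<in> N" if "v \<in> fun_space k \<Omega>" for v
    using \<pi>.f_closed[OF ve[OF that]] by simp
  define f where "f = (\<lambda>(x, y). if x \<in> \<Omega> then \<pi> (K.vmult (K.delta x) e) y else \<zero>\<^bsub>k\<^esub>)"
  have fM: "f \<in> carrier K.Mat"
  proof (rule K.MatI)
    show "f (x, y) \<in> carrier k" if "x \<in> \<Omega>" "y \<in> \<Omega>" for x y
      using that N_sub(1)[OF \<pi>v[OF K.delta_closed[OF that(1)]]] by (simp add: f_def)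
    show "f (x, y) = \<zero>\<^bsub>k\<^esub>" if "x \<notin> \<Omega> \<or> y \<notin> \<Omega>" for x y
      using that fun_spaceD(2)[OF N_sub(1)[OF \<pi>v[OF K.delta_closed]], of x y]
      by (cases "x \<in> \<Omega>") (auto simp: f_def)
  qed
  have vf: "K.vmult v f = \<pi> (K.vmult v e)" if v: "v \<in> fun_space k \<Omega>" for v
  proof
    fix y
    let ?F = "\<lambda>x. v x \<odot>\<^bsub>image e\<^esub> K.vmult (K.delta x) e"
    have F: "?F x \<in> carrier (image e)" if "x \<in> \<Omega>" for x
      using W.kM.smult_closed[OF K.vecD[OF v, of x] ve[OF K.delta_closed[OF that]]] .
    \<comment> \<open>The projection is defined on the image of \<open>e\<close> only, so the
      expansion in basis vectors has to take place after multiplication by \<open>e\<close>.\<close>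
    have "K.vmult v e = finsum (image e) ?F \<Omega>"
    proof
      fix z
      have "finsum (image e) ?F \<Omega> z = (\<Oplus>\<^bsub>k\<^esub>x\<in>\<Omega>. ?F x z)"
        using F v by (intro finsum_pointwise W.kM.M.abelian_monoid_axioms K.abelian_monoid_axioms
            K.finite_index) (auto simp: eM)
      also have "\<dots> = K.vmult v e z"
        unfolding K.vmult_def[of v] using v eM by (intro K.finsum_cong') (auto simp: K.vmult_delta)
      finally show "K.vmult v e z = finsum (image e) ?F \<Omega> z" ..
    qed
    then have "\<pi> (K.vmult v e) y = (finsum (image e\<lparr>carrier := N\<rparr>) (\<lambda>x. \<pi> (?F x)) \<Omega>) y"
      using \<pi>.f_finsum[OF K.finite_index, of ?F] F by simp
    also have "\<dots> = (\<Oplus>\<^bsub>k\<^esub>x\<in>\<Omega>. \<pi> (?F x) y)"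
      using \<pi>.f_closed[OF F] N_sub(1)
      by (intro finsum_pointwise \<pi>.N.kM.M.abelian_monoid_axioms K.abelian_monoid_axioms K.finite_index)
        (auto simp del: image_simps(4) intro: fun_spaceD(1))
    also have "\<dots> = K.vmult v f y"
    proof -
      have "\<pi> (?F x) y = v x \<otimes>\<^bsub>k\<^esub> f (x, y)" if "x \<in> \<Omega>" for x
        using \<pi>.f_smult[OF K.vecD[OF v] ve[OF K.delta_closed[OF that]]] that
        by (simp add: f_def)
      then show ?thesis
        unfolding K.vmult_def[of v f] using v fM by (intro K.finsum_cong') (auto simp del: image_simps(4))
    qed
    finally show "K.vmult v f y = \<pi> (K.vmult v e) y" ..
  qed
  have "f \<in> Inv H"
  proof -
    have "f (x \<bullet> h, y \<bullet> h) = f (x, y)" if "h \<in> H" "x \<in> \<Omega>" "y \<in> \<Omega>" for h x y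
    proof -
      have hG: "h \<in> carrier G" using that by simp
      have "K.delta (x \<bullet> h) = trans (K.delta x) h"
        using that hG
        by (intro K.vec_eqI trans_closed K.delta_closed)
          (auto simp: trans_apply K.delta_def dot_inv_eq_iff eq_commute[of x])
      then have "K.vmult (K.delta (x \<bullet> h)) e = trans (K.vmult (K.delta x) e) h"
        using that e(1) by (simp add: vmult_trans[OF H])
      then have "\<pi> (K.vmult (K.delta (x \<bullet> h)) e) = trans (\<pi> (K.vmult (K.delta x) e)) h"
        using \<pi>.f_act[OF ve[OF K.delta_closed[OF that(2)]], of h] that by simp
      then show ?thesis using that hG by (simp add: f_def trans_dot)
    qed
    then show ?thesis using fM by (simp add: Inv_def del: InvD)
  qed
  moreover have "f \<otimes>\<^bsub>K.Mat\<^esub> f = f"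
    using fM by (intro K.Mat_eq_vmultI)
      (auto simp: vf N_sub \<pi>v \<pi>N simp flip: K.vmult_assoc)
  moreover have "e \<otimes>\<^bsub>K.Mat\<^esub> f = f"
    using fM eM ve by (intro K.Mat_eq_vmultI) (auto simp: vf simp flip: K.vmult_assoc)
  moreover have "f \<otimes>\<^bsub>K.Mat\<^esub> e = f"
    using fM eM by (intro K.Mat_eq_vmultI) (auto simp: vf N_sub \<pi>v simp flip: K.vmult_assoc)
  moreover have "N = carrier (image f)"
  proof (intro Set.set_eqI iffI)
    fix v assume v: "v \<in> N"
    then show "v \<in> carrier (image f)" using N_sub[OF v] by (simp add: vf \<pi>N)
  next
    fix v assume "v \<in> carrier (image f)"
    then show "v \<in> N" using \<pi>v[of v] by (auto simp: vf)
  qed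
  ultimately show ?thesis by (rule that)
qed

text \<open>The complement is the image of the idempotent $e - f$.\<close>

lemma idempotent_imp_summand:
  assumes H: "subgroup H G" and e: "e \<in> Inv H" "e \<otimes>\<^bsub>K.Mat\<^esub> e = e"
    and f: "f \<in> Inv H" "f \<otimes>\<^bsub>K.Mat\<^esub> f = f" "e \<otimes>\<^bsub>K.Mat\<^esub> f = f" "f \<otimes>\<^bsub>K.Mat\<^esub> e = f"
  shows "direct_summand k (G\<lparr>carrier := H\<rparr>) (image e) (carrier (image f))"
proof -
  let ?H = "G\<lparr>carrier := H\<rparr>"
  interpret P: right_module k ?H perm_module
    by (rule right_module.subgroup_module[OF perm_right_module H])
  have eM: "e \<in> carrier K.Mat" and fM: "f \<in> carrier K.Mat" using e f by auto
  note eg = image_gsubmodule[OF H e(1)]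
  have sub: "gsubmodule k ?H (image e) (carrier (image x))" if x: "x \<in> Inv H" "x \<otimes>\<^bsub>K.Mat\<^esub> e = x" for x
  proof -
    have "carrier (image x) \<subseteq> carrier (image e)"
    proof
      fix v assume "v \<in> carrier (image x)"
      then have v: "v \<in> fun_space k \<Omega>" "K.vmult v x = v" by auto
      have "K.vmult v e = K.vmult (K.vmult v x) e" using v by simp
      also have "\<dots> = K.vmult v (x \<otimes>\<^bsub>K.Mat\<^esub> e)" using v(1) InvD[OF x(1)] eM by (rule K.vmult_assoc)
      also have "\<dots> = v" using v x(2) by simp
      finally show "v \<in> carrier (image e)" using v by simp
    qed
    then show ?thesis
      using image_gsubmodule[OF H x(1)] P.gsubmodule_submodule_iff[OF eg] by (simp add: image_def)
  qed
  define d where "d = e \<ominus>\<^bsub>K.Mat\<^esub> f"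
  have d: "d \<in> Inv H" using e f by (simp add: d_def Inv_diff)
    have de: "d \<otimes>\<^bsub>K.Mat\<^esub> e = d" "d \<otimes>\<^bsub>K.Mat\<^esub> f = \<zero>\<^bsub>K.Mat\<^esub>"
      using eM fM e f by (simp_all add: d_def a_minus_def K.Mat.l_distr K.Mat.l_minus K.Mat.r_neg)
    have edf: "e = d \<oplus>\<^bsub>K.Mat\<^esub> f" using eM fM by (simp add: d_def a_minus_def K.Mat.a_assoc K.Mat.l_neg)
    note subf = sub[OF f(1,4)] and subd = sub[OF d de(1)]
    interpret E: right_module k ?H "image e" by (rule image_right_module[OF H e(1)])
    have "v = (\<lambda>_. \<zero>\<^bsub>k\<^esub>)" if v: "v \<in> carrier (image f) \<inter> carrier (image d)" for v
    proof -
      have "v = K.vmult (K.vmult v d) f" using v by auto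
      also have "\<dots> = K.vmult v (d \<otimes>\<^bsub>K.Mat\<^esub> f)"
        using v InvD[OF d] fM by (intro K.vmult_assoc) auto
      also have "\<dots> = K.vmult v \<zero>\<^bsub>K.Mat\<^esub>" by (simp add: de)
      finally show ?thesis using v by (auto simp: K.vmult_def K.Mat_simps)
    qed
    then have "carrier (image f) \<inter> carrier (image d) = {\<zero>\<^bsub>image e\<^esub>}"
      using E.gsubmoduleD(2)[OF subf] E.gsubmoduleD(2)[OF subd] by auto
    moreover have "carrier (image f) <+>\<^bsub>image e\<^esub> carrier (image d) = carrier (image e)"
    proof
      show "carrier (image f) <+>\<^bsub>image e\<^esub> carrier (image d) \<subseteq> carrier (image e)"
        using E.gsubmodule_sum[OF subf subd] by (rule E.gsubmoduleD)
      show "carrier (image e) \<subseteq> carrier (image f) <+>\<^bsub>image e\<^esub> carrier (image d)"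
      proof
        fix v assume "v \<in> carrier (image e)"
        then have v: "v \<in> fun_space k \<Omega>" "K.vmult v e = v" by auto
        have dd: "d \<otimes>\<^bsub>K.Mat\<^esub> d = d"
          using de d eM fM by (subst (2) d_def) (simp add: a_minus_def K.Mat.r_distr K.Mat.r_minus)
        show "v \<in> carrier (image f) <+>\<^bsub>image e\<^esub> carrier (image d)"
        proof (rule E.mem_sumI)
          show "K.vmult v f \<in> carrier (image f)" "K.vmult v d \<in> carrier (image d)"
            using v f d dd by (auto simp: K.vmult_assoc)
          have "v = K.vmult v (f \<oplus>\<^bsub>K.Mat\<^esub> d)" using v edf fM d by (simp add: K.Mat.a_comm)
          then show "v = K.vmult v f \<oplus>\<^bsub>image e\<^esub> K.vmult v d"
            using v fM d by (simp add: K.vmult_add_right)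
        qed
      qed
    qed
    ultimately show ?thesis unfolding direct_summand_def using subf subd by blast
qed

lemma vmult_zero: "K.vmult v \<zero>\<^bsub>K.Mat\<^esub> = (\<lambda>_. \<zero>\<^bsub>k\<^esub>)" if "v \<in> fun_space k \<Omega>"
  using that by (simp add: K.vmult_def K.Mat_simps fun_eq_iff)

lemma image_zero_iff:
  assumes "a \<in> carrier K.Mat" "a \<otimes>\<^bsub>K.Mat\<^esub> a = a"
  shows "carrier (image a) = {\<lambda>_. \<zero>\<^bsub>k\<^esub>} \<longleftrightarrow> a = \<zero>\<^bsub>K.Mat\<^esub>"
proof
  assume a: "carrier (image a) = {\<lambda>_. \<zero>\<^bsub>k\<^esub>}"
  show "a = \<zero>\<^bsub>K.Mat\<^esub>"
  proof (rule K.Mat_eq_vmultI)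
    fix v assume v: "v \<in> fun_space k \<Omega>"
    then have "K.vmult v a \<in> carrier (image a)" using assms by (simp add: K.vmult_assoc)
    then have "K.vmult v a = (\<lambda>_. \<zero>\<^bsub>k\<^esub>)" using a by blast
    then show "K.vmult v a = K.vmult v \<zero>\<^bsub>K.Mat\<^esub>" using v by (simp add: vmult_zero)
  qed (use assms in simp_all)
next
  assume a0: "a = \<zero>\<^bsub>K.Mat\<^esub>"
  have *: "K.vmult v a = (\<lambda>_. \<zero>\<^bsub>k\<^esub>)" if "v \<in> fun_space k \<Omega>" for v
    unfolding a0 by (rule vmult_zero[OF that])
  have z: "(\<lambda>_. \<zero>\<^bsub>k\<^esub>) \<in> fun_space k \<Omega>" by (intro fun_spaceI K.zero_closed refl)
  show "carrier (image a) = {\<lambda>_. \<zero>\<^bsub>k\<^esub>}"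
  proof (rule subset_antisym; rule subsetI)
    fix v assume "v \<in> carrier (image a)"
    then have "v \<in> fun_space k \<Omega>" "K.vmult v a = v" by simp_all
    then show "v \<in> {\<lambda>_. \<zero>\<^bsub>k\<^esub>}" using *[of v] by simp
  next
    fix v :: "'x \<Rightarrow> 'k" assume "v \<in> {\<lambda>_. \<zero>\<^bsub>k\<^esub>}"
    then show "v \<in> carrier (image a)" using z *[OF z] by simp
  qed
qed

lemma image_eq_imp:
  assumes e: "e \<in> carrier K.Mat" "e \<otimes>\<^bsub>K.Mat\<^esub> e = e" and f: "f \<in> carrier K.Mat" "e \<otimes>\<^bsub>K.Mat\<^esub> f = f"
    and eq: "carrier (image e) \<subseteq> carrier (image f)"
  shows "f = e"
proof -
  have "e \<otimes>\<^bsub>K.Mat\<^esub> f = e"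
  proof (rule K.Mat_eq_vmultI)
    fix v assume v: "v \<in> fun_space k \<Omega>"
    then have "K.vmult v e \<in> carrier (image e)" using e by (simp add: K.vmult_assoc)
    then have "K.vmult v e \<in> carrier (image f)" using eq by blast
    then show "K.vmult v (e \<otimes>\<^bsub>K.Mat\<^esub> f) = K.vmult v e" using v e(1) f(1) by (simp add: K.vmult_assoc)
  qed (use e f in simp_all)
  then show ?thesis using f by simp
qed

lemma indecomposable_image_iff:
  assumes H: "subgroup H G" and e: "e \<in> Inv H" "e \<otimes>\<^bsub>K.Mat\<^esub> e = e"
  shows "indecomposable k (G\<lparr>carrier := H\<rparr>) (image e) \<longleftrightarrow> primitive H e"
proof -
  have eM: "e \<in> carrier K.Mat" using e by simp
  have z: "zero_module (image e) \<longleftrightarrow> e = \<zero>\<^bsub>K.Mat\<^esub>"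
    using image_zero_iff[OF eM e(2)] by (simp add: zero_module_def)
  show ?thesis
  proof
    assume ind: "indecomposable k (G\<lparr>carrier := H\<rparr>) (image e)"
    have "f = \<zero>\<^bsub>K.Mat\<^esub> \<or> f = e"
      if f: "f \<in> Inv H" "f \<otimes>\<^bsub>K.Mat\<^esub> f = f" "e \<otimes>\<^bsub>K.Mat\<^esub> f = f" "f \<otimes>\<^bsub>K.Mat\<^esub> e = f" for f
    proof -
      have "carrier (image f) = {\<zero>\<^bsub>image e\<^esub>} \<or> carrier (image f) = carrier (image e)"
        using ind idempotent_imp_summand[OF H e f] unfolding indecomposable_def by blast
      then show ?thesis
      proof
        assume "carrier (image f) = {\<zero>\<^bsub>image e\<^esub>}"
        then show ?thesis using image_zero_iff[OF InvD[OF f(1)] f(2)] by simp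
      next
        assume "carrier (image f) = carrier (image e)"
        then show ?thesis using image_eq_imp[OF eM e(2) InvD[OF f(1)] f(3)] by blast
      qed
    qed
    then show "primitive H e" using ind e z by (auto simp: primitive_def indecomposable_def)
  next
    assume p: "primitive H e"
    have "N = {\<zero>\<^bsub>image e\<^esub>} \<or> N = carrier (image e)"
      if N: "direct_summand k (G\<lparr>carrier := H\<rparr>) (image e) N" for N
    proof -
      obtain f where f: "f \<in> Inv H" "f \<otimes>\<^bsub>K.Mat\<^esub> f = f" "e \<otimes>\<^bsub>K.Mat\<^esub> f = f" "f \<otimes>\<^bsub>K.Mat\<^esub> e = f"
        "N = carrier (image f)" using summand_imp_idempotent[OF H e N] by blast
      then have "f = \<zero>\<^bsub>K.Mat\<^esub> \<or> f = e" using p by (simp add: primitive_def)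
      then show ?thesis using f image_zero_iff[OF InvD[OF f(1)] f(2)] by auto
    qed
    then show "indecomposable k (G\<lparr>carrier := H\<rparr>) (image e)"
      using p z by (auto simp: indecomposable_def primitive_def)
  qed
qed

end

section \<open>The Brauer construction of a permutation module\<close>

locale p_action = finite_action G \<Omega> dot k
  for G (structure) and \<Omega> :: "'x set" and dot :: "'x \<Rightarrow> 'a \<Rightarrow> 'x" (infixl \<open>\<bullet>\<close> 70)
    and k :: "('k, 'r) ring_scheme" +
  fixes p :: nat
  assumes prime_p: "Factorial_Ring.prime p" and finite_G: "finite (carrier G)"
    and char_p: "\<And>a. a \<in> carrier k \<Longrightarrow> [p] \<cdot>\<^bsub>k\<^esub> a = \<zero>\<^bsub>k\<^esub>"
begin

section \<open>Restriction of matrices to the fixed points of a \<open>p\<close>-subgroup\<close>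

lemma fixed_subset: "fixed Q \<subseteq> \<Omega>" by (auto simp: fixed_def)

lemma p_sum_fixed:
  assumes "p_subgroup p G Q" "\<And>x. x \<in> \<Omega> \<Longrightarrow> F x \<in> carrier k"
    and "\<And>x q. \<lbrakk>x \<in> \<Omega>; q \<in> Q\<rbrakk> \<Longrightarrow> F (x \<bullet> q) = F x"
  shows "(\<Oplus>\<^bsub>k\<^esub>x\<in>\<Omega>. F x) = (\<Oplus>\<^bsub>k\<^esub>x\<in>fixed Q. F x)"
proof -
  obtain n where n: "subgroup Q G" "card Q = p ^ n" using assms(1) by (auto simp: p_subgroup_def)
  interpret Q: right_action "G\<lparr>carrier := Q\<rparr>" \<Omega> dot using n(1) by (rule subgroup_action)
  show ?thesis
    using Q.p_group_sum_fixed[OF prime_p _ K.finite_index K.abelian_group_axioms char_p, of n F]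
      assms(2,3) n(2) by (simp add: order_def)
qed

lemma fixed_dot_iff:
  assumes "x \<in> \<Omega>" "g \<in> carrier G" "Q \<subseteq> carrier G"
  shows "x \<bullet> g \<in> fixed (conj_by G g ` Q) \<longleftrightarrow> x \<in> fixed Q"
proof -
  have "x \<bullet> g \<bullet> conj_by G g q = x \<bullet> g \<longleftrightarrow> x \<bullet> q = x" if "q \<in> Q" for q
  proof -
    have q: "q \<in> carrier G" using that assms by blast
    have "x \<bullet> g \<bullet> conj_by G g q = x \<bullet> (g \<otimes> conj_by G g q)" using assms q by (simp add: dot_mult)
    also have "g \<otimes> conj_by G g q = q \<otimes> g"
      using assms q by (simp add: conj_by_def m_assoc[symmetric])
    finally show ?thesis using assms q by (simp add: dot_mult dot_cancel)
  qed
  then show ?thesis using assms by (auto simp: fixed_def)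
qed

lemma fixed_normalizer:
  assumes "Q \<subseteq> carrier G" "x \<in> \<Omega>" "n \<in> normalizer G Q"
  shows "x \<bullet> n \<in> fixed Q \<longleftrightarrow> x \<in> fixed Q"
  using fixed_dot_iff[OF assms(2) normalizerD(1)[OF assms(3,1)] assms(1)] normalizerD(2)[OF assms(3,1)]
  by simp

text \<open>The Brauer homomorphism in terms of the permutation basis. Padding with zeros keeps the
  values in the full matrix ring, where those for different subgroups can be multiplied and
  compared.\<close>

definition br :: "'a set \<Rightarrow> ('x \<times> 'x \<Rightarrow> 'k) \<Rightarrow> 'x \<times> 'x \<Rightarrow> 'k" where
  "br Q a = (\<lambda>(x, y). if x \<in> fixed Q \<and> y \<in> fixed Q then a (x, y) else \<zero>\<^bsub>k\<^esub>)"

lemma br_closed [simp]: "a \<in> carrier K.Mat \<Longrightarrow> br Q a \<in> carrier K.Mat"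
  by (rule K.MatI) (auto simp: br_def fixed_def)

text \<open>For fixed points \<open>x\<close> and \<open>y\<close>, the terms of the entry of the
  product at \<open>(x, y)\<close> are invariant under \<open>Q\<close> in the summation index, so
  only the fixed indices contribute modulo \<open>p\<close>.\<close>

lemma br_mult:
  assumes Q: "p_subgroup p G Q" and a: "a \<in> Inv Q" and b: "b \<in> Inv Q"
  shows "br Q (a \<otimes>\<^bsub>K.Mat\<^esub> b) = br Q a \<otimes>\<^bsub>K.Mat\<^esub> br Q b"
proof (rule K.Mat_eqI)
  have aM: "a \<in> carrier K.Mat" and bM: "b \<in> carrier K.Mat" using a b by (auto dest: InvD)
  show "br Q (a \<otimes>\<^bsub>K.Mat\<^esub> b) \<in> carrier K.Mat" "br Q a \<otimes>\<^bsub>K.Mat\<^esub> br Q b \<in> carrier K.Mat"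
    using aM bM by simp_all
  fix x y assume xy: "x \<in> \<Omega>" "y \<in> \<Omega>"
  show "br Q (a \<otimes>\<^bsub>K.Mat\<^esub> b) (x, y) = (br Q a \<otimes>\<^bsub>K.Mat\<^esub> br Q b) (x, y)"
  proof (cases "x \<in> fixed Q \<and> y \<in> fixed Q")
    case True
    have fixd: "x \<bullet> q = x" "y \<bullet> q = y" if "q \<in> Q" for q using True that by (auto simp: fixed_def)
    have "(a \<otimes>\<^bsub>K.Mat\<^esub> b) (x, y) = (\<Oplus>\<^bsub>k\<^esub>z\<in>fixed Q. a (x, z) \<otimes>\<^bsub>k\<^esub> b (z, y))"
      unfolding K.Mat_simps
    proof (rule p_sum_fixed[OF Q])
      show "a (x, z \<bullet> q) \<otimes>\<^bsub>k\<^esub> b (z \<bullet> q, y) = a (x, z) \<otimes>\<^bsub>k\<^esub> b (z, y)"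
        if "z \<in> \<Omega>" "q \<in> Q" for z q
        using Inv_dot[OF a that(2) xy(1) that(1)] Inv_dot[OF b that(2) that(1) xy(2)]
          fixd[OF that(2)] by simp
    qed (use aM bM in auto)
    also have "\<dots> = (\<Oplus>\<^bsub>k\<^esub>z\<in>\<Omega>. br Q a (x, z) \<otimes>\<^bsub>k\<^esub> br Q b (z, y))"
      using True aM bM K.finite_index fixed_subset
      by (intro K.add.finprod_mono_neutral_cong_left) (auto simp: br_def)
    finally show ?thesis using True by (simp add: br_def K.Mat_simps)
  next
    case False
    have "(br Q a \<otimes>\<^bsub>K.Mat\<^esub> br Q b) (x, y) = (\<Oplus>\<^bsub>k\<^esub>z\<in>\<Omega>. \<zero>\<^bsub>k\<^esub>)"
      unfolding K.Mat_simps using False aM bM by (intro K.finsum_cong') (auto simp: br_def)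
    moreover have "br Q (a \<otimes>\<^bsub>K.Mat\<^esub> b) (x, y) = \<zero>\<^bsub>k\<^esub>" using False by (auto simp: br_def)
    ultimately show ?thesis by simp
  qed
qed

lemma br_br:
  assumes "fixed L \<subseteq> fixed Q" shows "br L (br Q a) = br L a"
  using assms by (auto simp: br_def fun_eq_iff subset_iff)

lemma br_add:
  "br Q (a \<oplus>\<^bsub>K.Mat\<^esub> b) = br Q a \<oplus>\<^bsub>K.Mat\<^esub> br Q b"
  by (auto simp: br_def fun_eq_iff K.Mat_simps)

lemma br_zero [simp]: "br Q \<zero>\<^bsub>K.Mat\<^esub> = \<zero>\<^bsub>K.Mat\<^esub>"
  by (auto simp: br_def fun_eq_iff K.Mat_simps)

lemma br_Inv:
  assumes "a \<in> Inv H" "Q \<subseteq> carrier G" "H \<subseteq> normalizer G Q"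
  shows "br Q a \<in> Inv H"
proof -
  have "br Q a (x \<bullet> h, y \<bullet> h) = br Q a (x, y)" if "h \<in> H" "x \<in> \<Omega>" "y \<in> \<Omega>" for x y h
    using that assms fixed_normalizer[OF assms(2), of _ h] Inv_dot[OF assms(1)]
    by (auto simp: br_def)
  then show ?thesis using assms(1) unfolding Inv_def by simp
qed

text \<open>The same cancellation within a single row: the entries in fixed columns already add up
  to the full row sum.\<close>

lemma br_nonzero:
  assumes L: "p_subgroup p G L" and a: "a \<in> Inv L" and x: "x \<in> fixed L"
    and row: "(\<Oplus>\<^bsub>k\<^esub>y\<in>\<Omega>. a (x, y)) \<noteq> \<zero>\<^bsub>k\<^esub>"
  shows "br L a \<noteq> \<zero>\<^bsub>K.Mat\<^esub>"
proof
  assume z: "br L a = \<zero>\<^bsub>K.Mat\<^esub>"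
  have x\<Omega>: "x \<in> \<Omega>" using x by (simp add: fixed_def)
  have "(\<Oplus>\<^bsub>k\<^esub>y\<in>\<Omega>. a (x, y)) = (\<Oplus>\<^bsub>k\<^esub>y\<in>fixed L. a (x, y))"
  proof (rule p_sum_fixed[OF L])
    show "a (x, y \<bullet> q) = a (x, y)" if "y \<in> \<Omega>" "q \<in> L" for y q
      using Inv_dot[OF a that(2) x\<Omega> that(1)] x that by (simp add: fixed_def)
  qed (use InvD[OF a] in simp)
  also have "\<dots> = (\<Oplus>\<^bsub>k\<^esub>y\<in>fixed L. \<zero>\<^bsub>k\<^esub>)"
  proof (rule K.finsum_cong')
    show "a (x, y) = \<zero>\<^bsub>k\<^esub>" if "y \<in> fixed L" for y
      using fun_cong[OF z, of "(x, y)"] x that by (simp add: br_def K.Mat_simps)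
  qed auto
  finally show False using row by simp
qed

text \<open>On vectors fixed by \<open>Q\<close>, restriction to the fixed points turns
  multiplication by \<open>a\<close> into multiplication by \<open>br Q a\<close>. Hence restriction
  maps the fixed vectors in the image of an idempotent \<open>a\<close> to the image of
  \<open>br Q a\<close>.\<close>

lemma vmult_br:
  assumes Q: "p_subgroup p G Q" and a: "a \<in> Inv Q" and v: "v \<in> fun_space k \<Omega>"
    and inv: "\<And>x q. \<lbrakk>x \<in> \<Omega>; q \<in> Q\<rbrakk> \<Longrightarrow> v (x \<bullet> q) = v x"
  shows "K.vmult (K.vmult v a) (K.diag (fixed Q)) = K.vmult v (br Q a)"
    and "K.vmult (K.vmult v (K.diag (fixed Q))) (br Q a) = K.vmult v (br Q a)"
proof -
  have aM: "a \<in> carrier K.Mat" using a by (rule InvD)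
  have *: "K.vmult v (br Q a) y = (if y \<in> fixed Q then \<Oplus>\<^bsub>k\<^esub>x\<in>fixed Q. v x \<otimes>\<^bsub>k\<^esub> a (x, y) else \<zero>\<^bsub>k\<^esub>)" for y
  proof (cases "y \<in> fixed Q")
    case True
    have "(\<Oplus>\<^bsub>k\<^esub>x\<in>fixed Q. v x \<otimes>\<^bsub>k\<^esub> a (x, y)) = (\<Oplus>\<^bsub>k\<^esub>x\<in>\<Omega>. v x \<otimes>\<^bsub>k\<^esub> br Q a (x, y))"
      using True aM v K.finite_index fixed_subset
      by (intro K.add.finprod_mono_neutral_cong_left) (auto simp: br_def)
    then show ?thesis using True by (simp add: K.vmult_def)
  next
    case False
    have "K.vmult v (br Q a) y = (\<Oplus>\<^bsub>k\<^esub>x\<in>\<Omega>. \<zero>\<^bsub>k\<^esub>)"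
      unfolding K.vmult_def using False aM v by (intro K.finsum_cong') (auto simp: br_def)
    then show ?thesis using False by simp
  qed
  show "K.vmult (K.vmult v a) (K.diag (fixed Q)) = K.vmult v (br Q a)"
  proof
    fix y
    have "K.vmult v a y = (\<Oplus>\<^bsub>k\<^esub>x\<in>fixed Q. v x \<otimes>\<^bsub>k\<^esub> a (x, y))" if y: "y \<in> fixed Q"
      unfolding K.vmult_def
    proof (rule p_sum_fixed[OF Q])
      show "v (x \<bullet> q) \<otimes>\<^bsub>k\<^esub> a (x \<bullet> q, y) = v x \<otimes>\<^bsub>k\<^esub> a (x, y)" if "x \<in> \<Omega>" "q \<in> Q" for x q
        using Inv_dot[OF a that(2) that(1), of y] y that by (simp add: fixed_def inv)
    qed (use aM v in auto)
    then show "K.vmult (K.vmult v a) (K.diag (fixed Q)) y = K.vmult v (br Q a) y"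
      using v aM fixed_subset by (simp add: K.vmult_diag *)
  qed
  have "K.diag (fixed Q) \<otimes>\<^bsub>K.Mat\<^esub> br Q a = br Q a"
    using aM fixed_subset K.diag_mult(1)[OF br_closed[OF aM] fixed_subset]
    by (intro K.Mat_eqI) (simp_all, simp add: br_def)
  then show "K.vmult (K.vmult v (K.diag (fixed Q))) (br Q a) = K.vmult v (br Q a)"
    using v aM fixed_subset by (simp add: K.vmult_assoc)
qed

section \<open>Identification of the Brauer construction\<close>

lemma image_incl_hom:
  assumes "right_module k (G\<lparr>carrier := H\<rparr>) M" "subgroup H G" "e \<in> Inv H"
    and f: "gmodule_hom k (G\<lparr>carrier := H\<rparr>) M (image e) f"
  shows "gmodule_hom k (G\<lparr>carrier := H\<rparr>) M perm_module f"
proof -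
  interpret f: gmodule_hom k "G\<lparr>carrier := H\<rparr>" M "image e" f by fact
  show ?thesis
    using f.f_closed f.f_add f.f_smult f.f_act
    by (intro gmodule_homI assms(1) right_module.subgroup_module[OF perm_right_module assms(2)]) simp_all
qed

text \<open>The vector is constant on \<open>Q\<close>-orbits, and an orbit contributes the trace,
  from the stabilizer of a representative, of the vector concentrated there. Sorting the
  representatives by stabilizer gives one trace for each subgroup, as \<open>trace_sum\<close>
  requires; the stabilizer \<open>Q\<close> does not occur because \<open>v\<close> vanishes at the
  fixed points.\<close>

lemma sum_of_traces:
  assumes Q: "subgroup Q G" and v: "v \<in> fun_space k \<Omega>"
    and inv: "\<And>x q. \<lbrakk>x \<in> \<Omega>; q \<in> Q\<rbrakk> \<Longrightarrow> v (x \<bullet> q) = v x"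
    and zero: "\<And>x. x \<in> fixed Q \<Longrightarrow> v x = \<zero>\<^bsub>k\<^esub>"
  obtains u where "\<And>R. u R \<in> fun_space k \<Omega>"
    and "\<And>R r. \<lbrakk>R \<in> proper_subgroups G Q; r \<in> R\<rbrakk> \<Longrightarrow> trans (u R) r = u R"
    and "v = (\<Oplus>\<^bsub>perm_module\<^esub>R\<in>proper_subgroups G Q. relative_trace G perm_module R Q (u R))"
proof -
  interpret P: right_module k G perm_module by (rule perm_right_module)
  interpret Q: subgroup Q G by fact
  interpret GQ: group "G\<lparr>carrier := Q\<rparr>" using Q by (rule subgroup_imp_group)
  have finQ: "finite Q" using finite_G Q.subset by (rule rev_finite_subset)
  define orb where "orb x = (\<lambda>q. x \<bullet> q) ` Q" for x
  \<comment> \<open>The choice depends only on the orbit as a set, so all points of an orbit share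
    the same representative.\<close>
  define \<rho> where "\<rho> x = (SOME y. y \<in> orb x)" for x
  have orb_dot: "orb (x \<bullet> q) = orb x" if x: "x \<in> \<Omega>" "q \<in> Q" for x q
  proof -
    have "x \<bullet> q \<bullet> r \<in> orb x" if "r \<in> Q" for r
      using that x by (auto simp: orb_def simp flip: dot_mult)
    moreover have "x \<bullet> r \<in> orb (x \<bullet> q)" if r: "r \<in> Q" for r
    proof -
      have "x \<bullet> r = x \<bullet> q \<bullet> (inv q \<otimes> r)" using x r by (simp add: dot_mult)
      then show ?thesis using x r by (auto simp: orb_def)
    qed
    ultimately show ?thesis by (auto simp: orb_def)
  qed
  have \<rho>_dot: "\<rho> (x \<bullet> q) = \<rho> x" if "x \<in> \<Omega>" "q \<in> Q" for x q
    using orb_dot[OF that] by (simp add: \<rho>_def)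
  have \<rho>_orb: "\<exists>q\<in>Q. \<rho> x = x \<bullet> q" for x
  proof -
    have "x \<bullet> \<one> \<in> orb x" unfolding orb_def using Q.one_closed by (rule imageI)
    then have "\<exists>y. y \<in> orb x" ..
    then have "\<rho> x \<in> orb x" unfolding \<rho>_def by (rule someI_ex)
    then show ?thesis by (auto simp: orb_def)
  qed
  define st where "st x = {q \<in> Q. x \<bullet> q = x}" for x
  define u where "u R = (\<lambda>x. if x \<in> \<Omega> \<and> \<rho> x = x \<and> st x = R then v x else \<zero>\<^bsub>k\<^esub>)" for R
  have u: "u R \<in> fun_space k \<Omega>" for R
    using v by (intro fun_spaceI) (auto simp: u_def)
  \<comment> \<open>If \<open>inv r\<close> moves \<open>x\<close>, then \<open>r\<close> fixes
    neither \<open>x\<close> nor its translate. Neither of them has stabilizer \<open>R\<close>, so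
    both values are zero.\<close>
  have uinv: "trans (u R) r = u R" if R: "R \<in> proper_subgroups G Q" "r \<in> R" for R r
  proof (rule K.vec_eqI)
    have "r \<in> Q"
      using R subgroup.subset[of R "G\<lparr>carrier := Q\<rparr>"] by (auto simp: proper_subgroups_def)
    then have rG: "r \<in> carrier G" by simp
    show "trans (u R) r \<in> fun_space k \<Omega>" "u R \<in> fun_space k \<Omega>" using u rG by simp_all
    fix x assume x: "x \<in> \<Omega>"
    have "u R (x \<bullet> inv r) = u R x"
    proof (cases "x \<bullet> inv r = x")
      case False
      then have "x \<bullet> r \<noteq> x" using x rG by (metis dot_inv_eq_iff)
      then have "st x \<noteq> R" using R(2) by (auto simp: st_def)
      moreover have "st (x \<bullet> inv r) \<noteq> R"
      proof
        assume "st (x \<bullet> inv r) = R"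
        then have "x \<bullet> inv r \<bullet> r = x \<bullet> inv r" using R(2) by (auto simp: st_def)
        then show False using False x rG by simp
      qed
      ultimately show ?thesis by (simp add: u_def)
    qed simp
    then show "trans (u R) r x = u R x" using x by (simp add: trans_apply)
  qed
  have "R \<subseteq> Q" if "R \<in> proper_subgroups G Q" for R
    using that subgroup.subset[of R "G\<lparr>carrier := Q\<rparr>"] by (simp add: proper_subgroups_def)
  then have "proper_subgroups G Q \<subseteq> Pow Q" by blast
  then have fin: "finite (proper_subgroups G Q)" using finQ by (simp add: finite_subset)
  have someC: "(SOME t. t \<in> C) \<in> C \<and> C \<subseteq> Q"
    if "R \<in> proper_subgroups G Q" "C \<in> rcosets\<^bsub>G\<lparr>carrier := Q\<rparr>\<^esub> R" for R C
  proof -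
    have R: "subgroup R (G\<lparr>carrier := Q\<rparr>)" using that by (simp add: proper_subgroups_def)
    have "C \<noteq> {}" using subgroup.rcosets_non_empty[OF R that(2)] .
    moreover have "C \<subseteq> Q" using GQ.rcosets_subset_PowG[OF R] that(2) by auto
    ultimately show ?thesis by (simp add: some_in_eq)
  qed
  have finC: "finite (rcosets\<^bsub>G\<lparr>carrier := Q\<rparr>\<^esub> R)" if "R \<in> proper_subgroups G Q" for R
    using GQ.rcosets_subset_PowG[of R] that finQ
    by (auto simp: proper_subgroups_def intro: finite_subset)
  have trc: "trans (u R) (SOME t. t \<in> C) \<in> fun_space k \<Omega>"
    if "R \<in> proper_subgroups G Q" "C \<in> rcosets\<^bsub>G\<lparr>carrier := Q\<rparr>\<^esub> R" for R C
    using someC[OF that] u by (intro trans_closed) auto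
  have tr_apply: "relative_trace G perm_module R Q (u R) y =
      (\<Oplus>\<^bsub>k\<^esub>C\<in>rcosets\<^bsub>G\<lparr>carrier := Q\<rparr>\<^esub> R. trans (u R) (SOME t. t \<in> C) y)"
    if "R \<in> proper_subgroups G Q" for R y
    unfolding relative_trace_def using trc[OF that] finC[OF that]
    by (intro finsum_pointwise P.kM.M.abelian_monoid_axioms K.abelian_monoid_axioms)
      (auto intro: fun_spaceD(1))
  have trC: "relative_trace G perm_module R Q (u R) \<in> fun_space k \<Omega>"
    if "R \<in> proper_subgroups G Q" for R
    using P.kM.M.finsum_closed[of "\<lambda>C. trans (u R) (SOME t. t \<in> C)" "rcosets\<^bsub>G\<lparr>carrier := Q\<rparr>\<^esub> R"]
      trc[OF that]
    by (simp add: relative_trace_def Pi_iff)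
  have "v = (\<Oplus>\<^bsub>perm_module\<^esub>R\<in>proper_subgroups G Q. relative_trace G perm_module R Q (u R))"
    (is "v = ?s")
  proof (rule K.vec_eqI[OF v])
    show "?s \<in> fun_space k \<Omega>"
      using P.kM.M.finsum_closed[of "\<lambda>R. relative_trace G perm_module R Q (u R)" "proper_subgroups G Q"] trC
      by (simp add: Pi_iff)
    fix y assume y: "y \<in> \<Omega>"
    have s: "?s y = (\<Oplus>\<^bsub>k\<^esub>R\<in>proper_subgroups G Q. relative_trace G perm_module R Q (u R) y)"
      using fin trC
      by (intro finsum_pointwise P.kM.M.abelian_monoid_axioms K.abelian_monoid_axioms)
        (auto intro: fun_spaceD(1))
    define x where "x = \<rho> y"
    obtain q0 where q0: "q0 \<in> Q" "y = x \<bullet> q0" and x\<Omega>: "x \<in> \<Omega>"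
    proof -
      obtain q where q: "q \<in> Q" "x = y \<bullet> q" using \<rho>_orb[of y] by (auto simp: x_def)
      have "x \<in> \<Omega>" using q y by simp
      moreover have "y = x \<bullet> inv q" using q y by simp
      ultimately show ?thesis using that[of "inv q"] q(1) by blast
    qed
    have \<rho>x: "\<rho> x = x" using \<rho>_dot[OF x\<Omega> q0(1)] q0(2) x_def by metis
    have vx: "v x = v y" using inv[OF x\<Omega> q0(1)] q0(2) by simp
    \<comment> \<open>In the orbit of \<open>y\<close> only the representative \<open>x\<close> can
      carry a value, so a translate is non-zero at \<open>y\<close> only if it moves
      \<open>x\<close> to \<open>y\<close>.\<close>
    have tm: "trans (u R) t y = (if R = st x \<and> y = x \<bullet> t then v x else \<zero>\<^bsub>k\<^esub>)" if "t \<in> Q" for R t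
    proof -
      have t: "t \<in> carrier G" using that by simp
      have \<rho>: "\<rho> (y \<bullet> inv t) = x" using \<rho>_dot[OF y, of "inv t"] that by (simp add: x_def)
      have iff: "y \<bullet> inv t = x \<longleftrightarrow> y = x \<bullet> t" by (rule dot_inv_eq_iff[OF y x\<Omega> t])
      have tr: "trans (u R) t y = u R (y \<bullet> inv t)" using y by (simp add: trans_apply)
      show ?thesis
      proof (cases "y \<bullet> inv t = x")
        case True
        have "u R x = (if R = st x then v x else \<zero>\<^bsub>k\<^esub>)" using \<rho>x x\<Omega> by (auto simp: u_def)
        then show ?thesis unfolding tr True using iff True by simp
      next
        case False
        then have "u R (y \<bullet> inv t) = \<zero>\<^bsub>k\<^esub>" unfolding u_def using \<rho> by simp
        then show ?thesis unfolding tr using iff False by simp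
      qed
    qed
    have st_sub: "subgroup (st x) (G\<lparr>carrier := Q\<rparr>)"
    proof -
      interpret AQ: right_action "G\<lparr>carrier := Q\<rparr>" \<Omega> dot using Q by (rule subgroup_action)
      show ?thesis using AQ.stab_subgroup[OF x\<Omega>] by (simp add: AQ.stab_def st_def)
    qed
    have tr0: "relative_trace G perm_module R Q (u R) y = \<zero>\<^bsub>k\<^esub>"
      if R: "R \<in> proper_subgroups G Q" "R \<noteq> st x" for R
    proof -
      have "relative_trace G perm_module R Q (u R) y = (\<Oplus>\<^bsub>k\<^esub>C\<in>rcosets\<^bsub>G\<lparr>carrier := Q\<rparr>\<^esub> R. \<zero>\<^bsub>k\<^esub>)"
        unfolding tr_apply[OF R(1)] using R(2) someC[OF R(1)]
        by (intro K.finsum_cong') (auto simp: tm subset_iff)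
      then show ?thesis by simp
    qed
    show "v y = ?s y"
    proof (cases "st x = Q")
      case True
      then have "x \<bullet> q = x" if "q \<in> Q" for q using that unfolding st_def by blast
      then have "y \<in> fixed Q" using x\<Omega> q0 by (simp add: fixed_def)
      moreover have "?s y = (\<Oplus>\<^bsub>k\<^esub>R\<in>proper_subgroups G Q. \<zero>\<^bsub>k\<^esub>)"
        unfolding s using tr0 True by (intro K.finsum_cong') (auto simp: proper_subgroups_def)
      ultimately show ?thesis using zero by simp
    next
      case False
      then have R0: "st x \<in> proper_subgroups G Q" using st_sub by (simp add: proper_subgroups_def)
      define C0 where "C0 = st x #>\<^bsub>G\<lparr>carrier := Q\<rparr>\<^esub> q0"
      have C0: "C0 \<in> rcosets\<^bsub>G\<lparr>carrier := Q\<rparr>\<^esub> st x"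
        using GQ.rcosetsI[OF subgroup.subset[OF st_sub]] q0 by (simp add: C0_def)
      \<comment> \<open>The elements of \<open>Q\<close> that move \<open>x\<close> to
        \<open>y\<close> form the single coset \<open>C0\<close>, so exactly one term of the trace
        survives.\<close>
      have iff: "y = x \<bullet> (SOME t. t \<in> C) \<longleftrightarrow> C0 = C" if C: "C \<in> rcosets\<^bsub>G\<lparr>carrier := Q\<rparr>\<^esub> st x" for C
      proof -
        let ?t = "SOME t. t \<in> C"
        have t: "?t \<in> C" "?t \<in> Q" using someC[OF R0 C] by auto
        obtain c where c: "c \<in> Q" "C = st x #>\<^bsub>G\<lparr>carrier := Q\<rparr>\<^esub> c" using C by (auto simp: RCOSETS_def)
        then have Ct: "C = st x #>\<^bsub>G\<lparr>carrier := Q\<rparr>\<^esub> ?t"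
          using t(1) GQ.repr_independence[OF _ _ st_sub, of ?t c] by simp
        have "y = x \<bullet> ?t \<longleftrightarrow> x \<bullet> (q0 \<otimes> inv ?t) = x"
          using t q0 x\<Omega> y by (auto simp: dot_mult dot_inv_eq_iff)
        also have "\<dots> \<longleftrightarrow> q0 \<otimes> inv ?t \<in> st x" using t q0 by (simp add: st_def)
        also have "\<dots> \<longleftrightarrow> C0 = C"
        proof
          assume "q0 \<otimes> inv ?t \<in> st x"
          then have "q0 \<otimes> inv ?t \<otimes> ?t \<in> st x #>\<^bsub>G\<lparr>carrier := Q\<rparr>\<^esub> ?t" by (auto simp: r_coset_def)
          then have "q0 \<in> st x #>\<^bsub>G\<lparr>carrier := Q\<rparr>\<^esub> ?t" using t q0 by (simp add: m_assoc)
          then have "st x #>\<^bsub>G\<lparr>carrier := Q\<rparr>\<^esub> ?t = C0"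
            using GQ.repr_independence[OF _ _ st_sub, of q0 ?t] t by (simp add: C0_def)
          then show "C0 = C" using Ct by simp
        next
          assume "C0 = C"
          moreover have "q0 \<in> C0" using GQ.rcos_self[OF _ st_sub, of q0] q0 by (simp add: C0_def)
          ultimately have "q0 \<in> st x #>\<^bsub>G\<lparr>carrier := Q\<rparr>\<^esub> ?t" using Ct by simp
          then obtain r where "r \<in> st x" "q0 = r \<otimes> ?t" by (auto simp: r_coset_def)
          moreover from this have "r \<in> Q" by (simp add: st_def)
          ultimately show "q0 \<otimes> inv ?t \<in> st x" using t by (simp add: m_assoc)
        qed
        finally show ?thesis .
      qed
      have "relative_trace G perm_module (st x) Q (u (st x)) y =
          (\<Oplus>\<^bsub>k\<^esub>C\<in>rcosets\<^bsub>G\<lparr>carrier := Q\<rparr>\<^esub> st x. if C0 = C then v x else \<zero>\<^bsub>k\<^esub>)"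
        unfolding tr_apply[OF R0] using someC[OF R0] v
        by (intro K.finsum_cong') (auto simp: tm iff subset_iff)
      also have "\<dots> = v x"
        using K.finsum_singleton[OF C0 finC[OF R0], of "\<lambda>_. v x"] v by simp
      finally have trx: "relative_trace G perm_module (st x) Q (u (st x)) y = v x" .
      have "?s y = (\<Oplus>\<^bsub>k\<^esub>R\<in>proper_subgroups G Q. if st x = R then v x else \<zero>\<^bsub>k\<^esub>)"
        unfolding s using tr0 trx v by (intro K.finsum_cong') auto
      also have "\<dots> = v x" using K.finsum_singleton[OF R0 fin, of "\<lambda>_. v x"] v by simp
      finally show ?thesis using vx by simp
    qed
  qed
  then show ?thesis using that u uinv by blast
qed

lemma rcosets_some:
  assumes Q: "subgroup Q G" and R: "subgroup R (G\<lparr>carrier := Q\<rparr>)"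
    and C: "C \<in> rcosets\<^bsub>G\<lparr>carrier := Q\<rparr>\<^esub> R"
  shows "(SOME t. t \<in> C) \<in> C" "(SOME t. t \<in> C) \<in> Q"
proof -
  interpret GQ: group "G\<lparr>carrier := Q\<rparr>" using Q by (rule subgroup_imp_group)
  have "C \<noteq> {}" using subgroup.rcosets_non_empty[OF R C] .
  then show *: "(SOME t. t \<in> C) \<in> C" by (simp add: some_in_eq)
  have "C \<subseteq> Q" using GQ.rcosets_subset_PowG[OF R] C by auto
  then show "(SOME t. t \<in> C) \<in> Q" using * by blast
qed

text \<open>By invariance of \<open>m\<close> under \<open>R\<close> the term of a coset does not
  depend on the element picked by \<open>SOME\<close>. Acting with \<open>q\<close> then merely
  permutes the cosets.\<close>

lemma relative_trace_fixed:
  assumes M: "right_module k G M" and Q: "subgroup Q G" and R: "subgroup R (G\<lparr>carrier := Q\<rparr>)"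
    and m: "m \<in> fixed_points M R" and q: "q \<in> Q"
  shows "relative_trace G M R Q m \<in> carrier M"
    and "relative_trace G M R Q m \<star>\<^bsub>M\<^esub> q = relative_trace G M R Q m"
proof -
  interpret M: right_module k G M by fact
  interpret Q: subgroup Q G by fact
  interpret GQ: group "G\<lparr>carrier := Q\<rparr>" using Q by (rule subgroup_imp_group)
  let ?X = "rcosets\<^bsub>G\<lparr>carrier := Q\<rparr>\<^esub> R"
  interpret A: right_action "G\<lparr>carrier := Q\<rparr>" ?X "r_coset (G\<lparr>carrier := Q\<rparr>)"
    by (rule GQ.rcosets_action[OF R])
  have finQ: "finite Q" using finite_G Q.subset by (rule rev_finite_subset)
  have finX: "finite ?X"
    using finite_subset[OF GQ.rcosets_subset_PowG[OF R]] finQ by simp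
  have mM: "m \<in> carrier M" and mR: "\<And>r. r \<in> R \<Longrightarrow> m \<star>\<^bsub>M\<^esub> r = m"
    using m by (auto simp: fixed_points_def)
  let ?t = "\<lambda>C. SOME t. t \<in> C"
  have t: "?t C \<in> C" "?t C \<in> Q" "?t C \<in> carrier G" if "C \<in> ?X" for C
    using rcosets_some[OF Q R that] by auto
  have indep: "m \<star>\<^bsub>M\<^esub> s = m \<star>\<^bsub>M\<^esub> ?t C" if C: "C \<in> ?X" and s: "s \<in> C" for C s
  proof -
    obtain c where c: "c \<in> Q" "C = R #>\<^bsub>G\<lparr>carrier := Q\<rparr>\<^esub> c" using C by (auto simp: RCOSETS_def)
    have "m \<star>\<^bsub>M\<^esub> s' = m \<star>\<^bsub>M\<^esub> c" if s': "s' \<in> C" for s'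
    proof -
      obtain r where r: "r \<in> R" "s' = r \<otimes> c" using s' c by (auto simp: r_coset_def)
      have "r \<in> Q" using r subgroup.mem_carrier[OF R] by simp
      then show ?thesis using r c mM mR by (simp add: M.act_mult)
    qed
    then show ?thesis using s t(1)[OF C] by simp
  qed
  show cl: "relative_trace G M R Q m \<in> carrier M"
    unfolding relative_trace_def using mM t by (intro M.kM.M.finsum_closed) (simp add: Pi_iff)
  have "relative_trace G M R Q m \<star>\<^bsub>M\<^esub> q = (\<Oplus>\<^bsub>M\<^esub>C\<in>?X. m \<star>\<^bsub>M\<^esub> ?t C \<star>\<^bsub>M\<^esub> q)"
  proof -
    have "(\<Oplus>\<^bsub>M\<^esub>C\<in>Y. m \<star>\<^bsub>M\<^esub> ?t C) \<star>\<^bsub>M\<^esub> q = (\<Oplus>\<^bsub>M\<^esub>C\<in>Y. m \<star>\<^bsub>M\<^esub> ?t C \<star>\<^bsub>M\<^esub> q)" if "finite Y" "Y \<subseteq> ?X" for Y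
      using that
    proof (induction Y rule: finite_induct)
      case empty show ?case using q by simp
    next
      case (insert C Y)
      then show ?case using q mM t by (simp add: Pi_iff M.act_add subset_iff)
    qed
    then show ?thesis unfolding relative_trace_def using finX by blast
  qed
  also have "\<dots> = (\<Oplus>\<^bsub>M\<^esub>C\<in>?X. m \<star>\<^bsub>M\<^esub> ?t (C #>\<^bsub>G\<lparr>carrier := Q\<rparr>\<^esub> q))"
  proof (rule M.kM.M.finsum_cong')
    show "m \<star>\<^bsub>M\<^esub> ?t C \<star>\<^bsub>M\<^esub> q = m \<star>\<^bsub>M\<^esub> ?t (C #>\<^bsub>G\<lparr>carrier := Q\<rparr>\<^esub> q)" if C: "C \<in> ?X" for C
    proof -
      have "?t C \<otimes> q \<in> C #>\<^bsub>G\<lparr>carrier := Q\<rparr>\<^esub> q" using t(1)[OF C] by (auto simp: r_coset_def)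
      moreover have "C #>\<^bsub>G\<lparr>carrier := Q\<rparr>\<^esub> q \<in> ?X" using A.dot_closed[OF C] q by simp
      ultimately have "m \<star>\<^bsub>M\<^esub> (?t C \<otimes> q) = m \<star>\<^bsub>M\<^esub> ?t (C #>\<^bsub>G\<lparr>carrier := Q\<rparr>\<^esub> q)" by (intro indep)
      then show ?thesis using mM t(3)[OF C] q by (simp add: M.act_mult)
    qed
    show "(\<lambda>C. m \<star>\<^bsub>M\<^esub> ?t (C #>\<^bsub>G\<lparr>carrier := Q\<rparr>\<^esub> q)) \<in> ?X \<rightarrow> carrier M"
      using mM t(3) A.dot_closed q by (simp add: Pi_iff)
  qed simp
  also have "\<dots> = (\<Oplus>\<^bsub>M\<^esub>C\<in>(\<lambda>C. C #>\<^bsub>G\<lparr>carrier := Q\<rparr>\<^esub> q) ` ?X. m \<star>\<^bsub>M\<^esub> ?t C)"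
  proof (rule M.kM.M.finsum_reindex[symmetric])
    show "inj_on (\<lambda>C. C #>\<^bsub>G\<lparr>carrier := Q\<rparr>\<^esub> q) ?X"
      using A.dot_cancel[of _ _ q] q by (intro inj_onI) simp
    show "(\<lambda>C. m \<star>\<^bsub>M\<^esub> ?t C) \<in> (\<lambda>C. C #>\<^bsub>G\<lparr>carrier := Q\<rparr>\<^esub> q) ` ?X \<rightarrow> carrier M"
      using mM t(3) A.dot_closed q by (auto simp: Pi_iff)
  qed
  also have "(\<lambda>C. C #>\<^bsub>G\<lparr>carrier := Q\<rparr>\<^esub> q) ` ?X = ?X"
  proof
    show "?X \<subseteq> (\<lambda>C. C #>\<^bsub>G\<lparr>carrier := Q\<rparr>\<^esub> q) ` ?X"
    proof
      fix C assume C: "C \<in> ?X"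
      have "inv\<^bsub>G\<lparr>carrier := Q\<rparr>\<^esub> q \<in> Q" using GQ.inv_closed[of q] q by simp
      then show "C \<in> (\<lambda>C. C #>\<^bsub>G\<lparr>carrier := Q\<rparr>\<^esub> q) ` ?X"
        using A.dot_dot_inv(2)[OF C, of q] A.dot_closed[OF C, of "inv\<^bsub>G\<lparr>carrier := Q\<rparr>\<^esub> q"] q
        by (intro image_eqI[of _ _ "C #>\<^bsub>G\<lparr>carrier := Q\<rparr>\<^esub> (inv\<^bsub>G\<lparr>carrier := Q\<rparr>\<^esub> q)"]) simp_all
    qed
    show "(\<lambda>C. C #>\<^bsub>G\<lparr>carrier := Q\<rparr>\<^esub> q) ` ?X \<subseteq> ?X" using A.dot_closed q by auto
  qed
  finally show "relative_trace G M R Q m \<star>\<^bsub>M\<^esub> q = relative_trace G M R Q m"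
    by (simp add: relative_trace_def)
qed

text \<open>Restriction to the fixed points of \<open>Q\<close> maps the \<open>Q\<close>-fixed
  elements of \<open>M\<close> onto the image of \<open>br Q e\<close>, and its kernel is the sum of
  the traces. The first isomorphism theorem does the rest.\<close>

lemma brauer_construction_image:
  assumes M: "right_module k G M" and e: "e \<in> Inv (carrier G)" "e \<otimes>\<^bsub>K.Mat\<^esub> e = e"
    and iso: "isomorphic k G M (image e)" and Q: "p_subgroup p G Q"
  shows "right_module k (G\<lparr>carrier := normalizer G Q\<rparr>) (brauer_construction G M Q)"
    and "isomorphic k (G\<lparr>carrier := normalizer G Q\<rparr>) (brauer_construction G M Q) (image (br Q e))"
proof -
  interpret M: right_module k G M by fact
  obtain n where n: "subgroup Q G" "card Q = p ^ n" using Q by (auto simp: p_subgroup_def)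
  interpret Q: subgroup Q G using n(1) .
  interpret GQ: group "G\<lparr>carrier := Q\<rparr>" using n(1) by (rule subgroup_imp_group)
  define N where "N = normalizer G Q"
  have N: "subgroup N G" unfolding N_def using Q.subset by (rule subgroup_normalizer)
  have QN: "Q \<subseteq> N" unfolding N_def using n(1) by (rule subset_normalizer)
  interpret N: subgroup N G using N .
  have eM: "e \<in> carrier K.Mat" using e by (auto dest: InvD)
  have eQ: "e \<in> Inv Q" using subsetD[OF Inv_mono[OF Q.subset] e(1)] .
  have eN: "e \<in> Inv N" using subsetD[OF Inv_mono[OF N.subset] e(1)] .
  have finQ: "finite Q" using finite_G Q.subset by (rule rev_finite_subset)
  have sG: "subgroup (carrier G) G" by (rule subgroup_self)
  have I: "right_module k G (image e)" using image_right_module[OF sG e(1)] by simp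
  obtain f where f: "gmodule_hom k G M (image e) f" "bij_betw f (carrier M) (carrier (image e))"
    using iso isomorphic_iff_hom[OF M I] by blast
  have "gmodule_hom k G M perm_module f"
    using image_incl_hom[of "carrier G" M e f] M sG e(1) f(1) by simp
  interpret f: gmodule_hom k G M perm_module f by fact
  have fim: "f m \<in> carrier (image e)" if "m \<in> carrier M" for m using f(2) that by (auto dest: bij_betwE)
  have finj: "x = y" if "f x = f y" "x \<in> carrier M" "y \<in> carrier M" for x y
    using f(2) that by (auto simp: bij_betw_def dest: inj_onD)
  have fsurj: "\<exists>m\<in>carrier M. f m = v" if "v \<in> carrier (image e)" for v
    using f(2) that unfolding bij_betw_def by (metis imageE)
  have fmv: "f m \<in> fun_space k \<Omega>" "K.vmult (f m) e = f m" if "m \<in> carrier M" for m using fim[OF that] by auto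
  define F where "F = fixed_points M Q"
  have FM: "m \<in> carrier M" "\<And>q. q \<in> Q \<Longrightarrow> m \<star>\<^bsub>M\<^esub> q = m" if "m \<in> F" for m
    using that by (auto simp: F_def fixed_points_def)
  have F_iff: "m \<in> F \<longleftrightarrow> m \<in> carrier M \<and> (\<forall>q\<in>Q. m \<star>\<^bsub>M\<^esub> q = m)" for m
    by (auto simp: F_def fixed_points_def)
  have fv_inv: "f m (x \<bullet> q) = f m x" if "m \<in> F" "x \<in> \<Omega>" "q \<in> Q" for m x q
  proof -
    have "trans (f m) q = f m" using f.f_act[OF FM(1)[OF that(1)], of q] FM(2)[OF that(1,3)] that(3) by simp
    then show ?thesis using trans_dot[OF that(2), of q "f m"] that(3) by simp
  qed
  interpret MN: right_module k "G\<lparr>carrier := N\<rparr>" M by (rule M.subgroup_module[OF N])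
  have Fsub: "gsubmodule k (G\<lparr>carrier := N\<rparr>) M F"
  proof (rule MN.gsubmoduleI)
    fix m g assume m: "m \<in> F" and g: "g \<in> carrier (G\<lparr>carrier := N\<rparr>)"
    have gN: "g \<in> N" and gG: "g \<in> carrier G" using g by auto
    have "m \<star>\<^bsub>M\<^esub> g \<star>\<^bsub>M\<^esub> q = m \<star>\<^bsub>M\<^esub> g" if q: "q \<in> Q" for q
    proof -
      have "inv g \<in> normalizer G Q" using gN N.m_inv_closed by (simp add: N_def)
      then have c: "conj_by G (inv g) q \<in> Q" using q Q.subset by (intro normalizerD(3))
      have "g \<otimes> q = conj_by G (inv g) q \<otimes> g" using gG q by (simp add: conj_by_def m_assoc)
      then show ?thesis
        using FM(1)[OF m] FM(2)[OF m c] gG q c by (simp flip: M.act_mult) (simp add: M.act_mult)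
    qed
    then show "m \<star>\<^bsub>M\<^esub> g \<in> F" using FM(1)[OF m] gG by (simp add: F_iff)
  qed (auto simp: F_iff M.act_add M.act_smult)
  let ?M' = "M\<lparr>carrier := F\<rparr>"
  interpret M': right_module k "G\<lparr>carrier := N\<rparr>" ?M' by (rule MN.submodule_right_module[OF Fsub])
  have brN: "br Q e \<in> Inv N" using br_Inv[OF eN Q.subset] by (simp add: N_def)
  have brM: "br Q e \<in> carrier K.Mat" using eM by simp
  interpret B: right_module k "G\<lparr>carrier := N\<rparr>" "image (br Q e)" by (rule image_right_module[OF N brN])
  define D where "D = K.diag (fixed Q)"
  have DM: "D \<in> carrier K.Mat" using fixed_subset by (simp add: D_def)
  have DN: "D \<in> Inv N" unfolding D_def
    using fixed_subset N.subset fixed_normalizer[OF Q.subset] by (intro Inv_diag) (auto simp: N_def)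
  \<comment> \<open>Restriction is written as multiplication by the invariant matrix
    \<open>D\<close>, so that linearity and equivariance follow from those of matrices.\<close>
  define \<Phi> where "\<Phi> m = K.vmult (f m) D" for m
  have \<Phi>br: "\<Phi> m = K.vmult (f m) (br Q e)" "K.vmult (\<Phi> m) (br Q e) = \<Phi> m" if m: "m \<in> F" for m
    using vmult_br[OF Q eQ fmv(1)[OF FM(1)[OF m]] fv_inv[OF m]] fmv(2)[OF FM(1)[OF m]]
    by (simp_all add: \<Phi>_def D_def)
  interpret \<Phi>: gmodule_hom k "G\<lparr>carrier := N\<rparr>" ?M' "image (br Q e)" \<Phi>
  proof (rule gmodule_homI[OF M'.right_module_axioms B.right_module_axioms])
    fix m assume m: "m \<in> carrier ?M'"
    then show "\<Phi> m \<in> carrier (image (br Q e))"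
      using \<Phi>br[of m] K.vmult_closed[OF fmv(1)[OF FM(1), of m] DM] by (simp add: \<Phi>_def)
  next
    fix x y assume "x \<in> carrier ?M'" "y \<in> carrier ?M'"
    then show "\<Phi> (x \<oplus>\<^bsub>?M'\<^esub> y) = \<Phi> x \<oplus>\<^bsub>image (br Q e)\<^esub> \<Phi> y"
      using f.f_add[OF FM(1) FM(1)] fmv(1)[OF FM(1)] DM by (simp add: \<Phi>_def K.vmult_add)
  next
    fix a x assume "a \<in> carrier k" "x \<in> carrier ?M'"
    then show "\<Phi> (a \<odot>\<^bsub>?M'\<^esub> x) = a \<odot>\<^bsub>image (br Q e)\<^esub> \<Phi> x"
      using f.f_smult[OF _ FM(1)] fmv(1)[OF FM(1)] DM by (simp add: \<Phi>_def K.vmult_smult)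
  next
    fix x g assume "x \<in> carrier ?M'" "g \<in> carrier (G\<lparr>carrier := N\<rparr>)"
    then show "\<Phi> (x \<star>\<^bsub>?M'\<^esub> g) = \<Phi> x \<star>\<^bsub>image (br Q e)\<^esub> g"
      using f.f_act[OF FM(1)] fmv(1)[OF FM(1)] vmult_trans[OF N _ DN] by (simp add: \<Phi>_def)
  qed
  have onto: "\<Phi> ` carrier ?M' = carrier (image (br Q e))"
  proof
    show "\<Phi> ` carrier ?M' \<subseteq> carrier (image (br Q e))" using \<Phi>.f_closed by blast
    show "carrier (image (br Q e)) \<subseteq> \<Phi> ` carrier ?M'"
    proof
      fix w assume "w \<in> carrier (image (br Q e))"
      then have w: "w \<in> fun_space k \<Omega>" "K.vmult w (br Q e) = w" by auto
      have brD: "br Q e \<otimes>\<^bsub>K.Mat\<^esub> D = br Q e"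
        unfolding D_def using brM fixed_subset K.diag_mult(2)[OF brM fixed_subset]
        by (intro K.Mat_eqI) (simp_all, simp add: br_def)
      have wD: "K.vmult w D = w" using w brM DM brD K.vmult_assoc[OF w(1) brM DM] by simp
      have w0: "w x = \<zero>\<^bsub>k\<^esub>" if "x \<notin> fixed Q" for x
        using fun_cong[OF wD, of x] K.vmult_diag[OF w(1) fixed_subset, of Q x] that by (simp add: D_def)
      have winv: "w (x \<bullet> q) = w x" if "x \<in> \<Omega>" "q \<in> Q" for x q
      proof (cases "x \<in> fixed Q")
        case True then show ?thesis using that by (simp add: fixed_def)
      next
        case False
        then have "x \<bullet> q \<notin> fixed Q" using fixed_normalizer[OF Q.subset that(1), of q] that(2) QN by (auto simp: N_def)
        then show ?thesis using False w0 by simp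
      qed
      \<comment> \<open>A preimage of \<open>w\<close> comes from its product with \<open>e\<close>:
        by \<open>vmult_br\<close> the restriction of this product is the product of
        \<open>w\<close> with \<open>br Q e\<close>, that is, \<open>w\<close> again.\<close>
      have "K.vmult w e \<in> carrier (image e)" using w eM e(2) by (simp add: K.vmult_assoc)
      then obtain m where m: "m \<in> carrier M" "f m = K.vmult w e" using fsurj by blast
      have "m \<in> F"
      proof -
        have "m \<star>\<^bsub>M\<^esub> q = m" if q: "q \<in> Q" for q
        proof (rule finj)
          have "trans w q = w"
          proof (rule K.vec_eqI)
            show "trans w q x = w x" if "x \<in> \<Omega>" for x
              using winv[OF that, of "inv q"] q that by (simp add: trans_apply)
          qed (use w q in auto)
          then have "trans (K.vmult w e) q = K.vmult w e"
            using vmult_trans[OF sG w(1) e(1), of q] q by simp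
          then show "f (m \<star>\<^bsub>M\<^esub> q) = f m" using f.f_act[OF m(1), of q] q m by simp
        qed (use m q in auto)
        then show ?thesis using m by (simp add: F_iff)
      qed
      moreover have "\<Phi> m = w"
      proof -
        have "\<Phi> m = K.vmult (K.vmult w e) D" using m by (simp add: \<Phi>_def)
        also have "\<dots> = K.vmult w (br Q e)" unfolding D_def by (rule vmult_br(1)[OF Q eQ w(1) winv])
        finally show ?thesis using w by simp
      qed
      ultimately show "w \<in> \<Phi> ` carrier ?M'" by (intro image_eqI[of _ _ m]) simp_all
    qed
  qed
  have ker: "{m \<in> carrier ?M'. \<Phi> m = \<zero>\<^bsub>image (br Q e)\<^esub>} = trace_sum G M Q"
  proof (intro subset_antisym subsetI)
    fix m assume "m \<in> {m \<in> carrier ?M'. \<Phi> m = \<zero>\<^bsub>image (br Q e)\<^esub>}"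
    then have m: "m \<in> F" "\<Phi> m = (\<lambda>_. \<zero>\<^bsub>k\<^esub>)" by simp_all
    have mM: "m \<in> carrier M" using FM m by blast
    have "f m x = \<zero>\<^bsub>k\<^esub>" if "x \<in> fixed Q" for x
      using fun_cong[OF m(2), of x] K.vmult_diag[OF fmv(1)[OF mM] fixed_subset, of Q x] that
      by (simp add: \<Phi>_def D_def)
    \<comment> \<open>These traces are formed in the permutation module. Multiplication by
      \<open>e\<close> commutes with the action and fixes \<open>f m\<close>, so it moves them into
      the image of \<open>e\<close>, where they come from traces in \<open>M\<close>.\<close>
    then obtain u where u: "\<And>R. u R \<in> fun_space k \<Omega>"
      "\<And>R r. \<lbrakk>R \<in> proper_subgroups G Q; r \<in> R\<rbrakk> \<Longrightarrow> trans (u R) r = u R"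
      "f m = (\<Oplus>\<^bsub>perm_module\<^esub>R\<in>proper_subgroups G Q. relative_trace G perm_module R Q (u R))"
      using sum_of_traces[OF n(1) fmv(1)[OF mM] fv_inv[OF m(1)]] by blast
    have ueim: "K.vmult (u R) e \<in> carrier (image e)" for R using u(1) eM e(2) by (simp add: K.vmult_assoc)
    define l where "l R = (SOME x. x \<in> carrier M \<and> f x = K.vmult (u R) e)" for R
    have l: "l R \<in> carrier M" "f (l R) = K.vmult (u R) e" for R
    proof -
      have "\<exists>x. x \<in> carrier M \<and> f x = K.vmult (u R) e" using fsurj[OF ueim[of R]] by blast
      from someI_ex[OF this] show "l R \<in> carrier M" "f (l R) = K.vmult (u R) e" by (simp_all add: l_def)
    qed
    have RQ: "R \<subseteq> Q" "subgroup R (G\<lparr>carrier := Q\<rparr>)" if "R \<in> proper_subgroups G Q" for R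
      using that subgroup.subset[of R "G\<lparr>carrier := Q\<rparr>"] by (simp_all add: proper_subgroups_def)
    have lfix: "l R \<in> fixed_points M R" if R: "R \<in> proper_subgroups G Q" for R
    proof -
      have "l R \<star>\<^bsub>M\<^esub> r = l R" if r: "r \<in> R" for r
      proof (rule finj)
        have rG: "r \<in> carrier G" using RQ(1)[OF R] r Q.subset by blast
        show "f (l R \<star>\<^bsub>M\<^esub> r) = f (l R)"
          using f.f_act[OF l(1) rG, of R] vmult_trans[OF sG u(1) e(1) rG, of R, symmetric]
            u(2)[OF R r] l(2) by simp
        show "l R \<star>\<^bsub>M\<^esub> r \<in> carrier M" "l R \<in> carrier M" using l(1) rG by simp_all
      qed
      then show ?thesis using l(1) by (simp add: fixed_points_def)
    qed
    interpret E: gmodule_hom k G perm_module perm_module "\<lambda>v. K.vmult v e"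
      using eM vmult_trans[OF sG _ e(1)]
      by (intro gmodule_homI perm_right_module) (simp_all add: K.vmult_add K.vmult_smult)
    have finX: "finite (rcosets\<^bsub>G\<lparr>carrier := Q\<rparr>\<^esub> R)" if "R \<in> proper_subgroups G Q" for R
      using finite_subset[OF GQ.rcosets_subset_PowG[OF RQ(2)[OF that]]] finQ by simp
    have "proper_subgroups G Q \<subseteq> Pow Q" using RQ(1) by blast
    then have finP: "finite (proper_subgroups G Q)" using finQ by (simp add: finite_subset)
    have tG: "(SOME t. t \<in> C) \<in> carrier G"
      if "R \<in> proper_subgroups G Q" "C \<in> rcosets\<^bsub>G\<lparr>carrier := Q\<rparr>\<^esub> R" for R C
      using rcosets_some(2)[OF n(1) RQ(2)[OF that(1)] that(2)] by simp
    have trM: "relative_trace G M R Q (l R) \<in> carrier M" if "R \<in> proper_subgroups G Q" for R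
      using relative_trace_fixed(1)[OF M n(1) RQ(2)[OF that] lfix[OF that] Q.one_closed] .
    have trP: "relative_trace G perm_module R Q (u R) \<in> fun_space k \<Omega>" if "R \<in> proper_subgroups G Q" for R
    proof -
      have "u R \<in> fixed_points perm_module R" using u that by (simp add: fixed_points_def)
      from relative_trace_fixed(1)[OF perm_right_module n(1) RQ(2)[OF that] this Q.one_closed]
      show ?thesis by simp
    qed
    have trf: "f (relative_trace G M R Q (l R)) = K.vmult (relative_trace G perm_module R Q (u R)) e"
      if R: "R \<in> proper_subgroups G Q" for R
    proof -
      have "f (relative_trace G M R Q (l R)) =
          (\<Oplus>\<^bsub>perm_module\<^esub>C\<in>rcosets\<^bsub>G\<lparr>carrier := Q\<rparr>\<^esub> R. f (l R \<star>\<^bsub>M\<^esub> (SOME t. t \<in> C)))"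
        unfolding relative_trace_def using l(1) tG[OF R] by (intro f.f_finsum finX R) simp_all
      also have "\<dots> = (\<Oplus>\<^bsub>perm_module\<^esub>C\<in>rcosets\<^bsub>G\<lparr>carrier := Q\<rparr>\<^esub> R. K.vmult (trans (u R) (SOME t. t \<in> C)) e)"
        using l tG[OF R] u(1) eM vmult_trans[OF sG u(1) e(1)]
        by (intro f.N.kM.M.finsum_cong') (simp_all add: f.f_act Pi_iff)
      also have "\<dots> = K.vmult (relative_trace G perm_module R Q (u R)) e"
        unfolding relative_trace_def using u(1) tG[OF R] by (intro E.f_finsum[symmetric] finX R) simp_all
      finally show ?thesis .
    qed
    have "f m = K.vmult (f m) e" using fmv(2)[OF mM] by simp
    also have "\<dots> = (\<Oplus>\<^bsub>perm_module\<^esub>R\<in>proper_subgroups G Q. K.vmult (relative_trace G perm_module R Q (u R)) e)"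
      unfolding u(3) using trP by (intro E.f_finsum finP) simp_all
    also have "\<dots> = (\<Oplus>\<^bsub>perm_module\<^esub>R\<in>proper_subgroups G Q. f (relative_trace G M R Q (l R)))"
      using trf f.f_closed[OF trM] by (intro f.N.kM.M.finsum_cong') (simp_all add: Pi_iff)
    also have "\<dots> = f (\<Oplus>\<^bsub>M\<^esub>R\<in>proper_subgroups G Q. relative_trace G M R Q (l R))"
      using trM by (intro f.f_finsum[symmetric] finP) simp_all
    finally have "m = (\<Oplus>\<^bsub>M\<^esub>R\<in>proper_subgroups G Q. relative_trace G M R Q (l R))"
      using mM trM by (intro finj M.kM.M.finsum_closed) (simp_all add: Pi_iff)
    then show "m \<in> trace_sum G M Q"
      unfolding trace_sum_def using lfix
      by (intro CollectI exI[of _ "\<lambda>R. relative_trace G M R Q (l R)"]) blast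
  next
    fix m assume "m \<in> trace_sum G M Q"
    then obtain h where h: "m = (\<Oplus>\<^bsub>M\<^esub>R\<in>proper_subgroups G Q. h R)"
      "\<And>R. R \<in> proper_subgroups G Q \<Longrightarrow> h R \<in> relative_trace G M R Q ` fixed_points M R"
      by (auto simp: trace_sum_def)
    have hK: "h R \<in> F \<and> \<Phi> (h R) = (\<lambda>_. \<zero>\<^bsub>k\<^esub>)" if R: "R \<in> proper_subgroups G Q" for R
    proof -
      have Rs: "subgroup R (G\<lparr>carrier := Q\<rparr>)" "R \<noteq> Q" using R by (simp_all add: proper_subgroups_def)
      obtain l where l: "l \<in> fixed_points M R" "h R = relative_trace G M R Q l" using h(2)[OF R] by blast
      have lM: "l \<in> carrier M" using l by (simp add: fixed_points_def)
      have hF: "h R \<in> F"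
        using relative_trace_fixed[OF M n(1) Rs(1) l(1)] Q.one_closed unfolding l(2) F_iff by blast
      let ?X = "rcosets\<^bsub>G\<lparr>carrier := Q\<rparr>\<^esub> R"
      have finX: "finite ?X" using finite_subset[OF GQ.rcosets_subset_PowG[OF Rs(1)]] finQ by simp
      have t: "(SOME t. t \<in> C) \<in> Q" if "C \<in> ?X" for C using rcosets_some(2)[OF n(1) Rs(1) that] .
      \<comment> \<open>At a fixed point of \<open>Q\<close> all terms of a trace take the same
        value, so the trace is this value times the number of cosets.\<close>
      have pX: "p dvd card ?X"
      proof -
        have lag: "card ?X * card R = p ^ n" using GQ.lagrange[OF Rs(1)] n(2) by (simp add: order_def)
        then obtain i where i: "card ?X = p ^ i" by (metis divides_primepow_nat dvd_triv_left prime_p)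
        have "R \<subseteq> Q" using subgroup.subset[OF Rs(1)] by simp
        then have "card R < card Q" using Rs(2) finQ by (intro psubset_card_mono) auto
        then have "i \<noteq> 0" using lag i n(2) by (cases "i = 0") auto
        then show ?thesis using i by (simp add: dvd_power)
      qed
      have "f (h R) x = \<zero>\<^bsub>k\<^esub>" if x: "x \<in> fixed Q" for x
      proof -
        have x\<Omega>: "x \<in> \<Omega>" using x by (simp add: fixed_def)
        have "f (h R) = (\<Oplus>\<^bsub>perm_module\<^esub>C\<in>?X. f (l \<star>\<^bsub>M\<^esub> (SOME t. t \<in> C)))"
          unfolding l(2) relative_trace_def using lM t by (intro f.f_finsum finX) simp_all
        then have "f (h R) x = (\<Oplus>\<^bsub>perm_module\<^esub>C\<in>?X. f (l \<star>\<^bsub>M\<^esub> (SOME t. t \<in> C))) x" by simp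
        also have "\<dots> = (\<Oplus>\<^bsub>k\<^esub>C\<in>?X. f (l \<star>\<^bsub>M\<^esub> (SOME t. t \<in> C)) x)"
          using lM t fmv(1)
          by (intro finsum_pointwise finX f.N.kM.M.abelian_monoid_axioms K.abelian_monoid_axioms)
            (simp_all add: fun_spaceD(1)[OF fmv(1)])
        also have "\<dots> = (\<Oplus>\<^bsub>k\<^esub>C\<in>?X. f l x)"
        proof (rule K.finsum_cong')
          show "f (l \<star>\<^bsub>M\<^esub> (SOME t. t \<in> C)) x = f l x" if C: "C \<in> ?X" for C
          proof -
            have "inv (SOME t. t \<in> C) \<in> Q" using t[OF C] by simp
            then have "x \<bullet> inv (SOME t. t \<in> C) = x" using x by (simp add: fixed_def)
            then show ?thesis using f.f_act[OF lM, of "SOME t. t \<in> C"] t[OF C] x\<Omega> by (simp add: trans_apply)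
          qed
        qed (simp_all add: fun_spaceD(1)[OF fmv(1)[OF lM]])
        also have "\<dots> = [card ?X] \<cdot>\<^bsub>k\<^esub> f l x" using fun_spaceD(1)[OF fmv(1)[OF lM]] by (simp add: K.add.finprod_const)
        also have "\<dots> = \<zero>\<^bsub>k\<^esub>"
        proof -
          obtain j where "card ?X = p * j" using pX by blast
          then have "[card ?X] \<cdot>\<^bsub>k\<^esub> f l x = [j] \<cdot>\<^bsub>k\<^esub> ([p] \<cdot>\<^bsub>k\<^esub> f l x)"
            using fun_spaceD(1)[OF fmv(1)[OF lM]] by (simp add: K.add.nat_pow_pow)
          then show ?thesis using char_p[OF fun_spaceD(1)[OF fmv(1)[OF lM]], of x] by simp
        qed
        finally show ?thesis .
      qed
      then have "\<Phi> (h R) = (\<lambda>_. \<zero>\<^bsub>k\<^esub>)"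
        using K.vmult_diag[OF fmv(1)[OF FM(1)[OF hF]] fixed_subset] by (auto simp: \<Phi>_def D_def fun_eq_iff)
      then show ?thesis using hF by blast
    qed
    have "h \<in> proper_subgroups G Q \<rightarrow> {m \<in> F. \<Phi> m = (\<lambda>_. \<zero>\<^bsub>k\<^esub>)}" using hK by blast
    moreover have "finsum M h A \<in> {m \<in> F. \<Phi> m = (\<lambda>_. \<zero>\<^bsub>k\<^esub>)}"
      if "h \<in> A \<rightarrow> {m \<in> F. \<Phi> m = (\<lambda>_. \<zero>\<^bsub>k\<^esub>)}" for A
    proof -
      have z: "\<zero>\<^bsub>M\<^esub> \<in> F" "\<Phi> \<zero>\<^bsub>M\<^esub> = (\<lambda>_. \<zero>\<^bsub>k\<^esub>)" using MN.gsubmoduleD(2)[OF Fsub] \<Phi>.f_zero by simp_all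
      show ?thesis using that
      proof (induction A rule: infinite_finite_induct)
        case (insert a A)
        then have a: "h a \<in> F" "\<Phi> (h a) = (\<lambda>_. \<zero>\<^bsub>k\<^esub>)" "finsum M h A \<in> F" "\<Phi> (finsum M h A) = (\<lambda>_. \<zero>\<^bsub>k\<^esub>)"
          and hA: "h \<in> A \<rightarrow> carrier M" using FM(1) by auto
        have "finsum M h (insert a A) = h a \<oplus>\<^bsub>M\<^esub> finsum M h A"
          using insert hA FM(1)[OF a(1)] by simp
        then show ?case using a \<Phi>.f_add[of "h a" "finsum M h A"] MN.gsubmoduleD(3)[OF Fsub] by simp
      qed (use z in simp_all)
    qed
    ultimately show "m \<in> {m \<in> carrier ?M'. \<Phi> m = \<zero>\<^bsub>image (br Q e)\<^esub>}" unfolding h(1) by simp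
  qed
  have eq: "brauer_construction G M Q = quotient_module ?M' {m \<in> carrier ?M'. \<Phi> m = \<zero>\<^bsub>image (br Q e)\<^esub>}"
    unfolding ker by (simp add: brauer_construction_def F_def)
  have "gsubmodule k (G\<lparr>carrier := N\<rparr>) (image (br Q e)) {\<zero>\<^bsub>image (br Q e)\<^esub>}"
    using B.kM.M.zero_closed by (intro B.gsubmoduleI) (auto simp: B.act_zero[simplified])
  then have "gsubmodule k (G\<lparr>carrier := N\<rparr>) ?M' {m \<in> carrier ?M'. \<Phi> m = \<zero>\<^bsub>image (br Q e)\<^esub>}"
    using \<Phi>.gsubmodule_vimage by fastforce
  then show "right_module k (G\<lparr>carrier := normalizer G Q\<rparr>) (brauer_construction G M Q)"
    unfolding eq N_def[symmetric] by (rule M'.quotient_right_module)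
  show "isomorphic k (G\<lparr>carrier := normalizer G Q\<rparr>) (brauer_construction G M Q) (image (br Q e))"
    unfolding eq N_def[symmetric] by (rule \<Phi>.first_isomorphism[OF onto])
qed

end

section \<open>Scott modules as images of primitive idempotents\<close>

lemma (in gmodule_hom) restrict_isomorphic:
  assumes f: "bij_betw f (carrier M) (carrier N)"
    and S: "gsubmodule k G M S" "gsubmodule k G N T" "\<And>x. x \<in> carrier M \<Longrightarrow> x \<in> S \<longleftrightarrow> f x \<in> T"
  shows "gmodule_hom k G (M\<lparr>carrier := S\<rparr>) (N\<lparr>carrier := T\<rparr>) f" "bij_betw f S T"
proof -
  have SM: "x \<in> carrier M" if "x \<in> S" for x using that M.gsubmoduleD(8)[OF S(1)] by simp
  have TN: "x \<in> carrier N" if "x \<in> T" for x using that N.gsubmoduleD(8)[OF S(2)] by simp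
  have fT: "f x \<in> T" if "x \<in> S" for x using S(3)[OF SM[OF that]] that by simp
  show "gmodule_hom k G (M\<lparr>carrier := S\<rparr>) (N\<lparr>carrier := T\<rparr>) f"
    using SM fT f_add f_smult f_act
    by (intro gmodule_homI M.submodule_right_module[OF S(1)] N.submodule_right_module[OF S(2)]) simp_all
  show "bij_betw f S T"
    unfolding bij_betw_def
  proof
    show "inj_on f S" using f SM unfolding bij_betw_def by (meson inj_on_subset subsetI)
    show "f ` S = T"
    proof
      show "f ` S \<subseteq> T" using S(3) SM by auto
      show "T \<subseteq> f ` S"
      proof
        fix y assume y: "y \<in> T"
        then obtain x where "x \<in> carrier M" "y = f x" using TN f unfolding bij_betw_def by blast
        then show "y \<in> f ` S" using y S(3) by blast
      qed
    qed
  qed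
qed

lemma gmodule_hom_compose:
  assumes "gmodule_hom k G L M f" "gmodule_hom k G M N g"
  shows "gmodule_hom k G L N (\<lambda>x. g (f x))"
proof -
  interpret f: gmodule_hom k G L M f by fact
  interpret g: gmodule_hom k G M N g by fact
  show ?thesis
    by (rule gmodule_homI[OF f.M.right_module_axioms g.N.right_module_axioms])
      (simp_all add: f.f_add f.f_smult f.f_act g.f_add g.f_smult g.f_act)
qed

lemma functional_finsum:
  assumes "gmodule_hom k G M (trivial_module k) l" "finite I" "\<And>i. i \<in> I \<Longrightarrow> x i \<in> carrier M"
  shows "l (finsum M x I) = (\<Oplus>\<^bsub>k\<^esub>i\<in>I. l (x i))"
proof -
  interpret l: gmodule_hom k G M "trivial_module k" l by fact
  show ?thesis using assms(2,3)
  proof (induction I rule: finite_induct)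
    case empty
    show ?case using l.f_zero by simp
  next
    case (insert i I)
    then have x: "x i \<in> carrier M" "finsum M x I \<in> carrier M" "\<And>j. j \<in> I \<Longrightarrow> l (x j) \<in> carrier k"
      "l (x i) \<in> carrier k" using l.f_closed by (simp_all add: Pi_iff)
    have "l (finsum M x (insert i I)) = l (x i \<oplus>\<^bsub>M\<^esub> finsum M x I)"
      using insert x by (simp add: Pi_iff)
    also have "\<dots> = l (x i) \<oplus>\<^bsub>k\<^esub> (\<Oplus>\<^bsub>k\<^esub>i\<in>I. l (x i))"
      using l.f_add[OF x(1,2)] insert by simp
    also have "\<dots> = (\<Oplus>\<^bsub>k\<^esub>i\<in>insert i I. l (x i))"
      using insert x by (simp add: Pi_iff)
    finally show ?case .
  qed
qed

section \<open>Row sums and supports of matrices\<close>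

context finite_action
begin

text \<open>The augmentation \<open>vsum\<close> of the row at \<open>x\<close>. For an invariant
  matrix it depends only on the orbit of \<open>x\<close>, by \<open>rsum_dot\<close>.\<close>

definition rsum :: "('x \<times> 'x \<Rightarrow> 'k) \<Rightarrow> 'x \<Rightarrow> 'k" where
  "rsum a x = (\<Oplus>\<^bsub>k\<^esub>y\<in>\<Omega>. a (x, y))"

definition vsum :: "('x \<Rightarrow> 'k) \<Rightarrow> 'k" where
  "vsum v = (\<Oplus>\<^bsub>k\<^esub>x\<in>\<Omega>. v x)"

definition supp :: "'x set \<Rightarrow> ('x \<times> 'x \<Rightarrow> 'k) \<Rightarrow> bool" where
  "supp Y a \<longleftrightarrow> (\<forall>x y. x \<notin> Y \<or> y \<notin> Y \<longrightarrow> a (x, y) = \<zero>\<^bsub>k\<^esub>)"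

lemma rsum_closed [simp]: "a \<in> carrier K.Mat \<Longrightarrow> rsum a x \<in> carrier k"
  unfolding rsum_def by (rule K.finsum_closed) simp

lemma vsum_closed [simp]: "v \<in> fun_space k \<Omega> \<Longrightarrow> vsum v \<in> carrier k"
  unfolding vsum_def by (rule K.finsum_closed) simp

lemma vsum_vmult:
  assumes v: "v \<in> fun_space k \<Omega>" and a: "a \<in> carrier K.Mat"
  shows "vsum (K.vmult v a) = (\<Oplus>\<^bsub>k\<^esub>x\<in>\<Omega>. v x \<otimes>\<^bsub>k\<^esub> rsum a x)"
proof -
  have "vsum (K.vmult v a) = (\<Oplus>\<^bsub>k\<^esub>x\<in>\<Omega>. \<Oplus>\<^bsub>k\<^esub>y\<in>\<Omega>. v x \<otimes>\<^bsub>k\<^esub> a (x, y))"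
    unfolding vsum_def K.vmult_def using v a K.finite_index by (intro K.finsum_swap) simp_all
  also have "\<dots> = (\<Oplus>\<^bsub>k\<^esub>x\<in>\<Omega>. v x \<otimes>\<^bsub>k\<^esub> rsum a x)"
    unfolding rsum_def using v a K.finite_index
    by (intro K.finsum_cong' refl) (simp_all add: K.finsum_rdistr Pi_iff)
  finally show ?thesis .
qed

lemma rsum_mult:
  assumes a: "a \<in> carrier K.Mat" and b: "b \<in> carrier K.Mat"
  shows "rsum (a \<otimes>\<^bsub>K.Mat\<^esub> b) x = (\<Oplus>\<^bsub>k\<^esub>z\<in>\<Omega>. a (x, z) \<otimes>\<^bsub>k\<^esub> rsum b z)"
proof -
  have "rsum (a \<otimes>\<^bsub>K.Mat\<^esub> b) x = (\<Oplus>\<^bsub>k\<^esub>z\<in>\<Omega>. \<Oplus>\<^bsub>k\<^esub>y\<in>\<Omega>. a (x, z) \<otimes>\<^bsub>k\<^esub> b (z, y))"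
    unfolding rsum_def K.Mat_simps using a b K.finite_index by (intro K.finsum_swap) simp_all
  also have "\<dots> = (\<Oplus>\<^bsub>k\<^esub>z\<in>\<Omega>. a (x, z) \<otimes>\<^bsub>k\<^esub> rsum b z)"
    unfolding rsum_def using a b K.finite_index
    by (intro K.finsum_cong' refl) (simp_all add: K.finsum_rdistr Pi_iff)
  finally show ?thesis .
qed

text \<open>Row sums multiply as soon as those of the right factor are constant on the support of
  the left one. Together with invariance this makes the row sum a multiplicative character on the
  matrices supported on one orbit.\<close>

lemma rsum_mult_const:
  assumes a: "a \<in> carrier K.Mat" "supp Y a" and b: "b \<in> carrier K.Mat"
    and c: "\<And>z. z \<in> Y \<Longrightarrow> rsum b z = c" "c \<in> carrier k"
  shows "rsum (a \<otimes>\<^bsub>K.Mat\<^esub> b) x = rsum a x \<otimes>\<^bsub>k\<^esub> c"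
proof -
  have "rsum (a \<otimes>\<^bsub>K.Mat\<^esub> b) x = (\<Oplus>\<^bsub>k\<^esub>z\<in>\<Omega>. a (x, z) \<otimes>\<^bsub>k\<^esub> c)"
    unfolding rsum_mult[OF a(1) b]
  proof (rule K.finsum_cong')
    show "a (x, z) \<otimes>\<^bsub>k\<^esub> rsum b z = a (x, z) \<otimes>\<^bsub>k\<^esub> c" if "z \<in> \<Omega>" for z
      using c a b by (cases "z \<in> Y") (simp_all add: supp_def)
  qed (use a c in simp_all)
  then show ?thesis unfolding rsum_def using a c K.finite_index by (simp add: K.finsum_ldistr Pi_iff)
qed

lemma rsum_dot:
  assumes "H \<subseteq> carrier G" "a \<in> Inv H" "h \<in> H" "x \<in> \<Omega>"
  shows "rsum a (x \<bullet> h) = rsum a x"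
proof -
  have hG: "h \<in> carrier G" using assms by blast
  have aM: "a \<in> carrier K.Mat" using assms(2) by (rule InvD)
  have "rsum a (x \<bullet> h) = (\<Oplus>\<^bsub>k\<^esub>y\<in>\<Omega>. a (x \<bullet> h, y \<bullet> h))"
    unfolding rsum_def using aM hG by (intro sum_dot[symmetric]) simp_all
  also have "\<dots> = rsum a x"
    unfolding rsum_def using aM assms Inv_dot[OF assms(2,3,4)] by (intro K.finsum_cong' refl) simp_all
  finally show ?thesis .
qed

lemma rsum_add:
  "\<lbrakk>a \<in> carrier K.Mat; b \<in> carrier K.Mat\<rbrakk> \<Longrightarrow> rsum (a \<oplus>\<^bsub>K.Mat\<^esub> b) x = rsum a x \<oplus>\<^bsub>k\<^esub> rsum b x"
  by (simp add: rsum_def K.Mat_simps K.finsum_addf Pi_iff)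

lemma supp_diag:
  assumes "a \<in> carrier K.Mat" "Y \<subseteq> \<Omega>"
  shows "supp Y a \<longleftrightarrow> K.diag Y \<otimes>\<^bsub>K.Mat\<^esub> a = a \<and> a \<otimes>\<^bsub>K.Mat\<^esub> K.diag Y = a"
proof
  assume s: "supp Y a"
  show "K.diag Y \<otimes>\<^bsub>K.Mat\<^esub> a = a \<and> a \<otimes>\<^bsub>K.Mat\<^esub> K.diag Y = a"
    using s assms K.diag_closed[OF assms(2)]
    by (intro conjI K.Mat_eqI) (simp_all add: K.diag_mult supp_def)
next
  assume d: "K.diag Y \<otimes>\<^bsub>K.Mat\<^esub> a = a \<and> a \<otimes>\<^bsub>K.Mat\<^esub> K.diag Y = a"
  show "supp Y a"
    unfolding supp_def
  proof (intro allI impI)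
    fix x y assume "x \<notin> Y \<or> y \<notin> Y"
    then show "a (x, y) = \<zero>\<^bsub>k\<^esub>"
      using K.diag_mult(1)[OF assms, of x y] K.diag_mult(2)[OF assms, of x y] d by auto
  qed
qed

lemma diag_idem: "Y \<subseteq> \<Omega> \<Longrightarrow> K.diag Y \<otimes>\<^bsub>K.Mat\<^esub> K.diag Y = K.diag Y"
  by (intro K.Mat_eqI) (simp_all add: K.diag_mult, auto simp: K.diag_def)

lemma rsum_diag:
  assumes "x \<in> Y" "Y \<subseteq> \<Omega>" shows "rsum (K.diag Y) x = \<one>\<^bsub>k\<^esub>"
proof -
  have "rsum (K.diag Y) x = (\<Oplus>\<^bsub>k\<^esub>y\<in>\<Omega>. if x = y then \<one>\<^bsub>k\<^esub> else \<zero>\<^bsub>k\<^esub>)"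
    unfolding rsum_def K.diag_def using assms by (intro K.finsum_cong' refl) auto
  then show ?thesis using K.finsum_delta[of x "\<lambda>_. \<one>\<^bsub>k\<^esub>"] assms by auto
qed

text \<open>Invariance makes the row sum a constant \<open>c\<close> on the orbit, and idempotence
  gives $c = c^2$ in a field.\<close>

lemma rsum_idempotent:
  assumes H: "subgroup H G" and y0: "y0 \<in> \<Omega>" and Y: "Y = (\<lambda>h. y0 \<bullet> h) ` H"
    and e: "e \<in> Inv H" "e \<otimes>\<^bsub>K.Mat\<^esub> e = e" "supp Y e"
  shows "(\<forall>x\<in>Y. rsum e x = \<zero>\<^bsub>k\<^esub>) \<or> (\<forall>x\<in>Y. rsum e x = \<one>\<^bsub>k\<^esub>)"
proof -
  have eM: "e \<in> carrier K.Mat" using e(1) by (rule InvD)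
  have c: "rsum e x = rsum e y0" if "x \<in> Y" for x
    using that rsum_dot[OF subgroup.subset[OF H] e(1) _ y0] by (auto simp: Y)
  let ?c = "rsum e y0"
  have ck: "?c \<in> carrier k" using eM by simp
  have "?c = ?c \<otimes>\<^bsub>k\<^esub> ?c" using rsum_mult_const[OF eM e(3) eM c ck, of y0] e(2) by simp
  then have "?c = \<zero>\<^bsub>k\<^esub> \<or> ?c = \<one>\<^bsub>k\<^esub>" using ck
    by (metis K.m_lcancel K.one_closed K.r_one)
  then show ?thesis using c by auto
qed

text \<open>Starting from the identity matrix of the orbit, an idempotent with row sums one and
  smallest image is taken. If it splits as \<open>f\<close> and $t - f$, the row sums of the parts
  are zero or one and add up to one, so one of the parts is again admissible and by minimality equal
  to \<open>t\<close>.\<close>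

lemma exists_primitive_row_sum_one:
  assumes H: "subgroup H G" and y0: "y0 \<in> \<Omega>" and Y: "Y = (\<lambda>h. y0 \<bullet> h) ` H"
  obtains t where "primitive H t" "supp Y t" "\<And>x. x \<in> Y \<Longrightarrow> rsum t x = \<one>\<^bsub>k\<^esub>"
proof -
  interpret H: subgroup H G by fact
  have Y\<Omega>: "Y \<subseteq> \<Omega>" using y0 by (auto simp: Y)
  have y0Y: "y0 \<in> Y" using y0 H.one_closed dot_one[OF y0] unfolding Y by (metis image_eqI)
  have Ydot: "x \<bullet> h \<in> Y \<longleftrightarrow> x \<in> Y" if x: "x \<in> \<Omega>" and h: "h \<in> H" for x h
  proof
    assume "x \<bullet> h \<in> Y"
    then obtain g where g: "g \<in> H" "x \<bullet> h = y0 \<bullet> g" by (auto simp: Y)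
    have "x = x \<bullet> h \<bullet> inv h" using x h by simp
    then have "x = y0 \<bullet> (g \<otimes> inv h)" using g h y0 by (simp add: dot_mult)
    then show "x \<in> Y" using g h by (simp add: Y)
  next
    assume "x \<in> Y"
    then obtain g where g: "g \<in> H" "x = y0 \<bullet> g" by (auto simp: Y)
    then have "x \<bullet> h = y0 \<bullet> (g \<otimes> h)" using h y0 by (simp add: dot_mult)
    then show "x \<bullet> h \<in> Y" using g h by (simp add: Y)
  qed
  define ok where "ok e \<longleftrightarrow> e \<in> Inv H \<and> e \<otimes>\<^bsub>K.Mat\<^esub> e = e \<and> supp Y e \<and> (\<forall>x\<in>Y. rsum e x = \<one>\<^bsub>k\<^esub>)" for e
  have dI: "K.diag Y \<in> Inv H" using Y\<Omega> H.subset Ydot by (rule Inv_diag)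
  have "ok (K.diag Y)"
    using dI diag_idem[OF Y\<Omega>] rsum_diag[OF _ Y\<Omega>] supp_diag[OF K.diag_closed[OF Y\<Omega>] Y\<Omega>] by (simp add: ok_def)
  obtain \<mu> :: "('x \<Rightarrow> 'k) set \<Rightarrow> nat" where
    \<mu>: "\<And>A B. \<lbrakk>subspace k \<Omega> A; subspace k \<Omega> B; A \<subset> B\<rbrakk> \<Longrightarrow> \<mu> A < \<mu> B"
    using K.subspace_measure[OF K.finite_index] by metis
  obtain t where t: "ok t" and min: "\<And>e. ok e \<Longrightarrow> \<mu> (carrier (image t)) \<le> \<mu> (carrier (image e))"
    using ex_has_least_nat[of ok "K.diag Y" "\<lambda>e. \<mu> (carrier (image e))"] \<open>ok (K.diag Y)\<close> by auto
  have tI: "t \<in> Inv H" "t \<otimes>\<^bsub>K.Mat\<^esub> t = t" "supp Y t" "\<And>x. x \<in> Y \<Longrightarrow> rsum t x = \<one>\<^bsub>k\<^esub>"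
    using t by (auto simp: ok_def)
  have tM: "t \<in> carrier K.Mat" using tI(1) by (rule InvD)
  interpret P: right_module k "G\<lparr>carrier := H\<rparr>" perm_module
    by (rule right_module.subgroup_module[OF perm_right_module H])
  have sub: "subspace k \<Omega> (carrier (image e))" if "e \<in> Inv H" for e
    using P.gsubmoduleD[OF image_gsubmodule[OF H that]] unfolding subspace_def by simp
  have t0: "t \<noteq> \<zero>\<^bsub>K.Mat\<^esub>"
  proof
    assume "t = \<zero>\<^bsub>K.Mat\<^esub>"
    then have "rsum t y0 = \<zero>\<^bsub>k\<^esub>" by (simp add: rsum_def K.Mat_simps)
    then show False using tI(4)[OF y0Y] by simp
  qed
  have eq: "f = t" if f: "f \<in> Inv H" "f \<otimes>\<^bsub>K.Mat\<^esub> f = f" "t \<otimes>\<^bsub>K.Mat\<^esub> f = f" "f \<otimes>\<^bsub>K.Mat\<^esub> t = f"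
    and r: "\<forall>x\<in>Y. rsum f x = \<one>\<^bsub>k\<^esub>" and s: "supp Y f" for f
  proof -
    have fM: "f \<in> carrier K.Mat" using f(1) by (rule InvD)
    have le: "carrier (image f) \<subseteq> carrier (image t)"
    proof
      fix v assume "v \<in> carrier (image f)"
      then have v: "v \<in> fun_space k \<Omega>" "K.vmult v f = v" by auto
      then have "K.vmult v t = v" using K.vmult_assoc[OF v(1) fM tM] f(4) by simp
      then show "v \<in> carrier (image t)" using v by simp
    qed
    have "ok f" using f r s by (simp add: ok_def)
    then have "\<not> carrier (image f) \<subset> carrier (image t)" using min \<mu>[OF sub sub] f(1) tI(1) by (meson not_less)
    then have "carrier (image t) \<subseteq> carrier (image f)" using le by blast
    then show ?thesis using image_eq_imp[OF tM tI(2) fM f(3)] by simp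
  qed
  have "primitive H t"
    unfolding primitive_def
  proof (intro conjI ballI impI tI t0)
    fix f assume fI: "f \<in> Inv H" and f: "f \<otimes>\<^bsub>K.Mat\<^esub> f = f \<and> t \<otimes>\<^bsub>K.Mat\<^esub> f = f \<and> f \<otimes>\<^bsub>K.Mat\<^esub> t = f"
    have fM: "f \<in> carrier K.Mat" using fI by (rule InvD)
    define d where "d = t \<ominus>\<^bsub>K.Mat\<^esub> f"
    have dI: "d \<in> Inv H" using tI fI by (simp add: d_def Inv_diff)
    have dM: "d \<in> carrier K.Mat" using dI by (rule InvD)
    have d1: "d \<otimes>\<^bsub>K.Mat\<^esub> t = d" "t \<otimes>\<^bsub>K.Mat\<^esub> d = d" "d \<otimes>\<^bsub>K.Mat\<^esub> f = \<zero>\<^bsub>K.Mat\<^esub>"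
      using tM fM f tI(2)
      by (simp_all add: d_def a_minus_def K.Mat.l_distr K.Mat.r_distr K.Mat.l_minus K.Mat.r_minus K.Mat.r_neg)
    have d2: "d \<otimes>\<^bsub>K.Mat\<^esub> d = d"
      using d1 dM tM fM by (subst (2) d_def) (simp add: a_minus_def K.Mat.r_distr K.Mat.r_minus)
    have tdf: "t = d \<oplus>\<^bsub>K.Mat\<^esub> f" using tM fM by (simp add: d_def a_minus_def K.Mat.a_assoc K.Mat.l_neg)
    have supp_sub: "supp Y x" if x: "x \<in> carrier K.Mat" "t \<otimes>\<^bsub>K.Mat\<^esub> x = x" "x \<otimes>\<^bsub>K.Mat\<^esub> t = x" for x
    proof -
      have D: "K.diag Y \<in> carrier K.Mat" using Y\<Omega> by simp
      have "K.diag Y \<otimes>\<^bsub>K.Mat\<^esub> t = t" "t \<otimes>\<^bsub>K.Mat\<^esub> K.diag Y = t" using tI(3) supp_diag[OF tM Y\<Omega>] by auto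
      then have "K.diag Y \<otimes>\<^bsub>K.Mat\<^esub> x = x" "x \<otimes>\<^bsub>K.Mat\<^esub> K.diag Y = x"
        using x D tM by (metis K.Mat.m_assoc)+
      then show ?thesis using supp_diag[OF x(1) Y\<Omega>] by simp
    qed
    have sf: "supp Y f" and sd: "supp Y d" using supp_sub fM dM f d1 by auto
    consider "\<forall>x\<in>Y. rsum f x = \<one>\<^bsub>k\<^esub>" | "\<forall>x\<in>Y. rsum f x = \<zero>\<^bsub>k\<^esub>"
      using rsum_idempotent[OF H y0 Y fI _ sf] f by blast
    then show "f = \<zero>\<^bsub>K.Mat\<^esub> \<or> f = t"
    proof cases
      case 1 then show ?thesis using eq[OF fI] f sf by blast
    next
      case 2
      have "rsum d x = \<one>\<^bsub>k\<^esub>" if x: "x \<in> Y" for x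
        using tI(4)[OF x] 2 x rsum_add[OF dM fM, of x] dM unfolding tdf[symmetric] by simp
      then have "d = t" using eq[OF dI d2 d1(2,1)] sd by blast
      then have "f = t \<otimes>\<^bsub>K.Mat\<^esub> f \<ominus>\<^bsub>K.Mat\<^esub> d \<otimes>\<^bsub>K.Mat\<^esub> f \<oplus>\<^bsub>K.Mat\<^esub> d \<otimes>\<^bsub>K.Mat\<^esub> f"
        using d1 f fM by (simp add: a_minus_def)
      then have "f = \<zero>\<^bsub>K.Mat\<^esub>" using \<open>d = t\<close> d1(3) f by simp
      then show ?thesis ..
    qed
  qed
  then show ?thesis using that tI(3,4) by blast
qed

section \<open>Functionals, induced modules and Scott modules\<close>

lemma vsum_hom:
  assumes H: "subgroup H G" and e: "e \<in> Inv H"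
  shows "gmodule_hom k (G\<lparr>carrier := H\<rparr>) (image e) (trivial_module k) vsum"
proof (rule gmodule_homI[OF image_right_module[OF H e] trivial_right_module[OF K.is_cring subgroup_imp_group[OF H]]])
  fix x y assume "x \<in> carrier (image e)" "y \<in> carrier (image e)"
  then show "vsum (x \<oplus>\<^bsub>image e\<^esub> y) = vsum x \<oplus>\<^bsub>trivial_module k\<^esub> vsum y"
    by (simp add: vsum_def K.finsum_addf Pi_iff)
next
  fix a x assume "a \<in> carrier k" "x \<in> carrier (image e)"
  then show "vsum (a \<odot>\<^bsub>image e\<^esub> x) = a \<odot>\<^bsub>trivial_module k\<^esub> vsum x"
    using K.finite_index by (simp add: vsum_def K.finsum_rdistr Pi_iff)
next
  fix x g assume x: "x \<in> carrier (image e)" and g: "g \<in> carrier (G\<lparr>carrier := H\<rparr>)"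
  have gG: "g \<in> carrier G" using g H subgroup.mem_carrier[OF H] by simp
  have xf: "x \<in> fun_space k \<Omega>" using x by simp
  have "vsum (trans x g) = (\<Oplus>\<^bsub>k\<^esub>y\<in>\<Omega>. trans x g (y \<bullet> g))"
    unfolding vsum_def using trans_closed[OF xf gG] gG by (intro sum_dot[symmetric]) simp_all
  also have "\<dots> = vsum x"
    unfolding vsum_def using xf gG by (intro K.finsum_cong' refl) (simp_all add: trans_dot)
  finally show "vsum (x \<star>\<^bsub>image e\<^esub> g) = vsum x \<star>\<^bsub>trivial_module k\<^esub> g" by simp
qed simp_all

text \<open>A functional on the image is a multiple of the sum of the coordinates, because it takes
  the same value on all \<open>vmult (delta x) e\<close> with \<open>x\<close> in the orbit.\<close>

lemma functional_imp_row_sum_one: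
  assumes H: "subgroup H G" and y0: "y0 \<in> \<Omega>" and Y: "Y = (\<lambda>h. y0 \<bullet> h) ` H"
    and e: "e \<in> Inv H" "e \<otimes>\<^bsub>K.Mat\<^esub> e = e" "supp Y e"
    and l: "gmodule_hom k (G\<lparr>carrier := H\<rparr>) (image e) (trivial_module k) l"
    and w: "w \<in> carrier (image e)" "l w \<noteq> \<zero>\<^bsub>k\<^esub>"
    and x: "x \<in> Y"
  shows "rsum e x = \<one>\<^bsub>k\<^esub>"
proof (rule ccontr)
  assume "rsum e x \<noteq> \<one>\<^bsub>k\<^esub>"
  then have r0: "\<And>x. x \<in> Y \<Longrightarrow> rsum e x = \<zero>\<^bsub>k\<^esub>" using rsum_idempotent[OF H y0 Y e] x by blast
  interpret H: subgroup H G by fact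
  interpret l: gmodule_hom k "G\<lparr>carrier := H\<rparr>" "image e" "trivial_module k" l by fact
  have eM: "e \<in> carrier K.Mat" using e(1) by (rule InvD)
  have Y\<Omega>: "Y \<subseteq> \<Omega>" using y0 by (auto simp: Y)
  have wf: "w \<in> fun_space k \<Omega>" "K.vmult w e = w" using w(1) by auto
  \<comment> \<open>As \<open>w\<close> equals its product with \<open>e\<close>, its coordinate sum
    is a linear combination of row sums of \<open>e\<close>.\<close>
  have vsw: "vsum w = \<zero>\<^bsub>k\<^esub>"
  proof -
    have "vsum w = (\<Oplus>\<^bsub>k\<^esub>x\<in>\<Omega>. w x \<otimes>\<^bsub>k\<^esub> rsum e x)" using vsum_vmult[OF wf(1) eM] wf(2) by simp
    also have "\<dots> = (\<Oplus>\<^bsub>k\<^esub>x\<in>\<Omega>. \<zero>\<^bsub>k\<^esub>)"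
    proof (rule K.finsum_cong')
      fix z assume "z \<in> \<Omega>"
      have "rsum e z = \<zero>\<^bsub>k\<^esub>"
      proof (cases "z \<in> Y")
        case False
        then have "rsum e z = (\<Oplus>\<^bsub>k\<^esub>y\<in>\<Omega>. \<zero>\<^bsub>k\<^esub>)"
          unfolding rsum_def using e(3) by (intro K.finsum_cong' refl) (simp_all add: supp_def)
        then show ?thesis by simp
      qed (rule r0)
      then show "w z \<otimes>\<^bsub>k\<^esub> rsum e z = \<zero>\<^bsub>k\<^esub>" using wf(1) by simp
    qed simp_all
    finally show ?thesis by simp
  qed
  define b where "b x = K.vmult (K.delta x) e" for x
  have bI: "b x \<in> carrier (image e)" if "x \<in> \<Omega>" for x
    using that eM e(2) by (simp add: b_def K.vmult_assoc)
  have b_dot: "l (b (y0 \<bullet> h)) = l (b y0)" if h: "h \<in> H" for h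
  proof -
    have "K.delta (y0 \<bullet> h) = trans (K.delta y0) h"
      using h y0 by (intro K.vec_eqI trans_closed K.delta_closed)
        (auto simp: trans_apply K.delta_def dot_inv_eq_iff eq_commute[of y0])
    then have "b (y0 \<bullet> h) = trans (b y0) h" using vmult_trans[OF H _ e(1) h] y0 by (simp add: b_def)
    then show ?thesis using l.f_act[OF bI[OF y0], of h] h by simp
  qed
  have lk: "l (b y0) \<in> carrier k" using l.f_closed[OF bI[OF y0]] by simp
  let ?F = "\<lambda>x. w x \<odot>\<^bsub>image e\<^esub> b x"
  have F: "?F x \<in> carrier (image e)" if "x \<in> \<Omega>" for x
    using l.M.kM.smult_closed[OF K.vecD[OF wf(1)] bI[OF that]] .
  have w0: "w z = \<zero>\<^bsub>k\<^esub>" if "z \<notin> Y" for z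
  proof -
    have "w z = (\<Oplus>\<^bsub>k\<^esub>x\<in>\<Omega>. w x \<otimes>\<^bsub>k\<^esub> e (x, z))" using fun_cong[OF wf(2), of z] by (simp add: K.vmult_def)
    also have "\<dots> = (\<Oplus>\<^bsub>k\<^esub>x\<in>\<Omega>. \<zero>\<^bsub>k\<^esub>)"
      using e(3) that wf(1) by (intro K.finsum_cong' refl) (simp_all add: supp_def)
    finally show ?thesis by simp
  qed
  have "w = finsum (image e) ?F \<Omega>"
  proof
    fix z
    have "finsum (image e) ?F \<Omega> z = (\<Oplus>\<^bsub>k\<^esub>x\<in>\<Omega>. ?F x z)"
      using F by (intro finsum_pointwise l.M.kM.M.abelian_monoid_axioms K.abelian_monoid_axioms
          K.finite_index) (simp_all add: b_def eM wf)
    also have "\<dots> = K.vmult w e z"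
      unfolding K.vmult_def[of w] using wf(1) eM
      by (intro K.finsum_cong' refl) (simp_all add: b_def K.vmult_delta)
    finally show "w z = finsum (image e) ?F \<Omega> z" using wf(2) by simp
  qed
  then have "l w = l (finsum (image e) ?F \<Omega>)" by simp
  also have "\<dots> = (\<Oplus>\<^bsub>k\<^esub>x\<in>\<Omega>. l (?F x))"
    using F by (rule functional_finsum[OF l K.finite_index])
  also have "\<dots> = (\<Oplus>\<^bsub>k\<^esub>x\<in>\<Omega>. w x \<otimes>\<^bsub>k\<^esub> l (b y0))"
  proof (rule K.finsum_cong')
    fix z assume z: "z \<in> \<Omega>"
    have "l (?F z) = w z \<otimes>\<^bsub>k\<^esub> l (b z)" using l.f_smult[OF K.vecD[OF wf(1)] bI[OF z]] by simp
    moreover have "l (b z) \<in> carrier k" using l.f_closed[OF bI[OF z]] by simp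
    ultimately show "l (?F z) = w z \<otimes>\<^bsub>k\<^esub> l (b y0)"
      using w0[of z] b_dot lk by (cases "z \<in> Y") (auto simp: Y)
  qed (use lk wf(1) in simp_all)
  also have "\<dots> = vsum w \<otimes>\<^bsub>k\<^esub> l (b y0)"
    unfolding vsum_def using wf(1) lk K.finite_index by (simp add: K.finsum_ldistr Pi_iff)
  finally show False using vsw lk w(2) by simp
qed

text \<open>With trivial coefficients an element of the induced module is a function constant on the
  right cosets of \<open>D\<close>. Since \<open>D\<close> is the stabilizer of \<open>y0\<close>,
  this is a function on the orbit, the point \<open>y0 \<bullet> h\<close> receiving the value at
  \<open>h\<close>.\<close>

lemma induced_module_image:
  assumes H: "subgroup H G" and y0: "y0 \<in> \<Omega>"
    and Y_def: "Y = (\<lambda>h. y0 \<bullet> h) ` H" and D_def: "D = {h \<in> H. y0 \<bullet> h = y0}"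
    and V_def: "V = induced_module (G\<lparr>carrier := H\<rparr>) D (trivial_module k)"
  obtains \<Phi> where "gmodule_hom k (G\<lparr>carrier := H\<rparr>) V (image (K.diag Y)) \<Phi>"
    "bij_betw \<Phi> (carrier V) (carrier (image (K.diag Y)))" "K.diag Y \<in> Inv H"
proof -
  interpret H: subgroup H G by fact
  have Y\<Omega>: "Y \<subseteq> \<Omega>" using y0 by (auto simp: Y_def)
  have Ydot: "x \<bullet> h \<in> Y \<longleftrightarrow> x \<in> Y" if x: "x \<in> \<Omega>" and h: "h \<in> H" for x h
  proof
    assume "x \<bullet> h \<in> Y"
    then obtain g where g: "g \<in> H" "x \<bullet> h = y0 \<bullet> g" by (auto simp: Y_def)
    have "x = x \<bullet> h \<bullet> inv h" using x h by simp
    then have "x = y0 \<bullet> (g \<otimes> inv h)" using g h y0 by (simp add: dot_mult)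
    then show "x \<in> Y" using g h by (simp add: Y_def)
  next
    assume "x \<in> Y"
    then obtain g where g: "g \<in> H" "x = y0 \<bullet> g" by (auto simp: Y_def)
    then have "x \<bullet> h = y0 \<bullet> (g \<otimes> h)" using h y0 by (simp add: dot_mult)
    then show "x \<bullet> h \<in> Y" using g h by (simp add: Y_def)
  qed
  have dI: "K.diag Y \<in> Inv H" using Y\<Omega> H.subset Ydot by (rule Inv_diag)
  let ?GH = "G\<lparr>carrier := H\<rparr>"
  interpret I: right_module k ?GH "image (K.diag Y)" by (rule image_right_module[OF H dI])
  have I_iff: "v \<in> carrier (image (K.diag Y)) \<longleftrightarrow> v \<in> fun_space k \<Omega> \<and> (\<forall>x. x \<notin> Y \<longrightarrow> v x = \<zero>\<^bsub>k\<^esub>)" for v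
  proof (cases "v \<in> fun_space k \<Omega>")
    case True
    have "K.vmult v (K.diag Y) = v \<longleftrightarrow> (\<forall>x. x \<notin> Y \<longrightarrow> v x = \<zero>\<^bsub>k\<^esub>)"
      using K.vmult_diag[OF True Y\<Omega>] by (auto simp: fun_eq_iff)
    then show ?thesis using True by simp
  qed simp
  have Vc: "carrier V = {f \<in> H \<rightarrow>\<^sub>E carrier k. \<forall>h\<in>D. \<forall>g\<in>H. f (h \<otimes> g) = f g}"
    and Vz: "\<zero>\<^bsub>V\<^esub> = (\<lambda>g\<in>H. \<zero>\<^bsub>k\<^esub>)"
    and Va: "\<And>f f'. f \<oplus>\<^bsub>V\<^esub> f' = (\<lambda>g\<in>H. f g \<oplus>\<^bsub>k\<^esub> f' g)"
    and Vs: "\<And>a f. a \<odot>\<^bsub>V\<^esub> f = (\<lambda>g\<in>H. a \<otimes>\<^bsub>k\<^esub> f g)"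
    and Vact: "\<And>f x. f \<star>\<^bsub>V\<^esub> x = (\<lambda>g\<in>H. f (g \<otimes> inv\<^bsub>?GH\<^esub> x))"
    by (simp_all add: V_def induced_module_def)
  have DH: "d \<in> H" if "d \<in> D" for d using that by (simp add: D_def)
  have Vk: "f h \<in> carrier k" if "f \<in> carrier V" "h \<in> H" for f h using that by (auto simp: Vc)
  have VD: "f (d \<otimes> h) = f h" if "f \<in> carrier V" "d \<in> D" "h \<in> H" for f d h using that by (simp add: Vc)
  have Vext: "f = f'" if "f \<in> carrier V" "f' \<in> carrier V" "\<And>h. h \<in> H \<Longrightarrow> f h = f' h" for f f'
    using that by (intro extensionalityI[of f H f']) (auto simp: Vc PiE_def)
  have VI: "f \<in> carrier V"
    if "f \<in> extensional H" "\<And>h. h \<in> H \<Longrightarrow> f h \<in> carrier k" "\<And>d h. \<lbrakk>d \<in> D; h \<in> H\<rbrakk> \<Longrightarrow> f (d \<otimes> h) = f h" for f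
    unfolding Vc using that by (intro CollectI conjI PiE_I ballI) (auto simp: extensional_def)
  have DHm: "d \<otimes> h \<in> H" if "d \<in> D" "h \<in> H" for d h using that DH by simp
  define \<Phi> where "\<Phi> f = (\<lambda>y. if y \<in> Y then f (SOME h. h \<in> H \<and> y0 \<bullet> h = y) else \<zero>\<^bsub>k\<^esub>)" for f :: "'a \<Rightarrow> 'k"
  have \<Phi>_apply: "\<Phi> f (y0 \<bullet> h) = f h" if f: "f \<in> carrier V" and h: "h \<in> H" for f h
  proof -
    define h' where "h' = (SOME h'. h' \<in> H \<and> y0 \<bullet> h' = y0 \<bullet> h)"
    have "\<exists>h'. h' \<in> H \<and> y0 \<bullet> h' = y0 \<bullet> h" using h by blast
    from someI_ex[OF this] have h': "h' \<in> H" "y0 \<bullet> h' = y0 \<bullet> h" by (simp_all add: h'_def)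
    have "y0 \<bullet> (h' \<otimes> inv h) = y0" using h h' y0 by (simp add: dot_mult)
    then have "h' \<otimes> inv h \<in> D" using h h' by (simp add: D_def)
    then have "f (h' \<otimes> inv h \<otimes> h) = f h" using VD f h by blast
    then have "f h' = f h" using h h' by (simp add: m_assoc)
    moreover have "y0 \<bullet> h \<in> Y" using h by (simp add: Y_def)
    ultimately show ?thesis by (simp add: \<Phi>_def h'_def[symmetric])
  qed
  have \<Phi>_out: "\<Phi> f y = \<zero>\<^bsub>k\<^esub>" if "y \<notin> Y" for f y using that by (simp add: \<Phi>_def)
  have \<Phi>_eq: "\<Phi> f = v" if f: "f \<in> carrier V" and v: "\<And>y. y \<notin> Y \<Longrightarrow> v y = \<zero>\<^bsub>k\<^esub>" "\<And>h. h \<in> H \<Longrightarrow> v (y0 \<bullet> h) = f h" for f v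
  proof
    fix y show "\<Phi> f y = v y"
    proof (cases "y \<in> Y")
      case True
      then obtain h where "h \<in> H" "y = y0 \<bullet> h" by (auto simp: Y_def)
      then show ?thesis using \<Phi>_apply[OF f] v(2) by simp
    qed (use v \<Phi>_out in simp)
  qed
  have \<Phi>I: "\<Phi> f \<in> carrier (image (K.diag Y))" if f: "f \<in> carrier V" for f
  proof -
    have "\<Phi> f y \<in> carrier k" for y
    proof (cases "y \<in> Y")
      case True
      then obtain h where "h \<in> H" "y = y0 \<bullet> h" by (auto simp: Y_def)
      then show ?thesis using \<Phi>_apply[OF f] Vk[OF f] by simp
    qed (simp add: \<Phi>_out)
    then have "\<Phi> f \<in> fun_space k \<Omega>" using \<Phi>_out Y\<Omega> by (intro fun_spaceI) auto
    then show ?thesis using \<Phi>_out by (simp only: I_iff) blast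
  qed
  have inj: "inj_on \<Phi> (carrier V)"
  proof (rule inj_onI)
    fix f f' assume f: "f \<in> carrier V" "f' \<in> carrier V" "\<Phi> f = \<Phi> f'"
    show "f = f'" using \<Phi>_apply[OF f(1)] \<Phi>_apply[OF f(2)] f(3) by (intro Vext f(1,2)) metis
  qed
  have add: "f \<oplus>\<^bsub>V\<^esub> f' \<in> carrier V \<and> \<Phi> (f \<oplus>\<^bsub>V\<^esub> f') = \<Phi> f \<oplus>\<^bsub>image (K.diag Y)\<^esub> \<Phi> f'"
    if f: "f \<in> carrier V" "f' \<in> carrier V" for f f'
  proof
    show c: "f \<oplus>\<^bsub>V\<^esub> f' \<in> carrier V"
      unfolding Va by (rule VI) (simp_all add: Vk[OF f(1)] Vk[OF f(2)] VD[OF f(1)] VD[OF f(2)] DHm)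
    show "\<Phi> (f \<oplus>\<^bsub>V\<^esub> f') = \<Phi> f \<oplus>\<^bsub>image (K.diag Y)\<^esub> \<Phi> f'"
      by (rule \<Phi>_eq[OF c]) (simp_all add: \<Phi>_out \<Phi>_apply[OF f(1)] \<Phi>_apply[OF f(2)] Va)
  qed
  have smult: "a \<odot>\<^bsub>V\<^esub> f \<in> carrier V \<and> \<Phi> (a \<odot>\<^bsub>V\<^esub> f) = a \<odot>\<^bsub>image (K.diag Y)\<^esub> \<Phi> f"
    if f: "a \<in> carrier k" "f \<in> carrier V" for a f
  proof
    show c: "a \<odot>\<^bsub>V\<^esub> f \<in> carrier V"
      unfolding Vs by (rule VI) (simp_all add: Vk[OF f(2)] VD[OF f(2)] DHm f(1))
    show "\<Phi> (a \<odot>\<^bsub>V\<^esub> f) = a \<odot>\<^bsub>image (K.diag Y)\<^esub> \<Phi> f"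
      by (rule \<Phi>_eq[OF c]) (simp_all add: \<Phi>_out \<Phi>_apply[OF f(2)] Vs f)
  qed
  have actV: "f \<star>\<^bsub>V\<^esub> x \<in> carrier V \<and> \<Phi> (f \<star>\<^bsub>V\<^esub> x) = \<Phi> f \<star>\<^bsub>image (K.diag Y)\<^esub> x"
    if f: "f \<in> carrier V" "x \<in> carrier ?GH" for f x
  proof
    have x: "x \<in> H" using f by simp
    have ix: "inv\<^bsub>?GH\<^esub> x = inv x" using x H by (simp add: m_inv_consistent)
    have "f (d \<otimes> h \<otimes> inv x) = f (h \<otimes> inv x)" if "d \<in> D" "h \<in> H" for d h
      using VD[OF f(1) that(1), of "h \<otimes> inv x"] that x DH by (simp add: m_assoc)
    then show c: "f \<star>\<^bsub>V\<^esub> x \<in> carrier V"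
      unfolding Vact ix using x by (intro VI) (simp_all add: Vk[OF f(1)] DHm)
    show "\<Phi> (f \<star>\<^bsub>V\<^esub> x) = \<Phi> f \<star>\<^bsub>image (K.diag Y)\<^esub> x"
    proof (rule \<Phi>_eq[OF c])
      fix y assume y: "y \<notin> Y"
      show "(\<Phi> f \<star>\<^bsub>image (K.diag Y)\<^esub> x) y = \<zero>\<^bsub>k\<^esub>"
      proof (cases "y \<in> \<Omega>")
        case True
        then have "y \<bullet> inv x \<notin> Y" using y Ydot[of y "inv x"] x by simp
        then show ?thesis by (simp add: trans_apply \<Phi>_out)
      qed (simp add: trans_apply)
    next
      fix h assume h: "h \<in> H"
      have "y0 \<bullet> h \<bullet> inv x = y0 \<bullet> (h \<otimes> inv x)" using h x y0 by (simp add: dot_mult)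
      then show "(\<Phi> f \<star>\<^bsub>image (K.diag Y)\<^esub> x) (y0 \<bullet> h) = (f \<star>\<^bsub>V\<^esub> x) h"
        using h x y0 \<Phi>_apply[OF f(1), of "h \<otimes> inv x"] by (simp add: trans_apply Vact ix)
    qed
  qed
  have zV: "\<zero>\<^bsub>V\<^esub> \<in> carrier V" unfolding Vz by (rule VI) (simp_all add: DHm)
  have z2: "\<Phi> \<zero>\<^bsub>V\<^esub> = \<zero>\<^bsub>image (K.diag Y)\<^esub>" by (rule \<Phi>_eq[OF zV]) (simp_all add: Vz)
  have VR: "right_module k ?GH V"
  proof (rule right_module_inj_transport[OF I.right_module_axioms, where f = \<Phi>])
    show "\<Phi> \<in> carrier V \<rightarrow> carrier (image (K.diag Y))" using \<Phi>I by (rule Pi_I)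
  qed (fact inj add zV smult actV z2)+
  have "gmodule_hom k ?GH V (image (K.diag Y)) \<Phi>"
    by (intro gmodule_homI VR I.right_module_axioms \<Phi>I conjunct2[OF add] conjunct2[OF smult] conjunct2[OF actV])
  moreover have "bij_betw \<Phi> (carrier V) (carrier (image (K.diag Y)))"
    unfolding bij_betw_def
  proof (intro conjI inj subset_antisym subsetI)
    fix v assume "v \<in> \<Phi> ` carrier V" then show "v \<in> carrier (image (K.diag Y))" using \<Phi>I by blast
  next
    fix v assume "v \<in> carrier (image (K.diag Y))"
    then have v: "v \<in> fun_space k \<Omega>" "\<And>y. y \<notin> Y \<Longrightarrow> v y = \<zero>\<^bsub>k\<^esub>" using I_iff by blast+
    have c: "(\<lambda>h\<in>H. v (y0 \<bullet> h)) \<in> carrier V"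
      using v(1) DH y0 by (auto simp: Vc dot_mult) (simp add: D_def)
    have "\<Phi> (\<lambda>h\<in>H. v (y0 \<bullet> h)) = v" by (rule \<Phi>_eq[OF c]) (simp_all add: v(2))
    then show "v \<in> \<Phi> ` carrier V" using c by (metis image_eqI)
  qed
  ultimately show ?thesis using that dI by blast
qed

text \<open>\<open>scott_module\<close> is a choice, so some summand meeting the conditions must be
  exhibited first; a primitive idempotent with row sums one supplies it. The summand actually chosen
  may be a different one, but its trivial top provides a functional, and this forces row sums one
  for its own idempotent.\<close>

lemma scott_module_image:
  assumes H: "subgroup H G" and y0: "y0 \<in> \<Omega>"
    and Y_def: "Y = (\<lambda>h. y0 \<bullet> h) ` H" and D_def: "D = {h \<in> H. y0 \<bullet> h = y0}"
  obtains t where "primitive H t" "supp Y t" "\<And>x. x \<in> Y \<Longrightarrow> rsum t x = \<one>\<^bsub>k\<^esub>"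
    "right_module k (G\<lparr>carrier := H\<rparr>) (scott_module k (G\<lparr>carrier := H\<rparr>) D)"
    "isomorphic k (G\<lparr>carrier := H\<rparr>) (scott_module k (G\<lparr>carrier := H\<rparr>) D) (image t)"
proof -
  let ?GH = "G\<lparr>carrier := H\<rparr>"
  interpret H: subgroup H G by fact
  define V where "V = induced_module ?GH D (trivial_module k)"
  obtain \<Phi> where \<Phi>: "gmodule_hom k ?GH V (image (K.diag Y)) \<Phi>"
    "bij_betw \<Phi> (carrier V) (carrier (image (K.diag Y)))" and dI: "K.diag Y \<in> Inv H"
    using induced_module_image[OF H y0 Y_def D_def V_def] by blast
  interpret \<Phi>: gmodule_hom k ?GH V "image (K.diag Y)" \<Phi> by fact
  have Y\<Omega>: "Y \<subseteq> \<Omega>" using y0 by (auto simp: Y_def)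
  have y0Y: "y0 \<in> Y" using y0 H.one_closed dot_one[OF y0] unfolding Y_def by (metis image_eqI)
  have did: "K.diag Y \<otimes>\<^bsub>K.Mat\<^esub> K.diag Y = K.diag Y" by (rule diag_idem[OF Y\<Omega>])
  define P where "P S \<longleftrightarrow> direct_summand k ?GH V S \<and> indecomposable k ?GH (V\<lparr>carrier := S\<rparr>) \<and>
    has_trivial_top k ?GH (V\<lparr>carrier := S\<rparr>)" for S
  define S where "S = (SOME S. P S)"
  have scott: "scott_module k ?GH D = V\<lparr>carrier := S\<rparr>"
    unfolding scott_module_def V_def[symmetric] Let_def S_def P_def has_trivial_top_def by simp
  have iso: "gmodule_hom k ?GH (V\<lparr>carrier := S\<rparr>) (image f) \<Phi>" "bij_betw \<Phi> S (carrier (image f))"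
    if S: "direct_summand k ?GH V S" and T: "direct_summand k ?GH (image (K.diag Y)) (carrier (image f))"
      and eq: "\<And>x. x \<in> carrier V \<Longrightarrow> x \<in> S \<longleftrightarrow> \<Phi> x \<in> carrier (image f)" for S f
  proof -
    have "gsubmodule k ?GH V S" "gsubmodule k ?GH (image (K.diag Y)) (carrier (image f))"
      using S T by (auto simp: direct_summand_def)
    note r = \<Phi>.restrict_isomorphic[OF \<Phi>(2) this eq]
    have "image (K.diag Y)\<lparr>carrier := carrier (image f)\<rparr> = image f" by (simp add: image_def)
    then show "gmodule_hom k ?GH (V\<lparr>carrier := S\<rparr>) (image f) \<Phi>" "bij_betw \<Phi> S (carrier (image f))"
      using r by simp_all
  qed
  have "\<exists>S. P S"
  proof -
    obtain t where t: "primitive H t" "supp Y t" "\<And>x. x \<in> Y \<Longrightarrow> rsum t x = \<one>\<^bsub>k\<^esub>"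
      using exists_primitive_row_sum_one[OF H y0] unfolding Y_def by metis
    have tI: "t \<in> Inv H" "t \<otimes>\<^bsub>K.Mat\<^esub> t = t" using t(1) by (auto simp: primitive_def)
    have tM: "t \<in> carrier K.Mat" using tI(1) by (rule InvD)
    have dt: "K.diag Y \<otimes>\<^bsub>K.Mat\<^esub> t = t" "t \<otimes>\<^bsub>K.Mat\<^esub> K.diag Y = t" using t(2) supp_diag[OF tM Y\<Omega>] by auto
    have T: "direct_summand k ?GH (image (K.diag Y)) (carrier (image t))"
      by (rule idempotent_imp_summand[OF H dI did tI dt])
    define S0 where "S0 = {x \<in> carrier V. \<Phi> x \<in> carrier (image t)}"
    have S0: "direct_summand k ?GH V S0" unfolding S0_def by (rule \<Phi>.direct_summand_vimage[OF \<Phi>(2) T])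
    have eq: "x \<in> S0 \<longleftrightarrow> \<Phi> x \<in> carrier (image t)" if "x \<in> carrier V" for x using that by (simp add: S0_def)
    note i = iso[OF S0 T eq]
    interpret \<phi>: gmodule_hom k ?GH "V\<lparr>carrier := S0\<rparr>" "image t" \<Phi> by (rule i(1))
    have isoT: "isomorphic k ?GH (V\<lparr>carrier := S0\<rparr>) (image t)"
      using isomorphic_iff_hom[OF \<phi>.M.right_module_axioms \<phi>.N.right_module_axioms] i by auto
    have ind: "indecomposable k ?GH (V\<lparr>carrier := S0\<rparr>)"
      using indecomposable_image_iff[OF H tI] t(1)
        indecomposable_isomorphic[OF \<phi>.M.right_module_axioms \<phi>.N.right_module_axioms isoT] by simp
    have lh: "gmodule_hom k ?GH (V\<lparr>carrier := S0\<rparr>) (trivial_module k) (\<lambda>x. vsum (\<Phi> x))"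
      by (rule gmodule_hom_compose[OF i(1) vsum_hom[OF H tI(1)]])
    \<comment> \<open>The row of \<open>y0\<close> is a vector with coordinate sum one, so the
      functional \<open>vsum\<close> does not vanish on the image of \<open>t\<close>.\<close>
    define w where "w = K.vmult (K.delta y0) t"
    have wI: "w \<in> carrier (image t)" using y0 tM tI(2) by (simp add: w_def K.vmult_assoc)
    have "vsum w = rsum t y0" using y0 tM by (simp add: vsum_def rsum_def w_def K.vmult_delta)
    then have w1: "vsum w = \<one>\<^bsub>k\<^esub>" using t(3)[OF y0Y] by simp
    have "w \<in> \<Phi> ` S0" using i(2) wI unfolding bij_betw_def by simp
    then obtain x where x: "x \<in> S0" "\<Phi> x = w" by auto
    obtain \<mu> :: "('x \<Rightarrow> 'k) set \<Rightarrow> nat" where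
      \<mu>: "\<And>A B. \<lbrakk>subspace k \<Omega> A; subspace k \<Omega> B; A \<subset> B\<rbrakk> \<Longrightarrow> \<mu> A < \<mu> B"
      using K.subspace_measure[OF K.finite_index] by metis
    have sub: "subspace k \<Omega> (\<Phi> ` A)" "A \<subseteq> S0" if A: "gsubmodule k ?GH (V\<lparr>carrier := S0\<rparr>) A" for A
    proof -
      note g = \<phi>.N.gsubmoduleD[OF \<phi>.gsubmodule_image[OF A]]
      show "subspace k \<Omega> (\<Phi> ` A)"
        unfolding subspace_def using g(1,2,3,6) by (simp add: subset_iff)
      show "A \<subseteq> S0" using \<phi>.M.gsubmoduleD(1)[OF A] by simp
    qed
    have "has_trivial_top k ?GH (V\<lparr>carrier := S0\<rparr>)"
    proof (rule \<phi>.M.functional_imp_trivial_top[OF K.field_axioms lh, where x = x and \<mu> = "\<lambda>A. \<mu> (\<Phi> ` A)"])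
      show "x \<in> carrier (V\<lparr>carrier := S0\<rparr>)" "vsum (\<Phi> x) \<noteq> \<zero>\<^bsub>k\<^esub>" using x w1 by simp_all
      fix A B assume A: "gsubmodule k ?GH (V\<lparr>carrier := S0\<rparr>) A"
        and B: "gsubmodule k ?GH (V\<lparr>carrier := S0\<rparr>) B" and AB: "A \<subset> B"
      have "inj_on \<Phi> S0" using i(2) by (simp add: bij_betw_def)
      then have "\<Phi> ` A \<subset> \<Phi> ` B"
        using AB sub(2)[OF A] sub(2)[OF B] by (metis image_mono inj_on_image_eq_iff psubset_eq)
      then show "\<mu> (\<Phi> ` A) < \<mu> (\<Phi> ` B)" by (rule \<mu>[OF sub(1)[OF A] sub(1)[OF B]])
    qed
    then have "P S0" using S0 ind by (simp add: P_def)
    then show ?thesis ..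
  qed
  then have "P S" unfolding S_def by (rule someI_ex)
  then have S: "direct_summand k ?GH V S" "indecomposable k ?GH (V\<lparr>carrier := S\<rparr>)"
    "has_trivial_top k ?GH (V\<lparr>carrier := S\<rparr>)" by (simp_all add: P_def)
  \<comment> \<open>The summand actually chosen is carried over to the orbit module, where it
    becomes the image of an idempotent.\<close>
  define \<Psi> where "\<Psi> = inv_into (carrier V) \<Phi>"
  have \<Psi>: "gmodule_hom k ?GH (image (K.diag Y)) V \<Psi>" unfolding \<Psi>_def by (rule \<Phi>.inverse[OF \<Phi>(2)])
  have \<Psi>b: "bij_betw \<Psi> (carrier (image (K.diag Y))) (carrier V)"
    unfolding \<Psi>_def by (rule bij_betw_inv_into[OF \<Phi>(2)])
  define T where "T = {v \<in> carrier (image (K.diag Y)). \<Psi> v \<in> S}"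
  have T: "direct_summand k ?GH (image (K.diag Y)) T"
    unfolding T_def by (rule gmodule_hom.direct_summand_vimage[OF \<Psi> \<Psi>b S(1)])
  obtain f where f: "f \<in> Inv H" "f \<otimes>\<^bsub>K.Mat\<^esub> f = f" "K.diag Y \<otimes>\<^bsub>K.Mat\<^esub> f = f" "f \<otimes>\<^bsub>K.Mat\<^esub> K.diag Y = f"
    "T = carrier (image f)" using summand_imp_idempotent[OF H dI did T] by blast
  have fM: "f \<in> carrier K.Mat" using f(1) by (rule InvD)
  have eq: "x \<in> S \<longleftrightarrow> \<Phi> x \<in> carrier (image f)" if x: "x \<in> carrier V" for x
  proof -
    have "\<Psi> (\<Phi> x) = x" using x \<Phi>(2) by (simp add: \<Psi>_def bij_betw_def)
    then show ?thesis using \<Phi>.f_closed[OF x] unfolding f(5)[symmetric] T_def by (simp del: image_simps)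
  qed
  note i = iso[OF S(1) T[unfolded f(5)] eq]
  interpret \<phi>: gmodule_hom k ?GH "V\<lparr>carrier := S\<rparr>" "image f" \<Phi> by (rule i(1))
  have isoS: "isomorphic k ?GH (V\<lparr>carrier := S\<rparr>) (image f)"
    using isomorphic_iff_hom[OF \<phi>.M.right_module_axioms \<phi>.N.right_module_axioms] i by auto
  have pf: "primitive H f"
    using indecomposable_image_iff[OF H f(1,2)] S(2)
      indecomposable_isomorphic[OF \<phi>.M.right_module_axioms \<phi>.N.right_module_axioms isoS] by simp
  have sf: "supp Y f" using f(3,4) supp_diag[OF fM Y\<Omega>] by simp
  obtain l x where l: "gmodule_hom k ?GH (V\<lparr>carrier := S\<rparr>) (trivial_module k) l" "x \<in> S" "l x \<noteq> \<zero>\<^bsub>k\<^esub>"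
    using \<phi>.M.trivial_top_imp_functional[OF K.one_not_zero S(3)] by auto
  have bS: "bij_betw \<Phi> (carrier (V\<lparr>carrier := S\<rparr>)) (carrier (image f))" using i(2) by simp
  have lh: "gmodule_hom k ?GH (image f) (trivial_module k) (\<lambda>v. l (inv_into S \<Phi> v))"
    using gmodule_hom_compose[OF \<phi>.inverse[OF bS] l(1)] by simp
  have "inv_into S \<Phi> (\<Phi> x) = x" using l(2) i(2) by (simp add: bij_betw_def)
  then have lw: "l (inv_into S \<Phi> (\<Phi> x)) \<noteq> \<zero>\<^bsub>k\<^esub>" using l(3) by simp
  have w: "\<Phi> x \<in> carrier (image f)" using l(2) \<phi>.f_closed by simp
  have rs: "rsum f y = \<one>\<^bsub>k\<^esub>" if "y \<in> Y" for y
    using functional_imp_row_sum_one[OF H y0 Y_def f(1,2) sf lh w lw that] .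
  show ?thesis
    using that[OF pf sf rs] \<phi>.M.right_module_axioms isoS unfolding scott by blast
qed

end

section \<open>Brauer indecomposability in terms of idempotents\<close>

context finite_action
begin

lemma sum_zero_if_orbit_sums_zero:
  assumes N: "subgroup N G" and Y: "Y \<subseteq> \<Omega>" "\<And>x n. \<lbrakk>x \<in> Y; n \<in> N\<rbrakk> \<Longrightarrow> x \<bullet> n \<in> Y"
    and F: "\<And>x. x \<in> \<Omega> \<Longrightarrow> F x \<in> carrier k"
    and zero: "\<And>x. x \<in> Y \<Longrightarrow> (\<Oplus>\<^bsub>k\<^esub>y\<in>(\<lambda>n. x \<bullet> n) ` N. F y) = \<zero>\<^bsub>k\<^esub>"
  shows "(\<Oplus>\<^bsub>k\<^esub>y\<in>Y. F y) = \<zero>\<^bsub>k\<^esub>"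
proof -
  interpret N: right_action "G\<lparr>carrier := N\<rparr>" \<Omega> dot using N by (rule subgroup_action)
  have fin: "finite Y" using Y(1) K.finite_index by (rule finite_subset)
  show ?thesis
  proof (rule N.stable_induct[OF fin Y(1)])
    fix x Z assume x: "x \<in> Y" and Z: "Z \<subseteq> Y"
      "(\<lambda>g. x \<bullet> g) ` carrier (G\<lparr>carrier := N\<rparr>) \<inter> Z = {}"
      "(\<lambda>g. x \<bullet> g) ` carrier (G\<lparr>carrier := N\<rparr>) \<subseteq> Y" "(\<Oplus>\<^bsub>k\<^esub>y\<in>Z. F y) = \<zero>\<^bsub>k\<^esub>"
    have "finite Z" "finite ((\<lambda>g. x \<bullet> g) ` N)" using Z(1,3) fin finite_subset by auto
    moreover have "F \<in> Z \<rightarrow> carrier k" "F \<in> (\<lambda>g. x \<bullet> g) ` N \<rightarrow> carrier k" using F Z(1,3) Y(1) by auto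
    ultimately show "(\<Oplus>\<^bsub>k\<^esub>y\<in>(\<lambda>g. x \<bullet> g) ` carrier (G\<lparr>carrier := N\<rparr>) \<union> Z. F y) = \<zero>\<^bsub>k\<^esub>"
      using Z(2,4) zero[OF x] by (simp add: K.finsum_Un_disjoint)
  qed (use Y(2) in simp_all)
qed

end

context p_action
begin

lemma br_minus: "\<lbrakk>a \<in> carrier K.Mat; b \<in> carrier K.Mat\<rbrakk>
    \<Longrightarrow> br Q (a \<ominus>\<^bsub>K.Mat\<^esub> b) = br Q a \<ominus>\<^bsub>K.Mat\<^esub> br Q b"
  using br_add[of Q "a \<ominus>\<^bsub>K.Mat\<^esub> b" b]
  by (simp add: a_minus_def K.Mat.a_assoc K.Mat.l_neg K.Mat.r_neg)

text \<open>The row sums of the powers are the powers of \<open>c\<close>, so a non-zero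
  \<open>c\<close> excludes nilpotence.\<close>

lemma rsum_pow:
  assumes g: "g \<in> carrier K.Mat" "supp Y g" and c: "\<And>x. x \<in> Y \<Longrightarrow> rsum g x = c" "c \<in> carrier k" "c \<noteq> \<zero>\<^bsub>k\<^esub>"
    and y: "y \<in> Y"
  shows "g [^]\<^bsub>K.Mat\<^esub> (n::nat) \<noteq> \<zero>\<^bsub>K.Mat\<^esub>"
proof
  have "rsum (g [^]\<^bsub>K.Mat\<^esub> Suc n) x = c [^]\<^bsub>k\<^esub> Suc n" if "x \<in> Y" for x n
    using that
  proof (induction n arbitrary: x)
    case (Suc n)
    have "g [^]\<^bsub>K.Mat\<^esub> Suc (Suc n) = g \<otimes>\<^bsub>K.Mat\<^esub> g [^]\<^bsub>K.Mat\<^esub> Suc n"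
      using g(1) K.Mat.nat_pow_mult[of g 1 "Suc n"] by simp
    then show ?case
      using rsum_mult_const[OF g, of "g [^]\<^bsub>K.Mat\<^esub> Suc n" "c [^]\<^bsub>k\<^esub> Suc n" x] Suc g(1) c K.nat_pow_mult[of c 1 "Suc n"]
      by simp
  qed (use g c in simp)
  moreover assume "g [^]\<^bsub>K.Mat\<^esub> n = \<zero>\<^bsub>K.Mat\<^esub>"
  then have "g [^]\<^bsub>K.Mat\<^esub> Suc n = \<zero>\<^bsub>K.Mat\<^esub>" using g(1) by simp
  ultimately have "c [^]\<^bsub>k\<^esub> Suc n = rsum \<zero>\<^bsub>K.Mat\<^esub> y" using y by metis
  then have "c [^]\<^bsub>k\<^esub> Suc n = \<zero>\<^bsub>k\<^esub>" by (simp add: rsum_def K.Mat_simps)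
  moreover have "c [^]\<^bsub>k\<^esub> m \<noteq> \<zero>\<^bsub>k\<^esub>" for m :: nat
    by (induction m) (use c K.integral in auto)
  ultimately show False by blast
qed

text \<open>What saturation says about a fully normalized \<open>Q\<close> when \<open>y0\<close> is
  the coset \<open>P\<close>: up to conjugation in the normalizer of \<open>Q\<close>, the
  stabilizer of \<open>y0\<close> there contains the stabilizers of all fixed points of
  \<open>Q\<close>.\<close>

definition dominant :: "'a set \<Rightarrow> 'x \<Rightarrow> bool" where
  "dominant Q y0 \<longleftrightarrow> y0 \<in> fixed Q \<and> (\<forall>x\<in>fixed Q. \<exists>n\<in>normalizer G Q.
     \<forall>l\<in>normalizer G Q. x \<bullet> l = x \<longrightarrow> y0 \<bullet> n \<bullet> l = y0 \<bullet> n)"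

text \<open>The image of \<open>t\<close> is a Scott module of the normalizer \<open>N\<close> of \<open>Q\<close>. The row sum of \<open>e\<close> at
  \<open>y0\<close> is the sum of its parts on the \<open>N\<close>-orbits that contain a fixed point of the stabilizer
  of \<open>y0\<close> in \<open>N\<close>. One of these parts does not vanish, and its orbit is isomorphic to that of
  \<open>y0\<close> by dominance. Hence the composite of \<open>t\<close>, \<open>br Q e\<close>, the isomorphism of the orbits and
  \<open>t\<close> has non-zero row sums, so that it is not nilpotent.\<close>

lemma scott_factorization:
  assumes Q: "p_subgroup p G Q" and e: "e \<in> Inv (carrier G)" "e \<otimes>\<^bsub>K.Mat\<^esub> e = e" "rsum e y0 = \<one>\<^bsub>k\<^esub>"
    and dom: "dominant Q y0" and N_def: "N = normalizer G Q"
    and D: "p_subgroup p G {n \<in> N. y0 \<bullet> n = y0}"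
    and Y_def: "Y = (\<lambda>n. y0 \<bullet> n) ` N"
    and t: "primitive N t" "supp Y t" "\<And>x. x \<in> Y \<Longrightarrow> rsum t x = \<one>\<^bsub>k\<^esub>"
  obtains a b where "a \<in> Inv N" "b \<in> Inv N" "t \<otimes>\<^bsub>K.Mat\<^esub> a = a" "a \<otimes>\<^bsub>K.Mat\<^esub> br Q e = a"
    "br Q e \<otimes>\<^bsub>K.Mat\<^esub> b = b" "b \<otimes>\<^bsub>K.Mat\<^esub> t = b" "a \<otimes>\<^bsub>K.Mat\<^esub> b = t"
proof -
  define D where "D = {n \<in> N. y0 \<bullet> n = y0}"
  have Dp: "p_subgroup p G D" using D by (simp add: D_def)
  have QG: "subgroup Q G" using Q by (simp add: p_subgroup_def)
  interpret Q: subgroup Q G by fact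
  have N: "subgroup N G" unfolding N_def using Q.subset by (rule subgroup_normalizer)
  interpret N: subgroup N G by fact
  have QN: "Q \<subseteq> N" unfolding N_def using QG by (rule subset_normalizer)
  have y0: "y0 \<in> fixed Q" "y0 \<in> \<Omega>" using dom by (auto simp: dominant_def fixed_def)
  have QD: "Q \<subseteq> D" using QN y0(1) by (auto simp: D_def fixed_def)
  have DN: "D \<subseteq> N" by (auto simp: D_def)
  have eM: "e \<in> carrier K.Mat" using e(1) by (rule InvD)
  have tI: "t \<in> Inv N" "t \<otimes>\<^bsub>K.Mat\<^esub> t = t" using t(1) by (auto simp: primitive_def)
  have tM: "t \<in> carrier K.Mat" using tI(1) by (rule InvD)
  have eQ: "e \<in> Inv Q" and eN: "e \<in> Inv N" and eD: "e \<in> Inv D"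
    using e(1) Inv_mono[OF Q.subset] Inv_mono[OF N.subset] Inv_mono[OF order_trans[OF DN N.subset]] by blast+
  define E where "E = br Q e"
  have EN: "E \<in> Inv N" unfolding E_def using eN Q.subset by (rule br_Inv) (simp add: N_def)
  have EM: "E \<in> carrier K.Mat" using EN by (rule InvD)
  have EE: "E \<otimes>\<^bsub>K.Mat\<^esub> E = E" unfolding E_def using br_mult[OF Q eQ eQ] e(2) by simp
  have y0Y: "y0 \<in> Y" unfolding Y_def using y0(2) by (intro image_eqI[of _ _ \<one>]) simp_all
  have Y\<Omega>: "Y \<subseteq> \<Omega>" using y0 by (auto simp: Y_def)
  define orb where "orb y = (\<lambda>n. y \<bullet> n) ` N" for y
  have fDQ: "fixed D \<subseteq> fixed Q" using QD by (auto simp: fixed_def)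
  have orb_self: "y \<in> orb y" if "y \<in> \<Omega>" for y
    unfolding orb_def using that by (intro image_eqI[of _ _ \<one>]) simp_all
  have orb_fixed: "orb y \<subseteq> fixed Q" if "y \<in> fixed Q" for y
    using that fixed_normalizer[OF Q.subset] by (auto simp: orb_def N_def fixed_def)
  \<comment> \<open>The row sum of \<open>e\<close> at \<open>y0\<close> and its part on the union
    \<open>U\<close> of the orbits through fixed points of \<open>D\<close> both reduce modulo
    \<open>p\<close> to the same sum over \<open>fixed D\<close>. Hence the part on \<open>U\<close>
    is one, and not every orbit in \<open>U\<close> can contribute zero.\<close>
  have "\<exists>y1\<in>fixed D. (\<Oplus>\<^bsub>k\<^esub>z\<in>orb y1. e (y0, z)) \<noteq> \<zero>\<^bsub>k\<^esub>"
  proof (rule ccontr)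
    assume "\<not> (\<exists>y1\<in>fixed D. (\<Oplus>\<^bsub>k\<^esub>z\<in>orb y1. e (y0, z)) \<noteq> \<zero>\<^bsub>k\<^esub>)"
    then have zero: "(\<Oplus>\<^bsub>k\<^esub>z\<in>orb y. e (y0, z)) = \<zero>\<^bsub>k\<^esub>" if "y \<in> fixed D" for y using that by blast
    define U where "U = (\<Union>y\<in>fixed D. orb y)"
    have U\<Omega>: "U \<subseteq> \<Omega>" by (auto simp: U_def orb_def fixed_def)
    have orb_eq: "orb (y \<bullet> n) = orb y" if "y \<in> \<Omega>" "n \<in> N" for y n
    proof -
      have "y \<bullet> n \<bullet> m \<in> orb y" if "m \<in> N" for m
        using that \<open>y \<in> \<Omega>\<close> \<open>n \<in> N\<close> by (auto simp: orb_def simp flip: dot_mult)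
      moreover have "y \<bullet> m \<in> orb (y \<bullet> n)" if m: "m \<in> N" for m
      proof -
        have "y \<bullet> m = y \<bullet> n \<bullet> (inv n \<otimes> m)" using m that \<open>y \<in> \<Omega>\<close> \<open>n \<in> N\<close> by (simp add: dot_mult)
        then show ?thesis using m \<open>n \<in> N\<close> by (auto simp: orb_def)
      qed
      ultimately show ?thesis by (auto simp: orb_def)
    qed
    have Ustab: "x \<bullet> n \<in> U" if x: "x \<in> U" and "n \<in> N" for x n
    proof -
      obtain y where y: "y \<in> fixed D" "x \<in> orb y" using x by (auto simp: U_def)
      have y\<Omega>: "y \<in> \<Omega>" using y by (simp add: fixed_def)
      obtain m where m: "m \<in> N" "x = y \<bullet> m" using y by (auto simp: orb_def)
      then have "x \<bullet> n = y \<bullet> (m \<otimes> n)" using that y\<Omega> by (simp add: dot_mult)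
      then have "x \<bullet> n \<in> orb y" using m that by (auto simp: orb_def)
      then show ?thesis using y by (auto simp: U_def)
    qed
    have "(\<Oplus>\<^bsub>k\<^esub>z\<in>U. e (y0, z)) = \<zero>\<^bsub>k\<^esub>"
    proof (rule sum_zero_if_orbit_sums_zero[OF N U\<Omega> Ustab])
      show "(\<Oplus>\<^bsub>k\<^esub>y\<in>(\<lambda>n. x \<bullet> n) ` N. e (y0, y)) = \<zero>\<^bsub>k\<^esub>" if x: "x \<in> U" for x
      proof -
        obtain y m where y: "y \<in> fixed D" "m \<in> N" "x = y \<bullet> m" using x by (auto simp: U_def orb_def)
        then have "orb x = orb y" using orb_eq by (simp add: fixed_def)
        then show ?thesis using zero[OF y(1)] by (simp add: orb_def)
      qed
    qed (use eM in simp_all)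
    moreover have "(\<Oplus>\<^bsub>k\<^esub>z\<in>U. e (y0, z)) = \<one>\<^bsub>k\<^esub>"
    proof -
      let ?F = "\<lambda>z. if z \<in> U then e (y0, z) else \<zero>\<^bsub>k\<^esub>"
      have edot: "e (y0, z \<bullet> d) = e (y0, z)" if "z \<in> \<Omega>" "d \<in> D" for z d
        using Inv_dot[OF eD that(2) y0(2) that(1)] that by (simp add: D_def)
      have "(\<Oplus>\<^bsub>k\<^esub>z\<in>U. e (y0, z)) = (\<Oplus>\<^bsub>k\<^esub>z\<in>\<Omega>. ?F z)"
        using U\<Omega> eM K.finite_index by (intro K.add.finprod_mono_neutral_cong_left) auto
      also have "\<dots> = (\<Oplus>\<^bsub>k\<^esub>z\<in>fixed D. ?F z)"
      proof (rule p_sum_fixed[OF Dp])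
        fix z d assume z: "z \<in> \<Omega>" "d \<in> D"
        have dN: "d \<in> N" using z DN by blast
        have "z \<bullet> d \<in> U \<longleftrightarrow> z \<in> U"
          using Ustab[of z d] Ustab[of "z \<bullet> d" "inv d"] z dN by auto
        then show "?F (z \<bullet> d) = ?F z" using edot[OF z] by simp
      qed (use eM in simp)
      also have "\<dots> = (\<Oplus>\<^bsub>k\<^esub>z\<in>fixed D. e (y0, z))"
      proof (rule K.finsum_cong')
        fix z assume "z \<in> fixed D"
        then have "z \<in> U" using orb_self fixed_subset by (auto simp: U_def)
        then show "?F z = e (y0, z)" by simp
      qed (use eM in simp_all)
      also have "\<dots> = rsum e y0"
        unfolding rsum_def using eM edot by (intro p_sum_fixed[OF Dp, symmetric]) simp_all
      finally show ?thesis using e(3) by simp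
    qed
    ultimately show False by simp
  qed
  then obtain y1 where y1: "y1 \<in> fixed D" "(\<Oplus>\<^bsub>k\<^esub>z\<in>orb y1. e (y0, z)) \<noteq> \<zero>\<^bsub>k\<^esub>" by blast
  define c where "c = (\<Oplus>\<^bsub>k\<^esub>z\<in>orb y1. e (y0, z))"
  have ck: "c \<in> carrier k" unfolding c_def using eM by (intro K.finsum_closed) simp
  have y1\<Omega>: "y1 \<in> \<Omega>" and y1Q: "y1 \<in> fixed Q" using y1(1) fDQ by (auto simp: fixed_def)
  have Y1\<Omega>: "orb y1 \<subseteq> \<Omega>" using y1\<Omega> by (auto simp: orb_def)
  \<comment> \<open>\<open>D\<close> fixes \<open>y1\<close>, while dominance embeds the stabilizer
    of \<open>y1\<close> into \<open>D\<close> up to conjugation. Comparing orders gives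
    equality.\<close>
  have stab1: "{n \<in> N. y1 \<bullet> n = y1} = D"
  proof -
    obtain n where n: "n \<in> N" "\<forall>l\<in>N. y1 \<bullet> l = y1 \<longrightarrow> y0 \<bullet> n \<bullet> l = y0 \<bullet> n"
      using dom y1Q unfolding dominant_def N_def by blast
    let ?S = "{l \<in> N. y1 \<bullet> l = y1}"
    have fin: "finite N" using finite_G N.subset by (rule rev_finite_subset)
    have DS: "D \<subseteq> ?S" using y1(1) DN by (auto simp: fixed_def)
    have "conj_by G (inv n) l \<in> D" if l: "l \<in> N" "y1 \<bullet> l = y1" for l
    proof -
      have "y0 \<bullet> n \<bullet> l \<bullet> inv n = y0" using n l y0 by simp
      moreover have "y0 \<bullet> n \<bullet> l \<bullet> inv n = y0 \<bullet> conj_by G (inv n) l"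
        using n(1) l(1) y0(2) by (simp add: conj_by_def dot_mult)
      moreover have "conj_by G (inv n) l \<in> N" using n(1) l(1) by (simp add: conj_by_def)
      ultimately show ?thesis by (simp add: D_def)
    qed
    then have "conj_by G (inv n) ` ?S \<subseteq> D" by blast
    then have "card (conj_by G (inv n) ` ?S) \<le> card D" using fin DN by (intro card_mono) (auto intro: finite_subset)
    moreover have "card (conj_by G (inv n) ` ?S) = card ?S" using n(1) by (intro card_conj_by) auto
    ultimately have "card ?S \<le> card D" by simp
    moreover have "finite ?S" using fin by simp
    ultimately show ?thesis using card_seteq[OF _ DS] by blast
  qed
  have y01: "y0 \<bullet> n = y0 \<bullet> m \<longleftrightarrow> y1 \<bullet> n = y1 \<bullet> m" if nm: "n \<in> N" "m \<in> N" for n m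
  proof -
    have *: "y \<bullet> n = y \<bullet> m \<longleftrightarrow> y \<bullet> (n \<otimes> inv m) = y" if "y \<in> \<Omega>" for y
      using that nm dot_inv_eq_iff[of "y \<bullet> n" y m] by (simp add: dot_mult)
    have "n \<otimes> inv m \<in> N" using nm by simp
    then have "y0 \<bullet> (n \<otimes> inv m) = y0 \<longleftrightarrow> y1 \<bullet> (n \<otimes> inv m) = y1" using stab1 unfolding D_def by blast
    then show ?thesis using * y0(2) y1\<Omega> by simp
  qed
  \<comment> \<open>The matrix of the isomorphism of \<open>N\<close>-sets from the orbit of
    \<open>y1\<close> to that of \<open>y0\<close> taking \<open>y1 \<bullet> n\<close> to
    \<open>y0 \<bullet> n\<close>. It exists because the two stabilizers agree.\<close>
  define r where "r = (\<lambda>(x, y). if \<exists>n\<in>N. x = y1 \<bullet> n \<and> y = y0 \<bullet> n then \<one>\<^bsub>k\<^esub> else \<zero>\<^bsub>k\<^esub>)"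
  have rM: "r \<in> carrier K.Mat"
    by (rule K.MatI) (use y0(2) y1\<Omega> in \<open>auto simp: r_def\<close>)
  have rI: "r \<in> Inv N"
  proof -
    have "(\<exists>n\<in>N. x \<bullet> h = y1 \<bullet> n \<and> y \<bullet> h = y0 \<bullet> n) \<longleftrightarrow> (\<exists>n\<in>N. x = y1 \<bullet> n \<and> y = y0 \<bullet> n)"
      if h: "h \<in> N" and xy: "x \<in> \<Omega>" "y \<in> \<Omega>" for x y h
    proof
      assume "\<exists>n\<in>N. x \<bullet> h = y1 \<bullet> n \<and> y \<bullet> h = y0 \<bullet> n"
      then obtain n where n: "n \<in> N" "x \<bullet> h = y1 \<bullet> n" "y \<bullet> h = y0 \<bullet> n" by blast
      have "x = y1 \<bullet> n \<bullet> inv h" "y = y0 \<bullet> n \<bullet> inv h"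
        using dot_dot_inv(1)[OF xy(1), of h] dot_dot_inv(1)[OF xy(2), of h] n h by simp_all
      then have "x = y1 \<bullet> (n \<otimes> inv h) \<and> y = y0 \<bullet> (n \<otimes> inv h)"
        using n(1) h y0(2) y1\<Omega> by (simp add: dot_mult)
      then show "\<exists>n\<in>N. x = y1 \<bullet> n \<and> y = y0 \<bullet> n" using n(1) h by (intro bexI[of _ "n \<otimes> inv h"]) simp_all
    next
      assume "\<exists>n\<in>N. x = y1 \<bullet> n \<and> y = y0 \<bullet> n"
      then obtain n where n: "n \<in> N" "x = y1 \<bullet> n" "y = y0 \<bullet> n" by blast
      then show "\<exists>n\<in>N. x \<bullet> h = y1 \<bullet> n \<and> y \<bullet> h = y0 \<bullet> n"
        using h y0(2) y1\<Omega> by (intro bexI[of _ "n \<otimes> h"]) (simp_all add: dot_mult)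
    qed
    then show ?thesis using rM by (simp add: Inv_def r_def del: InvD)
  qed
  have r_rsum: "rsum r w = (if w \<in> orb y1 then \<one>\<^bsub>k\<^esub> else \<zero>\<^bsub>k\<^esub>)" for w
  proof (cases "w \<in> orb y1")
    case True
    then obtain n where n: "n \<in> N" "w = y1 \<bullet> n" by (auto simp: orb_def)
    have "rsum r w = (\<Oplus>\<^bsub>k\<^esub>z\<in>\<Omega>. if y0 \<bullet> n = z then \<one>\<^bsub>k\<^esub> else \<zero>\<^bsub>k\<^esub>)"
      unfolding rsum_def
    proof (rule K.finsum_cong')
      fix z
      have "(\<exists>m\<in>N. w = y1 \<bullet> m \<and> z = y0 \<bullet> m) \<longleftrightarrow> y0 \<bullet> n = z"
        using n y01 by metis
      then show "r (w, z) = (if y0 \<bullet> n = z then \<one>\<^bsub>k\<^esub> else \<zero>\<^bsub>k\<^esub>)" by (simp add: r_def)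
    qed auto
    then show ?thesis using True n y0(2) K.finsum_delta[of "y0 \<bullet> n" "\<lambda>_. \<one>\<^bsub>k\<^esub>"] by simp
  next
    case False
    then have "r (w, z) = \<zero>\<^bsub>k\<^esub>" for z by (auto simp: r_def orb_def)
    then show ?thesis using False by (simp add: rsum_def)
  qed
  define E' where "E' = E \<otimes>\<^bsub>K.Mat\<^esub> r"
  have E'I: "E' \<in> Inv N" unfolding E'_def by (rule Inv_mult[OF N.subset EN rI])
  have E'M: "E' \<in> carrier K.Mat" using E'I by (rule InvD)
  have E'_out: "E' (x, z) = \<zero>\<^bsub>k\<^esub>" if "z \<notin> Y" for x z
  proof -
    have "E' (x, z) = (\<Oplus>\<^bsub>k\<^esub>w\<in>\<Omega>. \<zero>\<^bsub>k\<^esub>)"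
      unfolding E'_def K.Mat_simps using that EM by (intro K.finsum_cong') (auto simp: r_def Y_def)
    then show ?thesis by simp
  qed
  \<comment> \<open>An element of the corner of \<open>t\<close> with row sums \<open>c\<close>: the
    factors \<open>t\<close> and \<open>r\<close> have row sums one on the orbits concerned, and
    \<open>E\<close> contributes the part of its row that lies in the orbit of
    \<open>y1\<close>.\<close>
  define g where "g = t \<otimes>\<^bsub>K.Mat\<^esub> (E' \<otimes>\<^bsub>K.Mat\<^esub> t)"
  have gI: "g \<in> Inv N" unfolding g_def by (intro Inv_mult[OF N.subset] tI(1) E'I)
  have gM: "g \<in> carrier K.Mat" using gI by (rule InvD)
  have tg: "t \<otimes>\<^bsub>K.Mat\<^esub> g = g" "g \<otimes>\<^bsub>K.Mat\<^esub> t = g"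
    using tM E'M tI(2) by (simp_all add: g_def K.Mat.m_assoc) (simp add: K.Mat.m_assoc[symmetric])
  have rs0: "rsum (E' \<otimes>\<^bsub>K.Mat\<^esub> t) y0 = c"
  proof -
    have "rsum (E' \<otimes>\<^bsub>K.Mat\<^esub> t) y0 = (\<Oplus>\<^bsub>k\<^esub>z\<in>\<Omega>. E' (y0, z))"
      unfolding rsum_mult[OF E'M tM]
    proof (rule K.finsum_cong')
      fix z show "E' (y0, z) \<otimes>\<^bsub>k\<^esub> rsum t z = E' (y0, z)"
        using t(3)[of z] E'_out[of z y0] E'M tM by (cases "z \<in> Y") simp_all
    qed (use E'M in simp_all)
    also have "\<dots> = rsum E' y0" by (simp add: rsum_def)
    also have "\<dots> = (\<Oplus>\<^bsub>k\<^esub>w\<in>\<Omega>. E (y0, w) \<otimes>\<^bsub>k\<^esub> rsum r w)" unfolding E'_def by (rule rsum_mult[OF EM rM])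
    also have "\<dots> = (\<Oplus>\<^bsub>k\<^esub>w\<in>orb y1. e (y0, w))"
      using Y1\<Omega> EM eM K.finite_index orb_fixed[OF y1Q] y0(1)
      by (intro K.add.finprod_mono_neutral_cong_right) (auto simp: r_rsum E_def br_def)
    finally show ?thesis by (simp add: c_def)
  qed
  have rs: "rsum (E' \<otimes>\<^bsub>K.Mat\<^esub> t) x = c" if "x \<in> Y" for x
    using that rs0 rsum_dot[OF N.subset Inv_mult[OF N.subset E'I tI(1)] _ y0(2)] by (auto simp: Y_def)
  have rg: "rsum g x = c" if "x \<in> Y" for x
    unfolding g_def using rsum_mult_const[OF tM t(2) _ rs ck, of x] E'M tM t(3)[OF that] ck by simp
  have supg: "supp Y g"
  proof -
    have D: "K.diag Y \<in> carrier K.Mat" using Y\<Omega> by simp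
    have "K.diag Y \<otimes>\<^bsub>K.Mat\<^esub> t = t" "t \<otimes>\<^bsub>K.Mat\<^esub> K.diag Y = t" using t(2) supp_diag[OF tM Y\<Omega>] by auto
    then have "K.diag Y \<otimes>\<^bsub>K.Mat\<^esub> g = g" "g \<otimes>\<^bsub>K.Mat\<^esub> K.diag Y = g"
      using tg D tM gM by (metis K.Mat.m_assoc)+
    then show ?thesis using supp_diag[OF gM Y\<Omega>] by simp
  qed
  have "\<And>n::nat. g [^]\<^bsub>K.Mat\<^esub> n \<noteq> \<zero>\<^bsub>K.Mat\<^esub>"
    using rsum_pow[OF gM supg rg ck _ y0Y] y1(2) by (simp add: c_def)
  \<comment> \<open>\<open>h\<close> is the inverse of \<open>g\<close> in the corner of
    \<open>t\<close>. As $E E' = E'$, the factors $t E$ and $E' t h$ have product $t E' t h = g h =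
    t$.\<close>
  then obtain h where h: "h \<in> Inv N" "t \<otimes>\<^bsub>K.Mat\<^esub> h = h" "h \<otimes>\<^bsub>K.Mat\<^esub> t = h" "g \<otimes>\<^bsub>K.Mat\<^esub> h = t"
    using primitive_fitting[OF N.subset t(1) gI tg] by blast
  have hM: "h \<in> carrier K.Mat" using h(1) by (rule InvD)
  show ?thesis
  proof (rule that)
    show "t \<otimes>\<^bsub>K.Mat\<^esub> E \<in> Inv N" by (rule Inv_mult[OF N.subset tI(1) EN])
    show "E' \<otimes>\<^bsub>K.Mat\<^esub> (t \<otimes>\<^bsub>K.Mat\<^esub> h) \<in> Inv N" by (intro Inv_mult[OF N.subset] E'I tI(1) h(1))
    show "t \<otimes>\<^bsub>K.Mat\<^esub> (t \<otimes>\<^bsub>K.Mat\<^esub> E) = t \<otimes>\<^bsub>K.Mat\<^esub> E"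
      using tI(2) tM EM by (simp add: K.Mat.m_assoc[symmetric])
    show "t \<otimes>\<^bsub>K.Mat\<^esub> E \<otimes>\<^bsub>K.Mat\<^esub> br Q e = t \<otimes>\<^bsub>K.Mat\<^esub> E"
      using EE tM EM by (simp add: K.Mat.m_assoc E_def[symmetric])
    have EE': "E \<otimes>\<^bsub>K.Mat\<^esub> E' = E'" unfolding E'_def using EE EM rM by (simp add: K.Mat.m_assoc[symmetric])
    then show "br Q e \<otimes>\<^bsub>K.Mat\<^esub> (E' \<otimes>\<^bsub>K.Mat\<^esub> (t \<otimes>\<^bsub>K.Mat\<^esub> h)) = E' \<otimes>\<^bsub>K.Mat\<^esub> (t \<otimes>\<^bsub>K.Mat\<^esub> h)"
      using EM E'M tM hM by (simp add: K.Mat.m_assoc[symmetric] E_def[symmetric])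
    show "E' \<otimes>\<^bsub>K.Mat\<^esub> (t \<otimes>\<^bsub>K.Mat\<^esub> h) \<otimes>\<^bsub>K.Mat\<^esub> t = E' \<otimes>\<^bsub>K.Mat\<^esub> (t \<otimes>\<^bsub>K.Mat\<^esub> h)"
      using E'M tM hM h(3) by (simp add: K.Mat.m_assoc)
    have "t \<otimes>\<^bsub>K.Mat\<^esub> E \<otimes>\<^bsub>K.Mat\<^esub> (E' \<otimes>\<^bsub>K.Mat\<^esub> (t \<otimes>\<^bsub>K.Mat\<^esub> h)) = t \<otimes>\<^bsub>K.Mat\<^esub> ((E \<otimes>\<^bsub>K.Mat\<^esub> E') \<otimes>\<^bsub>K.Mat\<^esub> (t \<otimes>\<^bsub>K.Mat\<^esub> h))"
      using tM EM E'M hM by (simp add: K.Mat.m_assoc)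
    also have "\<dots> = g \<otimes>\<^bsub>K.Mat\<^esub> h" unfolding EE' g_def using tM E'M hM by (simp add: K.Mat.m_assoc)
    finally show "t \<otimes>\<^bsub>K.Mat\<^esub> E \<otimes>\<^bsub>K.Mat\<^esub> (E' \<otimes>\<^bsub>K.Mat\<^esub> (t \<otimes>\<^bsub>K.Mat\<^esub> h)) = t" using h(4) by simp
  qed
qed

section \<open>Conjugation of matrices and the subgroups $Q C_G(Q)$\<close>

definition transport :: "'a \<Rightarrow> ('x \<times> 'x \<Rightarrow> 'k) \<Rightarrow> 'x \<times> 'x \<Rightarrow> 'k" where
  "transport g a = (\<lambda>(x, y). if x \<in> \<Omega> \<and> y \<in> \<Omega> then a (x \<bullet> inv g, y \<bullet> inv g) else \<zero>\<^bsub>k\<^esub>)"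

lemma transport_closed: "\<lbrakk>g \<in> carrier G; a \<in> carrier K.Mat\<rbrakk> \<Longrightarrow> transport g a \<in> carrier K.Mat"
  by (rule K.MatI) (auto simp: transport_def)

lemma transport_mult:
  assumes g: "g \<in> carrier G" and a: "a \<in> carrier K.Mat" and b: "b \<in> carrier K.Mat"
  shows "transport g (a \<otimes>\<^bsub>K.Mat\<^esub> b) = transport g a \<otimes>\<^bsub>K.Mat\<^esub> transport g b"
proof (rule K.Mat_eqI)
  fix x y assume xy: "x \<in> \<Omega>" "y \<in> \<Omega>"
  have "transport g (a \<otimes>\<^bsub>K.Mat\<^esub> b) (x, y) = (\<Oplus>\<^bsub>k\<^esub>z\<in>\<Omega>. a (x \<bullet> inv g, z) \<otimes>\<^bsub>k\<^esub> b (z, y \<bullet> inv g))"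
    using xy by (simp add: transport_def K.Mat_simps)
  also have "\<dots> = (\<Oplus>\<^bsub>k\<^esub>z\<in>\<Omega>. a (x \<bullet> inv g, z \<bullet> inv g) \<otimes>\<^bsub>k\<^esub> b (z \<bullet> inv g, y \<bullet> inv g))"
    using a b g by (intro sum_dot[symmetric]) simp_all
  also have "\<dots> = (transport g a \<otimes>\<^bsub>K.Mat\<^esub> transport g b) (x, y)"
    unfolding K.Mat_simps using a b xy by (intro K.finsum_cong' refl) (auto simp: transport_def)
  finally show "transport g (a \<otimes>\<^bsub>K.Mat\<^esub> b) (x, y) = (transport g a \<otimes>\<^bsub>K.Mat\<^esub> transport g b) (x, y)" .
qed (use assms in \<open>simp_all add: transport_closed\<close>)

lemma transport_inv:
  assumes g: "g \<in> carrier G" and a: "a \<in> carrier K.Mat"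
  shows "transport g (transport (inv g) a) = a"
  using assms by (intro K.Mat_eqI transport_closed) (simp_all add: transport_def)

lemma transport_Inv:
  assumes g: "g \<in> carrier G" and H: "H \<subseteq> carrier G" and a: "a \<in> Inv H"
  shows "transport g a \<in> Inv (conj_by G g ` H)"
proof -
  have aM: "a \<in> carrier K.Mat" using a by (rule InvD)
  have "transport g a (x \<bullet> conj_by G g h, y \<bullet> conj_by G g h) = transport g a (x, y)"
    if h: "h \<in> H" and xy: "x \<in> \<Omega>" "y \<in> \<Omega>" for h x y
  proof -
    have hG: "h \<in> carrier G" using h H by blast
    have *: "z \<bullet> conj_by G g h \<bullet> inv g = z \<bullet> inv g \<bullet> h" if z: "z \<in> \<Omega>" for z
    proof -
      have "z \<bullet> conj_by G g h \<bullet> inv g = z \<bullet> (conj_by G g h \<otimes> inv g)" using z hG g by (simp add: dot_mult)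
      also have "conj_by G g h \<otimes> inv g = inv g \<otimes> h" using hG g by (simp add: conj_by_def m_assoc)
      finally show ?thesis using z hG g by (simp add: dot_mult)
    qed
    show ?thesis using xy g hG * Inv_dot[OF a h, of "x \<bullet> inv g" "y \<bullet> inv g"] by (simp add: transport_def)
  qed
  then show ?thesis using transport_closed[OF g aM] by (auto simp: Inv_def simp del: InvD)
qed

lemma primitive_transport:
  assumes g: "g \<in> carrier G" and H: "H \<subseteq> carrier G" and a: "primitive H a"
  shows "primitive (conj_by G g ` H) (transport g a)"
proof -
  have aI: "a \<in> Inv H" "a \<otimes>\<^bsub>K.Mat\<^esub> a = a" "a \<noteq> \<zero>\<^bsub>K.Mat\<^esub>" using a by (auto simp: primitive_def)
  have aM: "a \<in> carrier K.Mat" using aI(1) by (rule InvD)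
  have ig: "inv g \<in> carrier G" using g by simp
  have t0: "transport h \<zero>\<^bsub>K.Mat\<^esub> = \<zero>\<^bsub>K.Mat\<^esub>" for h by (auto simp: transport_def K.Mat_simps)
  have tb: "transport (inv g) (transport g b) = b" if "b \<in> carrier K.Mat" for b
    using transport_inv[OF ig that] g by simp
  have HH: "conj_by G (inv g) ` conj_by G g ` H = H"
    using g H conj_by_image_mult[OF g ig H] by simp
  show ?thesis
    unfolding primitive_def
  proof (intro conjI ballI impI)
    show "transport g a \<in> Inv (conj_by G g ` H)" by (rule transport_Inv[OF g H aI(1)])
    show "transport g a \<otimes>\<^bsub>K.Mat\<^esub> transport g a = transport g a"
      using transport_mult[OF g aM aM] aI(2) by simp
    show "transport g a \<noteq> \<zero>\<^bsub>K.Mat\<^esub>" using tb[OF aM] aI(3) t0 by metis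
    fix f assume fI: "f \<in> Inv (conj_by G g ` H)"
      and f: "f \<otimes>\<^bsub>K.Mat\<^esub> f = f \<and> transport g a \<otimes>\<^bsub>K.Mat\<^esub> f = f \<and> f \<otimes>\<^bsub>K.Mat\<^esub> transport g a = f"
    have fM: "f \<in> carrier K.Mat" using fI by (rule InvD)
    have taM: "transport g a \<in> carrier K.Mat" using g aM by (rule transport_closed)
    let ?f = "transport (inv g) f"
    have "conj_by G g ` H \<subseteq> carrier G" using g H by auto
    then have "?f \<in> Inv H" using transport_Inv[OF ig _ fI] HH by simp
    moreover have "?f \<otimes>\<^bsub>K.Mat\<^esub> ?f = ?f" using transport_mult[OF ig fM fM] f by simp
    moreover have "a \<otimes>\<^bsub>K.Mat\<^esub> ?f = ?f" using transport_mult[OF ig taM fM] f tb[OF aM] by simp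
    moreover have "?f \<otimes>\<^bsub>K.Mat\<^esub> a = ?f" using transport_mult[OF ig fM taM] f tb[OF aM] by simp
    ultimately have "?f = \<zero>\<^bsub>K.Mat\<^esub> \<or> ?f = a" using a by (simp add: primitive_def)
    then show "f = \<zero>\<^bsub>K.Mat\<^esub> \<or> f = transport g a" using transport_inv[OF g fM] t0 by metis
  qed
qed

text \<open>The entries of \<open>e\<close> are invariant under all of \<open>G\<close>, so moving
  the points only replaces the fixed points of \<open>Q\<close> by those of its conjugate.\<close>

lemma transport_br:
  assumes g: "g \<in> carrier G" and Q: "Q \<subseteq> carrier G" and e: "e \<in> Inv (carrier G)"
  shows "transport g (br Q e) = br (conj_by G g ` Q) e"
proof -
  have eM: "e \<in> carrier K.Mat" using e by (rule InvD)
  show ?thesis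
  proof (rule K.Mat_eqI)
    fix x y assume xy: "x \<in> \<Omega>" "y \<in> \<Omega>"
    have "z \<bullet> inv g \<in> fixed Q \<longleftrightarrow> z \<in> fixed (conj_by G g ` Q)" if "z \<in> \<Omega>" for z
      using fixed_dot_iff[OF _ g Q, of "z \<bullet> inv g"] that g by simp
    then show "transport g (br Q e) (x, y) = br (conj_by G g ` Q) e (x, y)"
      using xy g Inv_dot[OF e, of "inv g" x y] by (simp add: transport_def br_def)
  qed (use g eM in \<open>simp_all add: transport_closed\<close>)
qed

lemma QC_subgroup:
  assumes "subgroup Q G" shows "subgroup (Q <#> centralizer G Q) G"
proof -
  interpret Q: subgroup Q G by fact
  have cen: "c \<in> carrier G" "\<And>q. q \<in> Q \<Longrightarrow> c \<otimes> q = q \<otimes> c" if "c \<in> centralizer G Q" for c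
    using that by (auto simp: centralizer_def)
  have cinv: "inv c \<in> centralizer G Q" if c: "c \<in> centralizer G Q" for c
  proof -
    have "inv c \<otimes> q = q \<otimes> inv c" if q: "q \<in> Q" for q
    proof -
      have "inv c \<otimes> q = inv c \<otimes> (q \<otimes> c) \<otimes> inv c" using cen(1)[OF c] q by (simp add: m_assoc)
      also have "inv c \<otimes> (q \<otimes> c) = q"
        unfolding cen(2)[OF c q, symmetric] using cen(1)[OF c] q by (simp add: m_assoc[symmetric])
      finally show ?thesis .
    qed
    then show ?thesis using cen(1)[OF c] by (simp add: centralizer_def)
  qed
  have one: "\<one> \<in> centralizer G Q" by (simp add: centralizer_def)
  have mem: "x \<in> Q <#> centralizer G Q \<longleftrightarrow> (\<exists>q\<in>Q. \<exists>c\<in>centralizer G Q. x = q \<otimes> c)" for x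
    by (auto simp: set_mult_def)
  show ?thesis
  proof (rule subgroupI)
    show "Q <#> centralizer G Q \<subseteq> carrier G" using cen(1) by (auto simp: mem)
    show "Q <#> centralizer G Q \<noteq> {}" using one Q.one_closed mem by blast
  next
    fix x assume "x \<in> Q <#> centralizer G Q"
    then obtain q c where x: "q \<in> Q" "c \<in> centralizer G Q" "x = q \<otimes> c" using mem by blast
    have "inv x = inv q \<otimes> inv c"
      using x cen(1)[OF x(2)] cen(2)[OF cinv[OF x(2)], of "inv q"] by (simp add: inv_mult_group)
    then show "inv x \<in> Q <#> centralizer G Q" using mem cinv[OF x(2)] x(1) by blast
  next
    fix x y assume "x \<in> Q <#> centralizer G Q" "y \<in> Q <#> centralizer G Q"
    then obtain q c r d where x: "q \<in> Q" "c \<in> centralizer G Q" "x = q \<otimes> c"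
      and y: "r \<in> Q" "d \<in> centralizer G Q" "y = r \<otimes> d" using mem by metis
    note c = cen(1)[OF x(2)] and d = cen(1)[OF y(2)]
    have "x \<otimes> y = q \<otimes> (c \<otimes> r) \<otimes> d" using x y c d by (simp add: m_assoc)
    also have "\<dots> = (q \<otimes> r) \<otimes> (c \<otimes> d)" using x y c d cen(2)[OF x(2) y(1)] by (simp add: m_assoc)
    finally have "x \<otimes> y = (q \<otimes> r) \<otimes> (c \<otimes> d)" .
    moreover have "c \<otimes> d \<in> centralizer G Q"
    proof -
      have "c \<otimes> d \<otimes> q = q \<otimes> (c \<otimes> d)" if q: "q \<in> Q" for q
      proof -
        have "c \<otimes> d \<otimes> q = c \<otimes> q \<otimes> d" using c d q cen(2)[OF y(2) q] by (simp add: m_assoc)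
        then show ?thesis using c d q cen(2)[OF x(2) q] by (simp add: m_assoc)
      qed
      then show ?thesis using c d by (simp add: centralizer_def)
    qed
    ultimately show "x \<otimes> y \<in> Q <#> centralizer G Q" using mem x(1) y(1) by blast
  qed
qed

lemma QC_normalizer:
  assumes Q: "subgroup Q G" shows "Q <#> centralizer G Q \<subseteq> normalizer G Q"
proof -
  interpret Q: subgroup Q G by fact
  interpret N: subgroup "normalizer G Q" G using Q.subset by (rule subgroup_normalizer)
  have "centralizer G Q \<subseteq> normalizer G Q"
  proof
    fix c assume "c \<in> centralizer G Q"
    then have c: "c \<in> carrier G" "\<And>x. x \<in> Q \<Longrightarrow> conj_by G c x = x"
      unfolding centralizer_eq[OF Q.subset] by simp_all
    then have "conj_by G c ` Q = (\<lambda>x. x) ` Q" by (intro image_cong refl)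
    then show "c \<in> normalizer G Q" using c(1) unfolding normalizer_eq[OF Q.subset] by simp
  qed
  then have "q \<otimes> c \<in> normalizer G Q" if "q \<in> Q" "c \<in> centralizer G Q" for q c
    using subset_normalizer[OF Q] that by (meson N.m_closed subsetD)
  then show ?thesis unfolding set_mult_def by blast
qed

lemma QC_conj:
  assumes g: "g \<in> carrier G" and Q: "Q \<subseteq> carrier G"
  shows "conj_by G g ` (Q <#> centralizer G Q) = conj_by G g ` Q <#> centralizer G (conj_by G g ` Q)"
proof -
  have cC: "conj_by G g ` centralizer G Q \<subseteq> centralizer G (conj_by G g ` Q)"
    if g: "g \<in> carrier G" and Q: "Q \<subseteq> carrier G" for g Q
    using that by (auto simp: centralizer_def subset_iff simp flip: conj_by_hom)
  have "centralizer G (conj_by G g ` Q) \<subseteq> conj_by G g ` centralizer G Q"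
  proof
    fix c assume c: "c \<in> centralizer G (conj_by G g ` Q)"
    have gQ: "conj_by G g ` Q \<subseteq> carrier G" using g Q by auto
    have "conj_by G (inv g) ` conj_by G g ` Q = Q" using g Q conj_by_image_mult[of g "inv g" Q] by simp
    then have "conj_by G (inv g) c \<in> centralizer G Q" using cC[OF inv_closed[OF g] gQ] c by auto
    moreover have "c \<in> carrier G" using c by (simp add: centralizer_def)
    then have "c = conj_by G g (conj_by G (inv g) c)" using g by simp
    ultimately show "c \<in> conj_by G g ` centralizer G Q" by blast
  qed
  then have C: "centralizer G (conj_by G g ` Q) = conj_by G g ` centralizer G Q" using cC[OF g Q] by blast
  have CG: "c \<in> carrier G" if "c \<in> centralizer G Q" for c using that by (simp add: centralizer_def)
  show ?thesis
    unfolding C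
  proof (intro subset_antisym subsetI)
    fix x assume "x \<in> conj_by G g ` (Q <#> centralizer G Q)"
    then obtain q c where x: "q \<in> Q" "c \<in> centralizer G Q" "x = conj_by G g (q \<otimes> c)"
      unfolding set_mult_def by blast
    then have "x = conj_by G g q \<otimes> conj_by G g c" using g CG subsetD[OF Q] by (simp add: conj_by_hom)
    then show "x \<in> conj_by G g ` Q <#> conj_by G g ` centralizer G Q" using x(1,2) unfolding set_mult_def by blast
  next
    fix x assume "x \<in> conj_by G g ` Q <#> conj_by G g ` centralizer G Q"
    then obtain q c where x: "q \<in> Q" "c \<in> centralizer G Q" "x = conj_by G g q \<otimes> conj_by G g c"
      unfolding set_mult_def by blast
    then have "x = conj_by G g (q \<otimes> c)" using g CG subsetD[OF Q] by (simp add: conj_by_hom)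
    then show "x \<in> conj_by G g ` (Q <#> centralizer G Q)" using x(1,2) unfolding set_mult_def by blast
  qed
qed

text \<open>Permits the passage from a subgroup to a conjugate of it that is fully
  normalized.\<close>

lemma primitive_br_conj:
  assumes g: "g \<in> carrier G" and Q: "subgroup Q G" and e: "e \<in> Inv (carrier G)"
    and prim: "primitive (Q <#> centralizer G Q) (br Q e)"
  shows "primitive (conj_by G g ` Q <#> centralizer G (conj_by G g ` Q)) (br (conj_by G g ` Q) e)"
  using primitive_transport[OF g subgroup.subset[OF QC_subgroup[OF Q]] prim]
  unfolding transport_br[OF g subgroup.subset[OF Q] e] QC_conj[OF g subgroup.subset[OF Q]] .

lemma br_zero_conj:
  assumes g: "g \<in> carrier G" and Q: "subgroup Q G" and e: "e \<in> Inv (carrier G)" and z: "br Q e = \<zero>\<^bsub>K.Mat\<^esub>"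
  shows "br (conj_by G g ` Q) e = \<zero>\<^bsub>K.Mat\<^esub>"
proof -
  have "transport g \<zero>\<^bsub>K.Mat\<^esub> = \<zero>\<^bsub>K.Mat\<^esub>" by (auto simp: transport_def K.Mat_simps)
  then show ?thesis using transport_br[OF g subgroup.subset[OF Q] e] z by simp
qed

text \<open>Idempotence writes \<open>t\<close> as a product with $b a$ in the middle, and
  \<open>br L\<close> is multiplicative, so it is enough that \<open>br L t\<close> does not vanish.
  Dominance provides a translate of \<open>y0\<close> by the normalizer that \<open>L\<close> fixes,
  and there \<open>t\<close> has row sum one.\<close>

lemma br_factor_nonzero:
  assumes L: "p_subgroup p G L" "L \<subseteq> normalizer G Q" and QL: "Q \<subseteq> L" and dom: "dominant Q y0"
    and t: "t \<in> Inv (normalizer G Q)" "\<And>x. x \<in> (\<lambda>n. y0 \<bullet> n) ` normalizer G Q \<Longrightarrow> rsum t x = \<one>\<^bsub>k\<^esub>"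
    and tt: "t \<otimes>\<^bsub>K.Mat\<^esub> t = t" and a: "a \<in> Inv (normalizer G Q)" and b: "b \<in> Inv (normalizer G Q)"
    and ab: "a \<otimes>\<^bsub>K.Mat\<^esub> b = t" and x: "x \<in> fixed L"
  shows "br L (b \<otimes>\<^bsub>K.Mat\<^esub> a) \<noteq> \<zero>\<^bsub>K.Mat\<^esub>"
proof
  assume z: "br L (b \<otimes>\<^bsub>K.Mat\<^esub> a) = \<zero>\<^bsub>K.Mat\<^esub>"
  have LG: "L \<subseteq> carrier G" using L(1) by (auto simp: p_subgroup_def dest: subgroup.subset)
  have I: "a \<in> Inv L" "b \<in> Inv L" "t \<in> Inv L" using a b t(1) Inv_mono[OF L(2)] by auto
  have M: "a \<in> carrier K.Mat" "b \<in> carrier K.Mat" "t \<in> carrier K.Mat" using I by (auto dest: InvD)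
  have "x \<in> fixed Q" using x QL by (auto simp: fixed_def)
  then obtain n where n: "n \<in> normalizer G Q" "\<forall>l\<in>normalizer G Q. x \<bullet> l = x \<longrightarrow> y0 \<bullet> n \<bullet> l = y0 \<bullet> n"
    using dom by (auto simp: dominant_def)
  have nG: "n \<in> carrier G" using normalizerD(1)[OF n(1)] QL LG by blast
  have "y0 \<bullet> n \<bullet> l = y0 \<bullet> n" if "l \<in> L" for l using n(2) L(2) x that by (auto simp: fixed_def)
  then have "y0 \<bullet> n \<in> fixed L" using dom nG by (auto simp: fixed_def dominant_def)
  moreover have "rsum t (y0 \<bullet> n) = \<one>\<^bsub>k\<^esub>" using t(2) n(1) by blast
  ultimately have nz: "br L t \<noteq> \<zero>\<^bsub>K.Mat\<^esub>"
    using br_nonzero[OF L(1) I(3), of "y0 \<bullet> n"] by (simp add: rsum_def)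
  have ba: "b \<otimes>\<^bsub>K.Mat\<^esub> a \<in> Inv L" by (rule Inv_mult[OF LG I(2,1)])
  have "t = a \<otimes>\<^bsub>K.Mat\<^esub> (b \<otimes>\<^bsub>K.Mat\<^esub> a \<otimes>\<^bsub>K.Mat\<^esub> b)" using tt ab M by (simp add: K.Mat.m_assoc) (simp flip: K.Mat.m_assoc)
  then have "br L t = br L a \<otimes>\<^bsub>K.Mat\<^esub> (br L (b \<otimes>\<^bsub>K.Mat\<^esub> a) \<otimes>\<^bsub>K.Mat\<^esub> br L b)"
    using br_mult[OF L(1) I(1) Inv_mult[OF LG ba I(2)]] br_mult[OF L(1) ba I(2)] by simp
  then have "br L t = \<zero>\<^bsub>K.Mat\<^esub>" using z M by simp
  then show False using nz by simp
qed

text \<open>If \<open>f\<close> vanishes on the fixed points of every \<open>p\<close>-subgroup of the normalizer that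
  properly contains \<open>Q\<close>, then \<open>Q\<close> is a Sylow subgroup of the stabilizer of every pair where \<open>f\<close>
  does not vanish. Therefore the translates of \<open>f\<close> by elements of \<open>G\<close> fit together.\<close>

lemma lift_invariant:
  assumes Q: "p_subgroup p G Q" and f: "f \<in> Inv (normalizer G Q)" "br Q f = f"
    and van: "\<And>L. \<lbrakk>p_subgroup p G L; Q \<subset> L; L \<subseteq> normalizer G Q\<rbrakk> \<Longrightarrow> br L f = \<zero>\<^bsub>K.Mat\<^esub>"
  obtains f' where "f' \<in> Inv (carrier G)" "br Q f' = f"
proof -
  have QG: "subgroup Q G" using Q by (simp add: p_subgroup_def)
  interpret Q: subgroup Q G by fact
  have fM: "f \<in> carrier K.Mat" using f(1) by (rule InvD)
  \<comment> \<open>Burnside's fusion argument in the stabilizer \<open>S\<close> of the pair, which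
    contains \<open>Q\<close> and its conjugate \<open>Q'\<close>. If some \<open>c\<close> in
    \<open>S\<close> conjugates \<open>Q\<close> to \<open>Q'\<close>, then $c g$ normalizes
    \<open>Q\<close> and acts on the pair like \<open>g\<close>. Otherwise \<open>S\<close> has a
    larger \<open>p\<close>-subgroup normalizing \<open>Q\<close>, and \<open>f\<close> vanishes at
    the pair.\<close>
  have W1: "f (x \<bullet> g, y \<bullet> g) = f (x, y)"
    if xy: "x \<in> fixed Q" "y \<in> fixed Q" and g: "g \<in> carrier G" "x \<bullet> g \<in> fixed Q" "y \<bullet> g \<in> fixed Q"
      and nz: "f (x, y) \<noteq> \<zero>\<^bsub>k\<^esub>" for x y g
  proof -
    have xy\<Omega>: "x \<in> \<Omega>" "y \<in> \<Omega>" using xy by (auto simp: fixed_def)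
    define S where "S = stab x \<inter> stab y"
    have S: "subgroup S G" unfolding S_def
      by (rule subgroups_Inter_pair[OF stab_subgroup[OF xy\<Omega>(1)] stab_subgroup[OF xy\<Omega>(2)]])
    interpret S: group "G\<lparr>carrier := S\<rparr>" using S by (rule subgroup_imp_group)
    have QS: "Q \<subseteq> S" using xy by (auto simp: S_def stab_def fixed_def)
    define Q' where "Q' = conj_by G (inv g) ` Q"
    have Q'p: "p_subgroup p G Q'" unfolding Q'_def using Q g(1) by (intro p_subgroup_conj_by) simp_all
    have Q'S: "Q' \<subseteq> S"
    proof -
      have "x \<bullet> conj_by G (inv g) q = x \<and> y \<bullet> conj_by G (inv g) q = y" if q: "q \<in> Q" for q
      proof -
        have "z \<bullet> conj_by G (inv g) q = z" if "z \<in> \<Omega>" "z \<bullet> g \<in> fixed Q" for z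
        proof -
          have "z \<bullet> conj_by G (inv g) q = z \<bullet> g \<bullet> q \<bullet> inv g"
            using that q g(1) by (simp add: conj_by_def dot_mult)
          also have "z \<bullet> g \<bullet> q = z \<bullet> g" using that q by (simp add: fixed_def)
          finally show ?thesis using that g(1) by simp
        qed
        then show ?thesis using xy\<Omega> g by blast
      qed
      then show ?thesis using g(1) by (auto simp: Q'_def S_def stab_def)
    qed
    have pS: "p_subgroup p (G\<lparr>carrier := S\<rparr>) T" if "p_subgroup p G T" "T \<subseteq> S" for T
      using that S by (auto simp: p_subgroup_def intro: subgroup_incl)
    have "card Q' = card Q" unfolding Q'_def using g(1) Q.subset by (intro card_conj_by) simp_all
    moreover have "finite (carrier (G\<lparr>carrier := S\<rparr>))"
      using finite_subset[OF subgroup.subset[OF S] finite_G] by simp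
    ultimately consider c where "c \<in> S" "conj_by (G\<lparr>carrier := S\<rparr>) c ` Q = Q'"
      | L where "p_subgroup p (G\<lparr>carrier := S\<rparr>) L" "Q \<subset> L" "L \<subseteq> normalizer (G\<lparr>carrier := S\<rparr>) Q"
      using S.p_subgroups_conjugate_or_extend[OF _ prime_p pS[OF Q QS] pS[OF Q'p Q'S]] by auto
    then show ?thesis
    proof cases
      case 1
      have cG: "c \<in> carrier G" using 1(1) S subgroup.mem_carrier by metis
      have "conj_by G c ` Q = Q'" using 1 conj_by_subgroup[OF S 1(1)] by simp
      then have "conj_by G (c \<otimes> g) ` Q = Q"
        using cG g(1) Q.subset conj_by_image_mult[of "inv g" g Q]
        by (simp add: conj_by_image_mult Q'_def)
      then have "c \<otimes> g \<in> normalizer G Q" using cG g(1) Q.subset by (simp add: normalizer_eq)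
      from Inv_dot[OF f(1) this xy\<Omega>] have "f (x \<bullet> c \<bullet> g, y \<bullet> c \<bullet> g) = f (x, y)"
        using cG g(1) xy\<Omega> by (simp add: dot_mult)
      then show ?thesis using 1(1) by (simp add: S_def stab_def)
    next
      case 2
      have LS: "subgroup L (G\<lparr>carrier := S\<rparr>)" using 2(1) by (simp add: p_subgroup_def)
      have LG: "subgroup L G" using incl_subgroup[OF S LS] .
      have LS': "L \<subseteq> S" using subgroup.subset[OF LS] by simp
      have "p_subgroup p G L" using 2(1) LG by (simp add: p_subgroup_def)
      moreover have "L \<subseteq> normalizer G Q" using 2(3) normalizer_subgroup[OF S QS] by blast
      ultimately have "br L f = \<zero>\<^bsub>K.Mat\<^esub>" using van 2(2) by blast
      then have "br L f (x, y) = \<zero>\<^bsub>k\<^esub>" by (simp add: K.Mat_simps)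
      moreover have "x \<in> fixed L" "y \<in> fixed L" using LS' xy\<Omega> by (auto simp: S_def stab_def fixed_def)
      ultimately have "f (x, y) = \<zero>\<^bsub>k\<^esub>" by (simp add: br_def)
      then show ?thesis using nz by simp
    qed
  qed
  \<comment> \<open>If the entry at the given pair is zero, \<open>W1\<close> is applied backwards,
    to the translated pair and \<open>inv g\<close>.\<close>
  have W: "f (x \<bullet> g, y \<bullet> g) = f (x, y)"
    if xy: "x \<in> fixed Q" "y \<in> fixed Q" and g: "g \<in> carrier G" "x \<bullet> g \<in> fixed Q" "y \<bullet> g \<in> fixed Q" for x y g
  proof (cases "f (x, y) = \<zero>\<^bsub>k\<^esub>")
    case True
    have "x \<in> \<Omega>" "y \<in> \<Omega>" using xy by (auto simp: fixed_def)
    then have "f (x \<bullet> g, y \<bullet> g) \<noteq> \<zero>\<^bsub>k\<^esub> \<Longrightarrow> f (x, y) = f (x \<bullet> g, y \<bullet> g)"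
      using W1[OF g(2,3), of "inv g"] xy g(1) by simp
    then show ?thesis using True by auto
  qed (rule W1[OF that])
  define R where "R x y g \<longleftrightarrow> g \<in> carrier G \<and> x \<bullet> g \<in> fixed Q \<and> y \<bullet> g \<in> fixed Q" for x y g
  \<comment> \<open>A pair that some \<open>g\<close> moves into the fixed points of
    \<open>Q\<close> receives the entry found there; by \<open>W\<close> the choice of
    \<open>g\<close> does not matter. All other entries are zero.\<close>
  define f' where "f' = (\<lambda>(x, y). if x \<in> \<Omega> \<and> y \<in> \<Omega> \<and> (\<exists>g. R x y g)
    then f (x \<bullet> (SOME g. R x y g), y \<bullet> (SOME g. R x y g)) else \<zero>\<^bsub>k\<^esub>)"
  have f'_eq: "f' (x, y) = f (x \<bullet> g, y \<bullet> g)" if xy: "x \<in> \<Omega>" "y \<in> \<Omega>" and R: "R x y g" for x y g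
  proof -
    define h where "h = (SOME g. R x y g)"
    have h: "R x y h" unfolding h_def using R by (rule someI)
    have z: "z \<bullet> h = z \<bullet> g \<bullet> (inv g \<otimes> h)" if "z \<in> \<Omega>" for z
      using that R h by (simp add: R_def dot_mult)
    have "f (x \<bullet> g \<bullet> (inv g \<otimes> h), y \<bullet> g \<bullet> (inv g \<otimes> h)) = f (x \<bullet> g, y \<bullet> g)"
      using R h z[OF xy(1), symmetric] z[OF xy(2), symmetric] by (intro W) (simp_all add: R_def)
    then have "f (x \<bullet> h, y \<bullet> h) = f (x \<bullet> g, y \<bullet> g)" using z xy by simp
    moreover have "f' (x, y) = f (x \<bullet> h, y \<bullet> h)" using xy R unfolding f'_def h_def by auto
    ultimately show ?thesis by simp
  qed
  have f'_zero: "f' (x, y) = \<zero>\<^bsub>k\<^esub>" if "\<nexists>g. R x y g" for x y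
    unfolding f'_def using that by auto
  have f'M: "f' \<in> carrier K.Mat" using fM by (intro K.MatI) (auto simp: f'_def)
  have "f' (x \<bullet> h, y \<bullet> h) = f' (x, y)" if h: "h \<in> carrier G" and xy: "x \<in> \<Omega>" "y \<in> \<Omega>" for x y h
  proof (cases "\<exists>g. R x y g")
    case True
    then obtain g where g: "R x y g" by blast
    have gG: "g \<in> carrier G" using g by (simp add: R_def)
    have z: "z \<bullet> h \<bullet> (inv h \<otimes> g) = z \<bullet> g" if "z \<in> \<Omega>" for z using that h gG by (simp add: dot_mult)
    have "R (x \<bullet> h) (y \<bullet> h) (inv h \<otimes> g)" using g h z xy by (simp add: R_def)
    then have "f' (x \<bullet> h, y \<bullet> h) = f (x \<bullet> h \<bullet> (inv h \<otimes> g), y \<bullet> h \<bullet> (inv h \<otimes> g))"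
      using xy h by (intro f'_eq) simp_all
    then show ?thesis using f'_eq[OF xy g] z xy by simp
  next
    case False
    have "\<nexists>g. R (x \<bullet> h) (y \<bullet> h) g"
    proof
      assume "\<exists>g. R (x \<bullet> h) (y \<bullet> h) g"
      then obtain g where g: "R (x \<bullet> h) (y \<bullet> h) g" by blast
      then have "R x y (h \<otimes> g)" using h xy by (simp add: R_def dot_mult)
      then show False using False by blast
    qed
    then show ?thesis using False f'_zero by simp
  qed
  then have f'I: "f' \<in> Inv (carrier G)" using f'M by (simp add: Inv_def del: InvD)
  have "br Q f' = f"
  proof (rule K.Mat_eqI[OF br_closed[OF f'M] fM])
    fix x y assume xy: "x \<in> \<Omega>" "y \<in> \<Omega>"
    show "br Q f' (x, y) = f (x, y)"
    proof (cases "x \<in> fixed Q \<and> y \<in> fixed Q")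
      case True
      then have "f' (x, y) = f (x \<bullet> \<one>, y \<bullet> \<one>)" using xy by (intro f'_eq) (simp_all add: R_def)
      then show ?thesis using True xy by (simp add: br_def)
    next
      case False
      then show ?thesis using fun_cong[OF f(2), of "(x, y)"] by (auto simp: br_def)
    qed
  qed
  then show ?thesis using that f'I by blast
qed

text \<open>By the lifting lemma the complement of the Scott module in the Brauer construction would
  give a non-nilpotent element of the local algebra of \<open>e\<close>, hence be everything.\<close>

lemma br_eq_scott_part:
  assumes Q: "p_subgroup p G Q" and e: "primitive (carrier G) e"
    and s: "s \<in> Inv (normalizer G Q)" "s \<otimes>\<^bsub>K.Mat\<^esub> s = s" "br Q e \<otimes>\<^bsub>K.Mat\<^esub> s = s" "s \<otimes>\<^bsub>K.Mat\<^esub> br Q e = s"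
    and s0: "s \<noteq> \<zero>\<^bsub>K.Mat\<^esub>"
    and prim: "\<And>L. \<lbrakk>p_subgroup p G L; Q \<subset> L; L \<subseteq> normalizer G Q; fixed L \<noteq> {}\<rbrakk> \<Longrightarrow>
      primitive (L <#> centralizer G L) (br L e) \<and> br L s \<noteq> \<zero>\<^bsub>K.Mat\<^esub>"
  shows "s = br Q e"
proof (rule ccontr)
  assume ne: "s \<noteq> br Q e"
  let ?N = "normalizer G Q"
  have QG: "subgroup Q G" using Q by (simp add: p_subgroup_def)
  interpret Q: subgroup Q G by fact
  interpret N: subgroup ?N G using Q.subset by (rule subgroup_normalizer)
  have eI: "e \<in> Inv (carrier G)" "e \<otimes>\<^bsub>K.Mat\<^esub> e = e" using e by (auto simp: primitive_def)
  have eM: "e \<in> carrier K.Mat" using eI(1) by (rule InvD)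
  have sM: "s \<in> carrier K.Mat" using s(1) by (rule InvD)
  have eQ: "e \<in> Inv Q" and eN: "e \<in> Inv ?N" using eI(1) Inv_mono[OF Q.subset] Inv_mono[OF N.subset] by blast+
  define E where "E = br Q e"
  have EN: "E \<in> Inv ?N" unfolding E_def using eN Q.subset by (rule br_Inv) simp
  have EM: "E \<in> carrier K.Mat" using EN by (rule InvD)
  have EE: "E \<otimes>\<^bsub>K.Mat\<^esub> E = E" unfolding E_def using br_mult[OF Q eQ eQ] eI(2) by simp
  have sE: "E \<otimes>\<^bsub>K.Mat\<^esub> s = s" "s \<otimes>\<^bsub>K.Mat\<^esub> E = s" using s by (simp_all add: E_def)
  define f where "f = E \<ominus>\<^bsub>K.Mat\<^esub> s"
  have fI: "f \<in> Inv ?N" unfolding f_def by (rule Inv_diff[OF EN s(1)])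
  have fM: "f \<in> carrier K.Mat" using fI by (rule InvD)
  have Ef: "E = f \<oplus>\<^bsub>K.Mat\<^esub> s" using EM sM by (simp add: f_def a_minus_def K.Mat.a_assoc K.Mat.l_neg)
  have fE: "E \<otimes>\<^bsub>K.Mat\<^esub> f = f" "f \<otimes>\<^bsub>K.Mat\<^esub> E = f" and fs: "s \<otimes>\<^bsub>K.Mat\<^esub> f = \<zero>\<^bsub>K.Mat\<^esub>"
    using EM sM sE EE s(2)
    by (simp_all add: f_def a_minus_def K.Mat.l_distr K.Mat.r_distr K.Mat.l_minus K.Mat.r_minus K.Mat.r_neg)
  have ff: "f \<otimes>\<^bsub>K.Mat\<^esub> f = f"
  proof -
    have "f = E \<otimes>\<^bsub>K.Mat\<^esub> f" using fE by simp
    also have "\<dots> = f \<otimes>\<^bsub>K.Mat\<^esub> f \<oplus>\<^bsub>K.Mat\<^esub> s \<otimes>\<^bsub>K.Mat\<^esub> f" using Ef fM sM K.Mat.l_distr by metis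
    finally show ?thesis using fs fM by simp
  qed
  have f0: "f \<noteq> \<zero>\<^bsub>K.Mat\<^esub>" using Ef ne sM by (auto simp: E_def)
  \<comment> \<open>The group $L C_G(L)$ normalizes \<open>Q\<close>, so \<open>br L s\<close> is
    invariant under it. It is a non-zero idempotent below the primitive \<open>br L e\<close>, hence
    equal to it, and the difference \<open>br L f\<close> vanishes.\<close>
  have van: "br L f = \<zero>\<^bsub>K.Mat\<^esub>" if L: "p_subgroup p G L" "Q \<subset> L" "L \<subseteq> ?N" for L
  proof (cases "fixed L = {}")
    case True
    then show ?thesis by (auto simp: br_def K.Mat_simps fun_eq_iff)
  next
    case False
    have LG: "subgroup L G" using L(1) by (simp add: p_subgroup_def)
    let ?H = "L <#> centralizer G L"
    have HL: "?H \<subseteq> normalizer G L" by (rule QC_normalizer[OF LG])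
    have "centralizer G L \<subseteq> centralizer G Q" using L(2) by (auto simp: centralizer_def)
    moreover have "centralizer G Q \<subseteq> Q <#> centralizer G Q"
    proof
      fix c assume c: "c \<in> centralizer G Q"
      then have "c = \<one> \<otimes> c" by (simp add: centralizer_def)
      then show "c \<in> Q <#> centralizer G Q" using c Q.one_closed unfolding set_mult_def by blast
    qed
    ultimately have "centralizer G L \<subseteq> ?N" using QC_normalizer[OF QG] by blast
    then have "l \<otimes> c \<in> ?N" if "l \<in> L" "c \<in> centralizer G L" for l c
      using L(3) that by (meson N.m_closed subsetD)
    then have HN: "?H \<subseteq> ?N" unfolding set_mult_def by blast
    have pr: "primitive ?H (br L e)" "br L s \<noteq> \<zero>\<^bsub>K.Mat\<^esub>" using prim[OF L False] by auto
    have LI: "s \<in> Inv L" "E \<in> Inv L" using s(1) EN Inv_mono[OF L(3)] by auto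
    have bE: "br L E = br L e" unfolding E_def using L(2) by (intro br_br) (auto simp: fixed_def)
    have "br L s \<in> Inv ?H"
      using br_Inv[OF subsetD[OF Inv_mono[OF HN] s(1)] subgroup.subset[OF LG] HL] .
    moreover have "br L s \<otimes>\<^bsub>K.Mat\<^esub> br L s = br L s" using br_mult[OF L(1) LI(1) LI(1)] s(2) by simp
    moreover have "br L e \<otimes>\<^bsub>K.Mat\<^esub> br L s = br L s" using br_mult[OF L(1) LI(2) LI(1)] sE(1) bE by simp
    moreover have "br L s \<otimes>\<^bsub>K.Mat\<^esub> br L e = br L s" using br_mult[OF L(1) LI(1) LI(2)] sE(2) bE by simp
    ultimately have "br L s = br L e" using pr unfolding primitive_def by blast
    moreover have "br L f = br L E \<ominus>\<^bsub>K.Mat\<^esub> br L s" unfolding f_def by (rule br_minus[OF EM sM])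
    ultimately show ?thesis using bE eM by (simp add: a_minus_def K.Mat.r_neg)
  qed
  have "br Q f = f"
  proof -
    have "K.diag (fixed Q) \<otimes>\<^bsub>K.Mat\<^esub> E = E" "E \<otimes>\<^bsub>K.Mat\<^esub> K.diag (fixed Q) = E"
      using K.diag_mult[OF EM fixed_subset] EM fixed_subset
      by (intro K.Mat_eqI; simp; simp add: E_def br_def)+
    then have "K.diag (fixed Q) \<otimes>\<^bsub>K.Mat\<^esub> f = f" "f \<otimes>\<^bsub>K.Mat\<^esub> K.diag (fixed Q) = f"
      using fE EM fM K.diag_closed[OF fixed_subset, of Q] by (metis K.Mat.m_assoc)+
    then have "supp (fixed Q) f" using supp_diag[OF fM fixed_subset] by simp
    then show ?thesis by (auto simp: br_def supp_def fun_eq_iff)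
  qed
  then obtain f' where f': "f' \<in> Inv (carrier G)" "br Q f' = f" using lift_invariant[OF Q fI _ van] by blast
  have f'M: "f' \<in> carrier K.Mat" using f'(1) by (rule InvD)
  have f'Q: "f' \<in> Inv Q" using f'(1) Inv_mono[OF Q.subset] by blast
  \<comment> \<open>Multiplying by \<open>e\<close> on both sides places the lift in the corner of
    \<open>e\<close>. Its restriction is still \<open>f\<close>, because \<open>f\<close> lies below
    \<open>E\<close>.\<close>
  define a where "a = e \<otimes>\<^bsub>K.Mat\<^esub> (f' \<otimes>\<^bsub>K.Mat\<^esub> e)"
  have aI: "a \<in> Inv (carrier G)" unfolding a_def by (intro Inv_mult[OF subset_refl] eI(1) f'(1))
  have aM: "a \<in> carrier K.Mat" using aI by (rule InvD)
  have aQ: "a \<in> Inv Q" using aI Inv_mono[OF Q.subset] by blast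
  have ea: "e \<otimes>\<^bsub>K.Mat\<^esub> a = a" "a \<otimes>\<^bsub>K.Mat\<^esub> e = a"
    using eM f'M eI(2) by (simp_all add: a_def K.Mat.m_assoc) (simp add: K.Mat.m_assoc[symmetric])
  have ba: "br Q a = f"
    using br_mult[OF Q eQ Inv_mult[OF Q.subset f'Q eQ]] br_mult[OF Q f'Q eQ] f'(2) fE
    by (simp add: a_def E_def)
  \<comment> \<open>The exponents start at one: the zeroth power restricts to the identity on the
    fixed points, not to \<open>f\<close>.\<close>
  have pw: "br Q (a [^]\<^bsub>K.Mat\<^esub> Suc n) = f" "a [^]\<^bsub>K.Mat\<^esub> Suc n \<in> Inv Q" for n
  proof (induction n)
    case 0
    { case 1 show ?case using ba aM by simp }
    { case 2 show ?case using aQ aM by simp }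
  next
    case (Suc n)
    { case 1 show ?case using br_mult[OF Q Suc(2) aQ] Suc(1) ba ff by simp }
    { case 2 show ?case using Inv_mult[OF Q.subset Suc(2) aQ] by simp }
  qed
  have "a [^]\<^bsub>K.Mat\<^esub> n \<noteq> \<zero>\<^bsub>K.Mat\<^esub>" for n :: nat
  proof
    assume "a [^]\<^bsub>K.Mat\<^esub> n = \<zero>\<^bsub>K.Mat\<^esub>"
    then have "a [^]\<^bsub>K.Mat\<^esub> Suc n = \<zero>\<^bsub>K.Mat\<^esub>" using aM by simp
    then show False using pw(1)[of n] f0 by simp
  qed
  then obtain b where b: "b \<in> Inv (carrier G)" "a \<otimes>\<^bsub>K.Mat\<^esub> b = e"
    using primitive_fitting[OF subset_refl e aI ea] by blast
  have bQ: "b \<in> Inv Q" using b(1) Inv_mono[OF Q.subset] by blast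
  have bM: "br Q b \<in> carrier K.Mat" using b(1) by simp
  \<comment> \<open>A unit of the corner of \<open>e\<close> restricts to a unit of the corner of
    \<open>E\<close>, and the idempotent \<open>f\<close> can be a unit there only if it equals
    \<open>E\<close>.\<close>
  have "E = f \<otimes>\<^bsub>K.Mat\<^esub> br Q b" using br_mult[OF Q aQ bQ] b(2) ba by (simp add: E_def)
  then have "f \<otimes>\<^bsub>K.Mat\<^esub> E = E" using ff fM bM by (metis K.Mat.m_assoc)
  then have "f = E" using fE(2) by simp
  then have "s \<otimes>\<^bsub>K.Mat\<^esub> E = \<zero>\<^bsub>K.Mat\<^esub>" using fs by simp
  then show False using sE(2) s0 by simp
qed

end

section \<open>The equivalence for a primitive idempotent\<close>

context p_action
begin

lemma fixed_antimono: "Q \<subseteq> L \<Longrightarrow> fixed L \<subseteq> fixed Q"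
  by (auto simp: fixed_def)

lemma br_zero_if_no_fixed: "fixed Q = {} \<Longrightarrow> br Q a = \<zero>\<^bsub>K.Mat\<^esub>"
  by (auto simp: br_def K.Mat_simps fun_eq_iff)

lemma isomorphic_image_indecomposable_iff:
  assumes H: "subgroup H G" "H \<subseteq> N" and N: "subgroup N G"
    and V: "right_module k (G\<lparr>carrier := N\<rparr>) V" and a: "a \<in> Inv N" "a \<otimes>\<^bsub>K.Mat\<^esub> a = a"
    and iso: "isomorphic k (G\<lparr>carrier := N\<rparr>) V (image a)"
  shows "indecomposable k (G\<lparr>carrier := H\<rparr>) V \<longleftrightarrow> primitive H a"
    and "zero_module V \<longleftrightarrow> a = \<zero>\<^bsub>K.Mat\<^esub>"
proof -
  have aH: "a \<in> Inv H" using a(1) Inv_mono[OF H(2)] by blast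
  have HN: "subgroup H (G\<lparr>carrier := N\<rparr>)" using subgroup_incl[OF H(1) N H(2)] .
  have "right_module k (G\<lparr>carrier := H\<rparr>) V"
    using right_module.subgroup_module[OF V HN] by simp
  moreover have "isomorphic k (G\<lparr>carrier := H\<rparr>) V (image a)"
    using isomorphic_subgroup[OF iso, of H] H(2) by simp
  ultimately show "indecomposable k (G\<lparr>carrier := H\<rparr>) V \<longleftrightarrow> primitive H a"
    using indecomposable_isomorphic[OF _ image_right_module[OF H(1) aH]]
      indecomposable_image_iff[OF H(1) aH a(2)] by blast
  have "zero_module V \<longleftrightarrow> zero_module (image a)"
    by (rule zero_module_isomorphic[OF V image_right_module[OF N a(1)] iso])
  then show "zero_module V \<longleftrightarrow> a = \<zero>\<^bsub>K.Mat\<^esub>"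
    using image_zero_iff[OF _ a(2)] a(1) by (simp add: zero_module_def image_def)
qed

lemma brauer_construction_iff:
  assumes M: "right_module k G M" and e: "e \<in> Inv (carrier G)" "e \<otimes>\<^bsub>K.Mat\<^esub> e = e"
    and iso: "isomorphic k G M (image e)" and Q: "p_subgroup p G Q"
  shows "indecomposable k (G\<lparr>carrier := Q <#> centralizer G Q\<rparr>) (brauer_construction G M Q)
      \<longleftrightarrow> primitive (Q <#> centralizer G Q) (br Q e)"
    and "zero_module (brauer_construction G M Q) \<longleftrightarrow> br Q e = \<zero>\<^bsub>K.Mat\<^esub>"
proof -
  have QG: "subgroup Q G" using Q by (simp add: p_subgroup_def)
  note QC = subgroup.subset[OF QG]
  note N = subgroup_normalizer[OF QC]
  have eQ: "e \<in> Inv Q" using e(1) Inv_mono[OF QC] by blast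
  have E: "br Q e \<in> Inv (normalizer G Q)"
    using e(1) Inv_mono[OF subgroup.subset[OF N]] QC by (intro br_Inv) auto
  have EE: "br Q e \<otimes>\<^bsub>K.Mat\<^esub> br Q e = br Q e" using br_mult[OF Q eQ eQ] e(2) by simp
  note * = isomorphic_image_indecomposable_iff[OF QC_subgroup[OF QG] QC_normalizer[OF QG] N
      brauer_construction_image(1)[OF M e iso Q] E EE brauer_construction_image(2)[OF M e iso Q]]
  show "indecomposable k (G\<lparr>carrier := Q <#> centralizer G Q\<rparr>) (brauer_construction G M Q)
      \<longleftrightarrow> primitive (Q <#> centralizer G Q) (br Q e)"
    and "zero_module (brauer_construction G M Q) \<longleftrightarrow> br Q e = \<zero>\<^bsub>K.Mat\<^esub>" using * by blast+
qed

text \<open>The idempotent \<open>t\<close> of the Scott module lives on the orbit of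
  \<open>y0\<close> and need not lie below \<open>br Q e\<close>. Exchanging the factors in $t = a
  b$ gives $s = b a$, an idempotent with isomorphic image that does lie below it.\<close>

lemma scott_part:
  assumes Q: "p_subgroup p G Q" and e: "e \<in> Inv (carrier G)" "e \<otimes>\<^bsub>K.Mat\<^esub> e = e" "rsum e y0 = \<one>\<^bsub>k\<^esub>"
    and dom: "dominant Q y0" and N_def: "N = normalizer G Q" and D_def: "D = {n \<in> N. y0 \<bullet> n = y0}"
    and D: "p_subgroup p G D"
  obtains s where "s \<in> Inv N" "s \<otimes>\<^bsub>K.Mat\<^esub> s = s" "br Q e \<otimes>\<^bsub>K.Mat\<^esub> s = s" "s \<otimes>\<^bsub>K.Mat\<^esub> br Q e = s"
    "s \<noteq> \<zero>\<^bsub>K.Mat\<^esub>"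
    "right_module k (G\<lparr>carrier := N\<rparr>) (scott_module k (G\<lparr>carrier := N\<rparr>) D)"
    "isomorphic k (G\<lparr>carrier := N\<rparr>) (scott_module k (G\<lparr>carrier := N\<rparr>) D) (image s)"
    "\<And>L. \<lbrakk>p_subgroup p G L; Q \<subseteq> L; L \<subseteq> N; fixed L \<noteq> {}\<rbrakk> \<Longrightarrow> br L s \<noteq> \<zero>\<^bsub>K.Mat\<^esub>"
proof -
  have QG: "subgroup Q G" using Q by (simp add: p_subgroup_def)
  have N: "subgroup N G" unfolding N_def using subgroup.subset[OF QG] by (rule subgroup_normalizer)
  have y0: "y0 \<in> \<Omega>" using dom by (auto simp: dominant_def fixed_def)
  define Y where "Y = (\<lambda>n. y0 \<bullet> n) ` N"
  obtain t where t: "primitive N t" "supp Y t" "\<And>x. x \<in> Y \<Longrightarrow> rsum t x = \<one>\<^bsub>k\<^esub>"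
    and S: "right_module k (G\<lparr>carrier := N\<rparr>) (scott_module k (G\<lparr>carrier := N\<rparr>) D)"
      "isomorphic k (G\<lparr>carrier := N\<rparr>) (scott_module k (G\<lparr>carrier := N\<rparr>) D) (image t)"
    using scott_module_image[OF N y0 Y_def D_def] by blast
  have tI: "t \<in> Inv N" "t \<otimes>\<^bsub>K.Mat\<^esub> t = t" "t \<noteq> \<zero>\<^bsub>K.Mat\<^esub>" using t(1) by (auto simp: primitive_def)
  obtain a b where a: "a \<in> Inv N" "t \<otimes>\<^bsub>K.Mat\<^esub> a = a" "a \<otimes>\<^bsub>K.Mat\<^esub> br Q e = a"
    and b: "b \<in> Inv N" "br Q e \<otimes>\<^bsub>K.Mat\<^esub> b = b" "b \<otimes>\<^bsub>K.Mat\<^esub> t = b" and ab: "a \<otimes>\<^bsub>K.Mat\<^esub> b = t"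
    using scott_factorization[OF Q e dom N_def D[unfolded D_def] Y_def t] by blast
  have M: "a \<in> carrier K.Mat" "b \<in> carrier K.Mat" "t \<in> carrier K.Mat" "br Q e \<in> carrier K.Mat"
    using a(1) b(1) tI(1) e(1) by (auto dest: InvD)
  have a_ba: "a \<otimes>\<^bsub>K.Mat\<^esub> (b \<otimes>\<^bsub>K.Mat\<^esub> a) = a" using ab a(2) M by (simp add: K.Mat.m_assoc[symmetric])
  define s where "s = b \<otimes>\<^bsub>K.Mat\<^esub> a"
  have sI: "s \<in> Inv N" unfolding s_def by (rule Inv_mult[OF subgroup.subset[OF N] b(1) a(1)])
  have ss: "s \<otimes>\<^bsub>K.Mat\<^esub> s = s" unfolding s_def using a_ba M by (simp add: K.Mat.m_assoc)
  show ?thesis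
  proof (rule that[of s])
    show "br Q e \<otimes>\<^bsub>K.Mat\<^esub> s = s" unfolding s_def using b(2) M by (simp add: K.Mat.m_assoc[symmetric])
    show "s \<otimes>\<^bsub>K.Mat\<^esub> br Q e = s" unfolding s_def using a(3) M by (simp add: K.Mat.m_assoc)
    show "s \<noteq> \<zero>\<^bsub>K.Mat\<^esub>"
    proof
      assume "s = \<zero>\<^bsub>K.Mat\<^esub>"
      then have "a = \<zero>\<^bsub>K.Mat\<^esub>" using a_ba M by (simp add: s_def)
      then show False using ab tI(3) M by simp
    qed
    have "isomorphic k (G\<lparr>carrier := N\<rparr>) (image t) (image s)"
      by (rule image_isomorphic[OF N sI tI(1) a(1) a_ba[folded s_def] b(1,3) ab s_def[symmetric]])
    then show "isomorphic k (G\<lparr>carrier := N\<rparr>) (scott_module k (G\<lparr>carrier := N\<rparr>) D) (image s)"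
      by (rule isomorphic_trans[OF S(2)])
    fix L assume L: "p_subgroup p G L" "Q \<subseteq> L" "L \<subseteq> N" "fixed L \<noteq> {}"
    then obtain x where x: "x \<in> fixed L" by blast
    show "br L s \<noteq> \<zero>\<^bsub>K.Mat\<^esub>"
      unfolding s_def
      by (rule br_factor_nonzero[OF L(1) L(3)[unfolded N_def] L(2) dom tI(1)[unfolded N_def]
            t(3)[unfolded Y_def N_def] tI(2) a(1)[unfolded N_def] b(1)[unfolded N_def] ab x])
  qed (rule sI ss S(1))+
qed

text \<open>Every \<open>p\<close>-subgroup with a fixed point has a conjugate in \<open>F\<close>; in the application \<open>F\<close>
  consists of the fully normalized subgroups of the stabilizer of \<open>y0\<close>.\<close>

lemma relatively_brauer_indecomposable_iff:
  assumes M: "right_module k G M" and e: "primitive (carrier G) e" "rsum e y0 = \<one>\<^bsub>k\<^esub>"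
    and iso: "isomorphic k G M (image e)" and R: "R \<subseteq> carrier G"
    and F: "\<And>Q. Q \<in> F \<Longrightarrow> p_subgroup p G Q \<and> dominant Q y0 \<and> p_subgroup p G (D Q)"
    and F_conj: "\<And>Q. \<lbrakk>p_subgroup p G Q; fixed Q \<noteq> {}\<rbrakk> \<Longrightarrow> \<exists>g\<in>carrier G. conj_by G g ` Q \<in> F"
    and D: "\<And>Q. Q \<in> F \<Longrightarrow> D Q = {n \<in> normalizer G Q. y0 \<bullet> n = y0}"
    and S: "\<And>Q. S Q = scott_module k (G\<lparr>carrier := normalizer G Q\<rparr>) (D Q)"
  shows "relatively_brauer_indecomposable p k G R M \<longleftrightarrow>
      (\<forall>Q\<in>F. (\<exists>g\<in>carrier G. conj_by G g ` R \<subseteq> Q) \<longrightarrow>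
        indecomposable k (G\<lparr>carrier := Q <#> centralizer G Q\<rparr>) (S Q))" (is "?i \<longleftrightarrow> ?ii")
    and "relatively_brauer_indecomposable p k G R M \<Longrightarrow> Q \<in> F \<Longrightarrow>
      \<exists>g\<in>carrier G. conj_by G g ` R \<subseteq> Q \<Longrightarrow>
      isomorphic k (G\<lparr>carrier := normalizer G Q\<rparr>) (brauer_construction G M Q) (S Q)"
proof -
  have eI: "e \<in> Inv (carrier G)" "e \<otimes>\<^bsub>K.Mat\<^esub> e = e" using e(1) by (auto simp: primitive_def)
  note bc = brauer_construction_iff[OF M eI iso]
  \<comment> \<open>The condition of relative Brauer indecomposability at \<open>Q\<close>. It is
    invariant under conjugation, so a conjugate of \<open>R\<close> inside \<open>Q\<close> is as
    good as \<open>R\<close> itself.\<close>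
  define good where "good Q \<longleftrightarrow> primitive (Q <#> centralizer G Q) (br Q e) \<or> br Q e = \<zero>\<^bsub>K.Mat\<^esub>" for Q
  have i_iff: "?i \<longleftrightarrow> (\<forall>Q. p_subgroup p G Q \<and> R \<subseteq> Q \<longrightarrow> good Q)"
    unfolding relatively_brauer_indecomposable_def good_def using bc by blast
  have good_conj: "good (conj_by G g ` Q)" if "good Q" "p_subgroup p G Q" "g \<in> carrier G" for Q g
    using that primitive_br_conj[OF _ _ eI(1)] br_zero_conj[OF _ _ eI(1)]
    unfolding good_def p_subgroup_def by blast
  have good_conjD: "good Q" if "good (conj_by G g ` Q)" "p_subgroup p G Q" "g \<in> carrier G" for Q g
  proof -
    have "Q \<subseteq> carrier G" using that(2) by (simp add: p_subgroup_def subgroup.subset)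
    then have "conj_by G (inv g) ` conj_by G g ` Q = Q" using that(3) conj_by_image_mult[of g "inv g" Q] by simp
    then show ?thesis using good_conj[OF that(1) p_subgroup_conj_by[OF that(2,3)], of "inv g"] that(3) by simp
  qed
  have sub_conj: "\<exists>h\<in>carrier G. conj_by G h ` R \<subseteq> conj_by G g ` Q"
    if ex: "\<exists>h\<in>carrier G. conj_by G h ` R \<subseteq> Q" and g: "g \<in> carrier G" for Q g
  proof -
    obtain h where h: "h \<in> carrier G" "conj_by G h ` R \<subseteq> Q" using ex by blast
    have "conj_by G (h \<otimes> g) ` R \<subseteq> conj_by G g ` Q"
      unfolding conj_by_image_mult[OF h(1) g R] using h(2) by (rule image_mono)
    then show ?thesis using h(1) g m_closed by blast
  qed
  have good_if_i: "good Q" if i: "?i" and Q: "p_subgroup p G Q"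
    and gR: "\<exists>g\<in>carrier G. conj_by G g ` R \<subseteq> Q" for Q
  proof -
    obtain g where g: "g \<in> carrier G" "conj_by G g ` R \<subseteq> Q" using gR by blast
    have "R = conj_by G (inv g) ` conj_by G g ` R" using g(1) R conj_by_image_mult[of g "inv g" R] by simp
    then have "R \<subseteq> conj_by G (inv g) ` Q" using image_mono[OF g(2)] by metis
    then have "good (conj_by G (inv g) ` Q)" using i i_iff p_subgroup_conj_by[OF Q] g(1) by simp
    then show ?thesis using good_conjD Q g(1) by blast
  qed
  have S_if_i: "isomorphic k (G\<lparr>carrier := normalizer G Q\<rparr>) (brauer_construction G M Q) (S Q) \<and>
      indecomposable k (G\<lparr>carrier := Q <#> centralizer G Q\<rparr>) (S Q)"
    if i: ?i and QF: "Q \<in> F" and gR: "\<exists>g\<in>carrier G. conj_by G g ` R \<subseteq> Q" for Q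
  proof
    note Q = F[OF QF, THEN conjunct1]
    obtain s where s: "s \<in> Inv (normalizer G Q)" "s \<otimes>\<^bsub>K.Mat\<^esub> s = s" "br Q e \<otimes>\<^bsub>K.Mat\<^esub> s = s"
      "s \<otimes>\<^bsub>K.Mat\<^esub> br Q e = s" "s \<noteq> \<zero>\<^bsub>K.Mat\<^esub>"
      "right_module k (G\<lparr>carrier := normalizer G Q\<rparr>) (S Q)"
      "isomorphic k (G\<lparr>carrier := normalizer G Q\<rparr>) (S Q) (image s)"
      using scott_part[OF Q eI e(2) _ refl D[OF QF]] F[OF QF] unfolding S by metis
    have QG: "subgroup Q G" using Q by (simp add: p_subgroup_def)
    note N = subgroup_normalizer[OF subgroup.subset[OF QG]]
    \<comment> \<open>The non-zero idempotent \<open>s\<close> lies below \<open>br Q e\<close>,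
      which (i) makes primitive for the smaller group $Q C_G(Q)$, so the two coincide.\<close>
    have "s \<in> Inv (Q <#> centralizer G Q)" using s(1) Inv_mono[OF QC_normalizer[OF QG]] by blast
    moreover have "br Q e \<noteq> \<zero>\<^bsub>K.Mat\<^esub>" using s(1,3,5) by auto
    ultimately have prim: "primitive (Q <#> centralizer G Q) (br Q e)" and sE: "s = br Q e"
      using good_if_i[OF i Q gR] s(2-5) unfolding good_def primitive_def by blast+
    show "isomorphic k (G\<lparr>carrier := normalizer G Q\<rparr>) (brauer_construction G M Q) (S Q)"
      using isomorphic_trans[OF brauer_construction_image(2)[OF M eI iso Q]]
        isomorphic_sym[OF s(6) image_right_module[OF N s(1)] s(7)] unfolding sE .
    show "indecomposable k (G\<lparr>carrier := Q <#> centralizer G Q\<rparr>) (S Q)"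
      using isomorphic_image_indecomposable_iff(1)[OF QC_subgroup[OF QG] QC_normalizer[OF QG] N s(6,1,2,7)]
        prim sE by blast
  qed
  then show "isomorphic k (G\<lparr>carrier := normalizer G Q\<rparr>) (brauer_construction G M Q) (S Q)"
    if ?i "Q \<in> F" "\<exists>g\<in>carrier G. conj_by G g ` R \<subseteq> Q" for Q
    using that by blast
  show "?i \<longleftrightarrow> ?ii"
  proof
    assume ?i
    then show ?ii using S_if_i by blast
  next
    assume ii: ?ii
    have "good Q" if Q: "p_subgroup p G Q" and gR: "\<exists>g\<in>carrier G. conj_by G g ` R \<subseteq> Q" for Q
      using that
    \<comment> \<open>The induction goes from large to small \<open>Q\<close>, hence the difference
      of the orders. Asking only for a conjugate of \<open>R\<close> in \<open>Q\<close> keeps the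
      claim stable when \<open>Q\<close> is replaced by its conjugate in \<open>F\<close>.\<close>
    proof (induction "card (carrier G) - card Q" arbitrary: Q rule: less_induct)
      case less
      show ?case
      proof (cases "fixed Q = {}")
        case True
        then show ?thesis using br_zero_if_no_fixed by (simp add: good_def)
      next
        case False
        then obtain g where g: "g \<in> carrier G" "conj_by G g ` Q \<in> F" using F_conj less.prems(1) by blast
        define Q' where "Q' = conj_by G g ` Q"
        have QF: "Q' \<in> F" using g(2) by (simp add: Q'_def)
        note Q' = F[OF QF, THEN conjunct1]
        have Q'G: "subgroup Q' G" using Q' by (simp add: p_subgroup_def)
        have gR': "\<exists>g\<in>carrier G. conj_by G g ` R \<subseteq> Q'" unfolding Q'_def by (rule sub_conj[OF less.prems(2) g(1)])
        have cQ': "card Q' = card Q"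
          unfolding Q'_def using less.prems(1) g(1) by (intro card_conj_by) (simp_all add: p_subgroup_def subgroup.subset)
        note N = subgroup_normalizer[OF subgroup.subset[OF Q'G]]
        obtain s where s: "s \<in> Inv (normalizer G Q')" "s \<otimes>\<^bsub>K.Mat\<^esub> s = s" "br Q' e \<otimes>\<^bsub>K.Mat\<^esub> s = s"
          "s \<otimes>\<^bsub>K.Mat\<^esub> br Q' e = s" "s \<noteq> \<zero>\<^bsub>K.Mat\<^esub>"
          "right_module k (G\<lparr>carrier := normalizer G Q'\<rparr>) (S Q')"
          "isomorphic k (G\<lparr>carrier := normalizer G Q'\<rparr>) (S Q') (image s)"
          and s_br: "\<And>L. \<lbrakk>p_subgroup p G L; Q' \<subseteq> L; L \<subseteq> normalizer G Q'; fixed L \<noteq> {}\<rbrakk> \<Longrightarrow> br L s \<noteq> \<zero>\<^bsub>K.Mat\<^esub>"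
          using scott_part[OF Q' eI e(2) _ refl D[OF QF]] F[OF QF] unfolding S by metis
        have "s = br Q' e"
        proof (rule br_eq_scott_part[OF Q' e(1) s(1-5)])
          fix L assume L: "p_subgroup p G L" "Q' \<subset> L" "L \<subseteq> normalizer G Q'" "fixed L \<noteq> {}"
          have LG: "L \<subseteq> carrier G" using L(1) by (simp add: p_subgroup_def subgroup.subset)
          have finL: "finite L" using finite_subset[OF LG finite_G] .
          have "card Q' < card L" using psubset_card_mono[OF finL L(2)] .
          moreover have "card L \<le> card (carrier G)" using card_mono[OF finite_G LG] .
          ultimately have "card (carrier G) - card L < card (carrier G) - card Q" using cQ' by linarith
          moreover have "\<exists>g\<in>carrier G. conj_by G g ` R \<subseteq> L" using gR' L(2) by blast
          ultimately have "good L" using less.hyps L(1) by blast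
          moreover have bs: "br L s \<noteq> \<zero>\<^bsub>K.Mat\<^esub>" using s_br L by blast
          \<comment> \<open>This rules out the zero alternative in \<open>good\<close>: since
            \<open>s\<close> lies below \<open>br Q' e\<close>, the non-zero \<open>br L s\<close>
            has \<open>br L e\<close> as a factor.\<close>
          moreover have "br L e \<noteq> \<zero>\<^bsub>K.Mat\<^esub>"
          proof
            assume z: "br L e = \<zero>\<^bsub>K.Mat\<^esub>"
            have E: "br Q' e \<in> Inv L"
              using eI(1) Inv_mono[OF LG] L(3) subgroup.subset[OF Q'G] by (intro br_Inv) auto
            have sL: "s \<in> Inv L" using s(1) Inv_mono[OF L(3)] by blast
            have "br L (br Q' e) = \<zero>\<^bsub>K.Mat\<^esub>" using z br_br[of L Q' e] psubset_imp_subset[OF L(2)] by (simp add: fixed_antimono)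
            then have "br L s = \<zero>\<^bsub>K.Mat\<^esub>" using br_mult[OF L(1) E sL] s(3) sL by simp
            then show False using bs by blast
          qed
          ultimately show "primitive (L <#> centralizer G L) (br L e) \<and> br L s \<noteq> \<zero>\<^bsub>K.Mat\<^esub>"
            by (simp add: good_def)
        qed
        moreover have "primitive (Q' <#> centralizer G Q') s"
          using isomorphic_image_indecomposable_iff(1)[OF QC_subgroup[OF Q'G] QC_normalizer[OF Q'G] N s(6,1,2,7)]
            ii QF gR' by blast
        ultimately have "good (conj_by G g ` Q)" by (simp add: good_def Q'_def)
        then show ?thesis using good_conjD less.prems(1) g(1) by blast
      qed
    qed
    moreover have "\<exists>g\<in>carrier G. conj_by G g ` R \<subseteq> Q" if "R \<subseteq> Q" for Q
      using that R by (intro bexI[of _ \<one>]) simp_all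
    ultimately show ?i using i_iff by blast
  qed
qed

end

section \<open>Prime characteristic, fully normalized conjugates and the action on the cosets of
  \<open>P\<close>\<close>

lemma (in field) characteristic_prime:
  assumes p: "characteristic R = p" "p > 0"
  shows "Factorial_Ring.prime p" and "a \<in> carrier R \<Longrightarrow> [p] \<cdot>\<^bsub>R\<^esub> a = \<zero>"
proof -
  have iff: "[n] \<cdot>\<^bsub>R\<^esub> \<one> = \<zero> \<longleftrightarrow> p dvd n" for n :: nat
    using group.pow_eq_id[OF a_group, of \<one> n] p(1) by (simp add: characteristic_def add_pow_def)
  have mult: "[n] \<cdot>\<^bsub>R\<^esub> a = [n] \<cdot>\<^bsub>R\<^esub> \<one> \<otimes> a" if "a \<in> carrier R" for n :: nat and a
    using that add_pow_ldistr[of \<one> a n] by simp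
  \<comment> \<open>A multiple of one vanishes exactly if \<open>p\<close> divides the factor, so
    the absence of zero divisors is primality of \<open>p\<close>.\<close>
  have "\<forall>m n. p dvd m * n \<longrightarrow> p dvd m \<or> p dvd n"
  proof (intro allI impI)
    fix m n assume *: "p dvd m * n"
    have "[m] \<cdot>\<^bsub>R\<^esub> \<one> \<otimes> [n] \<cdot>\<^bsub>R\<^esub> \<one> = [(m * n)] \<cdot>\<^bsub>R\<^esub> \<one>"
      using mult[of "[n] \<cdot>\<^bsub>R\<^esub> \<one>" m] add.nat_pow_pow[of \<one> m n] by (simp add: mult.commute)
    then show "p dvd m \<or> p dvd n" using integral * iff by (metis add.nat_pow_closed one_closed)
  qed
  moreover have "\<not> p dvd 1" using iff[of 1] by simp
  ultimately show "Factorial_Ring.prime p"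
    using p(2) unfolding Factorial_Ring.prime_def Factorial_Ring.prime_elem_def by simp
  show "[p] \<cdot>\<^bsub>R\<^esub> a = \<zero>" if "a \<in> carrier R" for a
    using mult[OF that, of p] iff[of p] that by simp
qed

context group
begin

lemma rcoset_eq_iff:
  assumes "subgroup B G" "g \<in> carrier G" shows "B #> g = B \<longleftrightarrow> g \<in> B"
  using assms coset_join1 coset_join2 subgroup.subset by metis

lemma fully_normalizedD:
  assumes P: "subgroup P G" and Q: "fully_normalized G P Q"
  shows "subgroup Q G" "Q \<subseteq> P"
  using incl_subgroup[OF P] subgroup.subset[of Q "G\<lparr>carrier := P\<rparr>"] Q
  by (auto simp: fully_normalized_def)

text \<open>Among the conjugates of \<open>Q\<close> inside \<open>P\<close>, one with largest
  normalizer in \<open>P\<close> is taken; the orders are bounded by that of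
  \<open>P\<close>.\<close>

lemma exists_fully_normalized_conj:
  assumes fin: "finite (carrier G)" and P: "subgroup P G" and Q: "subgroup Q G"
    and g: "g \<in> carrier G" "conj_by G g ` Q \<subseteq> P"
  shows "\<exists>h\<in>carrier G. fully_normalized G P (conj_by G h ` Q)"
proof -
  define f where "f h = card (normalizer (G\<lparr>carrier := P\<rparr>) (conj_by G h ` Q))" for h
  let ?C = "\<lambda>h. h \<in> carrier G \<and> conj_by G h ` Q \<subseteq> P"
  note QG = subgroup.subset[OF Q]
  have "finite P" using subgroup.subset[OF P] fin by (rule finite_subset)
  then have "f h < Suc (card P)" if "?C h" for h
    unfolding f_def normalizer_subgroup[OF P that[THEN conjunct2]] by (simp add: card_mono less_Suc_eq_le)
  then have "\<exists>h. ?C h \<and> (\<forall>h'. ?C h' \<longrightarrow> f h' \<le> f h)"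
    using g by (intro ex_has_greatest_nat[of ?C g _ "Suc (card P)"]) blast+
  then obtain h where h: "?C h" and max: "\<And>h'. ?C h' \<Longrightarrow> f h' \<le> f h" by blast
  have sub: "subgroup (conj_by G h ` Q) (G\<lparr>carrier := P\<rparr>)"
    using subgroup_incl[OF subgroup_conj_by[OF Q] P] h by blast
  have "card (normalizer (G\<lparr>carrier := P\<rparr>) T) \<le> f h"
    if T: "subgroup T (G\<lparr>carrier := P\<rparr>)" "fusion_conjugate G (conj_by G h ` Q) T" for T
  proof -
    have TP: "T \<subseteq> P" using subgroup.subset[OF T(1)] by simp
    have hQ: "conj_by G h ` Q \<subseteq> carrier G" using h subgroup.subset[OF P] by blast
    obtain c where c: "c \<in> carrier G" "conj_by G c ` conj_by G h ` Q = T"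
      using T(2) fusion_conjugate_iff[OF hQ order_trans[OF TP subgroup.subset[OF P]]] by (elim iffD1[THEN bexE])
    then have "T = conj_by G (h \<otimes> c) ` Q" using h QG conj_by_image_mult by metis
    then show ?thesis using max[of "h \<otimes> c"] TP h c(1) by (simp add: f_def)
  qed
  then have "fully_normalized G P (conj_by G h ` Q)"
    using sub unfolding fully_normalized_def f_def by blast
  then show ?thesis using h by blast
qed

end

theorem theorem1p3:
  fixes k :: "'k ring" and G :: "'g monoid" and p :: nat
    and M :: "('k, 'g, 'm) gmodule" and P R :: "'g set"
  assumes "algebraically_closed k" and "characteristic k = p" and "p > 0"
    and "group G" and "finite (carrier G)"
    and "p_subgroup p G P"
    and "fg_right_module k G M" and "isomorphic k G M (scott_module k G P)"
    and "saturated p G P"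
    and "subgroup R (G\<lparr>carrier := P\<rparr>)"
  shows "(relatively_brauer_indecomposable p k G R M \<longleftrightarrow>
      (\<forall>Q. fully_normalized G P Q \<and> (\<exists>g\<in>carrier G. conj_by G g ` R \<subseteq> Q) \<longrightarrow>
        indecomposable k (G\<lparr>carrier := Q <#>\<^bsub>G\<^esub> centralizer G Q\<rparr>)
          (scott_module k (G\<lparr>carrier := normalizer G Q\<rparr>) (normalizer (G\<lparr>carrier := P\<rparr>) Q)))) \<and>
    (relatively_brauer_indecomposable p k G R M \<longrightarrow>
      (\<forall>Q. fully_normalized G P Q \<and> (\<exists>g\<in>carrier G. conj_by G g ` R \<subseteq> Q) \<longrightarrow>
        isomorphic k (G\<lparr>carrier := normalizer G Q\<rparr>) (brauer_construction G M Q)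
          (scott_module k (G\<lparr>carrier := normalizer G Q\<rparr>) (normalizer (G\<lparr>carrier := P\<rparr>) Q))))"
proof -
  interpret k: algebraically_closed k by fact
  interpret G: group G by fact
  interpret M: fg_right_module k G M by fact
  note prime_p = k.characteristic_prime(1)[OF assms(2,3)]
  have PG: "subgroup P G" using assms(6) by (simp add: p_subgroup_def)
  interpret P: subgroup P G by fact
  interpret A: right_action G "rcosets\<^bsub>G\<^esub> P" "r_coset G" using PG by (rule G.rcosets_action)
  have "finite (rcosets\<^bsub>G\<^esub> P)" using assms(5) G.rcosets_subset_PowG[OF PG] by (metis finite_Pow_iff finite_subset)
  then interpret A: p_action G "rcosets\<^bsub>G\<^esub> P" "r_coset G" k p
    by unfold_locales (use prime_p assms(5) k.characteristic_prime(2)[OF assms(2,3)] in simp_all)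
  note eq_iff = G.rcoset_eq_iff[OF PG]
  have P_coset: "P \<in> rcosets\<^bsub>G\<^esub> P" by (rule P.subgroup_in_rcosets[OF assms(4)])
  have rc: "\<exists>g\<in>carrier G. x = P #>\<^bsub>G\<^esub> g" if "x \<in> rcosets\<^bsub>G\<^esub> P" for x
    using that by (auto simp: RCOSETS_def)
  let ?D = "\<lambda>Q. normalizer (G\<lparr>carrier := P\<rparr>) Q"
  let ?S = "\<lambda>Q. scott_module k (G\<lparr>carrier := normalizer G Q\<rparr>) (?D Q)"
  \<comment> \<open>\<open>P\<close> is the stabilizer of its own coset and the action is
    transitive, so the module induced from \<open>P\<close> is the whole permutation module and
    \<open>M\<close> is the image of a primitive idempotent.\<close>
  have PD: "P = {h \<in> carrier G. P #>\<^bsub>G\<^esub> h = P}" using eq_iff P.subset by blast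
  obtain e where e: "A.primitive (carrier G) e"
      "\<And>x. x \<in> (\<lambda>h. P #>\<^bsub>G\<^esub> h) ` carrier G \<Longrightarrow> A.rsum e x = \<one>\<^bsub>k\<^esub>"
    and e_iso: "isomorphic k (G\<lparr>carrier := carrier G\<rparr>) (scott_module k (G\<lparr>carrier := carrier G\<rparr>) P) (A.image e)"
    by (rule A.scott_module_image[OF G.subgroup_self P_coset refl PD]) (rule that)
  have "P = P #>\<^bsub>G\<^esub> \<one>\<^bsub>G\<^esub>" using eq_iff[of "\<one>\<^bsub>G\<^esub>"] by simp
  then have eP: "A.rsum e P = \<one>\<^bsub>k\<^esub>" using e(2) by blast
  have iso: "isomorphic k G M (A.image e)" using isomorphic_trans[OF assms(8)] e_iso by simp
  \<comment> \<open>Turns the fixed points of \<open>Q\<close> into conjugates of \<open>Q\<close>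
    inside \<open>P\<close>, the objects of the fusion system.\<close>
  have fixed_iff: "P #>\<^bsub>G\<^esub> g \<in> A.fixed Q \<longleftrightarrow> conj_by G (inv\<^bsub>G\<^esub> g) ` Q \<subseteq> P"
    if "g \<in> carrier G" "Q \<subseteq> carrier G" for g Q
  proof -
    have "P #>\<^bsub>G\<^esub> g \<in> rcosets\<^bsub>G\<^esub> P" by (rule G.rcosetsI[OF P.subset that(1)])
    then show ?thesis using G.rcoset_dot_eq_iff[OF PG that(1)] that(2) by (simp add: A.fixed_def) blast
  qed
  \<comment> \<open>Inside the normalizer of \<open>Q\<close>, the stabilizer of the coset
    \<open>P\<close> is $N_P(Q)$, the subgroup that defines the Scott module in (ii).\<close>
  have D_eq: "?D Q = {n \<in> normalizer G Q. P #>\<^bsub>G\<^esub> n = P}" if "fully_normalized G P Q" for Q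
    using G.normalizer_subgroup[OF PG G.fully_normalizedD(2)[OF PG that]]
      G.normalizerD(1)[OF _ subgroup.subset[OF G.fully_normalizedD(1)[OF PG that]]] eq_iff by auto
  have F: "p_subgroup p G Q \<and> A.dominant Q P \<and> p_subgroup p G (?D Q)"
    if FN: "fully_normalized G P Q" for Q
  proof (intro conjI)
    note Q = G.fully_normalizedD[OF PG FN]
    note QG = subgroup.subset[OF Q(1)]
    show "p_subgroup p G Q" by (rule G.p_subgroup_subset[OF prime_p assms(6) Q])
    show "p_subgroup p G (?D Q)"
      unfolding G.normalizer_subgroup[OF PG Q(2)]
      by (rule G.p_subgroup_subset[OF prime_p assms(6)
          G.subgroups_Inter_pair[OF G.subgroup_normalizer[OF QG] PG] Int_lower2])
    show "A.dominant Q P"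
      unfolding A.dominant_def
    proof (intro conjI ballI)
      show "P \<in> A.fixed Q" using P_coset eq_iff Q(2) QG by (auto simp: A.fixed_def)
      fix x assume x: "x \<in> A.fixed Q"
      then have "x \<in> rcosets\<^bsub>G\<^esub> P" by (simp add: A.fixed_def)
      then obtain g where g: "g \<in> carrier G" "x = P #>\<^bsub>G\<^esub> g" using rc by blast
      \<comment> \<open>The stabilizer of $P g$ is $g^{-1} P g$, so saturation is applied to
        conjugation by \<open>inv g\<close>, and for the same reason the coset \<open>P\<close> has
        to be moved by \<open>inv n\<close>.\<close>
      obtain n where n: "n \<in> normalizer G Q"
        "\<forall>l\<in>normalizer G Q. conj_by G (inv\<^bsub>G\<^esub> g) l \<in> P \<longrightarrow> conj_by G n l \<in> P"
        using G.saturated_normalizer_conj[OF assms(5) prime_p assms(6,9) FN, of "inv\<^bsub>G\<^esub> g"]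
          fixed_iff[OF g(1) QG] x g by auto
      interpret N: subgroup "normalizer G Q" G using QG by (rule G.subgroup_normalizer)
      show "\<exists>n\<in>normalizer G Q. \<forall>l\<in>normalizer G Q. x #>\<^bsub>G\<^esub> l = x \<longrightarrow> P #>\<^bsub>G\<^esub> n #>\<^bsub>G\<^esub> l = P #>\<^bsub>G\<^esub> n"
        using n g G.rcoset_dot_eq_iff[OF PG] by (intro bexI[of _ "inv\<^bsub>G\<^esub> n"]) simp_all
    qed
  qed
  have F_conj: "\<exists>g\<in>carrier G. conj_by G g ` Q \<in> {Q. fully_normalized G P Q}"
    if Q: "p_subgroup p G Q" "A.fixed Q \<noteq> {}" for Q
  proof -
    have QG: "subgroup Q G" using Q(1) by (simp add: p_subgroup_def)
    obtain g where g: "g \<in> carrier G" "P #>\<^bsub>G\<^esub> g \<in> A.fixed Q"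
      using Q(2) rc A.fixed_subset by blast
    then show ?thesis
      using G.exists_fully_normalized_conj[OF assms(5) PG QG, of "inv\<^bsub>G\<^esub> g"]
        fixed_iff[OF g(1) subgroup.subset[OF QG]] by simp
  qed
  have RG: "R \<subseteq> carrier G" using subgroup.subset[OF assms(10)] P.subset by simp
  have F': "p_subgroup p G Q \<and> A.dominant Q P \<and> p_subgroup p G (?D Q)" if "Q \<in> {Q. fully_normalized G P Q}" for Q
    using F that by simp
  have D': "?D Q = {n \<in> normalizer G Q. P #>\<^bsub>G\<^esub> n = P}" if "Q \<in> {Q. fully_normalized G P Q}" for Q
    using D_eq that by simp
  \<comment> \<open>Here \<open>F\<close> is the set of fully normalized subgroups and
    \<open>y0\<close> is the coset \<open>P\<close>.\<close>
  note core = A.relatively_brauer_indecomposable_iff[OF M.right_module e(1) eP iso RG F' F_conj D' refl]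
  show ?thesis using core(1) core(2) by blast
qed

end
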